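(* Let $c_n\to c>0$ as $n\to\infty$. Then the sequences $\alpha^n/n$, $n\in\mathbb{N}$, and $\overline{U}^n$, $n\in\mathbb{N}$, obey the LDPs in the respective spaces $[0,1]$ and $\mathbb{S}_1$ for scale $n$ with the respective action functionals $$I_c^\alpha(a)=\inf_{\tau\in[(1-2a)^+,\,1-a]}\biggl(K_c(\tau)+L_c(\tau)+\frac{c(1-\tau)^2}{2}\,\pi\Bigl(\frac{2(1-a-\tau)}{c(1-\tau)^2}\Bigr)\biggr),\quad a\in[0,1],$$ and $$I_c^U(\mathbf{u})=\sum_{i=1}^\infty K_c(u_i)+L_c\Bigl(\Bigl(1-\frac1c\Bigr)\vee\sum_{i=1}^\infty u_i\Bigr),\quad \mathbf{u}=(u_1,u_2,\ldots)\in\mathbb{S}_1.$$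
   Context: $\mathcal{G}(n,c_n/n)$ is the random graph on $n$ vertices in which every two vertices are independently connected by an edge with probability $c_n/n$ ($c_n/n\in[0,1]$ for all large $n$). $\alpha^n$ is the number of its connected components; $(U^n_1,U^n_2,\ldots)$ is the sequence of the sizes (numbers of vertices) of the connected components arranged in descending order and appended with zeros to make it infinite; $\overline{U}^n=(U^n_1/n,U^n_2/n,\ldots)$. $\mathbb{S}_1$ is the space of non-increasing sequences $\mathbf{u}=(u_1,u_2,\ldots)$ of non-negative reals with $\sum_i u_i\le1$, equipped with the product topology. Functions: for $u\in[0,1]$, $c>0$, $K_c(u)=u\log\frac{cu}{1-e^{-cu}}-\frac{cu^2}{2}$ and $L_c(u)=(1-u)\log(1-u)+(c-\log c)u-\frac{cu^2}{2}$; $\pi(x)=x\log x-x+1$ for $x\in\mathbb{R}_+$; $a\vee b=\max(a,b)$, $a^+=\max(a,0)$. Conventions: $0/0=1$, $0\cdot\infty=0$ (in particular $0\log0=0$), $\pi(\infty)\cdot0=\infty$. LDP: a sequence of random elements $X_n$ of a metric space $\Upsilon$ obeys the large deviation principle (LDP) for scale $k_n$, $k_n\to\infty$, with action functional $I:\Upsilon\to[0,\infty]$ if the sets $\{\upsilon:I(\upsilon)\le a\}$ are compact for all $a\in\mathbb{R}_+$, $\limsup_n\frac1{k_n}\log\mathbf{P}(X_n\in F)\le-\inf_{F}I$ for all closed $F\subset\Upsilon$, and $\liminf_n\frac1{k_n}\log\mathbf{P}(X_n\in G)\ge-\inf_{G}I$ for all open $G\subset\Upsilon$. *)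

theory Defs
  imports "HOL-Probability.Probability"
begin

text \<open>The random graph \<open>G(n,p)\<close> on the vertex set \<open>{..<n}\<close>, represented by its random set of
  edges. (For \<open>p\<close> outside \<open>[0,1]\<close>, \<^const>\<open>bernoulli_pmf\<close> clamps the parameter to that interval.)\<close>

definition all_edges :: "nat \<Rightarrow> nat set set" where
  "all_edges n = {e. e \<subseteq> {..<n} \<and> card e = 2}"

definition random_graph :: "nat \<Rightarrow> real \<Rightarrow> nat set set pmf" where
  "random_graph n p =
     map_pmf (\<lambda>f. {e \<in> all_edges n. f e}) (Pi_pmf (all_edges n) False (\<lambda>_. bernoulli_pmf p))"

definition adjacency :: "nat \<Rightarrow> nat set set \<Rightarrow> (nat \<times> nat) set" where
  "adjacency n E = {(x, y). x < n \<and> y < n \<and> {x, y} \<in> E}"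

definition components :: "nat \<Rightarrow> nat set set \<Rightarrow> nat set set" where
  "components n E = {..<n} // Restr ((adjacency n E)\<^sup>*) {..<n}"

definition num_components :: "nat \<Rightarrow> nat set set \<Rightarrow> nat" where
  "num_components n E = card (components n E)"

text \<open>Indices start at \<open>0\<close>, so \<open>component_size n E i\<close> is $U^n_{i+1}$; likewise below, a sequence
  $(u_1,u_2,\dots)$ is the function \<open>\<lambda>i. u\<^sub>i\<^sub>+\<^sub>1\<close>.\<close>

definition component_sizes :: "nat \<Rightarrow> nat set set \<Rightarrow> nat list" where
  "component_sizes n E =
     rev (sorted_list_of_multiset (image_mset card (mset_set (components n E))))"

definition component_size :: "nat \<Rightarrow> nat set set \<Rightarrow> nat \<Rightarrow> nat" where
  "component_size n E i =
     (if i < length (component_sizes n E) then component_sizes n E ! i else 0)"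

text \<open>The topology of the type \<^typ>\<open>nat \<Rightarrow> real\<close> is the product topology, and this type is a metric
  space inducing that topology.\<close>

definition S1 :: "(nat \<Rightarrow> real) set" where
  "S1 = {u. decseq u \<and> (\<forall>i. 0 \<le> u i) \<and> summable u \<and> (\<Sum>i. u i) \<le> 1}"

text \<open>Logarithm of a probability, with $\log 0 = -\infty$.\<close>

definition log_prob :: "real \<Rightarrow> ereal" where
  "log_prob p = (if p = 0 then -\<infinity> else ereal (ln p))"

text \<open>The random elements \<open>X n\<close> of the metric space \<open>S\<close> (a subspace of its type) may live on
  different probability spaces \<open>M n\<close>. The infimum over the empty set is \<open>\<infinity>\<close>.\<close>

definition LDP ::
  "'b::metric_space set \<Rightarrow> (nat \<Rightarrow> 'a measure) \<Rightarrow> (nat \<Rightarrow> 'a \<Rightarrow> 'b) \<Rightarrow> (nat \<Rightarrow> real) \<Rightarrow> ('b \<Rightarrow> ereal) \<Rightarrow> bool"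
where
  "LDP S M X k I \<longleftrightarrow>
     (\<forall>n. prob_space (M n) \<and> X n \<in> M n \<rightarrow>\<^sub>M restrict_space borel S) \<and>
     filterlim k at_top sequentially \<and>
     (\<forall>x\<in>S. 0 \<le> I x) \<and>
     (\<forall>a::real. 0 \<le> a \<longrightarrow> compact {x \<in> S. I x \<le> ereal a}) \<and>
     (\<forall>F. closedin (top_of_set S) F \<longrightarrow>
        limsup (\<lambda>n. ereal (1 / k n) * log_prob (measure (M n) {\<omega> \<in> space (M n). X n \<omega> \<in> F}))
          \<le> - (INF x\<in>F. I x)) \<and>
     (\<forall>G. openin (top_of_set S) G \<longrightarrow>
        liminf (\<lambda>n. ereal (1 / k n) * log_prob (measure (M n) {\<omega> \<in> space (M n). X n \<omega> \<in> G}))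
          \<ge> - (INF x\<in>G. I x))"

text \<open>The conventions \<open>0/0 = 1\<close> and \<open>0 * log 0 = 0\<close> need no case distinction in the next three
  definitions: wherever \<open>0/0\<close> or \<open>log 0\<close> occurs there, it is multiplied by \<open>0\<close>.\<close>

definition K :: "real \<Rightarrow> real \<Rightarrow> real" where
  "K c u = u * ln (c * u / (1 - exp (- c * u))) - c * u\<^sup>2 / 2"

definition L :: "real \<Rightarrow> real \<Rightarrow> real" where
  "L c u = (1 - u) * ln (1 - u) + (c - ln c) * u - c * u\<^sup>2 / 2"

definition pi_fun :: "real \<Rightarrow> real" where
  "pi_fun x = x * ln x - x + 1"

text \<open>The argument of \<^const>\<open>pi_fun\<close> has denominator \<open>0\<close> only for \<open>\<tau> = 1\<close>, which forces \<open>a = 0\<close>;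
  its numerator then vanishes as well, so the argument is never \<open>\<infinity>\<close>. Under \<open>0/0 = 1\<close>
  the last summand is then \<open>0\<close>, and it is also \<open>0\<close> here because of the factor \<open>(1 - \<tau>)\<^sup>2\<close>.\<close>

definition I_alpha :: "real \<Rightarrow> real \<Rightarrow> ereal" where
  "I_alpha c a =
     (INF \<tau>\<in>{max (1 - 2 * a) 0 .. 1 - a}.
        ereal (K c \<tau> + L c \<tau>
          + c * (1 - \<tau>)\<^sup>2 / 2 * pi_fun (2 * (1 - a - \<tau>) / (c * (1 - \<tau>)\<^sup>2))))"

text \<open>On \<^const>\<open>S1\<close> the series converges absolutely, as $-C u^3 \le K_c(u) \le 0$ on $[0,1]$
  for a constant $C$.\<close>

definition I_U :: "real \<Rightarrow> (nat \<Rightarrow> real) \<Rightarrow> ereal" where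
  "I_U c u = ereal ((\<Sum>i. K c (u i)) + L c (max (1 - 1 / c) (\<Sum>i. u i)))"

end

theory Submission
  imports Defs "HOL-Real_Asymp.Real_Asymp"
begin

text \<open>
  Let \<open>\<lambda> = - ln (1 - p)\<close>, let \<open>C k\<close> be the probability that the random graph on \<open>k\<close> vertices is
  connected, and let \<open>w k = C k * exp (\<lambda> k^2 / 2) / k!\<close>. A multiset of component sizes with \<open>m k\<close>
  components of size \<open>k\<close> has probability \<open>n! exp (- \<lambda> n^2 / 2) (\<Prod>k. w k ^ m k / m k!)\<close>.
  The weights \<open>w k\<close> do not depend on \<open>n\<close>. All estimates of them come from a single identity: for
  every number \<open>M\<close> of vertices the probabilities that the component of a given vertex has \<open>k\<close> vertices
  add up to one. Varying \<open>M\<close> gives the sharp upper bounds; choosing \<open>M\<close> such that the giant component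
  has about \<open>u n\<close> vertices gives a matching lower bound for some \<open>k\<close> close to \<open>u n\<close>.

  Upper bounds on probabilities then follow by exponential tilting of the sizes, where all components
  of size at most \<open>\<epsilon> n\<close> enter only through \<open>\<Sum>k\<le>\<epsilon> n. w k * z ^ k\<close>. For lower bounds the prescribed
  large components are split off one by one, which leaves a subcritical graph. There large components
  are unlikely, and the number of components is prescribed by changing the edge probability. Finally,
  on a compact space such local estimates imply the large deviation principle.
\<close>

section \<open>Component profiles of random graphs\<close>

text \<open>The parameter \<lambda> is natural because k (n - k) = n^2/2 - (n-k)^2/2 - k^2/2: the
  probability of having no edge between a component and the rest splits into factors of n, n - k and
  k alone. A bound on the connection probability for a single size loses a polynomial factor per
  component. This is harmless for the at most 1/\<epsilon> components larger than \<epsilon> n, but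
  fatal for the order n small ones. These are never estimated one by one: their whole generating
  function is bounded by integrating the exploration identity over the number of vertices. The
  parameter t below is the mean degree of the graph outside the macroscopic components, and z = t
  exp(-t) / \<lambda>. This parametrisation is one-to-one only for t \<le> 1, and that restriction
  produces the threshold 1 - 1/c in the action functional of the sizes. The identity gives a lower
  bound on the connection probability for some size in every window, not for each size. This is
  enough for the lower bounds, since K and L are continuous.\<close>

definition edges_on :: "'a set \<Rightarrow> 'a set set" where
  "edges_on V = {e. e \<subseteq> V \<and> card e = 2}"

definition adj_on :: "'a set \<Rightarrow> 'a set set \<Rightarrow> ('a \<times> 'a) set" where
  "adj_on V E = {(x, y). x \<in> V \<and> y \<in> V \<and> {x, y} \<in> E}"

definition conn_rel :: "'a set \<Rightarrow> 'a set set \<Rightarrow> ('a \<times> 'a) set" where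
  "conn_rel V E = Restr ((adj_on V E)\<^sup>*) V"

text \<open>Over an arbitrary vertex set, unlike \<open>components\<close>: removing an explored
  component leaves a set that is not of the form \<open>{..<n}\<close>.\<close>

definition comps :: "'a set \<Rightarrow> 'a set set \<Rightarrow> 'a set set" where
  "comps V E = V // conn_rel V E"

text \<open>Both random elements of the theorem are functions of this multiset: its size is the
  number of components, and its entries in descending order are the component sizes.\<close>

definition profile :: "'a set \<Rightarrow> 'a set set \<Rightarrow> nat multiset" where
  "profile V E = image_mset card (mset_set (comps V E))"

lemma components_eq: "components n E = comps {..<n} E"
  by (auto simp: components_def comps_def conn_rel_def adjacency_def adj_on_def)

lemma all_edges_eq: "all_edges n = edges_on {..<n}"
  by (simp add: all_edges_def edges_on_def)

lemma equiv_conn_rel: "equiv V (conn_rel V E)"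
proof -
  have s: "sym (adj_on V E)" by (auto simp: sym_def adj_on_def insert_commute)
  have "sym ((adj_on V E)\<^sup>*)" by (rule sym_rtrancl[OF s])
  then show ?thesis
    by (auto simp: equiv_def refl_on_def sym_def trans_def conn_rel_def)
qed

lemma finite_edges_on [simp]: "finite V \<Longrightarrow> finite (edges_on V)"
  by (rule finite_subset[of _ "Pow V"]) (auto simp: edges_on_def)

lemma finite_comps [simp]: "finite V \<Longrightarrow> finite (comps V E)"
  unfolding comps_def by (rule finite_quotient) (auto simp: conn_rel_def)

lemma card_edges_on: "finite V \<Longrightarrow> card (edges_on V) = card V choose 2"
  unfolding edges_on_def by (rule n_subsets)

lemma comps_subset: "A \<in> comps V E \<Longrightarrow> A \<subseteq> V"
  unfolding comps_def conn_rel_def by (auto simp: quotient_def)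

lemma Union_comps: "\<Union>(comps V E) = V"
  unfolding comps_def by (rule Union_quotient[OF equiv_conn_rel])

lemma comps_nonempty: "A \<in> comps V E \<Longrightarrow> A \<noteq> {}"
  unfolding comps_def by (rule in_quotient_imp_non_empty[OF equiv_conn_rel])

lemma comps_disjoint: "A \<in> comps V E \<Longrightarrow> B \<in> comps V E \<Longrightarrow> A \<noteq> B \<Longrightarrow> A \<inter> B = {}"
  unfolding comps_def using quotient_disj[OF equiv_conn_rel] by blast

lemma sum_mset_profile: assumes "finite V" shows "sum_mset (profile V E) = card V"
proof -
  have "sum_mset (profile V E) = (\<Sum>A\<in>comps V E. card A)"
    by (simp add: profile_def sum_unfold_sum_mset)
  also have "\<dots> = card (\<Union>(comps V E))"
    by (rule card_Union_disjoint[symmetric])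
       (auto simp: pairwise_def disjnt_def comps_disjoint intro: finite_subset[OF comps_subset assms])
  finally show ?thesis by (simp add: Union_comps)
qed

lemma profile_pos: assumes "finite V" "k \<in># profile V E" shows "k \<ge> 1"
proof -
  obtain A where "A \<in> comps V E" "k = card A"
    using assms by (auto simp: profile_def)
  then show ?thesis using comps_nonempty[of A V E] finite_subset[OF comps_subset assms(1)]
    by (metis card_gt_0_iff less_eq_Suc_le One_nat_def)
qed

lemma adj_on_Un:
  assumes "A \<subseteq> V" "E1 \<subseteq> edges_on A" "E2 \<subseteq> edges_on (V - A)"
  shows "adj_on V (E1 \<union> E2) = adj_on A E1 \<union> adj_on (V - A) E2"
  using assms unfolding adj_on_def edges_on_def by fast

text \<open>No pair of s starts in A, so a path from a point of A can only use steps of r.\<close>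

lemma rtrancl_Un_separate:
  assumes "r \<subseteq> A \<times> A" "s \<subseteq> B \<times> B" "A \<inter> B = {}" "(x, y) \<in> (r \<union> s)\<^sup>*" "x \<in> A"
  shows "(x, y) \<in> r\<^sup>* \<and> y \<in> A"
  using assms(4)
proof (induction rule: rtrancl_induct)
  case base
  then show ?case using assms(5) by auto
next
  case (step y z)
  then have "(y, z) \<in> r" using assms(2,3) by auto
  then show ?case using step assms(1) by (meson mem_Sigma_iff rtrancl.rtrancl_into_rtrancl subsetD)
qed

lemma conn_rel_Un:
  assumes "A \<subseteq> V" "E1 \<subseteq> edges_on A" "E2 \<subseteq> edges_on (V - A)"
  shows "conn_rel V (E1 \<union> E2) = conn_rel A E1 \<union> conn_rel (V - A) E2"
proof -
  let ?r = "adj_on A E1" and ?s = "adj_on (V - A) E2"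
  have r: "?r \<subseteq> A \<times> A" and s: "?s \<subseteq> (V - A) \<times> (V - A)" by (auto simp: adj_on_def)
  have 1: "(x, y) \<in> ?r\<^sup>* \<and> y \<in> A" if "(x, y) \<in> (?r \<union> ?s)\<^sup>*" "x \<in> A" for x y
    by (rule rtrancl_Un_separate[OF r s _ that]) auto
  have 2: "(x, y) \<in> ?s\<^sup>* \<and> y \<in> V - A" if "(x, y) \<in> (?r \<union> ?s)\<^sup>*" "x \<in> V - A" for x y
    by (rule rtrancl_Un_separate[OF s r]) (use that in \<open>auto simp: Un_commute\<close>)
  have 3: "?r\<^sup>* \<subseteq> (?r \<union> ?s)\<^sup>*" "?s\<^sup>* \<subseteq> (?r \<union> ?s)\<^sup>*" by (auto intro: rtrancl_mono[THEN subsetD])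
  show ?thesis
    unfolding conn_rel_def adj_on_Un[OF assms] using 1 2 3 assms(1) by blast
qed

lemma comps_Un:
  assumes "A \<subseteq> V" "E1 \<subseteq> edges_on A" "E2 \<subseteq> edges_on (V - A)"
  shows "comps V (E1 \<union> E2) = comps A E1 \<union> comps (V - A) E2"
proof -
  have s: "conn_rel A E1 \<subseteq> A \<times> A" "conn_rel (V - A) E2 \<subseteq> (V - A) \<times> (V - A)"
    by (auto simp: conn_rel_def)
  have 1: "conn_rel V (E1 \<union> E2) `` {x} = conn_rel A E1 `` {x}" if "x \<in> A" for x
    unfolding conn_rel_Un[OF assms] using s that by blast
  have 2: "conn_rel V (E1 \<union> E2) `` {x} = conn_rel (V - A) E2 `` {x}" if "x \<in> V - A" for x
    unfolding conn_rel_Un[OF assms] using s that by blast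
  have V: "V = A \<union> (V - A)" using assms(1) by auto
  have "comps V (E1 \<union> E2) = (\<lambda>x. conn_rel V (E1 \<union> E2) `` {x}) ` (A \<union> (V - A))"
    unfolding comps_def quotient_def using V by auto
  also have "\<dots> = (\<lambda>x. conn_rel A E1 `` {x}) ` A \<union> (\<lambda>x. conn_rel (V - A) E2 `` {x}) ` (V - A)"
    unfolding image_Un using 1 2 by (intro arg_cong2[where f="(\<union>)"] image_cong) auto
  finally show ?thesis unfolding comps_def quotient_def by auto
qed

section \<open>Exploration of the component of a vertex\<close>

definition comp_of :: "'a set \<Rightarrow> 'a set set \<Rightarrow> 'a \<Rightarrow> 'a set" where
  "comp_of V E v = conn_rel V E `` {v}"

text \<open>A component is closed under adjacency, so every edge lies inside A or inside its
  complement. Together with \<open>connected_imp_comp_of_eq\<close>, graphs in which v has component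
  A correspond to pairs of a connected graph on A and any graph on the rest.\<close>

lemma comp_of_eq_imp_connected:
  assumes "E \<subseteq> edges_on V" "v \<in> V" "comp_of V E v = A"
  shows "E = (E \<inter> edges_on A) \<union> (E \<inter> edges_on (V - A))" "comps A (E \<inter> edges_on A) = {A}"
    "A \<subseteq> V" "v \<in> A"
proof -
  show AV: "A \<subseteq> V" using assms(3) by (auto simp: comp_of_def conn_rel_def)
  show vA: "v \<in> A" using assms(2,3) by (auto simp: comp_of_def conn_rel_def)
  have closed: "y \<in> A" if "x \<in> A" "{x, y} \<in> E" "y \<in> V" for x y
  proof -
    have "(v, x) \<in> (adj_on V E)\<^sup>*" "x \<in> V" using that assms by (auto simp: comp_of_def conn_rel_def)
    moreover have "(x, y) \<in> adj_on V E" using that \<open>x \<in> V\<close> by (auto simp: adj_on_def)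
    ultimately have "(v, y) \<in> (adj_on V E)\<^sup>*" by auto
    then show ?thesis using assms that by (auto simp: comp_of_def conn_rel_def)
  qed
  have "e \<in> edges_on A \<union> edges_on (V - A)" if "e \<in> E" for e
  proof -
    have "e \<subseteq> V" "card e = 2" using that assms(1) by (auto simp: edges_on_def)
    then obtain x y where e: "e = {x, y}" "x \<noteq> y" by (meson card_2_iff)
    have "x \<in> A \<longleftrightarrow> y \<in> A" using closed[of x y] closed[of y x] that e \<open>e \<subseteq> V\<close>
      by (auto simp: insert_commute)
    then show ?thesis using e \<open>e \<subseteq> V\<close> \<open>card e = 2\<close> by (auto simp: edges_on_def)
  qed
  then show E: "E = (E \<inter> edges_on A) \<union> (E \<inter> edges_on (V - A))" by auto
  have "conn_rel V E = conn_rel A (E \<inter> edges_on A) \<union> conn_rel (V - A) (E \<inter> edges_on (V - A))"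
    by (subst E, rule conn_rel_Un[OF AV]) auto
  then have "A = conn_rel A (E \<inter> edges_on A) `` {v}"
    using assms(3) vA by (auto simp: comp_of_def conn_rel_def)
  then have "A \<in> comps A (E \<inter> edges_on A)" 
    unfolding comps_def using vA by (metis quotientI)
  then have "B = A" if "B \<in> comps A (E \<inter> edges_on A)" for B
    using that comps_disjoint[of A A "E \<inter> edges_on A" B] comps_subset[OF that] comps_nonempty[OF that]
    by (metis inf.absorb2)
  with \<open>A \<in> comps A (E \<inter> edges_on A)\<close> show "comps A (E \<inter> edges_on A) = {A}" by blast
qed

lemma connected_imp_comp_of_eq:
  assumes "A \<subseteq> V" "v \<in> A" "E1 \<subseteq> edges_on A" "E2 \<subseteq> edges_on (V - A)" "comps A E1 = {A}"
  shows "comp_of V (E1 \<union> E2) v = A"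
proof -
  have "conn_rel A E1 `` {v} \<in> comps A E1" unfolding comps_def using assms(2) by (rule quotientI)
  then have "conn_rel A E1 `` {v} = A" using assms(5) by auto
  moreover have "conn_rel V (E1 \<union> E2) `` {v} = conn_rel A E1 `` {v}"
    unfolding conn_rel_Un[OF assms(1,3,4)] using assms(2) by (auto simp: conn_rel_def)
  ultimately show ?thesis by (simp add: comp_of_def)
qed

text \<open>The probability of the edge set E in the random graph on V. Working with finite weighted
  sums keeps the exploration purely algebraic; \<open>pmf_random_graph\<close> makes the link to
  \<open>random_graph\<close>.\<close>

definition graph_wt :: "real \<Rightarrow> 'a set \<Rightarrow> 'a set set \<Rightarrow> real" where
  "graph_wt p V E = p ^ card E * (1 - p) ^ (card (edges_on V) - card E)"

definition graph_sum :: "real \<Rightarrow> 'a set \<Rightarrow> (nat multiset \<Rightarrow> real) \<Rightarrow> real" where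
  "graph_sum p V h = (\<Sum>E\<in>Pow (edges_on V). graph_wt p V E * h (profile V E))"

definition conn_sum :: "real \<Rightarrow> 'a set \<Rightarrow> real" where
  "conn_sum p V = (\<Sum>E\<in>{E \<in> Pow (edges_on V). comps V E = {V}}. graph_wt p V E)"

lemma choose_two_add: "(a + b) choose 2 = (a choose 2) + (b choose 2) + a * b"
  by (induction a) (auto simp: numeral_2_eq_2 algebra_simps)

text \<open>The exponent of the first factor counts the pairs that join A to its complement, all of
  which are absent.\<close>

lemma graph_wt_Un:
  assumes "finite V" "A \<subseteq> V" "E1 \<subseteq> edges_on A" "E2 \<subseteq> edges_on (V - A)"
  shows "graph_wt p V (E1 \<union> E2) =
    (1 - p) ^ (card A * card (V - A)) * graph_wt p A E1 * graph_wt p (V - A) E2"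
proof -
  have fA: "finite A" "finite (V - A)" using assms finite_subset by auto
  have f: "finite E1" "finite E2" using assms fA finite_subset[OF _ finite_edges_on] by blast+
  have "E1 \<inter> E2 = {}"
  proof (rule ccontr)
    assume "E1 \<inter> E2 \<noteq> {}"
    then obtain e where "e \<in> E1" "e \<in> E2" by auto
    then have "e \<subseteq> A" "e \<subseteq> V - A" "card e = 2" using assms(3,4) by (auto simp: edges_on_def)
    then have "e = {}" by auto
    then show False using \<open>card e = 2\<close> by simp
  qed
  then have c: "card (E1 \<union> E2) = card E1 + card E2" using f by (simp add: card_Un_disjoint)
  have V: "card V = card A + card (V - A)"
    using assms(1,2) fA by (metis card_Un_disjoint Diff_disjoint Diff_partition)
  have ce: "card (edges_on V) = card (edges_on A) + card (edges_on (V - A)) + card A * card (V - A)"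
    unfolding card_edges_on[OF assms(1)] card_edges_on[OF fA(1)] card_edges_on[OF fA(2)]
    using V choose_two_add[of "card A" "card (V - A)"] by simp
  have "card E1 \<le> card (edges_on A)" "card E2 \<le> card (edges_on (V - A))"
    using assms fA by (auto intro: card_mono)
  then have "card (edges_on V) - card (E1 \<union> E2) =
      (card (edges_on A) - card E1) + (card (edges_on (V - A)) - card E2) + card A * card (V - A)"
    using ce c by simp
  then show ?thesis by (simp add: graph_wt_def c power_add)
qed

lemma profile_Un:
  assumes "finite V" "A \<subseteq> V" "A \<noteq> {}" "E1 \<subseteq> edges_on A" "E2 \<subseteq> edges_on (V - A)" "comps A E1 = {A}"
  shows "profile V (E1 \<union> E2) = add_mset (card A) (profile (V - A) E2)"
proof -
  have "A \<notin> comps (V - A) E2" using comps_subset[of A "V - A" E2] assms(3) by auto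
  moreover have "comps V (E1 \<union> E2) = insert A (comps (V - A) E2)"
    using comps_Un[OF assms(2,4,5)] assms(6) by simp
  ultimately show ?thesis using assms(1) by (simp add: profile_def)
qed

text \<open>Exploring the component of a fixed vertex: the rest is a fresh random graph.\<close>

lemma graph_sum_decompose:
  assumes V: "finite V" and v: "v \<in> V"
  shows "graph_sum p V h = (\<Sum>A\<in>{A. A \<subseteq> V \<and> v \<in> A}.
     (1 - p) ^ (card A * card (V - A)) * conn_sum p A * graph_sum p (V - A) (\<lambda>\<mu>. h (add_mset (card A) \<mu>)))"
proof -
  let ?F = "\<lambda>E. graph_wt p V E * h (profile V E)"
  let ?As = "{A. A \<subseteq> V \<and> v \<in> A}"
  have fin: "finite (Pow (edges_on V))" using V by simp
  have "graph_sum p V h = (\<Sum>A\<in>?As. \<Sum>E\<in>{E \<in> Pow (edges_on V). comp_of V E v = A}. ?F E)"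
    unfolding graph_sum_def
  proof (rule sum.group[symmetric, OF fin])
    show "(\<lambda>E. comp_of V E v) ` Pow (edges_on V) \<subseteq> ?As"
      using comp_of_eq_imp_connected(3,4)[OF _ v] by auto
  qed (use V in auto)
  also have "\<dots> = (\<Sum>A\<in>?As. (1 - p) ^ (card A * card (V - A)) * conn_sum p A *
      graph_sum p (V - A) (\<lambda>\<mu>. h (add_mset (card A) \<mu>)))"
  proof (rule sum.cong[OF refl])
    fix A assume "A \<in> ?As"
    then have A: "A \<subseteq> V" "v \<in> A" by auto
    let ?S = "{E \<in> Pow (edges_on A). comps A E = {A}}" and ?T = "Pow (edges_on (V - A))"
    have disj: "edges_on A \<inter> edges_on (V - A) = {}"
    proof -
      have False if "e \<in> edges_on A" "e \<in> edges_on (V - A)" for e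
      proof -
        have "e = {}" "card e = 2" using that by (auto simp: edges_on_def)
        then show False by simp
      qed
      then show ?thesis by auto
    qed
    have bij: "bij_betw (\<lambda>(E1, E2). E1 \<union> E2) (?S \<times> ?T) {E \<in> Pow (edges_on V). comp_of V E v = A}"
    proof (rule bij_betw_byWitness[where f'="\<lambda>E. (E \<inter> edges_on A, E \<inter> edges_on (V - A))"])
      show "\<forall>a\<in>?S \<times> ?T. (\<lambda>E. (E \<inter> edges_on A, E \<inter> edges_on (V - A))) ((\<lambda>(E1, E2). E1 \<union> E2) a) = a"
        using disj by auto
      show "\<forall>E\<in>{E \<in> Pow (edges_on V). comp_of V E v = A}.
          (\<lambda>(E1, E2). E1 \<union> E2) (E \<inter> edges_on A, E \<inter> edges_on (V - A)) = E"
        using comp_of_eq_imp_connected(1)[OF _ v] by auto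
      have "edges_on A \<subseteq> edges_on V" "edges_on (V - A) \<subseteq> edges_on V"
        using A by (auto simp: edges_on_def)
      then show "(\<lambda>(E1, E2). E1 \<union> E2) ` (?S \<times> ?T) \<subseteq> {E \<in> Pow (edges_on V). comp_of V E v = A}"
        using connected_imp_comp_of_eq[OF A] by auto
      show "(\<lambda>E. (E \<inter> edges_on A, E \<inter> edges_on (V - A))) ` {E \<in> Pow (edges_on V). comp_of V E v = A}
          \<subseteq> ?S \<times> ?T"
        using comp_of_eq_imp_connected(2)[OF _ v] by auto
    qed
    have "(\<Sum>E\<in>{E \<in> Pow (edges_on V). comp_of V E v = A}. ?F E) =
        (\<Sum>(E1, E2)\<in>?S \<times> ?T. ?F (E1 \<union> E2))"
      by (subst sum.reindex_bij_betw[OF bij, symmetric]) (simp add: case_prod_unfold)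
    also have "\<dots> = (\<Sum>(E1, E2)\<in>?S \<times> ?T. ((1 - p) ^ (card A * card (V - A)) * graph_wt p A E1) *
         (graph_wt p (V - A) E2 * h (add_mset (card A) (profile (V - A) E2))))"
    proof (rule sum.cong[OF refl], clarify)
      fix E1 E2 assume *: "E1 \<subseteq> edges_on A" "comps A E1 = {A}" "E2 \<subseteq> edges_on (V - A)"
      show "graph_wt p V (E1 \<union> E2) * h (profile V (E1 \<union> E2)) =
        (1 - p) ^ (card A * card (V - A)) * graph_wt p A E1 *
         (graph_wt p (V - A) E2 * h (add_mset (card A) (profile (V - A) E2)))"
      proof -
        have "A \<noteq> {}" using A(2) by auto
        then show ?thesis
          unfolding graph_wt_Un[OF V A(1) *(1,3)] profile_Un[OF V A(1) \<open>A \<noteq> {}\<close> *(1,3,2)]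
          by (simp only: mult.assoc)
      qed
    qed
    also have "\<dots> = (1 - p) ^ (card A * card (V - A)) * conn_sum p A *
        graph_sum p (V - A) (\<lambda>\<mu>. h (add_mset (card A) \<mu>))"
      unfolding sum.cartesian_product[symmetric] conn_sum_def graph_sum_def
      by (simp add: sum_product[symmetric] sum_distrib_left)
    finally show "(\<Sum>E\<in>{E \<in> Pow (edges_on V). comp_of V E v = A}. ?F E) =
      (1 - p) ^ (card A * card (V - A)) * conn_sum p A *
        graph_sum p (V - A) (\<lambda>\<mu>. h (add_mset (card A) \<mu>))" .
  qed
  finally show ?thesis .
qed


lemma graph_wt_nonneg: "0 \<le> p \<Longrightarrow> p \<le> 1 \<Longrightarrow> 0 \<le> graph_wt p V E"
  by (simp add: graph_wt_def)

lemma graph_sum_one: assumes "finite V" shows "graph_sum p V (\<lambda>_. 1) = 1"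
proof -
  have "(\<Prod>e\<in>edges_on V. p + (1 - p)) =
      (\<Sum>X\<in>Pow (edges_on V). (\<Prod>e\<in>X. p) * (\<Prod>e\<in>edges_on V - X. 1 - p))"
    by (rule prod_add) (use assms in simp)
  also have "\<dots> = graph_sum p V (\<lambda>_. 1)"
    unfolding graph_sum_def graph_wt_def
    by (rule sum.cong) (use assms in \<open>auto simp: card_Diff_subset finite_subset[OF _ finite_edges_on]\<close>)
  finally show ?thesis by simp
qed

lemma comps_empty [simp]: "comps {} E = {}"
  by (simp add: comps_def quotient_def)

lemma profile_empty [simp]: "profile {} E = {#}"
  by (simp add: profile_def)

lemma edges_on_empty [simp]: "edges_on {} = {}"
  by (auto simp: edges_on_def)

lemma graph_sum_empty [simp]: "graph_sum p {} h = h {#}"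
proof -
  show ?thesis by (simp add: graph_sum_def graph_wt_def)
qed

lemma sum_Pow_card:
  assumes "finite W"
  shows "(\<Sum>B\<in>Pow W. F (card B)) = (\<Sum>k\<le>card W. real (card W choose k) * F k)"
proof -
  have "(\<Sum>B\<in>Pow W. F (card B)) = (\<Sum>k\<le>card W. \<Sum>B\<in>{B \<in> Pow W. card B = k}. F (card B))"
    by (rule sum.group[symmetric]) (use assms in \<open>auto intro: card_mono\<close>)
  also have "\<dots> = (\<Sum>k\<le>card W. real (card W choose k) * F k)"
    using n_subsets[OF assms] by (intro sum.cong) auto
  finally show ?thesis .
qed

lemma sum_subsets_containing_card:
  assumes "finite V" "v \<in> V"
  shows "(\<Sum>A\<in>{A. A \<subseteq> V \<and> v \<in> A}. F (card A)) =
    (\<Sum>k=1..card V. real (card V - 1 choose (k - 1)) * F k)"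
proof -
  have bij: "bij_betw (insert v) (Pow (V - {v})) {A. A \<subseteq> V \<and> v \<in> A}"
    by (rule bij_betw_byWitness[where f'="\<lambda>A. A - {v}"]) (use assms in auto)
  have "(\<Sum>A\<in>{A. A \<subseteq> V \<and> v \<in> A}. F (card A)) = (\<Sum>B\<in>Pow (V - {v}). F (card (insert v B)))"
    by (rule sum.reindex_bij_betw[OF bij, symmetric])
  also have "\<dots> = (\<Sum>B\<in>Pow (V - {v}). F (Suc (card B)))"
  proof (rule sum.cong[OF refl])
    fix B assume "B \<in> Pow (V - {v})"
    then have "finite B" "v \<notin> B" using assms finite_subset[of B V] by auto
    then show "F (card (insert v B)) = F (Suc (card B))" by simp
  qed
  also have "\<dots> = (\<Sum>k\<le>card V - 1. real (card V - 1 choose k) * F (Suc k))"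
    by (subst sum_Pow_card) (use assms in auto)
  also have "\<dots> = (\<Sum>k=1..card V. real (card V - 1 choose (k - 1)) * F k)"
  proof (rule sum.reindex_bij_witness[where i="\<lambda>k. k - 1" and j=Suc])
    have "card V \<ge> 1" using assms by (auto simp: Suc_le_eq card_gt_0_iff)
    then show "\<And>a. a \<in> {..card V - 1} \<Longrightarrow> Suc a \<in> {1..card V}" by auto
  qed auto
  finally show ?thesis .
qed

section \<open>Expectations over profiles\<close>

definition conn_prob :: "real \<Rightarrow> nat \<Rightarrow> real" where
  "conn_prob p k = conn_sum p {..<k}"

definition profile_ex :: "real \<Rightarrow> nat \<Rightarrow> (nat multiset \<Rightarrow> real) \<Rightarrow> real" where
  "profile_ex p n h = graph_sum p {..<n} h"

text \<open>The probability that the component of a given vertex, among \<open>n\<close> vertices, has \<open>k\<close> vertices.\<close>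

definition step_prob :: "real \<Rightarrow> nat \<Rightarrow> nat \<Rightarrow> real" where
  "step_prob p n k = real (n - 1 choose (k - 1)) * conn_prob p k * (1 - p) ^ (k * (n - k))"

text \<open>Instead of relabelling vertices, strong induction through the exploration recursion
  expresses both quantities by smaller sets, where only cardinalities enter.\<close>

lemma graph_sum_invariant:
  fixes V :: "nat set"
  assumes "finite V" "card V = n"
  shows "graph_sum p V h = profile_ex p n h \<and> (n \<ge> 1 \<longrightarrow> conn_sum p V = conn_prob p n)"
  using assms
proof (induction n arbitrary: V h rule: less_induct)
  case (less n)
  show ?case
  proof (cases "n = 0")
    case True
    then show ?thesis using less.prems by (simp add: profile_ex_def)
  next
    case False
    define G where "G h k = (1 - p) ^ (k * (n - k)) * conn_prob p k *
        profile_ex p (n - k) (\<lambda>\<mu>. h (add_mset k \<mu>))" for h k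
    have *: "graph_sum p W h = (\<Sum>k=1..n. real (n - 1 choose (k - 1)) *
        (if k < n then G h k else conn_sum p W * h {#n#}))"
      if W: "finite W" "card W = n" for W :: "nat set" and h
    proof -
      obtain v where v: "v \<in> W" using W False by fastforce
      have "graph_sum p W h = (\<Sum>A\<in>{A. A \<subseteq> W \<and> v \<in> A}.
          (if card A < n then G h (card A) else conn_sum p W * h {#n#}))"
        unfolding graph_sum_decompose[OF W(1) v]
      proof (rule sum.cong[OF refl])
        fix A assume "A \<in> {A. A \<subseteq> W \<and> v \<in> A}"
        then have A: "A \<subseteq> W" "v \<in> A" by auto
        have fA: "finite A" using A W finite_subset by auto
        have cA: "card A \<ge> 1" using A fA by (auto simp: Suc_le_eq card_gt_0_iff)
        have cD: "card (W - A) = n - card A" using W A fA by (simp add: card_Diff_subset)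
        show "(1 - p) ^ (card A * card (W - A)) * conn_sum p A *
            graph_sum p (W - A) (\<lambda>\<mu>. h (add_mset (card A) \<mu>)) =
          (if card A < n then G h (card A) else conn_sum p W * h {#n#})"
        proof (cases "card A < n")
          case True
          then have "conn_sum p A = conn_prob p (card A)" using less.IH[OF True fA refl] cA by blast
          moreover have "graph_sum p (W - A) h' = profile_ex p (n - card A) h'" for h'
            using less.IH[of "n - card A" "W - A"] True cA W cD by auto
          ultimately show ?thesis using True cD by (simp add: G_def)
        next
          case F: False
          then have "A = W" using W A card_seteq[OF W(1) A(1)] by auto
          then show ?thesis using F W by simp
        qed
      qed
      also have "\<dots> = (\<Sum>k=1..n. real (n - 1 choose (k - 1)) *
          (if k < n then G h k else conn_sum p W * h {#n#}))"
        using sum_subsets_containing_card[OF W(1) v,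
            of "\<lambda>c. if c < n then G h c else conn_sum p W * h {#n#}"] W(2) by simp
      finally show ?thesis .
    qed
    have **: "graph_sum p W h = (\<Sum>k=1..<n. real (n - 1 choose (k - 1)) * G h k) +
        conn_sum p W * h {#n#}" if W: "finite W" "card W = n" for W :: "nat set" and h
    proof -
      have "{1..n} = insert n {1..<n}" using False by auto
      then show ?thesis unfolding *[OF W] by simp
    qed
    \<comment> \<open>The term k = n of the recursion contains \<open>conn_sum\<close> of W itself.
      Taking h = 1, where the total is one, solves for it in terms of smaller sizes.\<close>
    have c: "conn_sum p W = 1 - (\<Sum>k=1..<n. real (n - 1 choose (k - 1)) * G (\<lambda>_. 1) k)"
      if W: "finite W" "card W = n" for W :: "nat set"
      using **[OF W, of "\<lambda>_. 1"] graph_sum_one[OF W(1)] by simp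
    have "conn_sum p V = conn_prob p n"
      using c[OF less.prems] c[of "{..<n}"] by (simp add: conn_prob_def)
    then show ?thesis
      using **[OF less.prems] **[of "{..<n}"] by (simp add: profile_ex_def conn_prob_def)
  qed
qed

lemma profile_ex_rec:
  assumes "n \<ge> 1"
  shows "profile_ex p n h =
    (\<Sum>k=1..n. step_prob p n k * profile_ex p (n - k) (\<lambda>\<mu>. h (add_mset k \<mu>)))"
proof -
  have v: "0 \<in> {..<n}" using assms by auto
  have "profile_ex p n h = (\<Sum>A\<in>{A. A \<subseteq> {..<n} \<and> 0 \<in> A}.
      (1 - p) ^ (card A * (n - card A)) * conn_prob p (card A) *
      profile_ex p (n - card A) (\<lambda>\<mu>. h (add_mset (card A) \<mu>)))"
    unfolding profile_ex_def[of p n] graph_sum_decompose[OF finite_lessThan v]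
  proof (rule sum.cong[OF refl])
    fix A assume "A \<in> {A. A \<subseteq> {..<n} \<and> 0 \<in> A}"
    then have A: "A \<subseteq> {..<n}" "0 \<in> A" and fA: "finite A" using finite_subset by auto
    have cA: "card A \<ge> 1" using A fA by (auto simp: Suc_le_eq card_gt_0_iff)
    have cD: "card ({..<n} - A) = n - card A" using A fA by (simp add: card_Diff_subset)
    show "(1 - p) ^ (card A * card ({..<n} - A)) * conn_sum p A *
        graph_sum p ({..<n} - A) (\<lambda>\<mu>. h (add_mset (card A) \<mu>)) =
      (1 - p) ^ (card A * (n - card A)) * conn_prob p (card A) *
        profile_ex p (n - card A) (\<lambda>\<mu>. h (add_mset (card A) \<mu>))"
      using graph_sum_invariant[OF fA refl, of p] cA graph_sum_invariant[OF _ cD, of p] cD by simp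
  qed
  also have "\<dots> = (\<Sum>k=1..n. step_prob p n k * profile_ex p (n - k) (\<lambda>\<mu>. h (add_mset k \<mu>)))"
    using sum_subsets_containing_card[OF finite_lessThan v, of "\<lambda>c. (1 - p) ^ (c * (n - c)) * conn_prob p c *
      profile_ex p (n - c) (\<lambda>\<mu>. h (add_mset c \<mu>))"]
    by (simp add: step_prob_def mult_ac)
  finally show ?thesis .
qed

lemma profile_ex_one [simp]: "profile_ex p n (\<lambda>_. 1) = 1"
  by (simp add: profile_ex_def graph_sum_one)

lemma profile_ex_0 [simp]: "profile_ex p 0 h = h {#}"
  by (simp add: profile_ex_def)

lemma profile_ex_cmult: "profile_ex p n (\<lambda>\<mu>. a * h \<mu>) = a * profile_ex p n h"
  by (simp add: profile_ex_def graph_sum_def sum_distrib_left mult_ac)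

lemma profile_ex_mono:
  assumes "0 \<le> p" "p \<le> 1"
    "\<And>\<mu>. sum_mset \<mu> = n \<Longrightarrow> (\<And>k. k \<in># \<mu> \<Longrightarrow> 1 \<le> k) \<Longrightarrow> h \<mu> \<le> h' \<mu>"
  shows "profile_ex p n h \<le> profile_ex p n h'"
  unfolding profile_ex_def graph_sum_def
  by (intro sum_mono mult_left_mono graph_wt_nonneg assms)
     (auto simp: sum_mset_profile intro: profile_pos[OF finite_lessThan, simplified])

lemma profile_ex_sum: "profile_ex p n (\<lambda>\<mu>. \<Sum>i\<in>I. h i \<mu>) = (\<Sum>i\<in>I. profile_ex p n (h i))"
  unfolding profile_ex_def graph_sum_def sum_distrib_left by (rule sum.swap)

lemma profile_ex_nonneg:
  assumes "0 \<le> p" "p \<le> 1" "\<And>\<mu>. 0 \<le> h \<mu>"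
  shows "0 \<le> profile_ex p n h"
  unfolding profile_ex_def graph_sum_def
  by (intro sum_nonneg mult_nonneg_nonneg graph_wt_nonneg assms)

lemma conn_prob_nonneg: "0 \<le> p \<Longrightarrow> p \<le> 1 \<Longrightarrow> 0 \<le> conn_prob p k"
  unfolding conn_prob_def conn_sum_def by (intro sum_nonneg graph_wt_nonneg)

lemma step_prob_nonneg: "0 \<le> p \<Longrightarrow> p \<le> 1 \<Longrightarrow> 0 \<le> step_prob p n k"
  unfolding step_prob_def by (simp add: conn_prob_nonneg)

lemma sum_step_prob: "n \<ge> 1 \<Longrightarrow> (\<Sum>k=1..n. step_prob p n k) = 1"
  using profile_ex_rec[of n p "\<lambda>_. 1"] by simp

lemma step_prob_le_1:
  assumes "0 \<le> p" "p \<le> 1" "1 \<le> k" "k \<le> n"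
  shows "step_prob p n k \<le> 1"
  using member_le_sum[of k "{1..n}" "step_prob p n"] sum_step_prob[of n p] step_prob_nonneg[of p n] assms
  by auto

section \<open>Link with the random graph of the theorem\<close>

lemma pmf_random_graph:
  assumes p: "0 \<le> p" "p \<le> 1" and E: "E \<subseteq> all_edges n"
  shows "pmf (random_graph n p) E = graph_wt p {..<n} E"
proof -
  have fin: "finite (all_edges n)" by (simp add: all_edges_eq)
  let ?M = "Pi_pmf (all_edges n) False (\<lambda>_. bernoulli_pmf p)"
  have "pmf (random_graph n p) E = measure_pmf.prob ?M {f. {e \<in> all_edges n. f e} = E}"
    by (simp add: random_graph_def pmf_map vimage_def)
  also have "\<dots> = measure_pmf.prob ?M ({f. {e \<in> all_edges n. f e} = E} \<inter> set_pmf ?M)"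
    by (simp add: measure_Int_set_pmf)
  \<comment> \<open>Functions in the support are \<open>False\<close> outside
    \<open>all_edges n\<close>, so the edge set determines the function.\<close>
  also have "{f. {e \<in> all_edges n. f e} = E} \<inter> set_pmf ?M = {\<lambda>e. e \<in> E} \<inter> set_pmf ?M"
    using E set_Pi_pmf_subset[OF fin, of False "\<lambda>_. bernoulli_pmf p"] by fastforce
  also have "measure_pmf.prob ?M \<dots> = pmf ?M (\<lambda>e. e \<in> E)"
    by (simp add: measure_Int_set_pmf measure_pmf_single)
  also have "\<dots> = (\<Prod>e\<in>all_edges n. pmf (bernoulli_pmf p) (e \<in> E))"
    by (rule pmf_Pi'[OF fin]) (use E in auto)
  also have "\<dots> = (\<Prod>e\<in>all_edges n. if e \<in> E then p else 1 - p)"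
    using p by (intro prod.cong) auto
  also have "\<dots> = p ^ card E * (1 - p) ^ card (all_edges n - E)"
  proof -
    have "all_edges n \<inter> E = E" "all_edges n \<inter> - E = all_edges n - E" using E by auto
    then show ?thesis using fin by (simp add: prod.If_cases)
  qed
  also have "\<dots> = graph_wt p {..<n} E"
    unfolding graph_wt_def using E fin by (simp add: card_Diff_subset finite_subset all_edges_eq)
  finally show ?thesis .
qed

lemma prob_random_graph:
  assumes p: "0 \<le> p" "p \<le> 1"
  shows "measure_pmf.prob (random_graph n p) {E. R E} =
    (\<Sum>E\<in>{E \<in> Pow (all_edges n). R E}. graph_wt p {..<n} E)"
proof -
  have fin: "finite (all_edges n)" by (simp add: all_edges_eq)
  have s: "set_pmf (random_graph n p) \<subseteq> Pow (all_edges n)" by (auto simp: random_graph_def)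
  have "measure_pmf.prob (random_graph n p) {E. R E} =
      measure_pmf.prob (random_graph n p) ({E. R E} \<inter> set_pmf (random_graph n p))"
    by (simp add: measure_Int_set_pmf)
  also have "{E. R E} \<inter> set_pmf (random_graph n p) =
      {E \<in> Pow (all_edges n). R E} \<inter> set_pmf (random_graph n p)"
    using s by auto
  also have "measure_pmf.prob (random_graph n p) \<dots> =
      measure_pmf.prob (random_graph n p) {E \<in> Pow (all_edges n). R E}"
    by (simp add: measure_Int_set_pmf)
  also have "\<dots> = (\<Sum>E\<in>{E \<in> Pow (all_edges n). R E}. pmf (random_graph n p) E)"
    by (rule measure_measure_pmf_finite) (use fin in auto)
  also have "\<dots> = (\<Sum>E\<in>{E \<in> Pow (all_edges n). R E}. graph_wt p {..<n} E)"
    by (rule sum.cong) (use pmf_random_graph[OF p] in auto)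
  finally show ?thesis .
qed

definition profile_prob :: "real \<Rightarrow> nat \<Rightarrow> (nat multiset \<Rightarrow> bool) \<Rightarrow> real" where
  "profile_prob p n Q = profile_ex p n (\<lambda>\<mu>. of_bool (Q \<mu>))"

lemma prob_random_graph_profile:
  assumes p: "0 \<le> p" "p \<le> 1"
  shows "measure_pmf.prob (random_graph n p) {E. Q (profile {..<n} E)} = profile_prob p n Q"
  unfolding prob_random_graph[OF p] profile_prob_def profile_ex_def graph_sum_def all_edges_eq
  by (intro sum.mono_neutral_cong_left) auto

text \<open>An edge can only merge the classes of its two ends. Sending every old class, except that
  of y, to the new class of a representative is injective.\<close>

lemma card_comps_insert_edge:
  assumes "finite V" "x \<in> V" "y \<in> V"
  shows "card (comps V E) \<le> card (comps V (insert {x, y} E)) + 1"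
proof -
  let ?R = "conn_rel V E" and ?R' = "conn_rel V (insert {x, y} E)"
  note eqv = equiv_conn_rel[of V E] and eqv' = equiv_conn_rel[of V "insert {x, y} E"]
  let ?U = "?R `` {x} \<union> ?R `` {y}"
  have adj: "adj_on V (insert {x, y} E) = insert (x, y) (insert (y, x) (adj_on V E))"
    using assms by (auto simp: adj_on_def doubleton_eq_iff)
  \<comment> \<open>Invariant along a path of the enlarged graph: its ends are related already
    without the new edge, or both lie in the two classes that are merged.\<close>
  have key: "(a, b) \<in> ?R \<or> (a \<in> ?U \<and> b \<in> ?U)" if "(a, b) \<in> ?R'" for a b
  proof -
    have aV: "a \<in> V" and "(a, b) \<in> (adj_on V (insert {x, y} E))\<^sup>*" using that by (auto simp: conn_rel_def)
    from this(2) show ?thesis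
    proof (induction rule: rtrancl_induct)
      case base
      then show ?case using aV by (auto simp: conn_rel_def)
    next
      case (step b c)
      have tr: "(u, w) \<in> ?R" if "(u, v) \<in> ?R" "(v, w) \<in> ?R" for u v w
        using eqv that by (meson equiv_def transD)
      have sy: "(v, u) \<in> ?R" if "(u, v) \<in> ?R" for u v
        using eqv that by (meson equiv_def symD)
      have rf: "(u, u) \<in> ?R" if "u \<in> V" for u using that by (simp add: conn_rel_def)
      consider "(b, c) \<in> adj_on V E" | "b = x" "c = y" | "b = y" "c = x"
        using step(2) unfolding adj by auto
      then show ?case
      proof cases
        case 1
        then have "(b, c) \<in> ?R" by (auto simp: conn_rel_def adj_on_def)
        then show ?thesis using step(3) tr by blast
      next
        case 2
        then show ?thesis using step(3) sy rf assms by blast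
      next
        case 3
        then show ?thesis using step(3) sy rf assms by blast
      qed
    qed
  qed
  define f where "f C = (SOME a. a \<in> C)" for C :: "'a set"
  have f: "f C \<in> C" if "C \<in> comps V E" for C
    unfolding f_def using comps_nonempty[OF that] by (simp add: some_in_eq)
  have fV: "f C \<in> V" if "C \<in> comps V E" for C using f[OF that] comps_subset[OF that] by auto
  have cls: "C = ?R `` {a}" if "C \<in> comps V E" "a \<in> C" for C a
    using that eqv unfolding comps_def by (metis Image_singleton_iff equiv_class_eq_iff quotientE)
  \<comment> \<open>Two distinct old classes with the same image would both be among the classes of
    x and y, but that of y has been removed.\<close>
  have "inj_on (\<lambda>C. ?R' `` {f C}) (comps V E - {?R `` {y}})"
  proof (rule inj_onI)
    fix C D assume C: "C \<in> comps V E - {?R `` {y}}" and D: "D \<in> comps V E - {?R `` {y}}"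
      and "?R' `` {f C} = ?R' `` {f D}"
    then have "(f C, f D) \<in> ?R'" using fV eqv' by (metis DiffD1 eq_equiv_class)
    then consider "(f C, f D) \<in> ?R" | "f C \<in> ?U" "f D \<in> ?U" using key by blast
    then show "C = D"
    proof cases
      case 1
      then show ?thesis using cls[of C "f C"] cls[of D "f D"] f C D equiv_class_eq[OF eqv 1] by auto
    next
      case 2
      have "f B \<in> ?R `` {x}" if "B \<in> comps V E - {?R `` {y}}" "f B \<in> ?U" for B
        using that cls[of B "f B"] f[of B] equiv_class_eq[OF eqv, of y "f B"] by auto
      then have "f C \<in> ?R `` {x}" "f D \<in> ?R `` {x}" using C D 2 by auto
      then show ?thesis using cls[of C "f C"] cls[of D "f D"] f C D
        equiv_class_eq[OF eqv, of x "f C"] equiv_class_eq[OF eqv, of x "f D"] by auto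
    qed
  qed
  moreover have "(\<lambda>C. ?R' `` {f C}) ` (comps V E - {?R `` {y}}) \<subseteq> comps V (insert {x, y} E)"
    using fV by (auto simp: comps_def[of V "insert {x, y} E"] intro: quotientI)
  ultimately have "card (comps V E - {?R `` {y}}) \<le> card (comps V (insert {x, y} E))"
    using assms(1) card_inj_on_le finite_comps by metis
  then show ?thesis using assms(1) by (simp add: card_Diff_singleton_if split: if_splits)
qed

text \<open>Without edges every vertex is a component, and each edge lowers the number of components
  by at most one.\<close>

lemma card_le_comps_plus_edges:
  assumes "finite V" "E \<subseteq> edges_on V"
  shows "card V \<le> card (comps V E) + card E"
proof -
  have "finite E" using assms finite_subset finite_edges_on by blast
  then show ?thesis using assms(2)
  proof (induction E)
    case empty
    have "conn_rel V {} = Id_on V" by (auto simp: conn_rel_def adj_on_def)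
    then have "comps V {} = (\<lambda>x. {x}) ` V" by (auto simp: comps_def quotient_def)
    then show ?case by (simp add: card_image)
  next
    case (insert e E)
    then obtain x y where e: "e = {x, y}" "x \<in> V" "y \<in> V"
      by (auto simp: edges_on_def card_2_iff)
    show ?case using card_comps_insert_edge[OF assms(1) e(2,3), of E] insert e(1) by simp
  qed
qed

lemma profile_prob_nonneg: "0 \<le> p \<Longrightarrow> p \<le> 1 \<Longrightarrow> 0 \<le> profile_prob p n Q"
  unfolding profile_prob_def by (rule profile_ex_nonneg) auto

lemma profile_prob_mono:
  assumes "0 \<le> p" "p \<le> 1"
    "\<And>\<mu>. sum_mset \<mu> = n \<Longrightarrow> (\<And>k. k \<in># \<mu> \<Longrightarrow> 1 \<le> k) \<Longrightarrow> Q \<mu> \<Longrightarrow> Q' \<mu>"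
  shows "profile_prob p n Q \<le> profile_prob p n Q'"
  unfolding profile_prob_def by (rule profile_ex_mono) (use assms in auto)

lemma profile_prob_union:
  assumes p: "0 \<le> p" "p \<le> 1" and I: "finite I"
    and Q: "\<And>\<mu>. sum_mset \<mu> = n \<Longrightarrow> (\<And>k. k \<in># \<mu> \<Longrightarrow> 1 \<le> k) \<Longrightarrow> Q \<mu> \<Longrightarrow> \<exists>i\<in>I. Q' i \<mu>"
  shows "profile_prob p n Q \<le> (\<Sum>i\<in>I. profile_prob p n (Q' i))"
  unfolding profile_prob_def profile_ex_sum[symmetric]
proof (rule profile_ex_mono[OF p])
  fix \<mu> :: "nat multiset" assume \<mu>: "sum_mset \<mu> = n" "\<And>k. k \<in># \<mu> \<Longrightarrow> 1 \<le> k"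
  show "of_bool (Q \<mu>) \<le> (\<Sum>i\<in>I. of_bool (Q' i \<mu>) :: real)"
  proof (cases "Q \<mu>")
    case True
    then obtain i where "i \<in> I" "Q' i \<mu>" using Q[OF \<mu>] by auto
    then show ?thesis using True I member_le_sum[of i I "\<lambda>i. of_bool (Q' i \<mu>) :: real"] by simp
  qed (auto intro: sum_nonneg)
qed

lemma profile_prob_markov:
  assumes p: "0 \<le> p" "p \<le> 1" and B: "0 < B" and h: "\<And>\<mu>. 0 \<le> h \<mu>"
    and Q: "\<And>\<mu>. sum_mset \<mu> = n \<Longrightarrow> (\<And>k. k \<in># \<mu> \<Longrightarrow> 1 \<le> k) \<Longrightarrow> Q \<mu> \<Longrightarrow> B \<le> h \<mu>"
  shows "profile_prob p n Q \<le> profile_ex p n h / B"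
proof -
  have "profile_prob p n Q \<le> profile_ex p n (\<lambda>\<mu>. 1 / B * h \<mu>)"
    unfolding profile_prob_def
  proof (rule profile_ex_mono[OF p])
    fix \<mu> :: "nat multiset" assume \<mu>: "sum_mset \<mu> = n" "\<And>k. k \<in># \<mu> \<Longrightarrow> 1 \<le> k"
    show "of_bool (Q \<mu>) \<le> 1 / B * h \<mu>"
      using Q[OF \<mu>] h[of \<mu>] B by (cases "Q \<mu>") auto
  qed
  then show ?thesis unfolding profile_ex_cmult by simp
qed

lemma profile_prob_compl:
  "profile_prob p n Q = 1 - profile_prob p n (\<lambda>\<mu>. \<not> Q \<mu>)"
proof -
  have "profile_ex p n (\<lambda>\<mu>. \<Sum>b\<in>{True, False}. of_bool (Q \<mu> = b)) = profile_ex p n (\<lambda>_. 1)"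
    by (rule arg_cong[where f="profile_ex p n"]) auto
  then show ?thesis unfolding profile_ex_sum by (simp add: profile_prob_def)
qed

section \<open>Weights of component sizes\<close>

definition lam :: "real \<Rightarrow> real" where
  "lam p = - ln (1 - p)"

text \<open>The part of the product formula that depends on the number of vertices only. It enters
  through ratios \<open>gam p n / gam p (n - k)\<close>, one for each component that is split
  off.\<close>

definition gam :: "real \<Rightarrow> nat \<Rightarrow> real" where
  "gam p n = fact n * exp (- lam p * (real n)\<^sup>2 / 2)"

definition wgt :: "real \<Rightarrow> nat \<Rightarrow> real" where
  "wgt p k = conn_prob p k * exp (lam p * (real k)\<^sup>2 / 2) / fact k"

lemma lam_pos: "0 < p \<Longrightarrow> p < 1 \<Longrightarrow> 0 < lam p"
  by (simp add: lam_def)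

lemma power_eq_exp_lam: "p < 1 \<Longrightarrow> (1 - p) ^ m = exp (- lam p * real m)"
  by (simp add: lam_def mult.commute[of _ "real m"] exp_of_nat_mult)

lemma gam_pos: "gam p n > 0"
  by (simp add: gam_def)

lemma wgt_nonneg: "0 \<le> p \<Longrightarrow> p \<le> 1 \<Longrightarrow> 0 \<le> wgt p k"
  by (simp add: wgt_def conn_prob_nonneg)

lemma real_binomial_pred:
  assumes "1 \<le> k" "k \<le> n"
  shows "real (n - 1 choose (k - 1)) = real k / real n * (fact n / (fact k * fact (n - k)))"
proof -
  obtain n' k' where n: "n = Suc n'" and k: "k = Suc k'" using assms by (metis Suc_le_D One_nat_def le_trans)
  have "real (n' choose k') = fact n' / (fact k' * fact (n' - k'))"
    by (rule binomial_fact) (use assms n k in auto)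
  then show ?thesis by (simp add: n k field_simps del: of_nat_Suc)
qed

text \<open>The factor k/n is what remains of the binomial coefficient of n - 1 over k - 1 once n! /
  (k! (n-k)!) is extracted.\<close>

lemma step_prob_eq:
  assumes "p < 1" "1 \<le> k" "k \<le> n"
  shows "step_prob p n k = real k / real n * (gam p n / gam p (n - k)) * wgt p k"
proof -
  have e: "exp (- lam p * real (k * (n - k))) =
      exp (- lam p * (real n)\<^sup>2 / 2) / exp (- lam p * (real (n - k))\<^sup>2 / 2) * exp (lam p * (real k)\<^sup>2 / 2)"
  proof -
    have "- lam p * real (k * (n - k)) =
      (- lam p * (real n)\<^sup>2 / 2) - (- lam p * (real (n - k))\<^sup>2 / 2) + (lam p * (real k)\<^sup>2 / 2)"
      using assms by (simp add: of_nat_diff power2_eq_square algebra_simps) (simp add: field_simps)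
    then show ?thesis by (simp only: exp_add exp_diff)
  qed
  show ?thesis
    unfolding step_prob_def real_binomial_pred[OF assms(2,3)] power_eq_exp_lam[OF assms(1)] e gam_def wgt_def
    by (simp add: field_simps)
qed

text \<open>The recursion says that \<open>\<Sum>n. g n x^n\<close> is the exponential of \<open>\<Sum>k. a k x^k\<close>.\<close>

lemma exponential_formula_bound:
  fixes g a :: "nat \<Rightarrow> real"
  assumes g: "\<And>n. 0 \<le> g n" and a: "\<And>k. 0 \<le> a k" and g0: "g 0 = 1"
    and rec: "\<And>n. 1 \<le> n \<Longrightarrow> real n * g n = (\<Sum>k=1..n. real k * a k * g (n - k))"
  shows "g N \<le> exp (\<Sum>k=1..N. a k)"
proof -
  define G where "G x = (\<Sum>n\<le>N. g n * x ^ n)" for x :: real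
  define A where "A x = (\<Sum>k=1..N. a k * x ^ k)" for x :: real
  define G' where "G' x = (\<Sum>n\<le>N. g n * (real n * x ^ (n - 1)))" for x :: real
  define A' where "A' x = (\<Sum>k=1..N. a k * (real k * x ^ (k - 1)))" for x :: real
  have dG: "(G has_real_derivative G' x) (at x)" for x
    unfolding G_def G'_def by (auto intro!: derivative_eq_intros sum.cong)
  have dA: "(A has_real_derivative A' x) (at x)" for x
    unfolding A_def A'_def by (auto intro!: derivative_eq_intros sum.cong)
  \<comment> \<open>For the full series G' = A' G. After truncation at degree N the product A' G has
    extra terms, which are nonnegative for x \<ge> 0, so an inequality remains.\<close>
  have le: "G' x \<le> A' x * G x" if x: "0 \<le> x" for x
  proof -
    have "G' x = (\<Sum>n=1..N. g n * (real n * x ^ (n - 1)))"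
      unfolding G'_def by (rule sum.mono_neutral_right) (auto simp: not_le)
    also have "\<dots> = (\<Sum>n=1..N. \<Sum>k=1..n. (a k * (real k * x ^ (k - 1))) * (g (n - k) * x ^ (n - k)))"
    proof (rule sum.cong[OF refl])
      fix n assume n: "n \<in> {1..N}"
      have "g n * (real n * x ^ (n - 1)) = x ^ (n - 1) * (real n * g n)" by simp
      also have "\<dots> = (\<Sum>k=1..n. x ^ (n - 1) * (real k * a k * g (n - k)))"
        using n rec[of n] by (simp add: sum_distrib_left)
      also have "\<dots> = (\<Sum>k=1..n. (a k * (real k * x ^ (k - 1))) * (g (n - k) * x ^ (n - k)))"
      proof (rule sum.cong[OF refl])
        fix k assume "k \<in> {1..n}"
        then have "n - 1 = (k - 1) + (n - k)" by auto
        then have "x ^ (n - 1) = x ^ (k - 1) * x ^ (n - k)" by (metis power_add)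
        then show "x ^ (n - 1) * (real k * a k * g (n - k)) =
            (a k * (real k * x ^ (k - 1))) * (g (n - k) * x ^ (n - k))" by simp
      qed
      finally show "g n * (real n * x ^ (n - 1)) =
          (\<Sum>k=1..n. (a k * (real k * x ^ (k - 1))) * (g (n - k) * x ^ (n - k)))" .
    qed
    also have "\<dots> = (\<Sum>(n, k)\<in>(SIGMA n:{1..N}. {1..n}).
        (a k * (real k * x ^ (k - 1))) * (g (n - k) * x ^ (n - k)))"
      by (rule sum.Sigma) auto
    also have "\<dots> = (\<Sum>(k, m)\<in>{(k, m). 1 \<le> k \<and> k + m \<le> N}.
        (a k * (real k * x ^ (k - 1))) * (g m * x ^ m))"
      by (rule sum.reindex_bij_witness[where i="\<lambda>(k, m). (k + m, k)" and j="\<lambda>(n, k). (k, n - k)"]) auto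
    also have "\<dots> \<le> (\<Sum>(k, m)\<in>{1..N} \<times> {..N}. (a k * (real k * x ^ (k - 1))) * (g m * x ^ m))"
      by (rule sum_mono2) (use g a x in \<open>auto intro!: mult_nonneg_nonneg\<close>)
    also have "\<dots> = A' x * G x"
      unfolding A'_def G_def sum_product sum.cartesian_product by simp
    finally show ?thesis .
  qed
  \<comment> \<open>By the differential inequality G exp(-A) is nonincreasing on [0,1].\<close>
  have "G 1 * exp (- A 1) \<le> G 0 * exp (- A 0)"
  proof (rule DERIV_nonpos_imp_nonincreasing[of 0 1 "\<lambda>x. G x * exp (- A x)"])
    fix x :: real assume x: "0 \<le> x" "x \<le> 1"
    have "((\<lambda>x. G x * exp (- A x)) has_real_derivative (G' x - A' x * G x) * exp (- A x)) (at x)"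
      by (auto intro!: derivative_eq_intros dG dA simp: algebra_simps)
    moreover have "(G' x - A' x * G x) * exp (- A x) \<le> 0"
      using le[OF x(1)] by (simp add: mult_nonpos_nonneg)
    ultimately show "\<exists>y. ((\<lambda>x. G x * exp (- A x)) has_real_derivative y) (at x) \<and> y \<le> 0" by blast
  qed simp
  moreover have "A 0 = 0" unfolding A_def by (intro sum.neutral) auto
  moreover have "G 0 = 1"
  proof -
    have "G 0 = (\<Sum>n\<in>{0}. g n * 0 ^ n)" unfolding G_def by (rule sum.mono_neutral_right) auto
    then show ?thesis using g0 by simp
  qed
  ultimately have "G 1 \<le> exp (A 1)" by (simp add: exp_minus field_simps)
  moreover have "g N \<le> G 1" unfolding G_def using g by (auto intro: member_le_sum)
  moreover have "A 1 = (\<Sum>k=1..N. a k)" by (simp add: A_def)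
  ultimately show ?thesis by simp
qed

lemma prod_mset_image_nonneg:
  fixes f :: "'a \<Rightarrow> real"
  assumes "\<And>k. 0 \<le> f k"
  shows "0 \<le> (\<Prod>k\<in>#\<mu>. f k)"
  by (induction \<mu>) (auto simp: assms)

text \<open>For a multiplicative functional the exploration recursion, divided by
  \<open>gam\<close>, is the recursion of the exponential formula with coefficients
  \<open>wgt p k * z ^ k * f k\<close>. The parameter z is free, as in a saddle point bound.\<close>

lemma profile_ex_prod_bound:
  assumes p: "0 < p" "p < 1" and f: "\<And>k. 0 \<le> f k" and z: "0 < z"
  shows "profile_ex p n (\<lambda>\<mu>. \<Prod>k\<in>#\<mu>. f k) \<le>
    gam p n * (1 / z) ^ n * exp (\<Sum>k=1..n. wgt p k * z ^ k * f k)"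
proof -
  define \<Phi> where "\<Phi> n = profile_ex p n (\<lambda>\<mu>. \<Prod>k\<in>#\<mu>. f k)" for n
  define g where "g n = \<Phi> n * z ^ n / gam p n" for n
  have pos: "0 \<le> g n" for n
    unfolding g_def \<Phi>_def using p z gam_pos[of p n]
    by (intro divide_nonneg_pos mult_nonneg_nonneg profile_ex_nonneg) (auto intro!: prod_mset_image_nonneg simp: f)
  have rec: "real n * g n = (\<Sum>k=1..n. real k * (wgt p k * z ^ k * f k) * g (n - k))" if n: "1 \<le> n" for n
  proof -
    have "\<Phi> n = (\<Sum>k=1..n. step_prob p n k * (f k * \<Phi> (n - k)))"
      unfolding \<Phi>_def by (subst profile_ex_rec[OF n]) (simp add: profile_ex_cmult)
    then have "real n * g n = (\<Sum>k=1..n. real n * (z ^ n / gam p n * (step_prob p n k * (f k * \<Phi> (n - k)))))"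
      by (simp add: g_def sum_distrib_left sum_distrib_right sum_divide_distrib mult_ac)
    also have "\<dots> = (\<Sum>k=1..n. real k * (wgt p k * z ^ k * f k) * g (n - k))"
    proof (rule sum.cong[OF refl])
      fix k assume k: "k \<in> {1..n}"
      then have "z ^ n = z ^ k * z ^ (n - k)" by (simp add: power_add[symmetric])
      then show "real n * (z ^ n / gam p n * (step_prob p n k * (f k * \<Phi> (n - k)))) =
          real k * (wgt p k * z ^ k * f k) * g (n - k)"
        using k n p gam_pos[of p n] gam_pos[of p "n - k"]
        by (simp add: step_prob_eq g_def field_simps)
    qed
    finally show ?thesis .
  qed
  have "g n \<le> exp (\<Sum>k=1..n. wgt p k * z ^ k * f k)"
    by (rule exponential_formula_bound[OF pos _ _ rec])
       (use p z f in \<open>auto simp: wgt_nonneg g_def \<Phi>_def gam_def\<close>)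
  then have "\<Phi> n * z ^ n \<le> gam p n * exp (\<Sum>k=1..n. wgt p k * z ^ k * f k)"
    using gam_pos[of p n] by (simp add: g_def field_simps)
  then show ?thesis using z unfolding \<Phi>_def by (simp add: field_simps)
qed

text \<open>Sum the hypothesis over m: the left side has total mass one. The geometric series on the
  right is summed as a geometric distribution.\<close>

lemma pmf_geometric_bound:
  assumes P: "\<And>m. pmf P m \<le> D * \<theta> ^ m" and \<theta>: "0 \<le> \<theta>" "\<theta> < 1"
  shows "1 \<le> D / (1 - \<theta>)"
proof -
  have D: "D \<ge> 0" using P[of 0] order_trans[OF pmf_nonneg[of P 0]] by simp
  have "ennreal 1 = emeasure (measure_pmf P) UNIV" using measure_pmf.emeasure_space_1[of P] by simp
  also have "\<dots> = (\<integral>\<^sup>+ m. pmf P m \<partial>count_space UNIV)" by (simp add: nn_integral_pmf)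
  also have "\<dots> \<le> (\<integral>\<^sup>+ m. ennreal (D / (1 - \<theta>)) * ennreal (pmf (geometric_pmf (1 - \<theta>)) m) \<partial>count_space UNIV)"
  proof (rule nn_integral_mono)
    fix m :: nat
    have "pmf P m \<le> (D / (1 - \<theta>)) * pmf (geometric_pmf (1 - \<theta>)) m"
      using P[of m] \<theta> by simp
    then show "ennreal (pmf P m) \<le> ennreal (D / (1 - \<theta>)) * ennreal (pmf (geometric_pmf (1 - \<theta>)) m)"
      using D \<theta> by (simp add: ennreal_mult'[symmetric] ennreal_leI)
  qed
  also have "\<dots> = ennreal (D / (1 - \<theta>)) * emeasure (measure_pmf (geometric_pmf (1 - \<theta>))) UNIV"
    by (simp add: nn_integral_cmult nn_integral_pmf)
  also have "\<dots> = ennreal (D / (1 - \<theta>))"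
    using measure_pmf.emeasure_space_1[of "geometric_pmf (1 - \<theta>)"] by simp
  finally show ?thesis using D \<theta> by (simp add: ennreal_le_iff)
qed

text \<open>In a random graph on \<open>M\<close> vertices the component of a given vertex has size \<open>k\<close> with
  probability at most one; averaging over \<open>M\<close> with negative binomial weights bounds the
  connection probability without any exploration argument.\<close>

lemma conn_prob_upper:
  assumes p: "0 < p" "p < 1" and k: "1 \<le> k" and \<theta>: "0 < \<theta>" "\<theta> < 1"
  shows "conn_prob p k \<le> (1 - \<theta> * (1 - p) ^ k) ^ k / (1 - \<theta>)"
proof -
  define x where "x = (1 - p) ^ k"
  have x: "0 < x" "x < 1" using p k by (auto simp: x_def power_less_one_iff)
  have y: "0 < 1 - \<theta> * x" "1 - \<theta> * x \<le> 1"
  proof -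
    have "\<theta> * x < 1 * 1" using x \<theta> by (intro mult_strict_mono) auto
    then show "0 < 1 - \<theta> * x" by simp
  qed (use x \<theta> in auto)
  show ?thesis
  proof (cases "conn_prob p k = 0")
    case True
    then show ?thesis using y \<theta> by (simp add: x_def)
  next
    case False
    then have C: "conn_prob p k > 0" using conn_prob_nonneg[of p k] p by auto
    \<comment> \<open>With k + m vertices, \<open>step_prob\<close> at most one bounds the binomial
      coefficient times x^m by 1 / \<open>conn_prob p k\<close>. The negative binomial probabilities
      contain the same coefficient times (\<theta> x)^m.\<close>
    have "pmf (neg_binomial_pmf k (1 - \<theta> * x)) m \<le> ((1 - \<theta> * x) ^ k / conn_prob p k) * \<theta> ^ m" for m
    proof -
      have "step_prob p (k + m) k \<le> 1" by (rule step_prob_le_1) (use p k in auto)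
      moreover have "(k + m - 1) choose (k - 1) = (m + k - 1) choose m"
        using k by (subst binomial_symmetric) (auto simp: add.commute)
      ultimately have "real ((m + k - 1) choose m) * x ^ m \<le> 1 / conn_prob p k"
        using C by (simp add: step_prob_def x_def power_mult[symmetric] field_simps)
      then have "real ((m + k - 1) choose m) * x ^ m * ((1 - \<theta> * x) ^ k * \<theta> ^ m) \<le>
          1 / conn_prob p k * ((1 - \<theta> * x) ^ k * \<theta> ^ m)"
        by (rule mult_right_mono) (use y \<theta> in auto)
      then show ?thesis using y \<theta> x
        by (subst pmf_neg_binomial) (auto simp: power_mult_distrib mult_ac)
    qed
    from pmf_geometric_bound[OF this] have "1 \<le> ((1 - \<theta> * x) ^ k / conn_prob p k) / (1 - \<theta>)"
      using \<theta> by auto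
    then show ?thesis using C \<theta> by (simp add: field_simps x_def)
  qed
qed

text \<open>Take \<theta> = 1 - 1/n. This costs a factor n, and the change of the k-th power stays
  bounded as long as 1 - (1-p)^k is bounded away from zero, which in the sparse regime means k of
  order n.\<close>

lemma conn_prob_upper':
  assumes p: "0 < p" "p < 1" and k: "1 \<le> k" "k \<le> n" and n: "2 \<le> n"
  shows "conn_prob p k \<le> real n * exp (1 / (1 - (1 - p) ^ k)) * (1 - (1 - p) ^ k) ^ k"
proof -
  define x where "x = (1 - p) ^ k"
  have x: "0 < x" "x < 1" using p k by (auto simp: x_def power_less_one_iff)
  have "1 - (1 - 1 / real n) * x = (1 - x) * (1 + x / (real n * (1 - x)))"
    using x n by (simp add: field_simps)
  also have "\<dots> \<le> (1 - x) * exp (x / (real n * (1 - x)))"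
    using x exp_ge_add_one_self by (intro mult_left_mono) auto
  finally have "(1 - (1 - 1 / real n) * x) ^ k \<le> ((1 - x) * exp (x / (real n * (1 - x)))) ^ k"
    by (rule power_mono) (use x n in \<open>auto intro!: mult_le_one\<close>)
  also have "\<dots> = (1 - x) ^ k * exp (real k * (x / (real n * (1 - x))))"
    by (simp add: power_mult_distrib exp_of_nat_mult[symmetric])
  also have "\<dots> \<le> (1 - x) ^ k * exp (1 / (1 - x))"
  proof -
    have "real k * x \<le> real n * 1" using k x by (intro mult_mono) auto
    then have "(real k * x) / real n / (1 - x) \<le> 1 / (1 - x)"
      using x n by (intro divide_right_mono) (auto simp: field_simps)
    then have "real k * (x / (real n * (1 - x))) \<le> 1 / (1 - x)" by simp
    then show ?thesis using x by (intro mult_left_mono) auto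
  qed
  finally have *: "(1 - (1 - 1 / real n) * x) ^ k \<le> (1 - x) ^ k * exp (1 / (1 - x))" .
  have "conn_prob p k \<le> (1 - (1 - 1 / real n) * x) ^ k / (1 - (1 - 1 / real n))"
    unfolding x_def by (rule conn_prob_upper[OF p k(1)]) (use n in auto)
  also have "\<dots> = real n * (1 - (1 - 1 / real n) * x) ^ k" using n by simp
  also have "\<dots> \<le> real n * ((1 - x) ^ k * exp (1 / (1 - x)))"
    by (rule mult_left_mono[OF *]) simp
  finally show ?thesis by (simp add: x_def mult_ac)
qed

section \<open>Weights of small sizes in total\<close>

lemma one_minus_ge_exp:
  fixes x :: real
  assumes "0 \<le> x" "x \<le> 1 / 2"
  shows "exp (- 2 * x) \<le> 1 - x"
proof -
  have "x * x \<le> x * (1 / 2)" using assms by (intro mult_left_mono) auto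
  then have "- 2 * x \<le> ln (1 - x)"
    using ln_one_minus_pos_lower_bound[OF assms] by (simp add: power2_eq_square)
  then show ?thesis using assms by (simp add: ln_ge_iff)
qed

lemma fact_div_fact_ge:
  assumes "k \<le> M"
  shows "(real M - real k) ^ k \<le> fact M / fact (M - k)"
  using assms
proof (induction k arbitrary: M)
  case 0
  then show ?case by simp
next
  case (Suc k)
  then obtain M' where M: "M = Suc M'" by (metis Suc_le_D)
  have "(real M - real (Suc k)) ^ Suc k = (real M' - real k) * (real M' - real k) ^ k"
    by (simp add: M)
  also have "\<dots> \<le> real M * (fact M' / fact (M' - k))"
    using Suc.IH[of M'] Suc.prems M by (intro mult_mono) auto
  also have "\<dots> = fact M / fact (M - Suc k)" by (simp add: M)
  finally show ?case .
qed

text \<open>These are the terms \<open>k \<le> R\<close> of \<open>\<Sum>k. step_prob p M k = 1\<close>.\<close>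

lemma small_weights_nat:
  assumes p: "0 < p" "p < 1" and M: "1 \<le> M" "2 * R \<le> M"
  shows "(\<Sum>k=1..R. real k * wgt p k * (real M * exp (- lam p * real M) * exp (- 2 * real R / real M)) ^ k)
    \<le> real M"
proof -
  have tm: "real k * wgt p k * (real M * exp (- lam p * real M) * exp (- 2 * real R / real M)) ^ k
     \<le> real M * step_prob p M k" if k: "k \<in> {1..R}" for k
  proof -
    have kM: "1 \<le> k" "k \<le> M" "2 * k \<le> M" using k M by auto
    \<comment> \<open>The falling factorial of M is at least (M-k)^k, and k \<le> R \<le> M/2 allows
      M - k to be replaced by M at the price of the factor exp(-2R/M).\<close>
    have "real M * exp (- 2 * real R / real M) \<le> real M * exp (- 2 * (real k / real M))"
      using k M by (intro mult_left_mono) (auto simp: field_simps)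
    also have "\<dots> \<le> real M * (1 - real k / real M)"
      using kM M by (intro mult_left_mono one_minus_ge_exp) (auto simp: field_simps)
    also have "\<dots> = real M - real k" using M by (simp add: field_simps)
    finally have "(real M * exp (- 2 * real R / real M)) ^ k \<le> (real M - real k) ^ k"
      by (rule power_mono) auto
    also have "\<dots> \<le> fact M / fact (M - k)" by (rule fact_div_fact_ge) (use kM in auto)
    finally have 1: "(real M * exp (- 2 * real R / real M)) ^ k \<le> fact M / fact (M - k)" .
    have 2: "exp (- lam p * real M) ^ k \<le>
        exp (- lam p * (real M)\<^sup>2 / 2) / exp (- lam p * (real (M - k))\<^sup>2 / 2)"
    proof -
      \<comment> \<open>The term \<lambda> k^2/2 that is dropped is nonnegative.\<close>
      have "real k * (- lam p * real M) \<le> (- lam p * (real M)\<^sup>2 / 2) - (- lam p * (real (M - k))\<^sup>2 / 2)"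
      proof -
        have "(- lam p * (real M)\<^sup>2 / 2) - (- lam p * (real (M - k))\<^sup>2 / 2) =
           real k * (- lam p * real M) + lam p * (real k)\<^sup>2 / 2"
        proof -
          have d: "real (M - k) = real M - real k" using kM by (simp add: of_nat_diff)
          show ?thesis unfolding d by (simp add: power2_eq_square field_simps)
        qed
        then show ?thesis using lam_pos[OF p] by simp
      qed
      then show ?thesis by (simp add: exp_of_nat_mult[symmetric] exp_diff[symmetric])
    qed
    have "(real M * exp (- lam p * real M) * exp (- 2 * real R / real M)) ^ k =
        (real M * exp (- 2 * real R / real M)) ^ k * exp (- lam p * real M) ^ k"
      by (simp add: power_mult_distrib mult_ac)
    also have "\<dots> \<le> fact M / fact (M - k) *
        (exp (- lam p * (real M)\<^sup>2 / 2) / exp (- lam p * (real (M - k))\<^sup>2 / 2))"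
      by (rule mult_mono[OF 1 2]) auto
    also have "\<dots> = gam p M / gam p (M - k)" by (simp add: gam_def)
    finally have "real k * wgt p k * (real M * exp (- lam p * real M) * exp (- 2 * real R / real M)) ^ k
      \<le> real k * wgt p k * (gam p M / gam p (M - k))"
      by (rule mult_left_mono) (use wgt_nonneg p in auto)
    also have "\<dots> = real M * step_prob p M k"
      using step_prob_eq[OF p(2) kM(1,2)] M by simp
    finally show ?thesis .
  qed
  have "(\<Sum>k=1..R. real k * wgt p k * (real M * exp (- lam p * real M) * exp (- 2 * real R / real M)) ^ k)
     \<le> (\<Sum>k=1..R. real M * step_prob p M k)" by (rule sum_mono) (rule tm)
  also have "\<dots> \<le> (\<Sum>k=1..M. real M * step_prob p M k)"
    by (rule sum_mono2) (use M p in \<open>auto simp: step_prob_nonneg\<close>)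
  also have "\<dots> = real M" using sum_step_prob[OF M(1)] by (simp add: sum_distrib_left[symmetric])
  finally show ?thesis .
qed

text \<open>Round x down to an integer M \<ge> x/2. In the exponent of the bound on
  \<open>\<kappa>\<close>, 2/x pays for the rounding and 4R/x for the factor exp(-2R/M) of the
  integer case. Real x are used because the bound is integrated next.\<close>

lemma small_weights_real:
  assumes p: "0 < p" "p < 1" and x: "2 \<le> x" "4 * real R \<le> x"
    and \<kappa>: "0 \<le> \<kappa>" "\<kappa> \<le> exp (- (2 + 4 * real R) / x)"
  shows "(\<Sum>k=1..R. real k * wgt p k * (\<kappa> * (x * exp (- lam p * x))) ^ k) \<le> x"
proof -
  define M where "M = nat \<lfloor>x\<rfloor>"
  have M: "real M \<le> x" "x < real M + 1" "1 \<le> M" using x unfolding M_def by linarith+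
  then have M2: "x / 2 \<le> real M" using x by linarith
  have MR: "2 * R \<le> M" using M2 x by linarith
  have ex: "exp (- (2 + 4 * real R) / x) \<le> exp (- (1 / real M)) * exp (- 2 * real R / real M)"
  proof -
    have "(1 + 2 * real R) / real M \<le> (1 + 2 * real R) / (x / 2)"
      by (rule divide_left_mono) (use M2 x M in auto)
    then show ?thesis by (simp add: exp_add[symmetric] add_divide_distrib diff_divide_distrib)
  qed
  have "x \<le> real M * exp (1 / real M)"
  proof -
    have "real M * (1 + 1 / real M) = real M + 1" using M by (simp add: distrib_left)
    then have "x \<le> real M * (1 + 1 / real M)" using M by linarith
    also have "\<dots> \<le> real M * exp (1 / real M)" by (intro mult_left_mono) auto
    finally show ?thesis .
  qed
  then have xM: "x * exp (- (1 / real M)) \<le> real M"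
    by (simp add: exp_minus field_simps)
  have "\<kappa> * (x * exp (- lam p * x)) \<le>
      (exp (- (1 / real M)) * exp (- 2 * real R / real M)) * (x * exp (- lam p * real M))"
    using \<kappa> ex x M lam_pos[OF p] by (intro mult_mono) auto
  also have "\<dots> = (x * exp (- (1 / real M))) * (exp (- lam p * real M) * exp (- 2 * real R / real M))"
    by simp
  also have "\<dots> \<le> real M * (exp (- lam p * real M) * exp (- 2 * real R / real M))"
    using xM by (rule mult_right_mono) simp
  finally have z: "\<kappa> * (x * exp (- lam p * x)) \<le>
      real M * exp (- lam p * real M) * exp (- 2 * real R / real M)" by simp
  have "(\<Sum>k=1..R. real k * wgt p k * (\<kappa> * (x * exp (- lam p * x))) ^ k) \<le>
    (\<Sum>k=1..R. real k * wgt p k * (real M * exp (- lam p * real M) * exp (- 2 * real R / real M)) ^ k)"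
    using z p \<kappa> x by (intro sum_mono mult_left_mono power_mono) (auto simp: wgt_nonneg)
  also have "\<dots> \<le> real M" by (rule small_weights_nat[OF p M(3) MR])
  finally show ?thesis using M by simp
qed

text \<open>The logarithmic derivative of y exp(-\<lambda> y) is (1 - \<lambda> y)/y, so by the
  preceding bound the sum without the factor k has derivative at most 1 - \<lambda> y, as long as
  \<lambda> y \<le> 1. Integrate from x0 to x; at x0 the sum is at most x0. With t = \<lambda> x the
  main term is x (1 - t/2), the number of components expected for x vertices and mean degree
  t.\<close>

lemma small_weights_integrated:
  assumes p: "0 < p" "p < 1" and x0: "2 \<le> x0" "4 * real R \<le> x0"
    and \<kappa>: "0 \<le> \<kappa>" "\<kappa> \<le> exp (- (2 + 4 * real R) / x0)"
    and x: "x0 \<le> x" "lam p * x \<le> 1"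
  shows "(\<Sum>k=1..R. wgt p k * (\<kappa> * (x * exp (- lam p * x))) ^ k) \<le> x0 + x - lam p * x\<^sup>2 / 2"
proof -
  define W where "W y = (\<Sum>k=1..R. wgt p k * (\<kappa> * (y * exp (- lam p * y))) ^ k)" for y
  define S where "S y = (\<Sum>k=1..R. real k * wgt p k * (\<kappa> * (y * exp (- lam p * y))) ^ k)" for y
  have S: "S y \<le> y" if "x0 \<le> y" for y
    unfolding S_def
  proof (rule small_weights_real[OF p])
    have "(2 + 4 * real R) / y \<le> (2 + 4 * real R) / x0"
      by (rule divide_left_mono) (use that x0 in auto)
    then have "exp (- ((2 + 4 * real R) / x0)) \<le> exp (- ((2 + 4 * real R) / y))" by simp
    then have "exp (- (2 + 4 * real R) / x0) \<le> exp (- (2 + 4 * real R) / y)"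
      by (simp only: minus_divide_left)
    then show "\<kappa> \<le> exp (- (2 + 4 * real R) / y)" using \<kappa> by linarith
  qed (use that x0 \<kappa> in auto)
  have dW: "(W has_real_derivative S y * ((1 - lam p * y) / y)) (at y)" if y: "x0 \<le> y" for y
  proof -
    have y0: "y > 0" using y x0 by auto
    have "(W has_real_derivative (\<Sum>k=1..R. wgt p k * (real k * (\<kappa> * (y * exp (- lam p * y))) ^ (k - 1) *
        (\<kappa> * (exp (- lam p * y) * (1 - lam p * y)))))) (at y)"
      unfolding W_def
    proof (rule DERIV_sum)
      fix k
      have d: "((\<lambda>y. \<kappa> * (y * exp (- lam p * y))) has_real_derivative
          (\<kappa> * (exp (- lam p * y) * (1 - lam p * y)))) (at y)"
        by (auto intro!: derivative_eq_intros simp: algebra_simps)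
      show "((\<lambda>y. wgt p k * (\<kappa> * (y * exp (- lam p * y))) ^ k) has_real_derivative
          wgt p k * (real k * (\<kappa> * (y * exp (- lam p * y))) ^ (k - 1) *
          (\<kappa> * (exp (- lam p * y) * (1 - lam p * y))))) (at y)"
        by (rule DERIV_cmult, rule DERIV_cong[OF DERIV_power[OF d]]) simp
    qed
    also have "(\<Sum>k=1..R. wgt p k * (real k * (\<kappa> * (y * exp (- lam p * y))) ^ (k - 1) *
        (\<kappa> * (exp (- lam p * y) * (1 - lam p * y))))) = S y * ((1 - lam p * y) / y)"
      unfolding S_def sum_distrib_right
    proof (rule sum.cong[OF refl])
      fix k assume "k \<in> {1..R}"
      then obtain j where j: "k = Suc j" by (metis atLeastAtMost_iff Suc_le_D One_nat_def)
      show "wgt p k * (real k * (\<kappa> * (y * exp (- lam p * y))) ^ (k - 1) *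
          (\<kappa> * (exp (- lam p * y) * (1 - lam p * y)))) =
        real k * wgt p k * (\<kappa> * (y * exp (- lam p * y))) ^ k * ((1 - lam p * y) / y)"
        using y0 by (simp add: j field_simps)
    qed
    finally show ?thesis .
  qed
  have "W x - (x - lam p * x\<^sup>2 / 2) \<le> W x0 - (x0 - lam p * x0\<^sup>2 / 2)"
  proof (rule DERIV_nonpos_imp_nonincreasing[OF x(1)])
    fix y assume y: "x0 \<le> y" "y \<le> x"
    have y0: "y > 0" using y x0 by auto
    have "lam p * y \<le> lam p * x" using lam_pos[OF p] y by simp
    then have nn: "0 \<le> 1 - lam p * y" using x by linarith
    have "((\<lambda>y. W y - (y - lam p * y\<^sup>2 / 2)) has_real_derivative
        S y * ((1 - lam p * y) / y) - (1 - lam p * y)) (at y)"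
      by (auto intro!: derivative_eq_intros dW[OF y(1)])
    moreover have "S y * ((1 - lam p * y) / y) \<le> y * ((1 - lam p * y) / y)"
      using S[OF y(1)] nn y0 by (intro mult_right_mono) auto
    ultimately show "\<exists>d. ((\<lambda>y. W y - (y - lam p * y\<^sup>2 / 2)) has_real_derivative d) (at y) \<and> d \<le> 0"
      using y0 by (intro exI[of _ "S y * ((1 - lam p * y) / y) - (1 - lam p * y)"]) auto
  qed
  moreover have "W x0 \<le> S x0"
    unfolding W_def S_def
  proof (rule sum_mono)
    fix k assume "k \<in> {1..R}"
    then have "1 * wgt p k \<le> real k * wgt p k" using wgt_nonneg p by (intro mult_right_mono) auto
    then show "wgt p k * (\<kappa> * (x0 * exp (- lam p * x0))) ^ k \<le>
        real k * wgt p k * (\<kappa> * (x0 * exp (- lam p * x0))) ^ k"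
      using \<kappa> x0 by (intro mult_right_mono) auto
  qed
  moreover have "S x0 \<le> x0" by (rule S) simp
  moreover have "0 \<le> x0 - (x0 - lam p * x0\<^sup>2 / 2)" using lam_pos[OF p] by simp
  moreover have "x0 \<ge> lam p * x0\<^sup>2 / 2"
  proof -
    have "lam p * x0 \<le> lam p * x" using lam_pos[OF p] x by simp
    then have "lam p * x0 \<le> 1" using x by linarith
    then have "x0 * (lam p * x0) \<le> x0 * 1" using x0 by (intro mult_left_mono) auto
    then show ?thesis using x0 by (simp add: power2_eq_square mult_ac)
  qed
  moreover have "W x0 - (x0 - lam p * x0\<^sup>2 / 2) \<le> x0"
    using calculation by linarith
  ultimately show ?thesis unfolding W_def by linarith
qed

section \<open>The rate functions\<close>

lemma continuous_on_x_ln_x: "continuous_on {0..} (\<lambda>x::real. x * ln x)"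
proof (rule continuous_on_eq_continuous_within[THEN iffD2], rule ballI)
  fix x :: real assume "x \<in> {0..}"
  then consider "x > 0" | "x = 0" by fastforce
  then show "continuous (at x within {0..}) (\<lambda>x. x * ln x)"
  proof cases
    case 1
    then show ?thesis by (intro continuous_intros) auto
  next
    case 2
    have "((\<lambda>x::real. x * ln x) \<longlongrightarrow> 0) (at_right 0)" by real_asymp
    moreover have "at (0::real) within {0..} = at_right 0"
      unfolding at_within_def by (rule arg_cong[where f="\<lambda>S. inf (nhds 0) (principal S)"]) auto
    ultimately show ?thesis using 2 by (simp add: continuous_within)
  qed
qed

text \<open>This is ln ((x/2) / sinh (x/2)), a decreasing function with slopes in [-1/2, 0]; the
  properties of \<open>K\<close> follow through \<open>K_eq_kap\<close>. At x = 0 the conventions x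
  / 0 = 0 and ln 0 = 0 give 0, which is also the limit.\<close>

definition kap :: "real \<Rightarrow> real" where
  "kap x = ln (x / (1 - exp (- x))) - x / 2"

lemma K_eq_kap: "K c u = u * kap (c * u)"
  by (simp add: K_def kap_def algebra_simps power2_eq_square)

lemma kap_0 [simp]: "kap 0 = 0"
  by (simp add: kap_def)

lemma kap_bounds:
  assumes "0 < x"
  shows "kap x \<le> 0" "- x / 2 \<le> kap x"
proof -
  have e: "0 < 1 - exp (- x)" using assms by simp
  \<comment> \<open>This is x \<le> 2 sinh (x/2), which follows from cosh \<ge> 1 by
    integration.\<close>
  have "0 - exp (0 / 2) + exp (- 0 / 2) \<ge> x - exp (x / 2) + exp (- x / 2)"
  proof (rule DERIV_nonpos_imp_nonincreasing[of 0 x "\<lambda>x. x - exp (x / 2) + exp (- x / 2)"])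
    fix y :: real assume "0 \<le> y" "y \<le> x"
    have "((\<lambda>x. x - exp (x / 2) + exp (- x / 2)) has_real_derivative
        (1 - exp (y / 2) * (1 / 2) - exp (- y / 2) * (1 / 2))) (at y)"
      by (auto intro!: derivative_eq_intros)
    moreover have "1 - exp (y / 2) * (1 / 2) - exp (- y / 2) * (1 / 2) \<le> 0"
      using exp_ge_add_one_self[of "y / 2"] exp_ge_add_one_self[of "- y / 2"] by linarith
    ultimately show "\<exists>d. ((\<lambda>x. x - exp (x / 2) + exp (- x / 2)) has_real_derivative d) (at y) \<and> d \<le> 0"
      by blast
  qed (use assms in simp)
  then have "x \<le> exp (x / 2) - exp (- x / 2)" by simp
  also have "\<dots> = exp (x / 2) * (1 - exp (- x))"
    by (simp add: algebra_simps exp_add[symmetric])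
  finally have "x / (1 - exp (- x)) \<le> exp (x / 2)" using e by (simp add: field_simps)
  then have "ln (x / (1 - exp (- x))) \<le> x / 2"
    using assms e by (metis divide_pos_pos exp_gt_zero ln_exp ln_le_cancel_iff)
  then show "kap x \<le> 0" by (simp add: kap_def)
  have "1 \<le> x / (1 - exp (- x))" using e exp_ge_add_one_self[of "- x"] by (simp add: field_simps)
  then show "- x / 2 \<le> kap x" by (simp add: kap_def)
qed

lemma has_derivative_kap:
  assumes "0 < x"
  shows "(kap has_real_derivative (1 / x - 1 / (exp x - 1) - 1 / 2)) (at x)"
proof -
  have e: "0 < 1 - exp (- x)" "0 < exp x - 1" using assms by auto
  have "(kap has_real_derivative
      (1 / (x / (1 - exp (- x)))) * ((1 - exp (- x) - x * exp (- x)) / (1 - exp (- x))\<^sup>2) - 1 / 2) (at x)"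
    unfolding kap_def[abs_def] using assms e
    by (auto intro!: derivative_eq_intros simp: power2_eq_square)
  also have "(1 / (x / (1 - exp (- x)))) * ((1 - exp (- x) - x * exp (- x)) / (1 - exp (- x))\<^sup>2)
      = 1 / x - 1 / (exp x - 1)"
  proof -
    have "exp (- x) / (1 - exp (- x)) = 1 / (exp x - 1)" using e by (simp add: exp_minus field_simps)
    moreover have "(1 / (x / (1 - exp (- x)))) * ((1 - exp (- x) - x * exp (- x)) / (1 - exp (- x))\<^sup>2)
      = 1 / x - exp (- x) / (1 - exp (- x))"
      using assms e by (simp add: power2_eq_square divide_simps)
    ultimately show ?thesis by simp
  qed
  finally show ?thesis .
qed

text \<open>The upper bound amounts to 2 (e^x - 1) \<le> x (e^x + 1), the lower one to x \<le> e^x -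
  1.\<close>

lemma kap_derivative_bounds:
  assumes "(0::real) < x"
  shows "1 / x - 1 / (exp x - 1) - 1 / 2 \<le> 0" "- 1 / 2 \<le> 1 / x - 1 / (exp x - 1) - 1 / 2"
proof -
  have e: "0 < exp x - 1" using assms by auto
  have "0 * (exp 0 + 1) - 2 * (exp 0 - 1) \<le> x * (exp x + 1) - 2 * (exp x - 1)"
  proof (rule DERIV_nonneg_imp_nondecreasing[of 0 x "\<lambda>x. x * (exp x + 1) - 2 * (exp x - 1)"])
    fix y :: real assume "0 \<le> y" "y \<le> x"
    have "((\<lambda>x. x * (exp x + 1) - 2 * (exp x - 1)) has_real_derivative
        (1 + (y - 1) * exp y)) (at y)"
      by (auto intro!: derivative_eq_intros simp: algebra_simps)
    moreover have "0 \<le> 1 + (y - 1) * exp y"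
    proof -
      have "(1 - y) * exp y \<le> exp (- y) * exp y"
        using exp_ge_add_one_self[of "- y"] by (intro mult_right_mono) auto
      then show ?thesis by (simp add: exp_add[symmetric] algebra_simps)
    qed
    ultimately show "\<exists>d. ((\<lambda>x. x * (exp x + 1) - 2 * (exp x - 1)) has_real_derivative d) (at y) \<and> 0 \<le> d"
      by blast
  qed (use assms in simp)
  then have "2 * (exp x - 1) \<le> x * (exp x + 1)" by simp
  then have "1 / x \<le> (exp x + 1) / (2 * (exp x - 1))"
    using assms e by (simp add: field_simps)
  also have "\<dots> = 1 / (exp x - 1) + 1 / 2" using e by (simp add: field_simps)
  finally show "1 / x - 1 / (exp x - 1) - 1 / 2 \<le> 0" by simp
  have "x \<le> exp x - 1" using exp_ge_add_one_self[of x] by linarith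
  then have "1 / (exp x - 1) \<le> 1 / x" using assms by (intro divide_left_mono) auto
  then show "- 1 / 2 \<le> 1 / x - 1 / (exp x - 1) - 1 / 2" by simp
qed

lemma kap_mono:
  assumes "0 \<le> x" "x \<le> y"
  shows "kap y \<le> kap x" "kap x - kap y \<le> (y - x) / 2"
proof -
  have "kap y \<le> kap x \<and> kap x - kap y \<le> (y - x) / 2"
  proof (cases "x = 0")
    \<comment> \<open>The derivative is only available for positive arguments, so the end point 0 is
      taken from \<open>kap_bounds\<close>.\<close>
    case True
    then show ?thesis using kap_bounds[of y] assms by (cases "y = 0") auto
  next
    case False
    then have x: "0 < x" using assms by simp
    have "kap y \<le> kap x"
      by (rule DERIV_nonpos_imp_nonincreasing[OF assms(2)])
         (use x has_derivative_kap kap_derivative_bounds(1) in \<open>meson less_le_trans\<close>)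
    moreover have "kap x + x / 2 \<le> kap y + y / 2"
    proof (rule DERIV_nonneg_imp_nondecreasing[OF assms(2), of "\<lambda>x. kap x + x / 2"])
      fix z assume "x \<le> z" "z \<le> y"
      then have z: "0 < z" using x by simp
      have "((\<lambda>x. kap x + x / 2) has_real_derivative ((1 / z - 1 / (exp z - 1) - 1 / 2) + 1 / 2)) (at z)"
        by (auto intro!: derivative_eq_intros has_derivative_kap[OF z])
      then show "\<exists>d. ((\<lambda>x. kap x + x / 2) has_real_derivative d) (at z) \<and> 0 \<le> d"
        using kap_derivative_bounds(2)[OF z] by (intro exI conjI) auto
    qed
    ultimately show ?thesis by simp
  qed
  then show "kap y \<le> kap x" "kap x - kap y \<le> (y - x) / 2" by auto
qed

lemma kap_lipschitz:
  assumes "0 \<le> x" "0 \<le> y"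
  shows "\<bar>kap x - kap y\<bar> \<le> \<bar>x - y\<bar> / 2"
  using kap_mono[of x y] kap_mono[of y x] assms by (cases "x \<le> y") auto

section \<open>The functions K and L\<close>

lemma K_0 [simp]: "K c 0 = 0"
  by (simp add: K_eq_kap)

lemma K_nonpos: "0 \<le> c \<Longrightarrow> 0 \<le> u \<Longrightarrow> K c u \<le> 0"
  using kap_mono(1)[of 0 "c * u"] by (simp add: K_eq_kap mult_nonneg_nonpos)

lemma K_ge: "0 \<le> c \<Longrightarrow> 0 \<le> u \<Longrightarrow> - (c * u\<^sup>2 / 2) \<le> K c u"
proof -
  assume a: "0 \<le> c" "0 \<le> u"
  then have "u * (- (c * u) / 2) \<le> u * kap (c * u)"
    using kap_mono(2)[of 0 "c * u"] by (intro mult_left_mono) auto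
  then show ?thesis by (simp add: K_eq_kap power2_eq_square mult_ac)
qed

lemma K_antimono:
  assumes "0 \<le> c" "0 \<le> u" "u \<le> v"
  shows "K c v \<le> K c u"
proof -
  have "v * kap (c * v) \<le> u * kap (c * v)"
    using assms kap_mono(1)[of 0 "c * v"] by (intro mult_right_mono_neg) auto
  also have "\<dots> \<le> u * kap (c * u)"
    using assms by (intro mult_left_mono kap_mono(1)) auto
  finally show ?thesis by (simp add: K_eq_kap)
qed

lemma K_diff:
  assumes "0 \<le> c" "0 \<le> c'" "0 \<le> u" "u \<le> 1"
  shows "\<bar>K c u - K c' u\<bar> \<le> \<bar>c - c'\<bar> * u"
proof -
  have "\<bar>K c u - K c' u\<bar> = u * \<bar>kap (c * u) - kap (c' * u)\<bar>"
    using assms unfolding K_eq_kap right_diff_distrib[symmetric] by (simp add: abs_mult)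
  also have "\<dots> \<le> u * (\<bar>c * u - c' * u\<bar> / 2)"
    using assms by (intro mult_left_mono kap_lipschitz) auto
  also have "\<bar>c * u - c' * u\<bar> = \<bar>c - c'\<bar> * u" using assms unfolding left_diff_distrib[symmetric] by (simp add: abs_mult)
  also have "u * (\<bar>c - c'\<bar> * u / 2) \<le> u * \<bar>c - c'\<bar>"
  proof (rule mult_left_mono)
    have "\<bar>c - c'\<bar> * (u / 2) \<le> \<bar>c - c'\<bar> * 1" using assms by (intro mult_left_mono) auto
    then show "\<bar>c - c'\<bar> * u / 2 \<le> \<bar>c - c'\<bar>" by simp
  qed (use assms in auto)
  finally show ?thesis by (simp add: mult.commute)
qed

lemma continuous_on_K:
  assumes "0 \<le> c" shows "continuous_on {0..} (K c)"
proof -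
  have "continuous_on {0..} kap"
  proof (rule continuous_on_iff[THEN iffD2], intro ballI allI impI)
    fix x e :: real assume "x \<in> {0..}" "0 < e"
    then show "\<exists>d>0. \<forall>x'\<in>{0..}. dist x' x < d \<longrightarrow> dist (kap x') (kap x) < e"
      using kap_lipschitz by (intro exI[of _ e]) (fastforce simp: dist_real_def)
  qed
  from continuous_on_compose2[OF this, of "{0..}" "\<lambda>u. c * u"]
  have "continuous_on {0..} (\<lambda>u. kap (c * u))"
    using assms by (fastforce intro!: continuous_intros)
  then have "continuous_on {0..} (\<lambda>u. u * kap (c * u))" by (intro continuous_on_mult continuous_on_id)
  then show ?thesis by (simp add: K_eq_kap[abs_def])
qed

text \<open>\<open>K c u\<close> is u times a decreasing function of u, hence subadditive. Merging
  components lowers the sum, so the cheapest way to realise a given macroscopic mass is a single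
  component; this is why \<open>I_alpha\<close> contains only one \<tau>.\<close>

lemma K_sum_mset:
  assumes "0 \<le> c" "\<And>u. u \<in># M \<Longrightarrow> 0 \<le> u"
  shows "K c (\<Sum>u\<in>#M. u) \<le> (\<Sum>u\<in>#M. K c u)"
  using assms(2)
proof (induction M)
  case empty
  then show ?case by simp
next
  case (add x M)
  let ?s = "\<Sum>u\<in>#M. u"
  have "0 \<le> \<Sum>\<^sub># N" if "\<And>u. u \<in># N \<Longrightarrow> 0 \<le> u" for N :: "real multiset"
    using that by (induction N) auto
  then have s: "0 \<le> ?s" using add.prems by simp
  have x: "0 \<le> x" using add.prems by simp
  have "K c (x + ?s) = x * kap (c * (x + ?s)) + ?s * kap (c * (x + ?s))"
    by (simp add: K_eq_kap distrib_right)
  also have "\<dots> \<le> x * kap (c * x) + ?s * kap (c * ?s)"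
    using x s assms(1) by (intro add_mono mult_left_mono kap_mono(1)) (auto simp: distrib_left)
  also have "\<dots> \<le> K c x + (\<Sum>u\<in>#M. K c u)"
    using add by (simp add: K_eq_kap)
  finally show ?case by simp
qed

lemma continuous_on_L: "continuous_on {0..1} (L c)"
proof -
  have "continuous_on {0..1} (\<lambda>u::real. (1 - u) * ln (1 - u))"
    by (rule continuous_on_compose2[OF continuous_on_x_ln_x, of _ "\<lambda>u. 1 - u"])
       (auto intro!: continuous_intros)
  moreover have "continuous_on {0..1} (\<lambda>u. (c - ln c) * u - c * u\<^sup>2 / 2)"
    by (intro continuous_intros) auto
  ultimately have "continuous_on {0..1} (\<lambda>u. (1 - u) * ln (1 - u) + ((c - ln c) * u - c * u\<^sup>2 / 2))"
    by (rule continuous_on_add)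
  then show ?thesis unfolding L_def[abs_def] by (simp add: algebra_simps)
qed

text \<open>The derivative at x is w - 1 - ln w with w = c (1 - x).\<close>

lemma L_mono:
  assumes c: "0 < c" and uv: "0 \<le> u" "u \<le> v" "v \<le> 1"
  shows "L c u \<le> L c v"
proof (rule DERIV_nonneg_imp_increasing_open[OF uv(2)])
  fix x assume x: "u < x" "x < v"
  then have x1: "0 < 1 - x" using uv by simp
  have "ln (c * (1 - x)) = ln c + ln (1 - x)" using x1 c by (simp add: ln_mult)
  moreover have "(L c has_real_derivative (c * (1 - x) - 1 - (ln c + ln (1 - x)))) (at x)"
  proof -
    have "((\<lambda>u. (1 - u) * ln (1 - u)) has_real_derivative
        (- 1 * ln (1 - x) + (1 / (1 - x)) * (- 1) * (1 - x))) (at x)"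
      using x1 by (auto intro!: derivative_eq_intros)
    then have "((\<lambda>u. (1 - u) * ln (1 - u)) has_real_derivative (- ln (1 - x) - 1)) (at x)"
      using x1 by simp
    moreover have "((\<lambda>u. (c - ln c) * u - c * u\<^sup>2 / 2) has_real_derivative (c - ln c - c * x)) (at x)"
      by (auto intro!: derivative_eq_intros)
    ultimately have "((\<lambda>u. (1 - u) * ln (1 - u) + ((c - ln c) * u - c * u\<^sup>2 / 2)) has_real_derivative
        (- ln (1 - x) - 1) + (c - ln c - c * x)) (at x)"
      by (rule DERIV_add)
    then show ?thesis unfolding L_def[abs_def] by (simp add: algebra_simps)
  qed
  ultimately have "(L c has_real_derivative (c * (1 - x) - 1 - ln (c * (1 - x)))) (at x)" by simp
  moreover have "0 \<le> c * (1 - x) - 1 - ln (c * (1 - x))"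
    using ln_le_minus_one[of "c * (1 - x)"] c x1 by simp
  ultimately show "\<exists>y. (L c has_real_derivative y) (at x) \<and> 0 \<le> y" by blast
qed (rule continuous_on_subset[OF continuous_on_L], use uv in auto)

text \<open>The left side is the exponent of the Chebyshev bound for macroscopic mass s with y = 1.
  The best t is the mean degree c (1 - s) of the remaining graph, but only t \<le> 1 is admissible;
  this cut-off turns s into its maximum with 1 - 1/c. Raising t to at least \<open>\<beta>\<close>,
  for uniformity, costs the last term.\<close>

lemma upper_exponent_sizes:
  assumes c: "0 < c" and \<beta>: "0 < \<beta>" "\<beta> \<le> 1" and s: "0 \<le> s" "s \<le> 1"
  shows "\<exists>t\<in>{\<beta>..1}. ln c - 1 - c / 2 - (1 - s) * ln t + (1 - s) * t + s + (t - t\<^sup>2 / 2) / c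
    \<le> - L c (max (1 - 1 / c) s) + (1 + 1 / c) * \<beta>"
proof -
  define b where "b = 1 - s"
  have sb: "s = 1 - b" and b: "0 \<le> b" "b \<le> 1" using s by (auto simp: b_def)
  show ?thesis
  proof (cases "c * b \<ge> 1")
    \<comment> \<open>The remaining graph would not be subcritical, so t = 1. The terms in s then
      cancel and leave the value of L at 1 - 1/c.\<close>
    case True
    then have "1 / c \<le> b" using c by (simp add: field_simps)
    then have m: "max (1 - 1 / c) s = 1 - 1 / c" by (simp add: sb)
    have "L c (1 - 1 / c) = c / 2 - ln c - 1 / (2 * c)"
      using c by (simp add: L_def ln_div power2_eq_square field_simps)
    then have "ln c - 1 - c / 2 - (1 - s) * ln 1 + (1 - s) * 1 + s + (1 - 1\<^sup>2 / 2) / c = - L c (max (1 - 1 / c) s)"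
      unfolding m using c by (simp add: field_simps)
    moreover have "0 \<le> (1 + 1 / c) * \<beta>" using c \<beta> by simp
    ultimately show ?thesis using \<beta> by (intro bexI[of _ 1]) auto
  next
    case False
    then have "b \<le> 1 / c" using c by (simp add: field_simps)
    then have m: "max (1 - 1 / c) s = s" by (simp add: sb)
    define t0 where "t0 = c * b"
    have t0: "0 \<le> t0" "t0 < 1" using c b False by (auto simp: t0_def)
    define X where "X = ln c - 1 - c / 2 - b * ln t0 + b * t0 + s + (t0 - t0\<^sup>2 / 2) / c"
    have X: "X = - L c s"
    proof (cases "b = 0")
      case True
      then show ?thesis by (simp add: X_def L_def sb t0_def)
    next
      case False
      then have lt: "ln t0 = ln c + ln b" using b c by (simp add: t0_def ln_mult)
      show ?thesis unfolding X_def lt using c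
        by (simp add: L_def sb t0_def power2_eq_square field_simps)
    qed
    define t where "t = max \<beta> t0"
    have tt: "t \<in> {\<beta>..1}" using \<beta> t0 by (auto simp: t_def)
    have "- b * ln t \<le> - b * ln t0"
    proof (cases "b = 0")
      case False
      then have "0 < t0" using b c by (simp add: t0_def)
      then have "ln t0 \<le> ln t" by (simp add: t_def)
      then show ?thesis using b by (simp add: mult_left_mono)
    qed simp
    moreover have "b * t \<le> b * t0 + \<beta>"
    proof -
      have "b * t \<le> b * (t0 + \<beta>)" using b \<beta> t0 by (intro mult_left_mono) (auto simp: t_def)
      moreover have "b * \<beta> \<le> 1 * \<beta>" using b \<beta> by (intro mult_right_mono) auto
      ultimately show ?thesis by (simp add: distrib_left)
    qed
    moreover have "(t - t\<^sup>2 / 2) / c \<le> (t0 - t0\<^sup>2 / 2) / c + \<beta> / c"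
    proof -
      have "t0\<^sup>2 \<le> t\<^sup>2" using t0 by (intro power_mono) (auto simp: t_def)
      moreover have "t \<le> t0 + \<beta>" using t0 \<beta> by (simp add: t_def)
      ultimately have "t - t\<^sup>2 / 2 \<le> t0 - t0\<^sup>2 / 2 + \<beta>" by linarith
      then show ?thesis using c by (simp add: divide_right_mono add_divide_distrib[symmetric])
    qed
    ultimately have "ln c - 1 - c / 2 - b * ln t + b * t + s + (t - t\<^sup>2 / 2) / c \<le> X + (1 + 1 / c) * \<beta>"
      by (simp add: X_def distrib_right)
    then show ?thesis using tt unfolding m X b_def by blast
  qed
qed

text \<open>The function minimised in \<^const>\<open>I_alpha\<close>, with \<open>a\<close> replaced by the mean degree
  \<open>t = 2 (1 - a - \<tau>) / (1 - \<tau>)\<close> of the graph outside the giant component, so that it is continuous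
  on the unit square, including \<open>\<tau> = 1\<close>.\<close>

definition RA :: "real \<Rightarrow> real \<Rightarrow> real \<Rightarrow> real" where
  "RA c \<tau> t = K c \<tau> + L c \<tau> +
     ((1 - \<tau>) * (t * ln t) - t * ((1 - \<tau>) * ln (1 - \<tau>)) - (1 - \<tau>) * t * ln c) / 2
     - t * (1 - \<tau>) / 2 + c * (1 - \<tau>)\<^sup>2 / 2"

lemma continuous_on_RA:
  assumes "0 \<le> c" shows "continuous_on ({0..1} \<times> {0..1}) (\<lambda>(\<tau>, t). RA c \<tau> t)"
proof -
  have 1: "continuous_on ({0..1} \<times> {0..1}) (\<lambda>x::real \<times> real. snd x * ln (snd x))"
    by (rule continuous_on_compose2[OF continuous_on_x_ln_x]) (auto intro!: continuous_intros)
  have 2: "continuous_on ({0..1} \<times> {0..1}) (\<lambda>x::real \<times> real. (1 - fst x) * ln (1 - fst x))"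
    by (rule continuous_on_compose2[OF continuous_on_x_ln_x, of _ "\<lambda>x. 1 - fst x"])
       (auto intro!: continuous_intros)
  have 3: "continuous_on ({0..1} \<times> {0..1}) (\<lambda>x::real \<times> real. K c (fst x))"
    by (rule continuous_on_compose2[OF continuous_on_K[OF assms]]) (auto intro!: continuous_intros)
  have 4: "continuous_on ({0..1} \<times> {0..1}) (\<lambda>x::real \<times> real. L c (fst x))"
    by (rule continuous_on_compose2[OF continuous_on_L]) (auto intro!: continuous_intros)
  show ?thesis unfolding RA_def case_prod_unfold by (intro continuous_intros 1 2 3 4) auto
qed

lemma RA_eq:
  assumes c: "0 < c" and \<tau>: "\<tau> < 1" and t: "0 \<le> t"
  shows "RA c \<tau> t = K c \<tau> + L c \<tau> + c * (1 - \<tau>)\<^sup>2 / 2 * pi_fun (t / (c * (1 - \<tau>)))"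
proof (cases "t = 0")
  case True
  then show ?thesis by (simp add: RA_def pi_fun_def)
next
  case False
  define b where "b = 1 - \<tau>"
  have b: "0 < b" using \<tau> by (simp add: b_def)
  have l: "ln (t / (c * b)) = ln t - ln c - ln b" using False t c b by (simp add: ln_div ln_mult)
  have "c * b\<^sup>2 / 2 * pi_fun (t / (c * b)) = (t * b) / 2 * ln (t / (c * b)) - t * b / 2 + c * b\<^sup>2 / 2"
    using c b by (simp add: pi_fun_def power2_eq_square field_simps)
  then show ?thesis unfolding RA_def b_def[symmetric] l by (simp add: algebra_simps diff_divide_distrib add_divide_distrib)
qed

text \<open>The range of \<tau> in \<open>I_alpha\<close> corresponds exactly to 0 \<le> t \<le> 1.
  As an infimum of a continuous function over a fibre of a map on the compact square,
  \<open>I_alpha\<close> becomes accessible to compactness arguments.\<close>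

lemma I_alpha_fibre:
  assumes c: "0 < c" and a: "0 \<le> a" "a \<le> 1"
  shows "I_alpha c a = (INF x\<in>{(\<tau>, t). \<tau> \<in> {0..1} \<and> t \<in> {0..1} \<and> (1 - \<tau>) * (1 - t / 2) = a}.
    ereal (RA c (fst x) (snd x)))"
proof (rule antisym)
  let ?F = "\<lambda>\<tau>. ereal (K c \<tau> + L c \<tau>
          + c * (1 - \<tau>)\<^sup>2 / 2 * pi_fun (2 * (1 - a - \<tau>) / (c * (1 - \<tau>)\<^sup>2)))"
  have RF: "ereal (RA c \<tau> t) = ?F \<tau>"
    if "\<tau> \<in> {0..1}" "t \<in> {0..1}" "(1 - \<tau>) * (1 - t / 2) = a" for \<tau> t
  proof (cases "\<tau> = 1")
    case True
    then show ?thesis by (simp add: RA_def)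
  next
    case False
    then have \<tau>: "\<tau> < 1" using that by auto
    have "2 * (1 - a - \<tau>) = t * (1 - \<tau>)" unfolding that(3)[symmetric] by (simp add: field_simps)
    then have "2 * (1 - a - \<tau>) / (c * (1 - \<tau>)\<^sup>2) = t / (c * (1 - \<tau>))"
      using \<tau> c by (simp add: power2_eq_square)
    then show ?thesis using RA_eq[OF c \<tau>, of t] that by simp
  qed
  show "I_alpha c a \<le> (INF x\<in>{(\<tau>, t). \<tau> \<in> {0..1} \<and> t \<in> {0..1} \<and> (1 - \<tau>) * (1 - t / 2) = a}.
    ereal (RA c (fst x) (snd x)))"
  proof (rule INF_greatest, clarify)
    fix \<tau> t assume *: "\<tau> \<in> {0..1}" "t \<in> {0..1}" "a = (1 - \<tau>) * (1 - t / 2)"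
    have 1: "(1 - \<tau>) * (1 / 2) \<le> a" unfolding *(3) using * by (intro mult_left_mono) auto
    have 2: "a \<le> (1 - \<tau>) * 1" unfolding *(3) using * by (intro mult_left_mono) auto
    have "\<tau> \<in> {max (1 - 2 * a) 0..1 - a}" using * 1 2 by auto
    then have "I_alpha c a \<le> ?F \<tau>" unfolding I_alpha_def by (rule INF_lower)
    then show "I_alpha c ((1 - \<tau>) * (1 - t / 2)) \<le> ereal (RA c (fst (\<tau>, t)) (snd (\<tau>, t)))"
      using RF[of \<tau> t] * by simp
  qed
  show "(INF x\<in>{(\<tau>, t). \<tau> \<in> {0..1} \<and> t \<in> {0..1} \<and> (1 - \<tau>) * (1 - t / 2) = a}.
    ereal (RA c (fst x) (snd x))) \<le> I_alpha c a"
    unfolding I_alpha_def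
  proof (rule INF_greatest)
    fix \<tau> assume \<tau>: "\<tau> \<in> {max (1 - 2 * a) 0..1 - a}"
    \<comment> \<open>If \<tau> = 1 then a = 0 and every t lies in the fibre; 0 is one
      choice.\<close>
    define t where "t = (if \<tau> = 1 then 0 else 2 * (1 - a - \<tau>) / (1 - \<tau>))"
    have *: "\<tau> \<in> {0..1} \<and> t \<in> {0..1} \<and> (1 - \<tau>) * (1 - t / 2) = a"
      using \<tau> a by (auto simp: t_def field_simps)
    have "(INF x\<in>{(\<tau>, t). \<tau> \<in> {0..1} \<and> t \<in> {0..1} \<and> (1 - \<tau>) * (1 - t / 2) = a}.
      ereal (RA c (fst x) (snd x))) \<le> ereal (RA c (fst (\<tau>, t)) (snd (\<tau>, t)))"
      by (rule INF_lower) (use * in auto)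
    then show "(INF x\<in>{(\<tau>, t). \<tau> \<in> {0..1} \<and> t \<in> {0..1} \<and> (1 - \<tau>) * (1 - t / 2) = a}.
      ereal (RA c (fst x) (snd x))) \<le> ?F \<tau>"
      using RF[of \<tau> t] * by simp
  qed
qed

text \<open>The saddle point y = (a + \<beta>) c / (t - t^2/2) for a n small components has been
  inserted. If b = 1 - s \<le> 2 a, the vertices outside the macroscopic components can have mean
  degree 2 (1 - a/b) \<le> 1, and \<tau> = s. Otherwise this degree would exceed 1; then t = 1, and
  the surplus mass is counted as part of the giant component, \<tau> = 1 - 2 a > s.\<close>

lemma upper_exponent_alpha:
  assumes c: "0 < c" and \<beta>: "0 < \<beta>" "\<beta> \<le> 1" and s: "0 \<le> s" and a: "0 \<le> a" and as: "a + s \<le> 1"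
  shows "\<exists>t\<in>{\<beta>..1}. \<exists>\<tau>\<in>{0..1}. \<exists>t'\<in>{0..1}. (1 - \<tau>) * (1 - t' / 2) = a \<and> s \<le> \<tau> \<and>
    ln c - 1 - c / 2 - (1 - s) * ln t + (1 - s) * t + s + (a + \<beta>)
      - a * ln ((a + \<beta>) * c / (t - t\<^sup>2 / 2)) - K c \<tau> \<le> - RA c \<tau> t' + 4 * \<beta>"
proof -
  define b where "b = 1 - s"
  have sb: "s = 1 - b" and b: "0 \<le> b" "b \<le> 1" "a \<le> b" using s a as by (auto simp: b_def)
  have drop: "- a * ln ((a + \<beta>) * c / (t - t\<^sup>2 / 2)) \<le> - a * ln a - a * ln c + a * ln t + a * ln (1 - t / 2)"
    if "0 < t" "t \<le> 1" for t
  proof (cases "a = 0")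
    case False
    then have a0: "0 < a" using a by simp
    have "t - t\<^sup>2 / 2 = t * (1 - t / 2)" by (simp add: power2_eq_square algebra_simps)
    then have "ln ((a + \<beta>) * c / (t - t\<^sup>2 / 2)) = ln (a + \<beta>) + ln c - (ln t + ln (1 - t / 2))"
      using a0 \<beta> c that by (simp add: ln_div ln_mult)
    moreover have "a * ln a \<le> a * ln (a + \<beta>)" using a0 \<beta> by (intro mult_left_mono) auto
    moreover have "a * (ln (a + \<beta>) + ln c - (ln t + ln (1 - t / 2))) =
        a * ln (a + \<beta>) + a * ln c - a * ln t - a * ln (1 - t / 2)" by (simp add: algebra_simps)
    ultimately show ?thesis by simp
  qed simp
  consider "b = 0" | "b > 0" "b \<le> 2 * a" | "2 * a < b" using b a by linarith
  then show ?thesis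
  proof cases
    case 1
    then have a0: "a = 0" and s1: "s = 1" using a b sb by auto
    show ?thesis using c \<beta>
      by (intro bexI[of _ 1] bexI[of _ 0] conjI) (auto simp: a0 s1 RA_def L_def)
  next
    case 2
    define t0 where "t0 = 2 * (1 - a / b)"
    have t0: "0 \<le> t0" "t0 \<le> 1" and ab: "a = b * (1 - t0 / 2)"
      using 2 b a by (auto simp: t0_def field_simps)
    have a0: "0 < a" using 2 by simp
    have lna: "ln a = ln b + ln (1 - t0 / 2)" unfolding ab using 2 t0 by (subst ln_mult) auto
    define X where "X = ln c - 1 - c / 2 - (b / 2) * (t0 * ln t0) + b * t0 + s + a - a * ln c - a * ln b"
    have X: "X = - (RA c s t0 - K c s)"
      unfolding X_def RA_def b_def[symmetric] ab L_def
      by (simp add: sb power2_eq_square field_simps)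
    define t where "t = max \<beta> t0"
    have tt: "t \<in> {\<beta>..1}" "0 < t" "t \<le> 1" using \<beta> t0 by (auto simp: t_def)
    have main: "ln c - 1 - c / 2 - b * ln t + b * t + s + (a + \<beta>)
        + (- a * ln a - a * ln c + a * ln t + a * ln (1 - t / 2)) \<le> X + 4 * \<beta>"
    proof -
      have 1: "- b * ln t + a * ln t \<le> - (b / 2) * (t0 * ln t0)"
      proof -
        have "- b * ln t + a * ln t = - (b / 2 * t0) * ln t" unfolding ab by (simp add: algebra_simps)
        also have "\<dots> \<le> - (b / 2 * t0) * ln t0"
        proof (cases "t0 = 0")
          case False
          then have "ln t0 \<le> ln t" using t0 by (simp add: t_def)
          then show ?thesis using 2 t0 by (intro mult_left_mono_neg) auto
        qed simp
        finally show ?thesis by simp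
      qed
      have 2: "b * t \<le> b * t0 + \<beta>"
      proof -
        have "b * t \<le> b * (t0 + \<beta>)" using b \<beta> t0 by (intro mult_left_mono) (auto simp: t_def)
        moreover have "b * \<beta> \<le> 1 * \<beta>" using b \<beta> by (intro mult_right_mono) auto
        ultimately show ?thesis by (simp add: distrib_left)
      qed
      have 3: "a * ln (1 - t / 2) - a * ln (1 - t0 / 2) \<le> 0"
      proof -
        have "ln (1 - t / 2) \<le> ln (1 - t0 / 2)" using t0 tt by (simp add: t_def)
        then show ?thesis using a0 by (simp add: mult_left_mono)
      qed
      have "- a * ln a = - a * ln b - a * ln (1 - t0 / 2)" unfolding lna by (simp add: algebra_simps)
      with 1 2 3 \<beta> show ?thesis unfolding X_def by linarith
    qed
    have "ln c - 1 - c / 2 - (1 - s) * ln t + (1 - s) * t + s + (a + \<beta>)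
      - a * ln ((a + \<beta>) * c / (t - t\<^sup>2 / 2)) - K c s \<le> - RA c s t0 + 4 * \<beta>"
      using main drop[OF tt(2,3)] X unfolding b_def[symmetric] by linarith
    moreover have "(1 - s) * (1 - t0 / 2) = a" unfolding b_def[symmetric] using ab by simp
    ultimately show ?thesis using tt t0 s as a
      by (intro bexI[of _ t] bexI[of _ s] bexI[of _ t0]) auto
  next
    case 3
    define \<tau> where "\<tau> = 1 - 2 * a"
    have \<tau>: "\<tau> \<in> {0..1}" "s \<le> \<tau>" using 3 b a s by (auto simp: \<tau>_def sb)
    have ex: "ln c - 1 - c / 2 - b * ln 1 + b * 1 + s + (a + \<beta>)
        + (- a * ln a - a * ln c + a * ln 1 + a * ln (1 - 1 / 2)) = - (RA c \<tau> 1 - K c \<tau>) + \<beta>"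
    proof (cases "a = 0")
      case True
      then show ?thesis by (simp add: RA_def \<tau>_def L_def sb)
    next
      case False
      then have l: "ln (2 * a) = ln 2 + ln a" "ln (a * 2) = ln 2 + ln a" "ln (1 / 2 :: real) = - ln 2"
        using a by (auto simp: ln_mult ln_div)
      have "1 - \<tau> = 2 * a" by (simp add: \<tau>_def)
      then show ?thesis
        unfolding RA_def L_def by (simp add: l sb \<tau>_def power2_eq_square algebra_simps add_divide_distrib diff_divide_distrib)
    qed
    have "ln c - 1 - c / 2 - (1 - s) * ln 1 + (1 - s) * 1 + s + (a + \<beta>)
      - a * ln ((a + \<beta>) * c / (1 - 1\<^sup>2 / 2)) - K c \<tau> \<le> - RA c \<tau> 1 + 4 * \<beta>"
      using ex drop[of 1] \<beta> unfolding b_def[symmetric] by linarith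
    moreover have "(1 - \<tau>) * (1 - 1 / 2) = a" by (simp add: \<tau>_def)
    ultimately show ?thesis using \<beta> \<tau> by (intro bexI[of _ 1] bexI[of _ \<tau>]) auto
  qed
qed

section \<open>Exponential tilting\<close>

text \<open>One half of a crude Stirling formula, from (1 + 1/n)^n \<le> e; the other half, which
  follows, uses e \<le> (1 + 1/n)^(n+1). Errors polynomial in n are harmless at scale n.\<close>

lemma fact_ge_power_exp: "real n ^ n \<le> fact n * exp (real n)"
proof (induction n)
  case 0
  then show ?case by simp
next
  case (Suc n)
  show ?case
  proof (cases "n = 0")
    case False
    have "(1 + 1 / real n) ^ n \<le> exp (1 / real n) ^ n"
      using exp_ge_add_one_self by (intro power_mono) auto
    also have "\<dots> = exp 1" using False by (simp add: exp_of_nat_mult[symmetric])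
    finally have e: "(1 + 1 / real n) ^ n \<le> exp 1" .
    have "real (Suc n) = real n * (1 + 1 / real n)" using False by (simp add: field_simps)
    then have "real (Suc n) ^ Suc n = real (Suc n) * (real n ^ n * (1 + 1 / real n) ^ n)"
      by (metis power_Suc power_mult_distrib)
    also have "\<dots> \<le> real (Suc n) * ((fact n * exp (real n)) * exp 1)"
      by (intro mult_left_mono mult_mono Suc.IH e) auto
    also have "\<dots> = fact (Suc n) * exp (real (Suc n))" by (simp add: exp_add)
    finally show ?thesis .
  qed simp
qed

lemma fact_le_power_exp:
  assumes "1 \<le> n"
  shows "fact n * exp (real n) \<le> exp 1 * real n * real n ^ n"
  using assms
proof (induction n rule: dec_induct)
  case base
  then show ?case by simp
next
  case (step n)
  then have n: "0 < real n" by simp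
  have "1 / real (Suc n) \<le> ln (1 + 1 / real n)"
  proof -
    have "ln (real n / real (Suc n)) \<le> real n / real (Suc n) - 1"
      by (rule ln_le_minus_one) (use n in simp)
    also have "\<dots> = - (1 / real (Suc n))" using n by (simp add: field_simps)
    finally have "1 / real (Suc n) \<le> - ln (real n / real (Suc n))" by simp
    also have "\<dots> = ln (real (Suc n) / real n)" using n by (simp add: ln_div)
    also have "real (Suc n) / real n = 1 + 1 / real n" using n by (simp add: field_simps)
    finally show ?thesis .
  qed
  then have "1 \<le> real (Suc n) * ln (1 + 1 / real n)" by (simp add: field_simps)
  then have "exp 1 \<le> exp (real (Suc n) * ln (1 + 1 / real n))" by simp
  also have "\<dots> = (1 + 1 / real n) ^ Suc n" using n by (subst exp_of_nat_mult) (simp add: add_pos_pos)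
  finally have e: "exp 1 \<le> (1 + 1 / real n) ^ Suc n" .
  have "fact (Suc n) * exp (real (Suc n)) = real (Suc n) * (fact n * exp (real n)) * exp 1"
    by (simp add: exp_add)
  also have "\<dots> \<le> real (Suc n) * (exp 1 * real n * real n ^ n) * (1 + 1 / real n) ^ Suc n"
    by (rule mult_mono[OF mult_left_mono[OF step.IH] e]) auto
  also have "\<dots> = exp 1 * real (Suc n) * (real n * (1 + 1 / real n)) ^ Suc n"
    by (simp add: power_mult_distrib)
  also have "real n * (1 + 1 / real n) = real (Suc n)" using n by (simp add: field_simps)
  finally show ?case .
qed

text \<open>In this form k^k / e^k cancels against the k! of \<open>wgt\<close>. Besides linear
  terms the exponent that is left is -k \<open>kap\<close> (\<lambda> k) = -n \<open>K\<close> (n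
  \<lambda>) (k/n): this is the origin of K in the action functionals.\<close>

lemma conn_leading_order:
  assumes p: "0 < p" "p < 1" and k: "1 \<le> k"
  shows "(1 - (1 - p) ^ k) ^ k * exp (lam p * (real k)\<^sup>2 / 2) =
    exp (real k * (ln (lam p) + 1 - kap (lam p * real k))) * (real k ^ k / exp (real k))"
proof -
  have l: "0 < lam p" by (rule lam_pos[OF p])
  have q: "(1 - p) ^ k = exp (- (lam p * real k))" using power_eq_exp_lam[OF p(2), of k] by simp
  have e: "0 < 1 - exp (- (lam p * real k))" using l k by simp
  have kp: "kap (lam p * real k) = ln (lam p) + ln (real k) - ln (1 - exp (- (lam p * real k))) - lam p * real k / 2"
    unfolding kap_def using l k e by (simp add: ln_div ln_mult)
  have "real k * (ln (lam p) + 1 - kap (lam p * real k)) =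
      real k * ln (1 - exp (- (lam p * real k))) + lam p * (real k)\<^sup>2 / 2 + real k - real k * ln (real k)"
    unfolding kp by (simp add: algebra_simps power2_eq_square)
  then have "exp (real k * (ln (lam p) + 1 - kap (lam p * real k))) =
      (1 - exp (- (lam p * real k))) ^ k * exp (lam p * (real k)\<^sup>2 / 2) * exp (real k) / real k ^ k"
    using e k by (simp add: exp_add exp_diff exp_of_nat_mult)
  then show ?thesis using k q by simp
qed

lemma wgt_upper:
  assumes p: "0 < p" "p < 1" and k: "1 \<le> k" "k \<le> n" and n: "2 \<le> n"
  shows "wgt p k \<le> real n * exp (1 / (1 - (1 - p) ^ k)) *
    exp (real k * (ln (lam p) + 1 - kap (lam p * real k)))"
proof -
  let ?E = "exp (1 / (1 - (1 - p) ^ k))" and ?X = "exp (real k * (ln (lam p) + 1 - kap (lam p * real k)))"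
  have "wgt p k \<le> (real n * ?E * (1 - (1 - p) ^ k) ^ k) * exp (lam p * (real k)\<^sup>2 / 2) / fact k"
    unfolding wgt_def using conn_prob_upper'[OF p k n]
    by (intro divide_right_mono mult_right_mono) auto
  also have "\<dots> = real n * ?E * ((1 - (1 - p) ^ k) ^ k * exp (lam p * (real k)\<^sup>2 / 2)) / fact k"
    by (simp add: mult_ac)
  also have "\<dots> = real n * ?E * ?X * (real k ^ k / (fact k * exp (real k)))"
    unfolding conn_leading_order[OF p k(1)] by (simp add: mult_ac)
  also have "\<dots> \<le> real n * ?E * ?X * 1"
    using fact_ge_power_exp[of k] by (intro mult_left_mono) auto
  finally show ?thesis by simp
qed

lemma wgt_lower:
  assumes p: "0 < p" "p < 1" and k: "1 \<le> k" and C: "\<kappa> * (1 - (1 - p) ^ k) ^ k \<le> conn_prob p k"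
    and \<kappa>: "0 \<le> \<kappa>"
  shows "\<kappa> / (exp 1 * real k) * exp (real k * (ln (lam p) + 1 - kap (lam p * real k))) \<le> wgt p k"
proof -
  let ?X = "exp (real k * (ln (lam p) + 1 - kap (lam p * real k)))"
  have "1 / (exp 1 * real k) \<le> real k ^ k / (fact k * exp (real k))"
    using fact_le_power_exp[OF k] k by (simp add: divide_simps mult_ac)
  then have "\<kappa> * ?X * (1 / (exp 1 * real k)) \<le> \<kappa> * ?X * (real k ^ k / (fact k * exp (real k)))"
    using \<kappa> by (intro mult_left_mono) auto
  also have "\<dots> = \<kappa> * ((1 - (1 - p) ^ k) ^ k * exp (lam p * (real k)\<^sup>2 / 2)) / fact k"
    unfolding conn_leading_order[OF p k] by (simp add: mult_ac)
  also have "\<dots> = (\<kappa> * (1 - (1 - p) ^ k) ^ k) * exp (lam p * (real k)\<^sup>2 / 2) / fact k"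
    by simp
  also have "\<dots> \<le> wgt p k"
    unfolding wgt_def using C by (intro divide_right_mono mult_right_mono) auto
  finally show ?thesis by simp
qed

text \<open>The limit is stated for n \<lambda>, the quantity that the weights contain. The locale
  serves twice: for the graph of the theorem, and with c = t < 1 and edge probability t/n to
  describe a typical subcritical graph.\<close>

locale sparse_regime =
  fixes p :: "nat \<Rightarrow> real" and c :: real
  assumes p01: "\<forall>\<^sub>F n in sequentially. 0 < p n \<and> p n < 1"
    and lam_lim: "(\<lambda>n. real n * lam (p n)) \<longlonglongrightarrow> c"
    and c_pos: "0 < c"

text \<open>By the sandwich x \<le> - ln (1 - x) \<le> x / (1 - x).\<close>

lemma sparse_regimeI:
  assumes "cn \<longlonglongrightarrow> c" "0 < c"
  shows "sparse_regime (\<lambda>n. cn n / real n) c"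
proof
  have q0: "(\<lambda>n. cn n / real n) \<longlonglongrightarrow> 0"
    using tendsto_mult[OF assms(1) lim_1_over_n] by (simp add: divide_inverse)
  have pos: "\<forall>\<^sub>F n in sequentially. 0 < cn n" using assms order_tendstoD(1) by blast
  have lt: "\<forall>\<^sub>F n in sequentially. cn n / real n < 1" using q0 order_tendstoD(2) zero_less_one by blast
  show p01: "\<forall>\<^sub>F n in sequentially. 0 < cn n / real n \<and> cn n / real n < 1"
    using pos lt eventually_gt_at_top[of 0] by eventually_elim auto
  have up: "(\<lambda>n. cn n / (1 - cn n / real n)) \<longlonglongrightarrow> c / (1 - 0)"
    by (intro tendsto_intros assms q0) simp
  show "(\<lambda>n. real n * lam (cn n / real n)) \<longlonglongrightarrow> c"
  proof (rule real_tendsto_sandwich[OF _ _ assms(1)])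
    show "(\<lambda>n. cn n / (1 - cn n / real n)) \<longlonglongrightarrow> c" using up by simp
    show "\<forall>\<^sub>F n in sequentially. cn n \<le> real n * lam (cn n / real n)"
      using p01 eventually_gt_at_top[of 0]
    proof eventually_elim
      case (elim n)
      then have "cn n / real n \<le> lam (cn n / real n)"
        using ln_le_minus_one[of "1 - cn n / real n"] by (simp add: lam_def)
      then show ?case using elim by (simp add: field_simps)
    qed
    show "\<forall>\<^sub>F n in sequentially. real n * lam (cn n / real n) \<le> cn n / (1 - cn n / real n)"
      using p01 eventually_gt_at_top[of 0]
    proof eventually_elim
      case (elim n)
      define x where "x = cn n / real n"
      have x: "0 < x" "x < 1" using elim by (auto simp: x_def)
      have "lam x = ln (1 / (1 - x))" using x by (simp add: lam_def ln_div)
      also have "\<dots> \<le> 1 / (1 - x) - 1" by (rule ln_le_minus_one) (use x in simp)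
      also have "\<dots> = x / (1 - x)" using x by (simp add: field_simps)
      finally have "real n * lam x \<le> real n * (x / (1 - x))" by (intro mult_left_mono) auto
      then show ?case using elim by (simp add: x_def)
    qed
  qed
qed (use assms in simp)

section \<open>Macroscopic and small components\<close>

definition macro :: "real \<Rightarrow> nat \<Rightarrow> nat multiset \<Rightarrow> nat multiset" where
  "macro \<epsilon> n \<mu> = filter_mset (\<lambda>k. \<epsilon> * real n < real k) \<mu>"

definition small :: "real \<Rightarrow> nat \<Rightarrow> nat multiset \<Rightarrow> nat multiset" where
  "small \<epsilon> n \<mu> = filter_mset (\<lambda>k. real k \<le> \<epsilon> * real n) \<mu>"

lemma macro_small_union: "\<mu> = macro \<epsilon> n \<mu> + small \<epsilon> n \<mu>"
proof -
  have "small \<epsilon> n \<mu> = filter_mset (\<lambda>k. \<not> \<epsilon> * real n < real k) \<mu>"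
    unfolding small_def by (rule filter_mset_cong) auto
  then show ?thesis unfolding macro_def by (metis multiset_partition)
qed

text \<open>At z = t exp(-t) / \<lambda> the leading order of \<open>wgt p k * z ^ k\<close> is exp
  (k (ln t + 1 - t) - n K). A macroscopic component is weighted by the inverse of this, a small
  component by y.\<close>

definition tilt :: "real \<Rightarrow> real \<Rightarrow> nat \<Rightarrow> real \<Rightarrow> real \<Rightarrow> nat multiset \<Rightarrow> real" where
  "tilt c \<epsilon> n t y \<mu> = exp (real n * (\<Sum>k\<in>#macro \<epsilon> n \<mu>. K c (real k / real n))
      - real (sum_mset (macro \<epsilon> n \<mu>)) * (ln t + 1 - t)) * y ^ size (small \<epsilon> n \<mu>)"

lemma prod_mset_exp: "(\<Prod>k\<in>#\<mu>. exp (g k)) = exp (\<Sum>k\<in>#\<mu>. g k :: real)"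
  by (induction \<mu>) (auto simp: exp_add)

lemma tilt_eq_prod:
  "tilt c \<epsilon> n t y \<mu> = (\<Prod>k\<in>#\<mu>. if \<epsilon> * real n < real k
      then exp (real n * K c (real k / real n) - real k * (ln t + 1 - t)) else y)"
proof -
  let ?f = "\<lambda>k. if \<epsilon> * real n < real k then exp (real n * K c (real k / real n) - real k * (ln t + 1 - t)) else y"
  have "(\<Prod>k\<in>#\<mu>. ?f k) = (\<Prod>k\<in>#macro \<epsilon> n \<mu>. ?f k) * (\<Prod>k\<in>#small \<epsilon> n \<mu>. ?f k)"
    by (subst macro_small_union[of \<mu> \<epsilon> n]) simp
  also have "(\<Prod>k\<in>#macro \<epsilon> n \<mu>. ?f k) =
      (\<Prod>k\<in>#macro \<epsilon> n \<mu>. exp (real n * K c (real k / real n) - real k * (ln t + 1 - t)))"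
    by (intro arg_cong[where f=prod_mset] image_mset_cong) (auto simp: macro_def)
  also have "\<dots> = exp (real n * (\<Sum>k\<in>#macro \<epsilon> n \<mu>. K c (real k / real n))
      - real (sum_mset (macro \<epsilon> n \<mu>)) * (ln t + 1 - t))"
  proof -
    have "(\<Sum>k\<in>#M. real n * K c (real k / real n) - real k * (ln t + 1 - t)) =
      real n * (\<Sum>k\<in>#M. K c (real k / real n)) - real (sum_mset M) * (ln t + 1 - t)" for M
      by (induction M) (auto simp: algebra_simps)
    then show ?thesis by (simp add: prod_mset_exp)
  qed
  also have "(\<Prod>k\<in>#small \<epsilon> n \<mu>. ?f k) = (\<Prod>k\<in>#small \<epsilon> n \<mu>. y)"
    by (intro arg_cong[where f=prod_mset] image_mset_cong) (auto simp: small_def)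
  finally show ?thesis by (simp add: tilt_def)
qed

text \<open>A bound independent of n: a factor subexponential in n may be lost for each macroscopic
  component.\<close>

lemma size_macro_le:
  assumes "0 < \<epsilon>" "0 < n" "sum_mset \<mu> = n"
  shows "real (size (macro \<epsilon> n \<mu>)) \<le> 1 / \<epsilon>"
proof -
  have "\<epsilon> * real n * real (size M) \<le> real (sum_mset M)" if "\<And>k. k \<in># M \<Longrightarrow> \<epsilon> * real n < real k" for M
    using that by (induction M) (auto simp: algebra_simps intro: add_mono less_imp_le)
  from this[of "macro \<epsilon> n \<mu>"]
  have "\<epsilon> * real n * real (size (macro \<epsilon> n \<mu>)) \<le> real (sum_mset (macro \<epsilon> n \<mu>))"
    by (auto simp: macro_def)
  also have "sum_mset (macro \<epsilon> n \<mu>) \<le> sum_mset \<mu>"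
    by (metis le_add1 macro_small_union sum_mset.union)
  finally have "\<epsilon> * real n * real (size (macro \<epsilon> n \<mu>)) \<le> real n" using assms by simp
  then show ?thesis using assms by (simp add: field_simps)
qed

text \<open>Exponential Chebyshev: macroscopic sizes are weighted by (a bound for) the inverse of their
  weight, divided by \<open>D\<close> to make the sum over them at most one.\<close>

lemma tilt_bound_fixed:
  assumes p: "0 < p" "p < 1" and n: "2 \<le> n" and \<epsilon>: "0 < \<epsilon>" "2 \<le> x0" "4 * \<epsilon> * real n \<le> x0"
    and t: "0 < t" "t \<le> 1" "x0 \<le> t / lam p" and y: "0 < y" and c: "0 < c"
    and \<kappa>: "\<kappa> = exp (- (2 + 4 * \<epsilon> * real n) / x0)"
    and D: "D = (real n)\<^sup>2 * exp (1 / (1 - exp (- lam p * \<epsilon> * real n))) * exp (real n * \<bar>c - real n * lam p\<bar>)"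
  shows "profile_ex p n (tilt c \<epsilon> n t y) \<le>
    D powr (1 / \<epsilon>) * (gam p n * (1 / (\<kappa> * (t / lam p * exp (- t)))) ^ n) *
      exp (y * (x0 + (t - t\<^sup>2 / 2) / lam p) + 1)"
proof -
  define R where "R = nat \<lfloor>\<epsilon> * real n\<rfloor>"
  have R: "k \<le> R \<longleftrightarrow> real k \<le> \<epsilon> * real n" for k
    unfolding R_def using \<epsilon> by (simp add: le_nat_floor le_nat_iff le_floor_iff)
  have Rle: "real R \<le> \<epsilon> * real n" using R[of R] by simp
  have l: "0 < lam p" by (rule lam_pos[OF p])
  \<comment> \<open>The value at which \<open>small_weights_integrated\<close> bounds the small
    sizes, with x = t / \<lambda>.\<close>
  define z where "z = \<kappa> * (t / lam p * exp (- t))"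
  have \<kappa>1: "0 < \<kappa>" "\<kappa> \<le> 1"
  proof -
    have "0 \<le> \<epsilon> * real n" using \<epsilon> by simp
    then have "- (2 + 4 * \<epsilon> * real n) \<le> 0" by linarith
    then have "- (2 + 4 * \<epsilon> * real n) / x0 \<le> 0" using \<epsilon> by (intro divide_nonpos_pos) auto
    then show "0 < \<kappa>" "\<kappa> \<le> 1" by (auto simp: \<kappa>)
  qed
  have z: "0 < z" using \<kappa>1 t l by (simp add: z_def)
  have D1: "1 \<le> D"
  proof -
    have "1 * 1 * 1 \<le> D" unfolding D using n \<epsilon> l by (intro mult_mono) auto
    then show ?thesis by simp
  qed
  define g where "g k = exp (real n * K c (real k / real n) - real k * (ln t + 1 - t))" for k
  define f where "f k = (if \<epsilon> * real n < real k then g k / D else y)" for k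
  have f: "0 \<le> f k" for k using D1 y by (auto simp: f_def g_def)
  \<comment> \<open>Dividing every macroscopic weight by D costs at most D^(1/\<epsilon>) in
    total.\<close>
  have tilt_le: "tilt c \<epsilon> n t y \<mu> \<le> D powr (1 / \<epsilon>) * (\<Prod>k\<in>#\<mu>. f k)" if "sum_mset \<mu> = n" for \<mu>
  proof -
    have "(\<Prod>k\<in>#\<mu>. f k) * D ^ size (macro \<epsilon> n \<mu>) = tilt c \<epsilon> n t y \<mu>"
      unfolding tilt_eq_prod macro_def f_def g_def
      by (induction \<mu>) (use D1 in auto)
    moreover have "D ^ size (macro \<epsilon> n \<mu>) \<le> D powr (1 / \<epsilon>)"
    proof -
      have "D ^ size (macro \<epsilon> n \<mu>) = D powr real (size (macro \<epsilon> n \<mu>))"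
        using D1 by (simp add: powr_realpow)
      also have "\<dots> \<le> D powr (1 / \<epsilon>)"
        using size_macro_le[OF \<epsilon>(1) _ that] n D1 by (intro powr_mono) auto
      finally show ?thesis .
    qed
    moreover have "0 \<le> (\<Prod>k\<in>#\<mu>. f k)" by (rule prod_mset_image_nonneg) (rule f)
    ultimately show ?thesis by (metis mult.commute mult_left_mono)
  qed
  have "profile_ex p n (tilt c \<epsilon> n t y) \<le> profile_ex p n (\<lambda>\<mu>. D powr (1 / \<epsilon>) * (\<Prod>k\<in>#\<mu>. f k))"
    by (rule profile_ex_mono) (use p tilt_le in auto)
  also have "\<dots> = D powr (1 / \<epsilon>) * profile_ex p n (\<lambda>\<mu>. \<Prod>k\<in>#\<mu>. f k)" by (rule profile_ex_cmult)
  also have "\<dots> \<le> D powr (1 / \<epsilon>) * (gam p n * (1 / z) ^ n * exp (\<Sum>k=1..n. wgt p k * z ^ k * f k))"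
    by (intro mult_left_mono profile_ex_prod_bound p z f) simp
  also have "\<dots> \<le> D powr (1 / \<epsilon>) * (gam p n * (1 / z) ^ n * exp (y * (x0 + (t - t\<^sup>2 / 2) / lam p) + 1))"
  proof -
    \<comment> \<open>Each macroscopic size contributes at most 1/n, all of them together at most 1;
      this is the last summand in the exponent of the claim.\<close>
    have "(\<Sum>k=1..n. wgt p k * z ^ k * f k) \<le> (\<Sum>k=1..n. (if k \<le> R then y * (wgt p k * z ^ k) else 0) + 1 / real n)"
    proof (rule sum_mono)
      fix k assume k: "k \<in> {1..n}"
      show "wgt p k * z ^ k * f k \<le> (if k \<le> R then y * (wgt p k * z ^ k) else 0) + 1 / real n"
      proof (cases "k \<le> R")
        case True
        then have "f k = y" using R[of k] by (simp add: f_def)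
        then show ?thesis using True by simp
      next
        case False
        then have k\<epsilon>: "\<epsilon> * real n < real k" using R[of k] by simp
        have e1: "exp (1 / (1 - (1 - p) ^ k)) \<le> exp (1 / (1 - exp (- lam p * \<epsilon> * real n)))"
        proof -
          have "(1 - p) ^ k \<le> exp (- lam p * \<epsilon> * real n)"
            using k\<epsilon> l by (simp add: power_eq_exp_lam[OF p(2)] mult.assoc)
          moreover have "exp (- lam p * \<epsilon> * real n) < 1" using l \<epsilon> n by simp
          moreover from calculation have "(1 - p) ^ k < 1" by linarith
          ultimately show ?thesis by (auto intro!: divide_left_mono mult_pos_pos)
        qed
        have zk: "z ^ k \<le> exp (real k * (ln t - ln (lam p) - t))"
        proof -
          have "z \<le> 1 * (t / lam p * exp (- t))" unfolding z_def using \<kappa>1 t l by (intro mult_right_mono) auto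
          also have "\<dots> = exp (ln t - ln (lam p) - t)" using t l by (simp add: exp_diff exp_add exp_minus field_simps)
          finally have "z ^ k \<le> exp (ln t - ln (lam p) - t) ^ k" using z by (intro power_mono) auto
          then show ?thesis by (simp add: exp_of_nat_mult)
        qed
        have "wgt p k * z ^ k \<le> (real n * exp (1 / (1 - exp (- lam p * \<epsilon> * real n))) *
            exp (real k * (ln (lam p) + 1 - kap (lam p * real k)))) * exp (real k * (ln t - ln (lam p) - t))"
        proof (intro mult_mono zk)
          have "wgt p k \<le> real n * exp (1 / (1 - (1 - p) ^ k)) * exp (real k * (ln (lam p) + 1 - kap (lam p * real k)))"
            by (rule wgt_upper[OF p]) (use k n in auto)
          also have "\<dots> \<le> real n * exp (1 / (1 - exp (- lam p * \<epsilon> * real n))) *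
            exp (real k * (ln (lam p) + 1 - kap (lam p * real k)))"
            using e1 by (intro mult_right_mono mult_left_mono) auto
          finally show "wgt p k \<le> real n * exp (1 / (1 - exp (- lam p * \<epsilon> * real n))) *
            exp (real k * (ln (lam p) + 1 - kap (lam p * real k)))" .
        qed (use z in auto)
        then have "wgt p k * z ^ k * g k \<le> (real n * exp (1 / (1 - exp (- lam p * \<epsilon> * real n))) *
            exp (real k * (ln (lam p) + 1 - kap (lam p * real k)))) * exp (real k * (ln t - ln (lam p) - t)) * g k"
          by (rule mult_right_mono) (simp add: g_def)
        also have "\<dots> = real n * exp (1 / (1 - exp (- lam p * \<epsilon> * real n))) *
            exp (real n * K c (real k / real n) - real k * kap (lam p * real k))"
          unfolding g_def by (simp add: exp_add[symmetric] mult.assoc algebra_simps)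
        also have "\<dots> \<le> real n * exp (1 / (1 - exp (- lam p * \<epsilon> * real n))) *
            exp (real n * \<bar>c - real n * lam p\<bar>)"
        proof -
          have kn: "real k / real n \<le> 1" using k by simp
          have "real k * kap (lam p * real k) = real n * K (real n * lam p) (real k / real n)"
            using n by (simp add: K_eq_kap mult_ac)
          \<comment> \<open>The two exponents differ only by c in place of n \<lambda>; this
            difference is paid for by the last factor of D.\<close>
          then have "real n * K c (real k / real n) - real k * kap (lam p * real k) =
              real n * (K c (real k / real n) - K (real n * lam p) (real k / real n))"
            by (simp add: algebra_simps)
          also have "\<dots> \<le> real n * (\<bar>c - real n * lam p\<bar> * (real k / real n))"
            using K_diff[of c "real n * lam p" "real k / real n"] c l kn
            by (intro mult_left_mono) (auto simp: abs_le_iff)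
          also have "\<dots> \<le> real n * (\<bar>c - real n * lam p\<bar> * 1)"
            using kn by (intro mult_left_mono) auto
          finally show ?thesis by (intro mult_left_mono) auto
        qed
        also have "\<dots> = D / real n" using n by (simp add: D power2_eq_square)
        finally have "wgt p k * z ^ k * g k \<le> D / real n" .
        then have "wgt p k * z ^ k * g k / D \<le> D / real n / D" using D1 by (intro divide_right_mono) auto
        then have "wgt p k * z ^ k * f k \<le> 1 / real n" using D1 k\<epsilon> by (simp add: f_def)
        then show ?thesis using False by simp
      qed
    qed
    also have "\<dots> = (\<Sum>k=1..n. if k \<le> R then y * (wgt p k * z ^ k) else 0) + 1"
      using n by (simp add: sum.distrib)
    also have "(\<Sum>k=1..n. if k \<le> R then y * (wgt p k * z ^ k) else 0) \<le> y * (\<Sum>k=1..R. wgt p k * z ^ k)"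
    proof -
      have "(\<Sum>k=1..n. if k \<le> R then y * (wgt p k * z ^ k) else 0) = (\<Sum>k\<in>{1..n} \<inter> {..R}. y * (wgt p k * z ^ k))"
        by (subst sum.inter_restrict) auto
      also have "\<dots> \<le> (\<Sum>k=1..R. y * (wgt p k * z ^ k))"
        using y z p by (intro sum_mono2) (auto intro!: mult_nonneg_nonneg simp: wgt_nonneg)
      finally show ?thesis by (simp add: sum_distrib_left)
    qed
    also have "(\<Sum>k=1..R. wgt p k * z ^ k) \<le> x0 + t / lam p - lam p * (t / lam p)\<^sup>2 / 2"
    proof -
      have "(\<Sum>k=1..R. wgt p k * (\<kappa> * (t / lam p * exp (- lam p * (t / lam p)))) ^ k)
          \<le> x0 + t / lam p - lam p * (t / lam p)\<^sup>2 / 2"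
      proof (rule small_weights_integrated[OF p])
        show "\<kappa> \<le> exp (- (2 + 4 * real R) / x0)"
        proof -
          have "(2 + 4 * real R) / x0 \<le> (2 + 4 * \<epsilon> * real n) / x0"
            using Rle \<epsilon> by (intro divide_right_mono) auto
          then have "- ((2 + 4 * \<epsilon> * real n) / x0) \<le> - ((2 + 4 * real R) / x0)" by simp
          then show ?thesis unfolding \<kappa> by (simp only: minus_divide_left exp_le_cancel_iff)
        qed
      qed (use \<epsilon> Rle t l \<kappa>1 in auto)
      then show ?thesis using l by (simp add: z_def)
    qed
    also have "x0 + t / lam p - lam p * (t / lam p)\<^sup>2 / 2 = x0 + (t - t\<^sup>2 / 2) / lam p"
      using l by (simp add: power2_eq_square diff_divide_distrib)
    finally have "(\<Sum>k=1..n. wgt p k * z ^ k * f k) \<le> y * (x0 + (t - t\<^sup>2 / 2) / lam p) + 1"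
      using y by simp
    then show ?thesis using gam_pos[of p n] z by (intro mult_left_mono) auto
  qed
  finally show ?thesis by (simp add: z_def mult_ac)
qed

section \<open>Asymptotic upper bounds\<close>

context sparse_regime
begin

lemma n_lam_bounds: "\<forall>\<^sub>F n in sequentially. c / 2 < real n * lam (p n) \<and> real n * lam (p n) < 2 * c"
  using order_tendstoD(1)[OF lam_lim, of "c / 2"] order_tendstoD(2)[OF lam_lim, of "2 * c"] c_pos
  by (auto simp: eventually_conj_iff)

text \<open>For each n the bound is uniform in t and y, because these will depend on the macroscopic
  mass and the number of small components of a profile, which vary with n.\<close>

lemma tilt_bound:
  assumes \<beta>: "0 < \<beta>" and \<eta>: "0 < \<eta>"
  shows "\<exists>\<epsilon>0>0. \<forall>\<epsilon>. 0 < \<epsilon> \<and> \<epsilon> \<le> \<epsilon>0 \<longrightarrow>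
    (\<forall>\<^sub>F n in sequentially. \<forall>t\<in>{\<beta>..1}. \<forall>y>0. profile_ex (p n) n (tilt c \<epsilon> n t y) \<le>
      exp (real n * (ln c - 1 - c / 2 - ln t + t + y * (t - t\<^sup>2 / 2) / c + (1 + y) * \<eta>)))"
proof -
  \<comment> \<open>With x0 = \<open>\<eta>'\<close> n, the contribution of x0 itself is small, and
    x0 \<le> t / \<lambda> holds because n \<lambda> < 2 c and t \<ge> \<beta>.\<close>
  define \<eta>' where "\<eta>' = min (\<eta> / 4) (\<beta> / (2 * c))"
  have \<eta>': "0 < \<eta>'" "\<eta>' \<le> \<eta> / 4" "\<eta>' \<le> \<beta> / (2 * c)" using \<beta> \<eta> c_pos by (auto simp: \<eta>'_def)
  \<comment> \<open>The factor \<open>\<kappa>\<close> costs (2 + 4 \<epsilon> n) / x0 per vertex,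
    about 4 \<epsilon> / \<open>\<eta>'\<close>; hence \<epsilon> is chosen after
    \<open>\<eta>'\<close>.\<close>
  define \<epsilon>0 where "\<epsilon>0 = min (\<eta>' / 4) (\<eta>' * \<eta> / 32)"
  have \<epsilon>0: "0 < \<epsilon>0" using \<eta>' \<eta> by (simp add: \<epsilon>0_def)
  show ?thesis
  proof (intro exI[of _ \<epsilon>0] conjI allI impI)
    fix \<epsilon> assume "0 < \<epsilon> \<and> \<epsilon> \<le> \<epsilon>0"
    then have \<epsilon>: "0 < \<epsilon>" "4 * \<epsilon> \<le> \<eta>'" "4 * \<epsilon> \<le> \<eta>' * (\<eta> / 8)" by (auto simp: \<epsilon>0_def)
    define \<nu> where "\<nu> n = real n * lam (p n)" for n
    have \<nu>: "\<nu> \<longlonglongrightarrow> c" using lam_lim by (simp add: \<nu>_def[abs_def])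
    \<comment> \<open>This is ln D / n, which tends to 0; \<open>E2\<close> then collects all terms
      of the exponent whose limits are still to be taken.\<close>
    define E1 where "E1 n = 2 * (ln (real n) / real n) + 1 / (1 - exp (- (\<nu> n * \<epsilon>))) * (1 / real n) + \<bar>c - \<nu> n\<bar>" for n
    define E2 where "E2 n = 1 / \<epsilon> * E1 n + 2 * (1 / real n) + ln (real n) / real n + ln (\<nu> n) - \<nu> n / 2" for n
    have "E1 \<longlonglongrightarrow> 2 * 0 + 1 / (1 - exp (- (c * \<epsilon>))) * 0 + \<bar>c - c\<bar>"
      unfolding E1_def[abs_def] using \<epsilon> c_pos
      by (intro tendsto_intros \<nu> lim_ln_over_n) (auto simp: lim_1_over_n)
    then have "E2 \<longlonglongrightarrow> 1 / \<epsilon> * (2 * 0 + 1 / (1 - exp (- (c * \<epsilon>))) * 0 + \<bar>c - c\<bar>) + 2 * 0 + 0 + ln c - c / 2"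
      unfolding E2_def[abs_def] using c_pos
      by (intro tendsto_intros \<nu> lim_ln_over_n) (auto simp: lim_1_over_n)
    then have E2: "\<forall>\<^sub>F n in sequentially. E2 n < ln c - c / 2 + \<eta> / 2"
      by (rule order_tendstoD) (use \<eta> in simp)
    have "(\<lambda>n. 1 / \<nu> n) \<longlonglongrightarrow> 1 / c" by (intro tendsto_intros \<nu>) (use c_pos in simp)
    then have E3: "\<forall>\<^sub>F n in sequentially. 1 / \<nu> n < 1 / c + \<eta> / 2"
      by (rule order_tendstoD) (use \<eta> in simp)
    have big: "\<forall>\<^sub>F n in sequentially. 2 \<le> \<eta>' * real n \<and> 2 \<le> \<eta>' * (\<eta> / 8) * real n"
      by (intro eventually_conj) (use \<eta>' \<eta> in real_asymp)+
    show "\<forall>\<^sub>F n in sequentially. \<forall>t\<in>{\<beta>..1}. \<forall>y>0. profile_ex (p n) n (tilt c \<epsilon> n t y) \<le>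
      exp (real n * (ln c - 1 - c / 2 - ln t + t + y * (t - t\<^sup>2 / 2) / c + (1 + y) * \<eta>))"
      using p01 n_lam_bounds E2 E3 big eventually_ge_at_top[of 2]
    proof eventually_elim
      case (elim n)
      then have p: "0 < p n" "p n < 1" and nl: "c / 2 < \<nu> n" "\<nu> n < 2 * c" and n2: "2 \<le> n"
        by (auto simp: \<nu>_def)
      have n0: "0 < real n" using n2 by simp
      have l: "0 < lam (p n)" by (rule lam_pos[OF p])
      have \<nu>0: "0 < \<nu> n" using nl c_pos by simp
      show ?case
      proof (intro ballI allI impI)
        fix t y :: real assume t: "t \<in> {\<beta>..1}" and y: "0 < y"
        have t0: "0 < t" "t \<le> 1" using t \<beta> by auto
        define x0 where "x0 = \<eta>' * real n"
        have x01: "2 \<le> x0" using elim by (simp add: x0_def)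
        have x02: "4 * \<epsilon> * real n \<le> x0" using \<epsilon> by (simp add: x0_def mult_right_mono)
        have x03: "x0 \<le> t / lam (p n)"
        proof -
          have "\<eta>' * \<nu> n \<le> \<beta> / (2 * c) * (2 * c)"
            using \<eta>' nl \<nu>0 by (intro mult_mono) auto
          then have "\<eta>' * \<nu> n \<le> t" using t c_pos by simp
          then show ?thesis using l by (simp add: x0_def \<nu>_def field_simps)
        qed
        define D where "D = (real n)\<^sup>2 * exp (1 / (1 - exp (- lam (p n) * \<epsilon> * real n))) *
          exp (real n * \<bar>c - real n * lam (p n)\<bar>)"
        define \<kappa> where "\<kappa> = exp (- (2 + 4 * \<epsilon> * real n) / x0)"
        have D: "D powr (1 / \<epsilon>) = exp (real n * (1 / \<epsilon> * E1 n))"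
        proof -
          have "D = exp (real n * E1 n)"
            using n0 by (simp add: D_def E1_def exp_add distrib_left \<nu>_def exp_of_nat_mult[of 2, simplified] mult_ac)
          then show ?thesis by (simp add: powr_def)
        qed
        have \<kappa>: "(1 / \<kappa>) ^ n \<le> exp (real n * (\<eta> / 4))"
        proof -
          have "2 + 4 * \<epsilon> * real n \<le> \<eta>' * (\<eta> / 8) * real n + \<eta>' * (\<eta> / 8) * real n"
            using elim \<epsilon> by (intro add_mono mult_right_mono) auto
          then have "2 + 4 * \<epsilon> * real n \<le> \<eta> / 4 * x0" by (simp add: x0_def)
          then have "(2 + 4 * \<epsilon> * real n) / x0 \<le> \<eta> / 4"
            using x01 by (simp add: field_simps)
          moreover have "1 / \<kappa> = exp ((2 + 4 * \<epsilon> * real n) / x0)"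
            by (simp only: \<kappa>_def exp_minus minus_divide_left[symmetric]) (simp add: divide_inverse)
          ultimately have "1 / \<kappa> \<le> exp (\<eta> / 4)" by simp
          then have "(1 / \<kappa>) ^ n \<le> exp (\<eta> / 4) ^ n" by (rule power_mono) (simp add: \<kappa>_def)
          then show ?thesis unfolding exp_of_nat_mult .
        qed
        \<comment> \<open>By Stirling's formula n! exp(-\<lambda> n^2/2) (\<lambda> e^t / t)^n has,
          up to polynomial factors, the exponent -1 + ln (n \<lambda>) - n \<lambda>/2 - ln t + t
          per vertex.\<close>
        have G: "gam (p n) n * (1 / (\<kappa> * (t / lam (p n) * exp (- t)))) ^ n \<le>
          exp (real n * (1 / real n + ln (real n) / real n - 1 + ln (\<nu> n) - \<nu> n / 2 - ln t + t + \<eta> / 4))"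
        proof -
          have f: "fact n \<le> exp 1 * real n * real n ^ n * exp (- real n)"
            using fact_le_power_exp[of n] n2 by (simp add: exp_minus field_simps)
          have "gam (p n) n * (1 / (\<kappa> * (t / lam (p n) * exp (- t)))) ^ n =
            fact n * exp (- lam (p n) * (real n)\<^sup>2 / 2) * (lam (p n) / t * exp t) ^ n * (1 / \<kappa>) ^ n"
            by (simp add: gam_def power_mult_distrib power_divide exp_minus field_simps)
          also have "\<dots> \<le> (exp 1 * real n * real n ^ n * exp (- real n)) * exp (- lam (p n) * (real n)\<^sup>2 / 2) *
            (lam (p n) / t * exp t) ^ n * exp (real n * (\<eta> / 4))"
            using f \<kappa> l t0 by (intro mult_mono mult_right_mono) (auto simp: \<kappa>_def)
          also have "\<dots> = exp (1 + ln (real n) + real n * ln (real n) - real n - lam (p n) * (real n)\<^sup>2 / 2 +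
            real n * (ln (lam (p n)) - ln t + t) + real n * (\<eta> / 4))"
          proof -
            have "real n ^ n = exp (real n * ln (real n))" using n0 by (simp add: exp_of_nat_mult)
            moreover have "(lam (p n) / t * exp t) ^ n = exp (real n * (ln (lam (p n)) - ln t + t))"
            proof -
              have "lam (p n) / t * exp t = exp (ln (lam (p n)) - ln t + t)"
                using l t0 by (simp add: exp_add exp_diff)
              then show ?thesis by (simp add: exp_of_nat_mult)
            qed
            moreover have "exp 1 * real n * exp (real n * ln (real n)) * exp (- real n) *
                exp (- lam (p n) * (real n)\<^sup>2 / 2) * exp Y * exp Z =
              exp (1 + ln (real n) + real n * ln (real n) - real n - lam (p n) * (real n)\<^sup>2 / 2 + Y + Z)" for Y Z
            proof -
              have "real n = exp (ln (real n))" using n0 by simp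
              then have "exp 1 * real n * exp (real n * ln (real n)) * exp (- real n) *
                exp (- lam (p n) * (real n)\<^sup>2 / 2) * exp Y * exp Z = exp 1 * exp (ln (real n)) *
                exp (real n * ln (real n)) * exp (- real n) * exp (- lam (p n) * (real n)\<^sup>2 / 2) * exp Y * exp Z"
                by metis
              also have "\<dots> = exp (1 + ln (real n) + real n * ln (real n) + - real n
                  + - lam (p n) * (real n)\<^sup>2 / 2 + Y + Z)"
                by (simp only: exp_add)
              finally show ?thesis by simp
            qed
            ultimately show ?thesis by simp
          qed
          also have "1 + ln (real n) + real n * ln (real n) - real n - lam (p n) * (real n)\<^sup>2 / 2 +
            real n * (ln (lam (p n)) - ln t + t) + real n * (\<eta> / 4) =
            real n * (1 / real n + ln (real n) / real n - 1 + ln (\<nu> n) - \<nu> n / 2 - ln t + t + \<eta> / 4)"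
            using n0 l by (simp add: \<nu>_def ln_mult distrib_left right_diff_distrib power2_eq_square)
          finally show ?thesis .
        qed
        have W: "y * (x0 + (t - t\<^sup>2 / 2) / lam (p n)) + 1 \<le>
          real n * (y * (t - t\<^sup>2 / 2) / c + y * \<eta> + 1 / real n)"
        proof -
          have tt: "0 \<le> t - t\<^sup>2 / 2" "t - t\<^sup>2 / 2 \<le> 1"
          proof -
            have "t\<^sup>2 \<le> t" using t0 by (simp add: power2_eq_square mult_left_le_one_le)
            then show "0 \<le> t - t\<^sup>2 / 2" using t0 by simp
            show "t - t\<^sup>2 / 2 \<le> 1" using t0 by (simp add: add_increasing2 diff_le_eq)
          qed
          have "(t - t\<^sup>2 / 2) * (1 / \<nu> n) \<le> (t - t\<^sup>2 / 2) * (1 / c + \<eta> / 2)"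
            using tt elim by (intro mult_left_mono) auto
          also have "\<dots> \<le> (t - t\<^sup>2 / 2) / c + 1 * (\<eta> / 2)"
            using tt \<eta> unfolding distrib_left by (intro add_mono mult_right_mono) auto
          finally have 1: "(t - t\<^sup>2 / 2) * (1 / \<nu> n) \<le> (t - t\<^sup>2 / 2) / c + \<eta> / 2" by simp
          have "x0 + (t - t\<^sup>2 / 2) / lam (p n) = real n * (\<eta>' + (t - t\<^sup>2 / 2) * (1 / \<nu> n))"
            using n0 l by (simp add: x0_def \<nu>_def distrib_left)
          also have "\<dots> \<le> real n * ((t - t\<^sup>2 / 2) / c + \<eta>)"
            using 1 \<eta>' \<eta> by (intro mult_left_mono) auto
          finally have "y * (x0 + (t - t\<^sup>2 / 2) / lam (p n)) \<le> y * (real n * ((t - t\<^sup>2 / 2) / c + \<eta>))"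
            using y by (intro mult_left_mono) auto
          then show ?thesis using n0 by (simp add: distrib_left mult_ac)
        qed
        have "profile_ex (p n) n (tilt c \<epsilon> n t y) \<le>
          D powr (1 / \<epsilon>) * (gam (p n) n * (1 / (\<kappa> * (t / lam (p n) * exp (- t)))) ^ n) *
          exp (y * (x0 + (t - t\<^sup>2 / 2) / lam (p n)) + 1)"
          by (rule tilt_bound_fixed[OF p n2 \<epsilon>(1) x01 x02 t0 x03 y c_pos \<kappa>_def D_def])
        also have "\<dots> \<le> exp (real n * (1 / \<epsilon> * E1 n)) *
          exp (real n * (1 / real n + ln (real n) / real n - 1 + ln (\<nu> n) - \<nu> n / 2 - ln t + t + \<eta> / 4)) *
          exp (real n * (y * (t - t\<^sup>2 / 2) / c + y * \<eta> + 1 / real n))"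
          unfolding D using G W l t0 by (intro mult_mono) (auto simp: \<kappa>_def gam_pos less_imp_le)
        also have "\<dots> = exp (real n * (E2 n - 1 - ln t + t + \<eta> / 4 + y * (t - t\<^sup>2 / 2) / c + y * \<eta>))"
          unfolding exp_add[symmetric] distrib_left[symmetric] by (simp add: E2_def algebra_simps)
        also have "\<dots> \<le> exp (real n * (ln c - 1 - c / 2 - ln t + t + y * (t - t\<^sup>2 / 2) / c + (1 + y) * \<eta>))"
        proof -
          have "E2 n - 1 - ln t + t + \<eta> / 4 + y * (t - t\<^sup>2 / 2) / c + y * \<eta> \<le>
            ln c - 1 - c / 2 - ln t + t + y * (t - t\<^sup>2 / 2) / c + (1 + y) * \<eta>"
            using elim(3) \<eta> by (simp add: distrib_right)
          then show ?thesis by (simp add: mult_left_mono)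
        qed
        finally show "profile_ex (p n) n (tilt c \<epsilon> n t y) \<le>
          exp (real n * (ln c - 1 - c / 2 - ln t + t + y * (t - t\<^sup>2 / 2) / c + (1 + y) * \<eta>))" .
      qed
    qed
  qed (rule \<epsilon>0)
qed

text \<open>Tilt with y = 1. Since ln t + 1 - t \<le> 0, a lower bound on the macroscopic mass makes
  the tilt large, just as a lower bound on the sum of K does, so Chebyshev's inequality uses both at
  once.\<close>

lemma macro_upper:
  assumes e: "0 < e"
  shows "\<exists>\<epsilon>0>0. \<forall>\<epsilon> s \<kappa>. 0 < \<epsilon> \<and> \<epsilon> \<le> \<epsilon>0 \<and> 0 \<le> s \<and> s \<le> 1 \<longrightarrow>
    (\<forall>\<^sub>F n in sequentially. profile_prob (p n) n (\<lambda>\<mu>.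
        \<kappa> \<le> (\<Sum>k\<in>#macro \<epsilon> n \<mu>. K c (real k / real n)) \<and> s * real n \<le> real (sum_mset (macro \<epsilon> n \<mu>)))
      \<le> exp (real n * (- \<kappa> - L c (max (1 - 1 / c) s) + e)))"
proof -
  define \<beta> where "\<beta> = min 1 (e / (2 * (1 + 1 / c)))"
  have c1: "0 < 1 + 1 / c" using c_pos by (simp add: add_pos_pos)
  have \<beta>: "0 < \<beta>" "\<beta> \<le> 1" using e c1 by (auto simp: \<beta>_def)
  have \<beta>e: "(1 + 1 / c) * \<beta> \<le> e / 2"
  proof -
    have "(1 + 1 / c) * \<beta> \<le> (1 + 1 / c) * (e / (2 * (1 + 1 / c)))"
      using c1 by (intro mult_left_mono) (auto simp: \<beta>_def)
    also have "\<dots> = e / 2" using c1 by (simp add: field_simps)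
    finally show ?thesis .
  qed
  obtain \<epsilon>0 where \<epsilon>0: "0 < \<epsilon>0" and bd: "\<And>\<epsilon>. 0 < \<epsilon> \<and> \<epsilon> \<le> \<epsilon>0 \<Longrightarrow>
    (\<forall>\<^sub>F n in sequentially. \<forall>t\<in>{\<beta>..1}. \<forall>y>0. profile_ex (p n) n (tilt c \<epsilon> n t y) \<le>
      exp (real n * (ln c - 1 - c / 2 - ln t + t + y * (t - t\<^sup>2 / 2) / c + (1 + y) * (e / 4))))"
    using tilt_bound[OF \<beta>(1), of "e / 4"] e by auto
  show ?thesis
  proof (intro exI[of _ \<epsilon>0] conjI allI impI \<epsilon>0)
    fix \<epsilon> s \<kappa> :: real assume *: "0 < \<epsilon> \<and> \<epsilon> \<le> \<epsilon>0 \<and> 0 \<le> s \<and> s \<le> 1"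
    then have s: "0 \<le> s" "s \<le> 1" by auto
    obtain t where t: "t \<in> {\<beta>..1}" and te: "ln c - 1 - c / 2 - (1 - s) * ln t + (1 - s) * t + s + (t - t\<^sup>2 / 2) / c
      \<le> - L c (max (1 - 1 / c) s) + (1 + 1 / c) * \<beta>"
      using upper_exponent_sizes[OF c_pos \<beta> s] by auto
    have t0: "0 < t" using t \<beta> by auto
    have "\<forall>\<^sub>F n in sequentially. \<forall>t\<in>{\<beta>..1}. \<forall>y>0. profile_ex (p n) n (tilt c \<epsilon> n t y) \<le>
      exp (real n * (ln c - 1 - c / 2 - ln t + t + y * (t - t\<^sup>2 / 2) / c + (1 + y) * (e / 4)))"
      by (rule bd) (use * in auto)
    then show "\<forall>\<^sub>F n in sequentially. profile_prob (p n) n (\<lambda>\<mu>.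
        \<kappa> \<le> (\<Sum>k\<in>#macro \<epsilon> n \<mu>. K c (real k / real n)) \<and> s * real n \<le> real (sum_mset (macro \<epsilon> n \<mu>)))
      \<le> exp (real n * (- \<kappa> - L c (max (1 - 1 / c) s) + e))"
      using p01
    proof eventually_elim
      case (elim n)
      let ?Q = "\<lambda>\<mu>. \<kappa> \<le> (\<Sum>k\<in>#macro \<epsilon> n \<mu>. K c (real k / real n)) \<and> s * real n \<le> real (sum_mset (macro \<epsilon> n \<mu>))"
      define B where "B = exp (real n * \<kappa> - s * real n * (ln t + 1 - t))"
      have lt: "ln t + 1 - t \<le> 0" using ln_le_minus_one[OF t0] by simp
      have "profile_prob (p n) n ?Q \<le> profile_ex (p n) n (tilt c \<epsilon> n t 1) / B"
      proof (rule profile_prob_markov)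
        fix \<mu> assume "?Q \<mu>"
        then have 1: "real n * \<kappa> \<le> real n * (\<Sum>k\<in>#macro \<epsilon> n \<mu>. K c (real k / real n))"
          and 2: "real (sum_mset (macro \<epsilon> n \<mu>)) * (ln t + 1 - t) \<le> s * real n * (ln t + 1 - t)"
          using lt by (auto intro: mult_left_mono mult_right_mono_neg)
        then show "B \<le> tilt c \<epsilon> n t 1 \<mu>" by (simp only: B_def tilt_def power_one mult_1_right exp_le_cancel_iff)
      qed (use elim in \<open>auto simp: B_def tilt_def\<close>)
      also have "\<dots> \<le> exp (real n * (ln c - 1 - c / 2 - ln t + t + 1 * (t - t\<^sup>2 / 2) / c + (1 + 1) * (e / 4))) / B"
      proof (rule divide_right_mono)
        show "profile_ex (p n) n (tilt c \<epsilon> n t 1) \<le>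
            exp (real n * (ln c - 1 - c / 2 - ln t + t + 1 * (t - t\<^sup>2 / 2) / c + (1 + 1) * (e / 4)))"
          using elim(1) t zero_less_one by blast
      qed (simp add: B_def)
      also have "\<dots> = exp (real n * (ln c - 1 - c / 2 - (1 - s) * ln t + (1 - s) * t + s + (t - t\<^sup>2 / 2) / c + e / 2 - \<kappa>))"
        unfolding B_def exp_diff[symmetric] by (simp add: algebra_simps)
      also have "\<dots> \<le> exp (real n * (- \<kappa> - L c (max (1 - 1 / c) s) + e))"
        by (subst exp_le_cancel_iff, rule mult_left_mono) (use te \<beta>e in linarith, simp)
      finally show ?case .
    qed
  qed
qed

text \<open>The macroscopic sizes enter only through their total S: as K is subadditive and
  decreasing, their K sum is at least \<open>K c \<tau>\<close> for every \<tau> \<ge> S/n. The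
  number m of small components is picked out by the choice of y.\<close>

lemma alpha_type_upper:
  assumes e: "0 < e"
  shows "\<exists>\<epsilon>>0. \<forall>\<^sub>F n in sequentially. \<forall>S m. S + m \<le> n \<longrightarrow>
    (\<exists>\<tau>\<in>{0..1}. \<exists>t\<in>{0..1}. (1 - \<tau>) * (1 - t / 2) = real m / real n \<and>
      profile_prob (p n) n (\<lambda>\<mu>. sum_mset (macro \<epsilon> n \<mu>) = S \<and> size (small \<epsilon> n \<mu>) = m)
        \<le> exp (real n * (- RA c \<tau> t + e)))"
proof -
  define \<beta> where "\<beta> = min 1 (e / 8)"
  have \<beta>: "0 < \<beta>" "\<beta> \<le> 1" "4 * \<beta> \<le> e / 2" using e by (auto simp: \<beta>_def)
  \<comment> \<open>Makes (1 + y) \<open>\<eta>\<close> \<le> e/2 for all y \<le> 4 c / \<beta>, the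
    range that occurs below.\<close>
  define \<eta> where "\<eta> = e / 2 / (1 + 4 * c / \<beta>)"
  have \<eta>: "0 < \<eta>" using e c_pos \<beta> by (auto simp: \<eta>_def intro!: divide_pos_pos add_pos_nonneg)
  obtain \<epsilon> where \<epsilon>: "0 < \<epsilon>" and bd:
    "\<forall>\<^sub>F n in sequentially. \<forall>t\<in>{\<beta>..1}. \<forall>y>0. profile_ex (p n) n (tilt c \<epsilon> n t y) \<le>
      exp (real n * (ln c - 1 - c / 2 - ln t + t + y * (t - t\<^sup>2 / 2) / c + (1 + y) * \<eta>))"
    using tilt_bound[OF \<beta>(1) \<eta>] by auto
  show ?thesis
  proof (intro exI[of _ \<epsilon>] conjI \<epsilon>)
    show "\<forall>\<^sub>F n in sequentially. \<forall>S m. S + m \<le> n \<longrightarrow>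
      (\<exists>\<tau>\<in>{0..1}. \<exists>t\<in>{0..1}. (1 - \<tau>) * (1 - t / 2) = real m / real n \<and>
      profile_prob (p n) n (\<lambda>\<mu>. sum_mset (macro \<epsilon> n \<mu>) = S \<and> size (small \<epsilon> n \<mu>) = m)
        \<le> exp (real n * (- RA c \<tau> t + e)))"
      using bd p01 eventually_gt_at_top[of 0]
    proof (eventually_elim, intro allI impI)
      fix n S m :: nat
      assume bd: "\<forall>t\<in>{\<beta>..1}. \<forall>y>0. profile_ex (p n) n (tilt c \<epsilon> n t y) \<le>
        exp (real n * (ln c - 1 - c / 2 - ln t + t + y * (t - t\<^sup>2 / 2) / c + (1 + y) * \<eta>))"
        and p: "0 < p n \<and> p n < 1" and n: "0 < n" and Sm: "S + m \<le> n"
      define s where "s = real S / real n"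
      define a where "a = real m / real n"
      have s: "0 \<le> s" and a: "0 \<le> a" by (auto simp: s_def a_def)
      have "real S + real m \<le> real n" using Sm by linarith
      then have as: "a + s \<le> 1" using n by (simp add: s_def a_def add_divide_distrib[symmetric])
      obtain t \<tau> t' where t: "t \<in> {\<beta>..1}" and \<tau>: "\<tau> \<in> {0..1}" "t' \<in> {0..1}" "(1 - \<tau>) * (1 - t' / 2) = a" "s \<le> \<tau>"
        and main: "ln c - 1 - c / 2 - (1 - s) * ln t + (1 - s) * t + s + (a + \<beta>)
          - a * ln ((a + \<beta>) * c / (t - t\<^sup>2 / 2)) - K c \<tau> \<le> - RA c \<tau> t' + 4 * \<beta>"
        using upper_exponent_alpha[OF c_pos \<beta>(1,2) s a as] by blast
      have t0: "0 < t" "t \<le> 1" using t \<beta> by auto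
      have tt: "\<beta> / 2 \<le> t - t\<^sup>2 / 2"
      proof -
        have "t\<^sup>2 \<le> t" using t0 by (simp add: power2_eq_square mult_left_le_one_le)
        then show ?thesis using t by simp
      qed
      then have tt0: "0 < t - t\<^sup>2 / 2" using \<beta> by linarith
      \<comment> \<open>For this y the contribution y (t - t^2/2) / c of the small components to the
        exponent is a + \<beta>, their prescribed number per vertex up to \<beta>.\<close>
      define y where "y = (a + \<beta>) * c / (t - t\<^sup>2 / 2)"
      have y0: "0 < y" using a \<beta> c_pos tt0 by (simp add: y_def add_nonneg_pos)
      have y1: "y \<le> 4 * c / \<beta>"
      proof -
        have "y \<le> 2 * c / (\<beta> / 2)"
          unfolding y_def using a as s \<beta> c_pos tt by (intro frac_le mult_right_mono) auto
        then show ?thesis by simp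
      qed
      have err: "(1 + y) * \<eta> \<le> e / 2"
      proof -
        have "(1 + y) * \<eta> \<le> (1 + 4 * c / \<beta>) * \<eta>" using y1 \<eta> by (intro mult_right_mono) auto
        also have "\<dots> = e / 2"
        proof -
          define Z where "Z = 1 + 4 * c / \<beta>"
          have "0 < Z" using c_pos \<beta> by (simp add: Z_def add_pos_pos)
          then show ?thesis unfolding \<eta>_def Z_def[symmetric] by simp
        qed
        finally show ?thesis .
      qed
      have yt: "y * (t - t\<^sup>2 / 2) / c = a + \<beta>" using tt0 c_pos by (simp add: y_def)
      let ?Q = "\<lambda>\<mu>. sum_mset (macro \<epsilon> n \<mu>) = S \<and> size (small \<epsilon> n \<mu>) = m"
      define B where "B = exp (real n * K c \<tau> - real S * (ln t + 1 - t)) * y ^ m"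
      have B0: "0 < B" using y0 by (simp add: B_def)
      have "profile_prob (p n) n ?Q \<le> profile_ex (p n) n (tilt c \<epsilon> n t y) / B"
      proof (rule profile_prob_markov[OF _ _ B0])
        fix \<mu> assume Q: "?Q \<mu>"
        have "K c \<tau> \<le> K c s" using s \<tau> c_pos by (intro K_antimono) auto
        also have "\<dots> = K c (\<Sum>u\<in>#image_mset (\<lambda>k. real k / real n) (macro \<epsilon> n \<mu>). u)"
        proof -
          have "(\<Sum>u\<in>#image_mset (\<lambda>k. real k / real n) M. u) = real (sum_mset M) / real n" for M
            by (induction M) (auto simp: add_divide_distrib)
          then show ?thesis using Q unfolding s_def by metis
        qed
        also have "\<dots> \<le> (\<Sum>u\<in>#image_mset (\<lambda>k. real k / real n) (macro \<epsilon> n \<mu>). K c u)"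
          by (rule K_sum_mset) (use c_pos in auto)
        also have "\<dots> = (\<Sum>k\<in>#macro \<epsilon> n \<mu>. K c (real k / real n))"
          by (simp add: image_mset.compositionality comp_def)
        finally have "real n * K c \<tau> \<le> real n * (\<Sum>k\<in>#macro \<epsilon> n \<mu>. K c (real k / real n))"
          by (intro mult_left_mono) auto
        then show "B \<le> tilt c \<epsilon> n t y \<mu>"
          unfolding B_def tilt_def using Q y0 by (intro mult_mono) auto
      qed (use p y0 in \<open>auto simp: tilt_def\<close>)
      also have "\<dots> \<le> exp (real n * (ln c - 1 - c / 2 - ln t + t + y * (t - t\<^sup>2 / 2) / c + (1 + y) * \<eta>)) / B"
        using bd t y0 B0 by (intro divide_right_mono) auto
      also have "B = exp (real n * (K c \<tau> - s * (ln t + 1 - t) + a * ln y))"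
      proof -
        have "y ^ m = exp (real m * ln y)" using y0 by (simp add: exp_of_nat_mult)
        then show ?thesis using n by (simp add: B_def s_def a_def exp_add[symmetric] distrib_left right_diff_distrib)
      qed
      also have "exp (real n * (ln c - 1 - c / 2 - ln t + t + y * (t - t\<^sup>2 / 2) / c + (1 + y) * \<eta>)) / \<dots> =
        exp (real n * (ln c - 1 - c / 2 - (1 - s) * ln t + (1 - s) * t + s + (a + \<beta>) - a * ln y - K c \<tau> + (1 + y) * \<eta>))"
        unfolding yt exp_diff[symmetric] by (simp add: algebra_simps)
      also have "\<dots> \<le> exp (real n * (- RA c \<tau> t' + e))"
        by (subst exp_le_cancel_iff, rule mult_left_mono) (use main[folded y_def] err \<beta> in linarith, simp)
      finally have fin: "profile_prob (p n) n ?Q \<le> exp (real n * (- RA c \<tau> t' + e))" .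
      show "\<exists>\<tau>\<in>{0..1}. \<exists>t\<in>{0..1}. (1 - \<tau>) * (1 - t / 2) = real m / real n \<and>
        profile_prob (p n) n ?Q \<le> exp (real n * (- RA c \<tau> t + e))"
        using \<tau> fin by (intro bexI[of _ \<tau>] bexI[of _ t'] conjI) (simp_all add: a_def)
    qed
  qed
qed

end

section \<open>Lower bounds on connection probabilities\<close>

text \<open>By the bound on \<open>conn_prob\<close>, up to the factor in front
  \<open>step_prob p M k\<close> is at most the probability that a binomial variable with parameters
  M and 1 - (1-p)^k equals k. By Hoeffding's inequality this is tiny unless k/M nearly solves the
  equation of the giant component.\<close>

lemma step_prob_hoeffding:
  assumes p: "0 < p" "p < 1" and k: "1 \<le> k" "k \<le> M" and M: "2 \<le> M" and \<delta>: "0 \<le> \<delta>"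
    and dev: "\<delta> \<le> \<bar>real k / real M - (1 - (1 - p) ^ k)\<bar>"
  shows "step_prob p M k \<le> real M * exp (1 / (1 - (1 - p) ^ k)) * (2 * exp (- 2 * real M * \<delta>\<^sup>2))"
proof -
  define x where "x = (1 - p) ^ k"
  have x: "0 < x" "x < 1" using p k by (auto simp: x_def power_less_one_iff)
  let ?E = "exp (1 / (1 - x))"
  interpret bd: binomial_distribution M "1 - x" by unfold_locales (use x in auto)
  have "step_prob p M k = real (M - 1 choose (k - 1)) * conn_prob p k * x ^ (M - k)"
    by (simp add: step_prob_def x_def power_mult)
  also have "\<dots> \<le> real (M choose k) * (real M * ?E * (1 - x) ^ k) * x ^ (M - k)"
  proof (intro mult_mono)
    obtain M' k' where MM: "M = Suc M'" "k = Suc k'" using k by (metis Suc_le_D One_nat_def le_trans)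
    show "real (M - 1 choose (k - 1)) \<le> real (M choose k)"
      unfolding MM by simp
    show "conn_prob p k \<le> real M * ?E * (1 - x) ^ k"
      unfolding x_def by (rule conn_prob_upper'[OF p k M])
  qed (use p x in \<open>auto simp: conn_prob_nonneg\<close>)
  also have "\<dots> = real M * ?E * pmf (binomial_pmf M (1 - x)) k"
    using x by simp
  also have "\<dots> \<le> real M * ?E * (2 * exp (- 2 * real M * \<delta>\<^sup>2))"
  proof (rule mult_left_mono)
    have "pmf (binomial_pmf M (1 - x)) k = measure_pmf.prob (binomial_pmf M (1 - x)) {k}"
      by (simp add: measure_pmf_single)
    also have "\<dots> \<le> measure_pmf.prob (binomial_pmf M (1 - x)) {j. \<bar>real j / real M - (1 - x)\<bar> \<ge> \<delta>}"
      by (rule measure_pmf.finite_measure_mono) (use dev in \<open>auto simp: x_def\<close>)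
    also have "\<dots> \<le> 2 * exp (- 2 * real M * \<delta>\<^sup>2)"
      using bd.prob_abs_ge'[of \<delta>] M \<delta> by simp
    finally show "pmf (binomial_pmf M (1 - x)) k \<le> 2 * exp (- 2 * real M * \<delta>\<^sup>2)" .
  qed simp
  finally show ?thesis by (simp add: x_def)
qed

text \<open>Explore one component after another: there are at most M explorations, and each of them
  finds a large component with probability at most \<rho>.\<close>

lemma all_small_prob_ge:
  assumes p: "0 < p" "p < 1" and \<rho>: "0 \<le> \<rho>" "\<rho> \<le> 1"
    and step: "\<And>M'. 1 \<le> M' \<Longrightarrow> M' \<le> M \<Longrightarrow> (\<Sum>k\<in>{k\<in>{1..M'}. T < real k}. step_prob p M' k) \<le> \<rho>"
  shows "1 - real M * \<rho> \<le> profile_prob p M (\<lambda>\<mu>. \<forall>k\<in>#\<mu>. real k \<le> T)"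
  using step
proof (induction M rule: less_induct)
  case (less M)
  let ?b = "\<lambda>M. profile_prob p M (\<lambda>\<mu>. \<forall>k\<in>#\<mu>. real k \<le> T)"
  show ?case
  proof (cases "M = 0")
    case True
    then show ?thesis by (simp add: profile_prob_def)
  next
    case False
    then have M: "1 \<le> M" by simp
    let ?r = "1 - real (M - 1) * \<rho>"
    \<comment> \<open>The bound for the first exploration can be multiplied with a nonnegative bound
      for the rest; if the latter is negative, so is the claimed bound.\<close>
    show ?thesis
    proof (cases "?r \<ge> 0")
      case r: True
      have "?b M = (\<Sum>k=1..M. step_prob p M k * profile_ex p (M - k)
          (\<lambda>\<mu>. of_bool (real k \<le> T) * of_bool (\<forall>k\<in>#\<mu>. real k \<le> T)))"
        unfolding profile_prob_def profile_ex_rec[OF M] by (simp add: of_bool_conj)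
      also have "\<dots> = (\<Sum>k=1..M. step_prob p M k * (of_bool (real k \<le> T) * ?b (M - k)))"
        unfolding profile_ex_cmult by (simp add: profile_prob_def)
      also have "\<dots> \<ge> (\<Sum>k=1..M. step_prob p M k * (of_bool (real k \<le> T) * ?r))"
      proof (intro sum_mono mult_left_mono)
        fix k assume k: "k \<in> {1..M}"
        have "1 - real (M - k) * \<rho> \<le> ?b (M - k)"
          by (rule less.IH) (use k less.prems in auto)
        moreover have "?r \<le> 1 - real (M - k) * \<rho>"
          using k \<rho> by (auto intro!: mult_right_mono)
        ultimately show "?r \<le> ?b (M - k)" by linarith
      qed (use p in \<open>auto simp: step_prob_nonneg\<close>)
      also have "(\<Sum>k=1..M. step_prob p M k * (of_bool (real k \<le> T) * ?r)) =
          (\<Sum>k=1..M. step_prob p M k * of_bool (real k \<le> T)) * ?r"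
        unfolding sum_distrib_right by (simp only: mult.assoc)
      also have "(\<Sum>k=1..M. step_prob p M k * of_bool (real k \<le> T)) =
          1 - (\<Sum>k\<in>{k\<in>{1..M}. T < real k}. step_prob p M k)"
      proof -
        have "(\<Sum>k=1..M. step_prob p M k * of_bool (real k \<le> T)) + (\<Sum>k=1..M. step_prob p M k * of_bool (T < real k)) =
          (\<Sum>k=1..M. step_prob p M k)"
          unfolding sum.distrib[symmetric] by (rule sum.cong) auto
        moreover have "(\<Sum>k=1..M. step_prob p M k * of_bool (T < real k)) = (\<Sum>k\<in>{k\<in>{1..M}. T < real k}. step_prob p M k)"
          by (intro sum.mono_neutral_cong_right) auto
        ultimately show ?thesis using sum_step_prob[OF M, of p] by linarith
      qed
      finally have 1: "(1 - (\<Sum>k\<in>{k\<in>{1..M}. T < real k}. step_prob p M k)) * ?r \<le> ?b M" .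
      have "(1 - \<rho>) * ?r \<le> (1 - (\<Sum>k\<in>{k\<in>{1..M}. T < real k}. step_prob p M k)) * ?r"
        using less.prems[OF M order_refl] r by (intro mult_right_mono) auto
      moreover have "1 - real M * \<rho> \<le> (1 - \<rho>) * ?r"
      proof -
        have "real M = real (M - 1) + 1" using M by simp
        moreover have "0 \<le> real (M - 1) * \<rho> * \<rho>" using \<rho> by simp
        ultimately show ?thesis by (simp only: algebra_simps)
      qed
      ultimately show ?thesis using 1 by linarith
    next
      case False
      have "real (M - 1) * \<rho> \<le> real M * \<rho>" using \<rho> by (intro mult_right_mono) auto
      then have "1 - real M * \<rho> \<le> 0" using False by linarith
      then show ?thesis using profile_prob_nonneg[of p M] p by (meson less_imp_le order_trans)
    qed
  qed
qed

text \<open>The logarithm of the function is \<open>kap x + x / 2\<close>. Strictness yields the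
  uniqueness of the positive solution of the giant component equation in
  \<open>window_deviation\<close>.\<close>

lemma exp_weight_strict_mono:
  assumes "0 < x" "x < y"
  shows "x / (1 - exp (- x)) < y / (1 - exp (- (y::real)))"
proof -
  have "kap x + x / 2 < kap y + y / 2"
  proof (rule DERIV_pos_imp_increasing[OF assms(2), of "\<lambda>x. kap x + x / 2"])
    fix z assume "x \<le> z" "z \<le> y"
    then have z: "0 < z" using assms by simp
    have "((\<lambda>x. kap x + x / 2) has_real_derivative ((1 / z - 1 / (exp z - 1) - 1 / 2) + 1 / 2)) (at z)"
      by (auto intro!: derivative_eq_intros has_derivative_kap[OF z])
    moreover have "z < exp z - 1"
    proof -
      have "(1 + z / 2) * (1 + z / 2) \<le> exp (z / 2) * exp (z / 2)"
        using exp_ge_add_one_self[of "z / 2"] z by (intro mult_mono) auto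
      then have "1 + z + (z / 2) * (z / 2) \<le> exp z" by (simp add: exp_add[symmetric] algebra_simps)
      moreover have "0 < (z / 2) * (z / 2)" using z by simp
      ultimately show ?thesis by linarith
    qed
    then have "1 / (exp z - 1) < 1 / z" using z by (intro divide_strict_left_mono) auto
    ultimately show "\<exists>d. ((\<lambda>x. kap x + x / 2) has_real_derivative d) (at z) \<and> 0 < d"
      by (intro exI conjI) auto
  qed
  then have "ln (x / (1 - exp (- x))) < ln (y / (1 - exp (- y)))" by (simp add: kap_def)
  then show ?thesis using assms by simp
qed

context sparse_regime
begin

text \<open>In the subcritical range 1 - (1-p)^k \<le> \<lambda> k \<le> (1 - \<beta>/2) k/M, so a
  macroscopic k misses the giant component equation by at least (\<beta>/2) k/M, and Hoeffding's
  inequality gives exponential decay. The bound is uniform in M, the number of vertices that remain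
  once large components are split off.\<close>

lemma no_macro:
  assumes \<beta>: "0 < \<beta>" "\<beta> < 1" and \<delta>: "0 < \<delta>" and \<xi>: "0 < \<xi>"
  shows "\<forall>\<^sub>F n in sequentially. \<forall>M\<le>n. c * real M \<le> (1 - \<beta>) * real n \<longrightarrow>
    1 - \<xi> \<le> profile_prob (p n) M (\<lambda>\<mu>. \<forall>k\<in>#\<mu>. real k \<le> \<delta> * real n)"
proof -
  define \<delta>' where "\<delta>' = \<delta> * \<beta> / 2"
  have \<delta>': "0 < \<delta>'" using \<beta> \<delta> by (simp add: \<delta>'_def)
  define E where "E = exp (1 / (1 - exp (- (c / 2 * \<delta>))))"
  \<comment> \<open>The bound for one size times at most n sizes; the number of explorations brings
    one more factor n.\<close>
  define \<rho> where "\<rho> n = real n * (real n * E * (2 * exp (- 2 * (\<delta> * real n) * \<delta>'\<^sup>2)))" for n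
  have "(\<lambda>n. real n * \<rho> n) \<longlonglongrightarrow> 0"
  proof -
    have "((\<lambda>x::real. x * (x * (x * (2 * exp (- 2 * (\<delta> * x) * \<delta>'\<^sup>2))))) \<longlongrightarrow> 0) at_top"
      using \<delta> \<delta>' by real_asymp
    from filterlim_compose[OF this filterlim_real_sequentially]
    have "(\<lambda>n. E * (real n * (real n * (real n * (2 * exp (- 2 * (\<delta> * real n) * \<delta>'\<^sup>2)))))) \<longlonglongrightarrow> E * 0"
      by (intro tendsto_intros)
    then show ?thesis by (simp add: \<rho>_def mult_ac)
  qed
  then have 1: "\<forall>\<^sub>F n in sequentially. real n * \<rho> n < min \<xi> 1" by (rule order_tendstoD) (use \<xi> in simp)
  have 2: "\<forall>\<^sub>F n in sequentially. (1 - \<beta>) * (real n * lam (p n)) < c * (1 - \<beta> / 2)"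
  proof (rule order_tendstoD)
    show "(\<lambda>n. (1 - \<beta>) * (real n * lam (p n))) \<longlonglongrightarrow> (1 - \<beta>) * c"
      by (intro tendsto_intros lam_lim)
    show "(1 - \<beta>) * c < c * (1 - \<beta> / 2)" using \<beta> c_pos by (simp add: algebra_simps)
  qed
  have 3: "\<forall>\<^sub>F n in sequentially. 2 < \<delta> * real n" using \<delta> by real_asymp
  show ?thesis
    using 1 2 3 p01 n_lam_bounds eventually_ge_at_top[of 1]
  proof (eventually_elim, intro allI impI)
    fix n M
    assume r: "real n * \<rho> n < min \<xi> 1" and s: "(1 - \<beta>) * (real n * lam (p n)) < c * (1 - \<beta> / 2)"
      and b: "2 < \<delta> * real n" and p: "0 < p n \<and> p n < 1"
      and nl: "c / 2 < real n * lam (p n) \<and> real n * lam (p n) < 2 * c" and n1: "1 \<le> n"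
      and M: "M \<le> n" "c * real M \<le> (1 - \<beta>) * real n"
    have l: "0 < lam (p n)" using p by (intro lam_pos) auto
    have \<rho>0: "0 \<le> \<rho> n" by (simp add: \<rho>_def E_def)
    have \<rho>1: "\<rho> n \<le> 1"
    proof -
      have "1 * \<rho> n \<le> real n * \<rho> n" using n1 \<rho>0 by (intro mult_right_mono) auto
      then show ?thesis using r by simp
    qed
    have "1 - real M * \<rho> n \<le> profile_prob (p n) M (\<lambda>\<mu>. \<forall>k\<in>#\<mu>. real k \<le> \<delta> * real n)"
    proof (rule all_small_prob_ge)
      fix M' assume M': "1 \<le> M'" "M' \<le> M"
      have sub: "lam (p n) * real M' \<le> 1 - \<beta> / 2"
      proof -
        have "c * (lam (p n) * real M') \<le> c * (lam (p n) * real M)" using M' l c_pos by simp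
        also have "\<dots> \<le> lam (p n) * ((1 - \<beta>) * real n)" using M l by (simp add: mult_ac)
        also have "\<dots> = (1 - \<beta>) * (real n * lam (p n))" by simp
        also have "\<dots> \<le> c * (1 - \<beta> / 2)" using s by simp
        finally show ?thesis using c_pos by simp
      qed
      have "step_prob (p n) M' k \<le> real n * E * (2 * exp (- 2 * (\<delta> * real n) * \<delta>'\<^sup>2))"
        if k: "k \<in> {k\<in>{1..M'}. \<delta> * real n < real k}" for k
      proof -
        have kM: "1 \<le> k" "k \<le> M'" "\<delta> * real n < real k" using k by auto
        have M2: "2 \<le> M'" using kM b by linarith
        have Mn: "real M' \<le> real n" using M' M by simp
        have "1 - (1 - p n) ^ k \<le> lam (p n) * real k"
          using exp_ge_add_one_self[of "- (lam (p n) * real k)"] p by (simp add: power_eq_exp_lam)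
        also have "\<dots> = lam (p n) * real M' * (real k / real M')" using M' by simp
        also have "\<dots> \<le> (1 - \<beta> / 2) * (real k / real M')" using sub by (intro mult_right_mono) auto
        finally have "\<beta> / 2 * (real k / real M') \<le> real k / real M' - (1 - (1 - p n) ^ k)"
          by (simp add: algebra_simps)
        moreover have "\<delta>' \<le> \<beta> / 2 * (real k / real M')"
        proof -
          have "\<delta> * real M' \<le> \<delta> * real n" using Mn \<delta> by simp
          then have "\<delta> \<le> real k / real M'" using kM M' by (simp add: field_simps)
          then have "\<beta> / 2 * \<delta> \<le> \<beta> / 2 * (real k / real M')" using \<beta> by (intro mult_left_mono) auto
          then show ?thesis by (simp add: \<delta>'_def mult_ac)
        qed
        ultimately have dev: "\<delta>' \<le> \<bar>real k / real M' - (1 - (1 - p n) ^ k)\<bar>" by linarith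
        have "step_prob (p n) M' k \<le> real M' * exp (1 / (1 - (1 - p n) ^ k)) * (2 * exp (- 2 * real M' * \<delta>'\<^sup>2))"
          by (rule step_prob_hoeffding[OF _ _ kM(1,2) M2 _ dev]) (use p \<delta>' in auto)
        also have "\<dots> \<le> real n * E * (2 * exp (- 2 * (\<delta> * real n) * \<delta>'\<^sup>2))"
        proof (intro mult_mono)
          show "exp (1 / (1 - (1 - p n) ^ k)) \<le> E"
          proof -
            have "c / 2 * \<delta> \<le> real n * lam (p n) * \<delta>" using nl \<delta> by (intro mult_right_mono) auto
            also have "\<dots> = lam (p n) * (\<delta> * real n)" by simp
            also have "\<dots> \<le> lam (p n) * real k" using kM l by (intro mult_left_mono) auto
            finally have "(1 - p n) ^ k \<le> exp (- (c / 2 * \<delta>))" using p by (simp add: power_eq_exp_lam)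
            moreover have "exp (- (c / 2 * \<delta>)) < 1" using c_pos \<delta> by simp
            moreover from calculation have "(1 - p n) ^ k < 1" by linarith
            ultimately show ?thesis unfolding E_def by (auto intro!: divide_left_mono mult_pos_pos)
          qed
          have "\<delta> * real n \<le> real M'" using kM by linarith
          then show "exp (- 2 * real M' * \<delta>'\<^sup>2) \<le> exp (- 2 * (\<delta> * real n) * \<delta>'\<^sup>2)"
            by (simp add: mult_right_mono)
        qed (use Mn in \<open>auto simp: E_def\<close>)
        finally show ?thesis .
      qed
      then have "(\<Sum>k\<in>{k\<in>{1..M'}. \<delta> * real n < real k}. step_prob (p n) M' k) \<le>
          real (card {k\<in>{1..M'}. \<delta> * real n < real k}) * (real n * E * (2 * exp (- 2 * (\<delta> * real n) * \<delta>'\<^sup>2)))"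
        by (rule sum_bounded_above)
      also have "\<dots> \<le> \<rho> n"
      proof -
        have "card {k\<in>{1..M'}. \<delta> * real n < real k} \<le> card {1..M'}" by (intro card_mono) auto
        then have "card {k\<in>{1..M'}. \<delta> * real n < real k} \<le> n" using M' M by simp
        then show ?thesis unfolding \<rho>_def by (intro mult_right_mono) (auto simp: E_def)
      qed
      finally show "(\<Sum>k\<in>{k\<in>{1..M'}. \<delta> * real n < real k}. step_prob (p n) M' k) \<le> \<rho> n" .
    qed (use p \<rho>0 \<rho>1 in auto)
    moreover have "real M * \<rho> n \<le> real n * \<rho> n" using M \<rho>0 by (intro mult_right_mono) auto
    ultimately show "1 - \<xi> \<le> profile_prob (p n) M (\<lambda>\<mu>. \<forall>k\<in>#\<mu>. real k \<le> \<delta> * real n)"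
      using r by linarith
  qed
qed

end

section \<open>Connection probabilities near a given size\<close>

lemma fact_div_fact_le_power: "k \<le> M \<Longrightarrow> fact M / fact (M - k) \<le> real M ^ k"
proof (induction k arbitrary: M)
  case (Suc k)
  then obtain M' where M: "M = Suc M'" by (metis Suc_le_D)
  have "fact M / fact (M - Suc k) = real M * (fact M' / fact (M' - k))" by (simp add: M)
  also have "\<dots> \<le> real M * real M' ^ k" using Suc M by (intro mult_left_mono) auto
  also have "\<dots> \<le> real M * real M ^ k" using M by (intro mult_left_mono power_mono) auto
  finally show ?case by simp
qed simp

text \<open>Meant for \<lambda> M > 1. Then M exp(-\<lambda> M) lies below the maximum of x
  exp(-\<lambda> x), attained at x = 1/\<lambda>, and the small sizes can be estimated there instead
  of at M. Their probability is at most 1/(\<lambda> M) < 1, which leaves room for a giant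
  component. Of the 5R in the hypothesis, 4R come from \<open>small_weights_real\<close> and R from
  the factor exp(\<lambda> k^2/2).\<close>

lemma step_prob_small_sum:
  assumes p: "0 < p" "p < 1" and M: "1 \<le> M" and x: "2 * lam p \<le> 1" "4 * real R * lam p \<le> 1"
    and sub: "lam p * real M * exp (1 - lam p * real M) \<le> exp (- (2 + 5 * real R) * lam p)"
  shows "(\<Sum>k\<in>{k\<in>{1..M}. k \<le> R}. step_prob p M k) \<le> 1 / (lam p * real M)"
proof -
  have l: "0 < lam p" by (rule lam_pos[OF p])
  define \<kappa> where "\<kappa> = exp (- (2 + 4 * real R) * lam p)"
  define z where "z = \<kappa> * (1 / lam p * exp (- lam p * (1 / lam p)))"
  have tm: "step_prob p M k \<le> real k * wgt p k * z ^ k / real M" if k: "1 \<le> k" "k \<le> M" "k \<le> R" for k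
  proof -
    have "gam p M / gam p (M - k) \<le> (real M * exp (- lam p * real M + lam p * real R)) ^ k"
    proof -
      have "fact M / fact (M - k) \<le> real M ^ k"
        using fact_div_fact_le_power[OF k(2)] .
      moreover have "exp (- lam p * (real M)\<^sup>2 / 2) / exp (- lam p * (real (M - k))\<^sup>2 / 2)
         \<le> exp (- lam p * real M + lam p * real R) ^ k"
      proof -
        have d: "real (M - k) = real M - real k" using k by (simp add: of_nat_diff)
        have "lam p * (real k * real k) \<le> lam p * (real k * (2 * real R))"
          using l k by (intro mult_left_mono) auto
        then have "(- lam p * (real M)\<^sup>2 / 2) - (- lam p * (real (M - k))\<^sup>2 / 2) \<le>
            real k * (- lam p * real M + lam p * real R)"
          unfolding d by (simp add: power2_eq_square field_simps)
        then show ?thesis by (simp add: exp_diff[symmetric] exp_of_nat_mult[symmetric])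
      qed
      ultimately have "fact M / fact (M - k) * (exp (- lam p * (real M)\<^sup>2 / 2) / exp (- lam p * (real (M - k))\<^sup>2 / 2))
         \<le> real M ^ k * exp (- lam p * real M + lam p * real R) ^ k"
        by (intro mult_mono) auto
      then show ?thesis by (simp add: gam_def power_mult_distrib)
    qed
    also have "\<dots> \<le> z ^ k"
    proof (rule power_mono)
      have "lam p * real M * exp (1 - lam p * real M) * exp (lam p * real R) \<le>
          exp (- (2 + 5 * real R) * lam p) * exp (lam p * real R)"
        using sub by (rule mult_right_mono) simp
      also have "\<dots> = \<kappa>" by (simp add: \<kappa>_def exp_add[symmetric] algebra_simps)
      finally have "lam p * real M * exp (1 - lam p * real M) * exp (lam p * real R) \<le> \<kappa>" .
      then have "lam p * real M * exp (1 - lam p * real M) * exp (lam p * real R) * (exp (- 1) / lam p) \<le> \<kappa> * (exp (- 1) / lam p)"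
        by (rule mult_right_mono) (use l in simp)
      moreover have "lam p * real M * exp (1 - lam p * real M) * exp (lam p * real R) * (exp (- 1) / lam p) =
          real M * exp (- lam p * real M + lam p * real R)"
        using l by (simp add: exp_add[symmetric] mult.assoc)
      ultimately have "real M * exp (- lam p * real M + lam p * real R) \<le> \<kappa> * (exp (- 1) / lam p)"
        by linarith
      then show "real M * exp (- lam p * real M + lam p * real R) \<le> z" using l by (simp add: z_def)
    qed simp
    finally have "real k / real M * wgt p k * (gam p M / gam p (M - k)) \<le> real k / real M * wgt p k * z ^ k"
      using wgt_nonneg p by (intro mult_left_mono) auto
    then show ?thesis using step_prob_eq[OF p(2) k(1,2)] by (simp add: mult_ac)
  qed
  have "(\<Sum>k\<in>{k\<in>{1..M}. k \<le> R}. step_prob p M k) \<le> (\<Sum>k\<in>{k\<in>{1..M}. k \<le> R}. real k * wgt p k * z ^ k / real M)"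
    by (rule sum_mono) (use tm in auto)
  also have "\<dots> \<le> (\<Sum>k=1..R. real k * wgt p k * z ^ k / real M)"
    using p l by (intro sum_mono2) (auto simp: z_def \<kappa>_def wgt_nonneg intro!: divide_nonneg_nonneg mult_nonneg_nonneg)
  also have "\<dots> = (\<Sum>k=1..R. real k * wgt p k * z ^ k) / real M" by (simp add: sum_divide_distrib)
  also have "\<dots> \<le> (1 / lam p) / real M"
  proof (rule divide_right_mono)
    show "(\<Sum>k=1..R. real k * wgt p k * z ^ k) \<le> 1 / lam p"
      unfolding z_def by (rule small_weights_real[OF p]) (use l x in \<open>auto simp: \<kappa>_def field_simps\<close>)
  qed simp
  finally show ?thesis by (simp add: mult.commute)
qed

text \<open>\<open>step_prob\<close> times (1 - (1-p)^k)^k is \<open>conn_prob\<close> times a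
  negative binomial probability, which is at most one.\<close>

lemma conn_prob_ge_of_step_prob:
  assumes p: "0 < p" "p < 1" and k: "1 \<le> k" "k \<le> M" and g: "\<gamma> \<le> step_prob p M k"
  shows "\<gamma> * (1 - (1 - p) ^ k) ^ k \<le> conn_prob p k"
proof -
  define x where "x = (1 - p) ^ k"
  have x: "0 < x" "x < 1" using p k by (auto simp: x_def power_less_one_iff)
  have b: "(M - 1) choose (k - 1) = ((M - k) + k - 1) choose (M - k)"
    using k by (subst binomial_symmetric) auto
  have "pmf (neg_binomial_pmf k (1 - x)) (M - k) = real ((M - 1) choose (k - 1)) * (1 - x) ^ k * x ^ (M - k)"
    unfolding b using x by (subst pmf_neg_binomial) auto
  then have le1: "real ((M - 1) choose (k - 1)) * (1 - x) ^ k * x ^ (M - k) \<le> 1"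
    using pmf_le_1[of "neg_binomial_pmf k (1 - x)" "M - k"] by linarith
  have "\<gamma> * (1 - x) ^ k \<le> step_prob p M k * (1 - x) ^ k"
    using g x by (intro mult_right_mono) auto
  also have "\<dots> = conn_prob p k * (real ((M - 1) choose (k - 1)) * (1 - x) ^ k * x ^ (M - k))"
    by (simp add: step_prob_def x_def power_mult mult_ac)
  also have "\<dots> \<le> conn_prob p k * 1"
    using le1 conn_prob_nonneg[of p k] p by (intro mult_left_mono) auto
  finally show ?thesis by (simp add: x_def)
qed


lemma one_minus_less_exp: "(0::real) < x \<Longrightarrow> 1 - x < exp (- x)"
proof (cases "x \<le> 1")
  case True
  assume x: "0 < x"
  have "(1 - x / 2) * (1 - x / 2) \<le> exp (- (x / 2)) * exp (- (x / 2))"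
    using exp_ge_add_one_self[of "- (x / 2)"] x True by (intro mult_mono) auto
  then have "1 - x + (x / 2) * (x / 2) \<le> exp (- x)" by (simp add: exp_add[symmetric] algebra_simps)
  moreover have "0 < (x / 2) * (x / 2)" using x by simp
  ultimately show ?thesis by linarith
next
  case False
  then have "1 - x < 0" by simp
  also have "0 < exp (- x)" by simp
  finally show ?thesis .
qed

lemma eventually_less_of_tendsto:
  fixes a b :: real
  assumes "(f \<longlongrightarrow> a) F" "(g \<longlongrightarrow> b) F" "a < b"
  shows "\<forall>\<^sub>F x in F. f x < g x"
proof -
  obtain m where m: "a < m" "m < b" using dense[OF assms(3)] by auto
  show ?thesis
    using order_tendstoD(2)[OF assms(1) m(1)] order_tendstoD(1)[OF assms(2) m(2)]
    by eventually_elim simp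
qed

context sparse_regime
begin

text \<open>By strict monotonicity y = u is the only positive solution of y/v = 1 - exp(-c y). So
  the deviation is positive on the compact set of all y in question, and hence bounded below
  there.\<close>

lemma window_deviation:
  assumes u: "0 < u" and v: "v = u / (1 - exp (- (c * u)))" and \<epsilon>: "0 < \<epsilon>" and \<delta>: "0 < \<delta>"
  shows "\<exists>\<delta>'>0. \<forall>y\<in>{\<epsilon>..v}. \<delta> \<le> \<bar>y - u\<bar> \<longrightarrow> \<delta>' \<le> \<bar>y / v - (1 - exp (- (c * y)))\<bar>"
proof -
  have v0: "0 < v" using u c_pos by (simp add: v)
  define S where "S = {\<epsilon>..v} \<inter> {y. \<delta> \<le> \<bar>y - u\<bar>}"
  define \<phi> where "\<phi> y = \<bar>y / v - (1 - exp (- (c * y)))\<bar>" for y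
  have cS: "compact S" unfolding S_def
    by (intro compact_Int_closed closed_Collect_le continuous_intros) auto
  have pos: "0 < \<phi> y" if y: "y \<in> S" for y
  proof (rule ccontr)
    assume "\<not> 0 < \<phi> y"
    then have eq: "y / v = 1 - exp (- (c * y))" by (simp add: \<phi>_def)
    have y0: "0 < y" "y \<noteq> u" using y \<epsilon> \<delta> by (auto simp: S_def)
    then have e: "0 < 1 - exp (- (c * y))" using c_pos by simp
    have "v * (1 - exp (- (c * y))) = y" using eq v0 by (simp add: divide_eq_eq mult.commute)
    then have "v = y / (1 - exp (- (c * y)))" using e by (metis less_irrefl nonzero_mult_div_cancel_right)
    then have "(c * y) / (1 - exp (- (c * y))) = (c * u) / (1 - exp (- (c * u)))"
      using v by (metis times_divide_eq_right)
    moreover have "c * y < c * u \<or> c * u < c * y" using y0 c_pos by auto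
    ultimately show False
      using exp_weight_strict_mono[of "c * y" "c * u"] exp_weight_strict_mono[of "c * u" "c * y"] y0 u c_pos
      by fastforce
  qed
  show ?thesis
  proof (cases "S = {}")
    case True
    then show ?thesis by (intro exI[of _ 1]) (auto simp: S_def)
  next
    case False
    have "continuous_on S \<phi>" unfolding \<phi>_def[abs_def] using v0 by (intro continuous_intros) auto
    then obtain y where y: "y \<in> S" "\<And>z. z \<in> S \<Longrightarrow> \<phi> y \<le> \<phi> z"
      using continuous_attains_inf[OF cS False] by blast
    show ?thesis
      using pos[OF y(1)] y(2) by (intro exI[of _ "\<phi> y"]) (auto simp: S_def \<phi>_def)
  qed
qed

text \<open>With \<open>v n\<close> vertices, \<open>v\<close> as in \<open>window_deviation\<close>, the giant component has about \<open>u n\<close>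
  vertices.\<close>

lemma connected_window:
  assumes u: "0 < u" and \<delta>: "0 < \<delta>"
  shows "\<exists>\<kappa>>0. \<forall>\<^sub>F n in sequentially. \<exists>k\<ge>1. \<bar>real k / real n - u\<bar> < \<delta> \<and>
    \<kappa> / real n * (1 - (1 - p n) ^ k) ^ k \<le> conn_prob (p n) k"
proof -
  define v where "v = u / (1 - exp (- (c * u)))"
  have e0: "0 < 1 - exp (- (c * u))" using u c_pos by simp
  have v0: "0 < v" using u e0 by (simp add: v_def)
  \<comment> \<open>The mean degree of the graph on v n vertices, which turns out to be
    supercritical.\<close>
  define d where "d = c * v"
  have d1: "1 < d"
  proof -
    have "1 - c * u < exp (- (c * u))" using u c_pos by (intro one_minus_less_exp) simp
    then show ?thesis using e0 by (simp add: d_def v_def field_simps)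
  qed
  have de: "d * exp (1 - d) < 1"
  proof -
    have "ln d < d - 1" using ln_le_minus_one[of d] ln_eq_minus_one[of d] d1 by fastforce
    then have "exp (ln d + (1 - d)) < exp 0" by (subst exp_less_cancel_iff) linarith
    then show ?thesis using d1 by (simp add: exp_add)
  qed
  \<comment> \<open>The two bounds ensure 4 \<epsilon> n \<lambda> \<le> 1 and 5 \<epsilon> c < - ln
    (d exp (1 - d)), as \<open>step_prob_small_sum\<close> requires.\<close>
  define \<epsilon> where "\<epsilon> = min (1 / (8 * c)) (- ln (d * exp (1 - d)) / (12 * c))"
  have lde: "ln (d * exp (1 - d)) < 0" using de d1 by simp
  have \<epsilon>: "0 < \<epsilon>" "\<epsilon> \<le> 1 / (8 * c)" "\<epsilon> \<le> - ln (d * exp (1 - d)) / (12 * c)"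
    using lde c_pos by (auto simp: \<epsilon>_def divide_neg_pos)
  obtain \<delta>' where \<delta>': "0 < \<delta>'" and dev: "\<And>y. y \<in> {\<epsilon>..v} \<Longrightarrow> \<delta> \<le> \<bar>y - u\<bar> \<Longrightarrow> \<delta>' \<le> \<bar>y / v - (1 - exp (- (c * y)))\<bar>"
    using window_deviation[OF u v_def \<epsilon>(1) \<delta>] by blast
  define M where "M n = nat \<lfloor>v * real n\<rfloor>" for n
  have M: "real (M n) \<le> v * real n" "v * real n - 1 < real (M n)" for n
    using v0 by (auto simp: M_def floor_less_iff of_nat_nat) 
  define \<nu> where "\<nu> n = real n * lam (p n)" for n
  have \<nu>: "\<nu> \<longlonglongrightarrow> c" using lam_lim by (simp add: \<nu>_def[abs_def])
  have Mn: "(\<lambda>n. real (M n) / real n) \<longlonglongrightarrow> v"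
  proof (rule real_tendsto_sandwich)
    show "\<forall>\<^sub>F n in sequentially. v - 1 / real n \<le> real (M n) / real n"
      using eventually_gt_at_top[of 0]
    proof eventually_elim
      case (elim n)
      then have "(v * real n - 1) / real n \<le> real (M n) / real n"
        using M(2)[of n] by (intro divide_right_mono) auto
      then show ?case using elim by (simp add: diff_divide_distrib)
    qed
    show "\<forall>\<^sub>F n in sequentially. real (M n) / real n \<le> v"
      using eventually_gt_at_top[of 0] by eventually_elim (use M(1) in \<open>simp add: field_simps\<close>)
    show "(\<lambda>n. v - 1 / real n) \<longlonglongrightarrow> v"
      using tendsto_diff[OF tendsto_const[of v] lim_1_over_n] by simp
  qed simp
  have lM: "(\<lambda>n. lam (p n) * real (M n)) \<longlonglongrightarrow> d"
  proof -
    have "(\<lambda>n. \<nu> n * (real (M n) / real n)) \<longlonglongrightarrow> c * v" by (intro tendsto_intros \<nu> Mn)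
    moreover have "\<forall>\<^sub>F n in sequentially. \<nu> n * (real (M n) / real n) = lam (p n) * real (M n)"
      using eventually_gt_at_top[of 0] by eventually_elim (simp add: \<nu>_def)
    ultimately show ?thesis unfolding d_def by (rule Lim_transform_eventually)
  qed
  define E where "E = exp (1 / (1 - exp (- (c / 2 * \<epsilon>))))"
  define \<rho> where "\<rho> n = (v * real n) * ((v * real n) * E * (2 * exp (- 2 * (v * real n - 1) * (\<delta>' / 2)\<^sup>2)))" for n
  \<comment> \<open>Half of 1 - 1/d, the limiting lower bound on the probability that is left for
    the window.\<close>
  define \<gamma> where "\<gamma> = (1 - 1 / d) / 2"
  have \<gamma>: "0 < \<gamma>" using d1 by (simp add: \<gamma>_def)
  have "\<rho> \<longlonglongrightarrow> 0"
  proof -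
    have "((\<lambda>x::real. (v * x) * ((v * x) * (2 * exp (- 2 * (v * x - 1) * (\<delta>' / 2)\<^sup>2)))) \<longlongrightarrow> 0) at_top"
      using v0 \<delta>' by real_asymp
    from filterlim_compose[OF this filterlim_real_sequentially]
    have "(\<lambda>n. E * ((v * real n) * ((v * real n) * (2 * exp (- 2 * (v * real n - 1) * (\<delta>' / 2)\<^sup>2))))) \<longlonglongrightarrow> E * 0"
      by (intro tendsto_intros)
    then show ?thesis by (simp add: \<rho>_def[abs_def] mult_ac)
  qed
  moreover have "(\<lambda>n. 1 / (lam (p n) * real (M n))) \<longlonglongrightarrow> 1 / d"
    using d1 by (intro tendsto_divide[OF tendsto_const lM]) auto
  ultimately have "(\<lambda>n. 1 - 1 / (lam (p n) * real (M n)) - \<rho> n) \<longlonglongrightarrow> 1 - 1 / d - 0"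
    by (intro tendsto_diff tendsto_const)
  then have ev1: "\<forall>\<^sub>F n in sequentially. \<gamma> < 1 - 1 / (lam (p n) * real (M n)) - \<rho> n"
    by (rule order_tendstoD) (use d1 in \<open>simp add: \<gamma>_def field_simps\<close>)
  have "(\<lambda>n. 1 / (v * real n) + v * \<bar>\<nu> n - c\<bar>) \<longlonglongrightarrow> 1 / v * 0 + v * \<bar>c - c\<bar>"
    using tendsto_add[OF tendsto_mult[OF tendsto_const[of "1 / v"] lim_1_over_n]
      tendsto_mult[OF tendsto_const[of v] tendsto_rabs[OF tendsto_diff[OF \<nu> tendsto_const[of c]]]]]
    by simp
  then have ev2: "\<forall>\<^sub>F n in sequentially. 1 / (v * real n) + v * \<bar>\<nu> n - c\<bar> < \<delta>' / 2"
    by (rule order_tendstoD) (use \<delta>' in simp)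
  have "(\<lambda>n. lam (p n) * real (M n) * exp (1 - lam (p n) * real (M n))) \<longlonglongrightarrow> d * exp (1 - d)"
    by (intro tendsto_intros lM)
  moreover have "(\<lambda>n. exp (- (2 * (\<nu> n * (1 / real n)) + 5 * \<epsilon> * \<nu> n))) \<longlonglongrightarrow> exp (- (2 * (c * 0) + 5 * \<epsilon> * c))"
    by (intro tendsto_intros \<nu> lim_1_over_n)
  moreover have "d * exp (1 - d) < exp (- (2 * (c * 0) + 5 * \<epsilon> * c))"
  proof -
    have "5 * \<epsilon> * c \<le> 5 * c * (- ln (d * exp (1 - d)) / (12 * c))"
      using mult_left_mono[OF \<epsilon>(3), of "5 * c"] c_pos by (simp only: mult_ac)
    also have "\<dots> < - ln (d * exp (1 - d))" using c_pos lde by simp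
    finally have "ln (d * exp (1 - d)) < - (2 * (c * 0) + 5 * \<epsilon> * c)" by simp
    then have "exp (ln (d * exp (1 - d))) < exp (- (2 * (c * 0) + 5 * \<epsilon> * c))" by (subst exp_less_cancel_iff)
    then show ?thesis using d1 by simp
  qed
  ultimately have ev3: "\<forall>\<^sub>F n in sequentially. lam (p n) * real (M n) * exp (1 - lam (p n) * real (M n))
      < exp (- (2 * (\<nu> n * (1 / real n)) + 5 * \<epsilon> * \<nu> n))"
    by (rule eventually_less_of_tendsto)
  have ev4: "\<forall>\<^sub>F n in sequentially. 4 < v * real n" using v0 by real_asymp
  have ev5: "\<forall>\<^sub>F n in sequentially. 4 * c < real n" by real_asymp
  show ?thesis
  proof (intro exI[of _ "\<gamma> / v"] conjI)
    show "\<forall>\<^sub>F n in sequentially. \<exists>k\<ge>1. \<bar>real k / real n - u\<bar> < \<delta> \<and>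
      \<gamma> / v / real n * (1 - (1 - p n) ^ k) ^ k \<le> conn_prob (p n) k"
      using ev1 ev2 ev3 ev4 ev5 p01 n_lam_bounds eventually_gt_at_top[of 0]
    proof eventually_elim
      case (elim n)
      then have p: "0 < p n" "p n < 1" and nl: "c / 2 < \<nu> n" "\<nu> n < 2 * c" and n0: "0 < real n"
        by (auto simp: \<nu>_def)
      have l: "0 < lam (p n)" by (rule lam_pos[OF p])
      have M2: "2 \<le> M n" using M(2)[of n] elim by linarith
      define R where "R = nat \<lfloor>\<epsilon> * real n\<rfloor>"
      have R: "k \<le> R \<longleftrightarrow> real k \<le> \<epsilon> * real n" for k
        unfolding R_def using \<epsilon> by (simp add: le_nat_floor le_nat_iff le_floor_iff)
      have Rle: "real R \<le> \<epsilon> * real n" using R[of R] by simp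
      define W where "W = {k\<in>{1..M n}. \<not> k \<le> R \<and> \<bar>real k / real n - u\<bar> < \<delta>}"
      define N where "N = {k\<in>{1..M n}. \<not> k \<le> R \<and> \<not> \<bar>real k / real n - u\<bar> < \<delta>}"
      have split: "(\<Sum>k\<in>{k\<in>{1..M n}. k \<le> R}. step_prob (p n) (M n) k) +
          (\<Sum>k\<in>N. step_prob (p n) (M n) k) + (\<Sum>k\<in>W. step_prob (p n) (M n) k) = 1"
      proof -
        have "{1..M n} = ({k\<in>{1..M n}. k \<le> R} \<union> N) \<union> W" by (auto simp: N_def W_def)
        then have "(\<Sum>k=1..M n. step_prob (p n) (M n) k) =
          (\<Sum>k\<in>({k\<in>{1..M n}. k \<le> R} \<union> N) \<union> W. step_prob (p n) (M n) k)"
          by (rule arg_cong[where f="sum (step_prob (p n) (M n))"])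
        also have "\<dots> = (\<Sum>k\<in>{k\<in>{1..M n}. k \<le> R}. step_prob (p n) (M n) k) +
          (\<Sum>k\<in>N. step_prob (p n) (M n) k) + (\<Sum>k\<in>W. step_prob (p n) (M n) k)"
        proof -
          have "finite N" "finite W" "({k\<in>{1..M n}. k \<le> R} \<union> N) \<inter> W = {}" "{k\<in>{1..M n}. k \<le> R} \<inter> N = {}"
            by (auto simp: N_def W_def)
          then show ?thesis by (simp add: sum.union_disjoint)
        qed
        finally show ?thesis using sum_step_prob[of "M n" "p n"] M2 by simp
      qed
      have small: "(\<Sum>k\<in>{k\<in>{1..M n}. k \<le> R}. step_prob (p n) (M n) k) \<le> 1 / (lam (p n) * real (M n))"
      proof (rule step_prob_small_sum[OF p])
        have "2 * \<nu> n \<le> real n" using nl elim by linarith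
        then show "2 * lam (p n) \<le> 1" using n0 by (simp add: \<nu>_def)
        have "4 * real R * lam (p n) \<le> 4 * (\<epsilon> * real n) * lam (p n)" using Rle l by simp
        also have "\<dots> = 4 * \<epsilon> * \<nu> n" by (simp add: \<nu>_def)
        also have "\<dots> \<le> 4 * (1 / (8 * c)) * (2 * c)" using \<epsilon> nl c_pos by (intro mult_mono) auto
        also have "\<dots> = 1" using c_pos by simp
        finally show "4 * real R * lam (p n) \<le> 1" .
        have "(2 + 5 * real R) * lam (p n) \<le> (2 + 5 * (\<epsilon> * real n)) * lam (p n)" using Rle l by simp
        also have "\<dots> = 2 * (\<nu> n * (1 / real n)) + 5 * \<epsilon> * \<nu> n" using n0 by (simp add: \<nu>_def algebra_simps)
        finally have "exp (- (2 * (\<nu> n * (1 / real n)) + 5 * \<epsilon> * \<nu> n)) \<le> exp (- (2 + 5 * real R) * lam (p n))"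
          by (simp only: exp_le_cancel_iff mult_minus_left neg_le_iff_le)
        then show "lam (p n) * real (M n) * exp (1 - lam (p n) * real (M n)) \<le> exp (- (2 + 5 * real R) * lam (p n))"
          using elim(3) by linarith
      qed (use M2 in simp)
      have tm: "step_prob (p n) (M n) k \<le> (v * real n) * E * (2 * exp (- 2 * (v * real n - 1) * (\<delta>' / 2)\<^sup>2))"
        if k: "k \<in> N" for k
      proof -
        have kM: "1 \<le> k" "k \<le> M n" "\<epsilon> * real n < real k" "\<delta> \<le> \<bar>real k / real n - u\<bar>"
          using k R[of k] by (auto simp: N_def)
        define y where "y = real k / real n"
        have kv: "real k \<le> v * real n" using of_nat_mono[OF kM(2), where 'a=real] M(1)[of n] by linarith
        have y: "y \<in> {\<epsilon>..v}" using kM kv n0 by (auto simp: y_def field_simps)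
        have yd: "\<delta>' \<le> \<bar>y / v - (1 - exp (- (c * y)))\<bar>" using dev[OF y] kM by (simp add: y_def)
        \<comment> \<open>Replacing v n by its integer part and c by n \<lambda> costs at most half
          of the deviation \<open>\<delta>'\<close>.\<close>
        have a: "\<bar>real k / real (M n) - y / v\<bar> \<le> 1 / (v * real n)"
        proof -
          have "real k / real (M n) - y / v = (real k / real (M n)) * ((v * real n - real (M n)) / (v * real n))"
            using n0 v0 M2 by (simp add: y_def field_simps)
          moreover have "\<bar>(real k / real (M n)) * ((v * real n - real (M n)) / (v * real n))\<bar> \<le> 1 * (1 / (v * real n))"
            unfolding abs_mult using kM M[of n] v0 n0 M2
            by (intro mult_mono) (auto simp: abs_divide divide_right_mono)
          ultimately show ?thesis by simp
        qed
        have b: "\<bar>exp (- (c * y)) - (1 - p n) ^ k\<bar> \<le> v * \<bar>\<nu> n - c\<bar>"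
        proof -
          have q: "(1 - p n) ^ k = exp (- (\<nu> n * y))" using n0 p by (simp add: power_eq_exp_lam \<nu>_def y_def)
          have ee: "\<bar>exp (- a) - exp (- b)\<bar> \<le> \<bar>a - b\<bar>" if "0 \<le> a" "0 \<le> b" for a b :: real
          proof -
            have *: "exp (- a) - exp (- b) \<le> b - a" if "0 \<le> a" "a \<le> b" for a b :: real
            proof -
              have "1 - exp (- (b - a)) \<le> b - a"
                using exp_ge_add_one_self[of "- (b - a)"] by linarith
              then have "exp (- a) * (1 - exp (- (b - a))) \<le> 1 * (b - a)"
                by (rule mult_mono[rotated]) (use that in auto)
              then show ?thesis by (simp add: right_diff_distrib exp_add[symmetric])
            qed
            show ?thesis using *[of a b] *[of b a] that by (cases "a \<le> b") auto
          qed
          have "\<bar>exp (- (c * y)) - exp (- (\<nu> n * y))\<bar> \<le> \<bar>c * y - \<nu> n * y\<bar>"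
            by (rule ee) (use y \<epsilon> c_pos nl in auto)
          also have "\<dots> = y * \<bar>\<nu> n - c\<bar>" using y \<epsilon> unfolding left_diff_distrib[symmetric] by (simp add: abs_mult abs_minus_commute)
          also have "\<dots> \<le> v * \<bar>\<nu> n - c\<bar>" using y by (intro mult_right_mono) auto
          finally show ?thesis unfolding q .
        qed
        have "\<delta>' / 2 \<le> \<bar>real k / real (M n) - (1 - (1 - p n) ^ k)\<bar>" using a b yd elim(2) by linarith
        then have "step_prob (p n) (M n) k \<le> real (M n) * exp (1 / (1 - (1 - p n) ^ k)) *
            (2 * exp (- 2 * real (M n) * (\<delta>' / 2)\<^sup>2))"
          by (intro step_prob_hoeffding p kM M2) (use \<delta>' in auto)
        also have "\<dots> \<le> (v * real n) * E * (2 * exp (- 2 * (v * real n - 1) * (\<delta>' / 2)\<^sup>2))"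
        proof (intro mult_mono)
          show "exp (1 / (1 - (1 - p n) ^ k)) \<le> E"
          proof -
            have "c / 2 * \<epsilon> \<le> \<nu> n * \<epsilon>" using nl \<epsilon> by (intro mult_right_mono) auto
            also have "\<dots> = lam (p n) * (\<epsilon> * real n)" by (simp add: \<nu>_def)
            also have "\<dots> \<le> lam (p n) * real k" using kM l by (intro mult_left_mono) auto
            finally have "(1 - p n) ^ k \<le> exp (- (c / 2 * \<epsilon>))" using p by (simp add: power_eq_exp_lam)
            moreover have "exp (- (c / 2 * \<epsilon>)) < 1" using c_pos \<epsilon> by simp
            moreover from calculation have "(1 - p n) ^ k < 1" by linarith
            ultimately show ?thesis unfolding E_def by (auto intro!: divide_left_mono mult_pos_pos)
          qed
          show "exp (- 2 * real (M n) * (\<delta>' / 2)\<^sup>2) \<le> exp (- 2 * (v * real n - 1) * (\<delta>' / 2)\<^sup>2)"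
            by (intro exp_le_cancel_iff[THEN iffD2] mult_right_mono) (use M(2)[of n] in auto)
        qed (use M v0 in \<open>auto simp: E_def\<close>)
        finally show ?thesis .
      qed
      have "(\<Sum>k\<in>N. step_prob (p n) (M n) k) \<le> real (card N) *
          ((v * real n) * E * (2 * exp (- 2 * (v * real n - 1) * (\<delta>' / 2)\<^sup>2)))"
        using tm by (rule sum_bounded_above)
      also have "\<dots> \<le> \<rho> n"
      proof -
        have "card N \<le> card {1..M n}" by (intro card_mono) (auto simp: N_def)
        then have "real (card N) \<le> v * real n" using M(1)[of n] by simp
        then show ?thesis unfolding \<rho>_def using v0 by (intro mult_right_mono) (auto simp: E_def)
      qed
      finally have big: "\<gamma> < (\<Sum>k\<in>W. step_prob (p n) (M n) k)" using split small elim(1) by linarith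
      \<comment> \<open>The window contains at most v n sizes, and one of them carries at least the
        average.\<close>
      have "\<exists>k\<in>W. \<gamma> / (v * real n) \<le> step_prob (p n) (M n) k"
      proof (rule ccontr)
        assume "\<not> ?thesis"
        then have "\<And>k. k \<in> W \<Longrightarrow> step_prob (p n) (M n) k \<le> \<gamma> / (v * real n)" by force
        then have "(\<Sum>k\<in>W. step_prob (p n) (M n) k) \<le> real (card W) * (\<gamma> / (v * real n))"
          by (rule sum_bounded_above)
        also have "\<dots> \<le> (v * real n) * (\<gamma> / (v * real n))"
        proof (rule mult_right_mono)
          have "card W \<le> card {1..M n}" by (intro card_mono) (auto simp: W_def)
          then show "real (card W) \<le> v * real n" using M(1)[of n] by simp
        qed (use \<gamma> v0 in auto)
        also have "\<dots> = \<gamma>" using v0 n0 by simp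
        finally show False using big by simp
      qed
      then obtain k where k: "k \<in> W" "\<gamma> / (v * real n) \<le> step_prob (p n) (M n) k" by blast
      have "\<gamma> / (v * real n) * (1 - (1 - p n) ^ k) ^ k \<le> conn_prob (p n) k"
        by (rule conn_prob_ge_of_step_prob[OF p _ _ k(2)]) (use k in \<open>auto simp: W_def\<close>)
      then show ?case using k by (intro exI[of _ k]) (auto simp: W_def)
    qed
  qed (use \<gamma> v0 in simp)
qed

end

section \<open>Splitting off large components\<close>

text \<open>Unroll the exploration recursion and keep in each step only the term of the prescribed
  size. The factor k/n of \<open>step_prob\<close> is at least 1/n0, a polynomial loss per
  component.\<close>

lemma profile_prob_lower_list:
  assumes p: "0 < p" "p < 1"
  shows "(\<And>k. k \<in> set ks \<Longrightarrow> 1 \<le> k) \<Longrightarrow> sum_list ks \<le> n \<Longrightarrow> n \<le> n0 \<Longrightarrow>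
    gam p n / gam p (n - sum_list ks) * (\<Prod>k\<leftarrow>ks. wgt p k / real n0) *
      profile_prob p (n - sum_list ks) (\<lambda>\<mu>. Q (mset ks + \<mu>)) \<le> profile_prob p n Q"
proof (induction ks arbitrary: n Q)
  case Nil
  then show ?case using gam_pos[of p n] by simp
next
  case (Cons k ks)
  have k: "1 \<le> k" "k \<le> n" using Cons.prems by auto
  then have n1: "1 \<le> n" by linarith
  have IH: "gam p (n - k) / gam p (n - k - sum_list ks) * (\<Prod>k\<leftarrow>ks. wgt p k / real n0) *
      profile_prob p (n - k - sum_list ks) (\<lambda>\<mu>. Q (add_mset k (mset ks + \<mu>)))
      \<le> profile_prob p (n - k) (\<lambda>\<mu>. Q (add_mset k \<mu>))"
    by (rule Cons.IH) (use Cons.prems in auto)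
  let ?P = "(\<Prod>k\<leftarrow>ks. wgt p k / real n0)"
  have P0: "0 \<le> ?P" using p by (induction ks) (auto simp: wgt_nonneg)
  have "gam p n / gam p (n - sum_list (k # ks)) * (\<Prod>k\<leftarrow>k # ks. wgt p k / real n0) *
      profile_prob p (n - sum_list (k # ks)) (\<lambda>\<mu>. Q (mset (k # ks) + \<mu>)) =
    (gam p n / gam p (n - k) * (wgt p k / real n0)) * (gam p (n - k) / gam p (n - k - sum_list ks) * ?P *
      profile_prob p (n - k - sum_list ks) (\<lambda>\<mu>. Q (add_mset k (mset ks + \<mu>))))"
    using gam_pos[of p "n - k"] by (simp add: diff_diff_left mult_ac)
  also have "\<dots> \<le> step_prob p n k * profile_prob p (n - k) (\<lambda>\<mu>. Q (add_mset k \<mu>))"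
  proof (rule mult_mono[OF _ IH])
    have "1 / real n0 \<le> real k / real n" using k n1 Cons.prems(3) by (intro frac_le) auto
    then have "gam p n / gam p (n - k) * wgt p k * (1 / real n0) \<le> gam p n / gam p (n - k) * wgt p k * (real k / real n)"
      using gam_pos[of p] p by (intro mult_left_mono) (auto simp: wgt_nonneg less_imp_le)
    then show "gam p n / gam p (n - k) * (wgt p k / real n0) \<le> step_prob p n k"
      using step_prob_eq[OF p(2) k(1,2)] by (simp add: mult_ac)
    show "0 \<le> step_prob p n k" using p by (simp add: step_prob_nonneg)
    show "0 \<le> gam p (n - k) / gam p (n - k - sum_list ks) * ?P *
      profile_prob p (n - k - sum_list ks) (\<lambda>\<mu>. Q (add_mset k (mset ks + \<mu>)))"
      by (intro mult_nonneg_nonneg divide_nonneg_nonneg profile_prob_nonneg P0 less_imp_le[OF gam_pos]) (use p in auto)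
  qed
  also have "\<dots> \<le> (\<Sum>k=1..n. step_prob p n k * profile_prob p (n - k) (\<lambda>\<mu>. Q (add_mset k \<mu>)))"
    by (rule member_le_sum[of k "{1..n}" "\<lambda>k. step_prob p n k * profile_prob p (n - k) (\<lambda>\<mu>. Q (add_mset k \<mu>))"])
       (use k p in \<open>auto intro!: mult_nonneg_nonneg step_prob_nonneg profile_prob_nonneg\<close>)
  also have "\<dots> = profile_prob p n Q"
    unfolding profile_prob_def using profile_ex_rec[OF n1] by simp
  finally show ?case .
qed

text \<open>Stirling's formula for n! and N!. The terms with ln n are kept apart since they cancel
  later against those in the weights, where \<lambda> is about c/n.\<close>

lemma gam_ratio_lower:
  assumes p: "0 < p" "p < 1" and N: "1 \<le> N" "N \<le> n" and b: "b = real N / real n"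
  shows "exp (real n * (ln (real n) - 1 - b * ln b - b * ln (real n) + b - (real n * lam p) * (1 - b\<^sup>2) / 2)
      - 1 - ln (real n)) \<le> gam p n / gam p N"
proof -
  have n0: "0 < real n" "0 < real N" using N by auto
  have bn: "real N = b * real n" "0 < b" "b \<le> 1" using n0 N by (auto simp: b)
  have lN: "ln (real N) = ln b + ln (real n)" using bn n0 by (simp add: ln_mult)
  have f1: "exp (real n * ln (real n) - real n) \<le> fact n"
    using fact_ge_power_exp[of n] n0 by (simp add: exp_diff exp_of_nat_mult field_simps)
  have f2: "fact N \<le> exp (1 + ln (real n) + real N * ln (real N) - real N)"
  proof -
    have "fact N \<le> exp 1 * real N * real N ^ N * exp (- real N)"
      using fact_le_power_exp[OF N(1)] by (simp add: exp_minus field_simps)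
    also have "\<dots> \<le> exp 1 * real n * real N ^ N * exp (- real N)"
      using N by (intro mult_right_mono mult_left_mono) auto
    also have "\<dots> = exp (1 + ln (real n) + real N * ln (real N) - real N)"
      using n0 by (simp add: exp_add exp_diff exp_minus exp_of_nat_mult field_simps)
    finally show ?thesis .
  qed
  have "exp (real n * ln (real n) - real n) / exp (1 + ln (real n) + real N * ln (real N) - real N) \<le> fact n / fact N"
    using f1 f2 by (intro frac_le) auto
  then have "exp (real n * ln (real n) - real n) / exp (1 + ln (real n) + real N * ln (real N) - real N) *
    (exp (- lam p * (real n)\<^sup>2 / 2) / exp (- lam p * (real N)\<^sup>2 / 2)) \<le> fact n / fact N *
    (exp (- lam p * (real n)\<^sup>2 / 2) / exp (- lam p * (real N)\<^sup>2 / 2))"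
    by (rule mult_right_mono) simp
  also have "\<dots> = gam p n / gam p N" by (simp add: gam_def)
  also have "exp (real n * ln (real n) - real n) / exp (1 + ln (real n) + real N * ln (real N) - real N) *
    (exp (- lam p * (real n)\<^sup>2 / 2) / exp (- lam p * (real N)\<^sup>2 / 2)) =
    exp (real n * (ln (real n) - 1 - b * ln b - b * ln (real n) + b - (real n * lam p) * (1 - b\<^sup>2) / 2)
      - 1 - ln (real n))"
    unfolding exp_diff[symmetric] exp_add[symmetric] lN unfolding bn(1)
    by (rule arg_cong[where f=exp]) (simp add: power2_eq_square field_simps)
  finally show ?thesis .
qed

lemma L_diff:
  assumes "0 < c" "0 < c'" "0 \<le> s" "s \<le> 1"
  shows "\<bar>L c s - L c' s\<bar> \<le> \<bar>c - c'\<bar> + \<bar>ln c - ln c'\<bar>"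
proof -
  have "L c s - L c' s = (c - c') * (s - s\<^sup>2 / 2) - (ln c - ln c') * s"
    by (simp add: L_def field_simps)
  moreover have "\<bar>(c - c') * (s - s\<^sup>2 / 2)\<bar> \<le> \<bar>c - c'\<bar> * 1"
  proof -
    have "s\<^sup>2 \<le> s" using assms by (simp add: power2_eq_square mult_left_le_one_le)
    moreover have "0 \<le> s\<^sup>2" by simp
    ultimately have "\<bar>s - s\<^sup>2 / 2\<bar> \<le> 1" using assms by linarith
    then show ?thesis unfolding abs_mult by (intro mult_left_mono) auto
  qed
  moreover have "\<bar>(ln c - ln c') * s\<bar> \<le> \<bar>ln c - ln c'\<bar> * 1"
    unfolding abs_mult using assms by (intro mult_left_mono) auto
  ultimately show ?thesis
    using abs_triangle_ineq4[of "(c - c') * (s - s\<^sup>2 / 2)" "(ln c - ln c') * s"] by simp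
qed

context sparse_regime
begin

text \<open>The exponents add up to minus the sum of K minus L: K comes from the weights, L from the
  ratio of \<open>gam\<close> together with the factors (e \<lambda>)^k of the weights. The 3 ln n
  per component stem from \<kappa>/n, from k \<le> n in Stirling's formula, and from the 1/n of the
  recursion.\<close>

lemma macro_product_lower:
  fixes k :: "nat \<Rightarrow> nat"
  assumes p: "0 < p n" "p n < 1" and n: "1 \<le> n" and k: "\<And>i. i < r \<Longrightarrow> 1 \<le> k i" and S: "(\<Sum>i<r. k i) < n"
    and \<kappa>: "0 < \<kappa>" "\<And>i. i < r \<Longrightarrow> \<kappa> / real n * (1 - (1 - p n) ^ k i) ^ k i \<le> conn_prob (p n) (k i)"
  shows "exp (real n * (- (\<Sum>i<r. K (real n * lam (p n)) (real (k i) / real n))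
        - L (real n * lam (p n)) (\<Sum>i<r. real (k i) / real n))
        - real r * (3 * ln (real n) + 1 - ln \<kappa>) - 1 - ln (real n))
    \<le> gam (p n) n / gam (p n) (n - (\<Sum>i<r. k i)) * (\<Prod>k\<leftarrow>map k [0..<r]. wgt (p n) k / real n)"
proof -
  define \<nu> where "\<nu> = real n * lam (p n)"
  have l: "0 < lam (p n)" by (rule lam_pos[OF p])
  have n0: "0 < real n" using n by simp
  have ln\<nu>: "ln (lam (p n)) = ln \<nu> - ln (real n)" using l n0 by (simp add: \<nu>_def ln_mult)
  define N where "N = n - (\<Sum>i<r. k i)"
  define s where "s = (\<Sum>i<r. real (k i) / real n)"
  have sS: "real n * s = real (\<Sum>i<r. k i)" using n0 by (simp add: s_def sum_divide_distrib[symmetric])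
  have N: "1 \<le> N" "N \<le> n" using S by (auto simp: N_def)
  have b: "1 - s = real N / real n"
  proof -
    have "real N = real n - real n * s" using S unfolding sS by (simp add: N_def of_nat_diff)
    then show ?thesis using n0 by (simp add: field_simps)
  qed
  have w: "exp (real (k i) * (ln (lam (p n)) + 1) - real n * K \<nu> (real (k i) / real n) - (3 * ln (real n) + 1 - ln \<kappa>))
      \<le> wgt (p n) (k i) / real n" if i: "i < r" for i
  proof -
    have kn: "real (k i) \<le> real n"
    proof -
      have "k i \<le> (\<Sum>i<r. k i)" using i by (intro member_le_sum) auto
      then show ?thesis using S by simp
    qed
    have "\<kappa> / real n / (exp 1 * real (k i)) * exp (real (k i) * (ln (lam (p n)) + 1 - kap (lam (p n) * real (k i)))) \<le> wgt (p n) (k i)"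
      by (rule wgt_lower[OF p k[OF i] \<kappa>(2)[OF i]]) (use \<kappa> in simp)
    moreover have "\<kappa> / real n / (exp 1 * real n) * exp (real (k i) * (ln (lam (p n)) + 1 - kap (lam (p n) * real (k i)))) \<le>
      \<kappa> / real n / (exp 1 * real (k i)) * exp (real (k i) * (ln (lam (p n)) + 1 - kap (lam (p n) * real (k i))))"
      using kn k[OF i] \<kappa> n0 by (intro mult_right_mono divide_left_mono) auto
    ultimately have "\<kappa> / real n / (exp 1 * real n) * exp (real (k i) * (ln (lam (p n)) + 1 - kap (lam (p n) * real (k i)))) / real n
      \<le> wgt (p n) (k i) / real n" by (intro divide_right_mono) auto
    also have "\<kappa> / real n / (exp 1 * real n) * exp (real (k i) * (ln (lam (p n)) + 1 - kap (lam (p n) * real (k i)))) / real n =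
      exp (real (k i) * (ln (lam (p n)) + 1 - kap (lam (p n) * real (k i))) - (3 * ln (real n) + 1 - ln \<kappa>))"
    proof -
      have "exp (3 * ln (real n)) = real n ^ 3" using n0 exp_of_nat_mult[of 3 "ln (real n)"] by simp
      then have "exp (- (3 * ln (real n) + 1 - ln \<kappa>)) = \<kappa> / (real n ^ 3 * exp 1)"
        using \<kappa> by (simp add: exp_minus exp_add exp_diff field_simps)
      then show ?thesis
        unfolding diff_conv_add_uminus[of _ "3 * ln (real n) + 1 - ln \<kappa>"] exp_add by (simp add: power3_eq_cube mult_ac)
    qed
    also have "real (k i) * (ln (lam (p n)) + 1 - kap (lam (p n) * real (k i))) =
      real (k i) * (ln (lam (p n)) + 1) - real n * K \<nu> (real (k i) / real n)"
      using n0 by (simp add: K_eq_kap \<nu>_def right_diff_distrib mult_ac)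
    finally show ?thesis .
  qed
  have prod: "(\<Prod>k\<leftarrow>map k [0..<r]. wgt (p n) k / real n) = (\<Prod>i<r. wgt (p n) (k i) / real n)"
    by (simp add: prod.list_conv_set_nth atLeast0LessThan)
  have "exp (\<Sum>i<r. real (k i) * (ln (lam (p n)) + 1) - real n * K \<nu> (real (k i) / real n) - (3 * ln (real n) + 1 - ln \<kappa>))
      \<le> (\<Prod>i<r. wgt (p n) (k i) / real n)"
    unfolding exp_sum[OF finite_lessThan] by (intro prod_mono) (use w in auto)
  moreover have "(\<Sum>i<r. real (k i) * (ln (lam (p n)) + 1) - real n * K \<nu> (real (k i) / real n) - (3 * ln (real n) + 1 - ln \<kappa>))
     = real n * (s * (ln \<nu> - ln (real n) + 1) - (\<Sum>i<r. K \<nu> (real (k i) / real n))) - real r * (3 * ln (real n) + 1 - ln \<kappa>)"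
  proof -
    have "(\<Sum>i<r. real (k i) * (ln (lam (p n)) + 1)) = real n * s * (ln (lam (p n)) + 1)"
      unfolding sS by (simp add: sum_distrib_right)
    then show ?thesis
      unfolding sum_subtractf ln\<nu> by (simp add: sum_distrib_left right_diff_distrib mult.assoc)
  qed
  ultimately have P: "exp (real n * (s * (ln \<nu> - ln (real n) + 1) - (\<Sum>i<r. K \<nu> (real (k i) / real n))) - real r * (3 * ln (real n) + 1 - ln \<kappa>))
      \<le> (\<Prod>k\<leftarrow>map k [0..<r]. wgt (p n) k / real n)" unfolding prod by simp
  have "exp (real n * (ln (real n) - 1 - (1 - s) * ln (1 - s) - (1 - s) * ln (real n) + (1 - s) - \<nu> * (1 - (1 - s)\<^sup>2) / 2)
      - 1 - ln (real n)) *
    exp (real n * (s * (ln \<nu> - ln (real n) + 1) - (\<Sum>i<r. K \<nu> (real (k i) / real n))) - real r * (3 * ln (real n) + 1 - ln \<kappa>))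
    \<le> gam (p n) n / gam (p n) N * (\<Prod>k\<leftarrow>map k [0..<r]. wgt (p n) k / real n)"
    by (rule mult_mono[OF gam_ratio_lower[OF p N b, folded \<nu>_def] P]) (auto simp: gam_pos less_imp_le)
  also have "exp (real n * (ln (real n) - 1 - (1 - s) * ln (1 - s) - (1 - s) * ln (real n) + (1 - s) - \<nu> * (1 - (1 - s)\<^sup>2) / 2)
      - 1 - ln (real n)) *
    exp (real n * (s * (ln \<nu> - ln (real n) + 1) - (\<Sum>i<r. K \<nu> (real (k i) / real n))) - real r * (3 * ln (real n) + 1 - ln \<kappa>))
    = exp (real n * (- (\<Sum>i<r. K \<nu> (real (k i) / real n)) - L \<nu> s) - real r * (3 * ln (real n) + 1 - ln \<kappa>) - 1 - ln (real n))"
    unfolding exp_add[symmetric] L_def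
    by (rule arg_cong[where f=exp]) (simp add: power2_eq_square field_simps)
  finally show ?thesis unfolding \<nu>_def s_def N_def .
qed

text \<open>Splits off components of about x i n vertices at the right cost and leaves a random
  graph on the remaining vertices, for which the event is still free. The sizes k i come from
  \<open>connected_window\<close>, so they are known only up to \<delta> n.\<close>

lemma macro_lower:
  fixes x :: "nat \<Rightarrow> real"
  assumes x: "\<And>i. i < r \<Longrightarrow> 0 < x i" and sx: "(\<Sum>i<r. x i) < 1" and e: "0 < e" and \<delta>: "0 < \<delta>"
  shows "\<forall>\<^sub>F n in sequentially. \<exists>k::nat \<Rightarrow> nat. (\<forall>i<r. \<bar>real (k i) / real n - x i\<bar> < \<delta>) \<and> (\<Sum>i<r. k i) < n \<and>
    (\<forall>Q. exp (real n * (- (\<Sum>i<r. K c (x i)) - L c (\<Sum>i<r. x i) - e)) *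
        profile_prob (p n) (n - (\<Sum>i<r. k i)) (\<lambda>\<mu>. Q (mset (map k [0..<r]) + \<mu>)) \<le> profile_prob (p n) n Q)"
proof -
  let ?s = "\<Sum>i<r. x i"
  have s0: "0 \<le> ?s" using x by (intro sum_nonneg less_imp_le) auto
  have rr: "0 < 1 + real r" by simp
  define e1 where "e1 = e / (4 * (1 + real r))"
  have e1: "0 < e1" using e by (simp add: e1_def)
  have "\<exists>d>0. \<forall>y\<ge>0. \<bar>y - x i\<bar> < d \<longrightarrow> \<bar>K c y - K c (x i)\<bar> < e1" if "i < r" for i
    using continuous_on_K[of c, unfolded continuous_on_iff, rule_format, of "x i" e1] x[OF that] e1 c_pos
    by (auto simp: dist_real_def)
  then obtain d where d: "\<And>i. i < r \<Longrightarrow> 0 < d i"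
    "\<And>i y. i < r \<Longrightarrow> 0 \<le> y \<Longrightarrow> \<bar>y - x i\<bar> < d i \<Longrightarrow> \<bar>K c y - K c (x i)\<bar> < e1" by metis
  obtain dL where dL: "0 < dL" "\<And>y. y \<in> {0..1} \<Longrightarrow> \<bar>y - ?s\<bar> < dL \<Longrightarrow> \<bar>L c y - L c ?s\<bar> < e / 4"
    using continuous_on_L[of c, unfolded continuous_on_iff, rule_format, of ?s "e / 4"] s0 sx e
    by (auto simp: dist_real_def)
  \<comment> \<open>Radii for the continuity of L at the total and of K at each x i, and for a total
    below 1; dividing by 1 + r controls the sum of r errors.\<close>
  define T where "T = insert \<delta> (insert (dL / (1 + real r)) (insert ((1 - ?s) / (1 + real r)) (d ` {..<r})))"
  define \<delta>' where "\<delta>' = Min T"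
  have T: "finite T" "T \<noteq> {}" by (auto simp: T_def)
  have "0 < z" if "z \<in> T" for z using that \<delta> dL d sx by (auto simp: T_def)
  then have "0 < \<delta>'" unfolding \<delta>'_def using T by (simp add: Min_gr_iff)
  moreover have "\<delta>' \<le> z" if "z \<in> T" for z unfolding \<delta>'_def using T that by (intro Min_le)
  ultimately
  have \<delta>': "0 < \<delta>'" "\<delta>' \<le> \<delta>" "\<delta>' \<le> dL / (1 + real r)" "\<delta>' \<le> (1 - ?s) / (1 + real r)" "\<And>i. i < r \<Longrightarrow> \<delta>' \<le> d i"
    by (auto simp: T_def)
  have \<delta>r: "real r * \<delta>' < dL" "real r * \<delta>' < 1 - ?s"
  proof -
    have 0: "real r * \<delta>' < (1 + real r) * \<delta>'" using \<delta>' by simp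
    have "(1 + real r) * \<delta>' \<le> (1 + real r) * (dL / (1 + real r))" using \<delta>' by (intro mult_left_mono) auto
    then show "real r * \<delta>' < dL" using 0 by simp
    have "(1 + real r) * \<delta>' \<le> (1 + real r) * ((1 - ?s) / (1 + real r))" using \<delta>' by (intro mult_left_mono) auto
    then show "real r * \<delta>' < 1 - ?s" using 0 by simp
  qed
  have "\<forall>i\<in>{..<r}. \<exists>\<kappa>>0. \<forall>\<^sub>F n in sequentially. \<exists>k\<ge>1. \<bar>real k / real n - x i\<bar> < \<delta>' \<and>
    \<kappa> / real n * (1 - (1 - p n) ^ k) ^ k \<le> conn_prob (p n) k"
    using connected_window[OF x \<delta>'(1)] by blast
  then obtain \<kappa>' where \<kappa>': "\<And>i. i < r \<Longrightarrow> 0 < \<kappa>' i"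
    "\<And>i. i < r \<Longrightarrow> \<forall>\<^sub>F n in sequentially. \<exists>k\<ge>1. \<bar>real k / real n - x i\<bar> < \<delta>' \<and>
    \<kappa>' i / real n * (1 - (1 - p n) ^ k) ^ k \<le> conn_prob (p n) k"
    unfolding bchoice_iff by auto
  define \<kappa> where "\<kappa> = Min (insert 1 (\<kappa>' ` {..<r}))"
  have \<kappa>: "0 < \<kappa>" "\<And>i. i < r \<Longrightarrow> \<kappa> \<le> \<kappa>' i" using \<kappa>' unfolding \<kappa>_def by (auto simp: Min_gr_iff)
  have "\<forall>\<^sub>F n in sequentially. \<forall>i\<in>{..<r}. \<exists>k\<ge>1. \<bar>real k / real n - x i\<bar> < \<delta>' \<and>
    \<kappa>' i / real n * (1 - (1 - p n) ^ k) ^ k \<le> conn_prob (p n) k"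
    using \<kappa>' by (intro eventually_ball_finite) auto
  moreover have "(\<lambda>n. \<bar>c - real n * lam (p n)\<bar>) \<longlonglongrightarrow> \<bar>c - c\<bar>" by (intro tendsto_intros lam_lim)
  then have "\<forall>\<^sub>F n in sequentially. \<bar>c - real n * lam (p n)\<bar> < e / 16" by (rule order_tendstoD) (use e in simp)
  moreover have "(\<lambda>n. \<bar>ln c - ln (real n * lam (p n))\<bar>) \<longlonglongrightarrow> \<bar>ln c - ln c\<bar>"
    using c_pos by (intro tendsto_intros lam_lim) auto
  then have "\<forall>\<^sub>F n in sequentially. \<bar>ln c - ln (real n * lam (p n))\<bar> < e / 16" by (rule order_tendstoD) (use e in simp)
  moreover have "(\<lambda>n. real r * (3 * (ln (real n) / real n) + (1 - ln \<kappa>) * (1 / real n)) + 1 / real n + ln (real n) / real n) \<longlonglongrightarrow>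
      real r * (3 * 0 + (1 - ln \<kappa>) * 0) + 0 + 0"
    by (intro tendsto_intros lim_ln_over_n lim_1_over_n)
  then have "\<forall>\<^sub>F n in sequentially. real r * (3 * (ln (real n) / real n) + (1 - ln \<kappa>) * (1 / real n)) + 1 / real n + ln (real n) / real n < e / 8"
    by (rule order_tendstoD) (use e in simp)
  ultimately show ?thesis
    using p01 n_lam_bounds eventually_ge_at_top[of 1]
  proof eventually_elim
    case (elim n)
    then have p: "0 < p n" "p n < 1" and nl: "c / 2 < real n * lam (p n)" and n1: "1 \<le> n" by auto
    have n0: "0 < real n" using n1 by simp
    define \<nu> where "\<nu> = real n * lam (p n)"
    have \<nu>0: "0 < \<nu>" using nl c_pos by (simp add: \<nu>_def)
    obtain k where k: "\<And>i. i < r \<Longrightarrow> 1 \<le> k i" "\<And>i. i < r \<Longrightarrow> \<bar>real (k i) / real n - x i\<bar> < \<delta>'"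
      "\<And>i. i < r \<Longrightarrow> \<kappa>' i / real n * (1 - (1 - p n) ^ k i) ^ k i \<le> conn_prob (p n) (k i)"
      using elim(1) unfolding bchoice_iff by auto
    define y where "y i = real (k i) / real n" for i
    have y0: "0 \<le> y i" for i by (simp add: y_def)
    have sy: "\<bar>(\<Sum>i<r. y i) - ?s\<bar> \<le> real r * \<delta>'"
    proof -
      have "\<bar>(\<Sum>i<r. y i) - ?s\<bar> = \<bar>\<Sum>i<r. y i - x i\<bar>" by (simp add: sum_subtractf)
      also have "\<dots> \<le> (\<Sum>i<r. \<bar>y i - x i\<bar>)" by (rule sum_abs)
      also have "\<dots> \<le> real (card {..<r}) * \<delta>'" by (rule sum_bounded_above) (use k(2) in \<open>auto simp: y_def less_imp_le\<close>)
      finally show ?thesis by simp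
    qed
    then have sy1: "(\<Sum>i<r. y i) < 1" using \<delta>r by linarith
    have sy0: "0 \<le> (\<Sum>i<r. y i)" using y0 by (intro sum_nonneg) auto
    have S: "(\<Sum>i<r. k i) < n"
    proof -
      have "(\<Sum>i<r. y i) = real (\<Sum>i<r. k i) / real n" by (simp add: y_def sum_divide_distrib)
      then have "real (\<Sum>i<r. k i) < real n" using sy1 n0 by simp
      then show ?thesis by (simp only: of_nat_less_iff)
    qed
    have kk: "\<kappa> / real n * (1 - (1 - p n) ^ k i) ^ k i \<le> conn_prob (p n) (k i)" if "i < r" for i
    proof -
      have "\<kappa> / real n * (1 - (1 - p n) ^ k i) ^ k i \<le> \<kappa>' i / real n * (1 - (1 - p n) ^ k i) ^ k i"
        using \<kappa>(2)[OF that] p by (intro mult_right_mono divide_right_mono zero_le_power) (auto intro!: power_le_one)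
      then show ?thesis using k(3)[OF that] by linarith
    qed
    note low = macro_product_lower[where k=k and r=r and n=n, OF p n1 k(1) S \<kappa>(1) kk, folded \<nu>_def y_def]
    have K1: "(\<Sum>i<r. K \<nu> (y i)) \<le> (\<Sum>i<r. K c (x i)) + e / 4 + e / 16"
    proof -
      have "(\<Sum>i<r. K \<nu> (y i)) \<le> (\<Sum>i<r. (K c (x i) + e1) + e / 16 * y i)"
      proof (rule sum_mono)
        fix i assume i: "i \<in> {..<r}"
        have "y i \<le> (\<Sum>i<r. y i)" using i y0 by (intro member_le_sum) auto
        then have "\<bar>K c (y i) - K \<nu> (y i)\<bar> \<le> \<bar>c - \<nu>\<bar> * y i"
          using sy1 y0 \<nu>0 c_pos by (intro K_diff) auto
        also have "\<dots> \<le> e / 16 * y i" using elim(2) y0 by (intro mult_right_mono) (auto simp: \<nu>_def)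
        finally have "K \<nu> (y i) \<le> K c (y i) + e / 16 * y i" by linarith
        moreover have "\<bar>K c (y i) - K c (x i)\<bar> < e1"
          using i y0 k(2)[of i] \<delta>'(5)[of i] by (intro d(2)) (auto simp: y_def)
        ultimately show "K \<nu> (y i) \<le> (K c (x i) + e1) + e / 16 * y i" by linarith
      qed
      also have "\<dots> = (\<Sum>i<r. K c (x i)) + real r * e1 + e / 16 * (\<Sum>i<r. y i)"
        by (simp add: sum.distrib sum_distrib_left)
      also have "\<dots> \<le> (\<Sum>i<r. K c (x i)) + e / 4 + e / 16 * 1"
        using sy1 e by (intro add_mono mult_left_mono) (auto simp: e1_def field_simps)
      finally show ?thesis by simp
    qed
    have L1: "L \<nu> (\<Sum>i<r. y i) \<le> L c ?s + e / 4 + e / 8"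
    proof -
      have "\<bar>L c (\<Sum>i<r. y i) - L \<nu> (\<Sum>i<r. y i)\<bar> \<le> \<bar>c - \<nu>\<bar> + \<bar>ln c - ln \<nu>\<bar>"
        by (rule L_diff) (use \<nu>0 c_pos sy0 sy1 in auto)
      also have "\<dots> \<le> e / 8" using elim(2,3) by (simp add: \<nu>_def)
      finally have "\<bar>L c (\<Sum>i<r. y i) - L \<nu> (\<Sum>i<r. y i)\<bar> \<le> e / 8" .
      moreover have "\<bar>L c (\<Sum>i<r. y i) - L c ?s\<bar> < e / 4"
        by (rule dL(2)) (use sy sy0 sy1 \<delta>r in auto)
      ultimately show ?thesis by linarith
    qed
    have "exp (real n * (- (\<Sum>i<r. K c (x i)) - L c ?s - e)) \<le>
      exp (real n * (- (\<Sum>i<r. K \<nu> (y i)) - L \<nu> (\<Sum>i<r. y i)) - real r * (3 * ln (real n) + 1 - ln \<kappa>) - 1 - ln (real n))"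
    proof -
      have "real r * (3 * ln (real n) + 1 - ln \<kappa>) + 1 + ln (real n) =
        real n * (real r * (3 * (ln (real n) / real n) + (1 - ln \<kappa>) * (1 / real n)) + 1 / real n + ln (real n) / real n)"
        using n0 by (simp add: field_simps)
      also have "\<dots> \<le> real n * (e / 8)" using elim(4) by (intro mult_left_mono) auto
      finally have 1: "real r * (3 * ln (real n) + 1 - ln \<kappa>) + 1 + ln (real n) \<le> real n * (e / 8)" .
      have "- (\<Sum>i<r. K c (x i)) - L c ?s - e \<le> - (\<Sum>i<r. K \<nu> (y i)) - L \<nu> (\<Sum>i<r. y i) - e / 8"
        using K1 L1 e by linarith
      then have "real n * (- (\<Sum>i<r. K c (x i)) - L c ?s - e) \<le> real n * (- (\<Sum>i<r. K \<nu> (y i)) - L \<nu> (\<Sum>i<r. y i) - e / 8)"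
        by (intro mult_left_mono) auto
      then have "real n * (- (\<Sum>i<r. K c (x i)) - L c ?s - e) \<le> real n * (- (\<Sum>i<r. K \<nu> (y i)) - L \<nu> (\<Sum>i<r. y i)) - real n * (e / 8)"
        by (simp only: right_diff_distrib)
      then show ?thesis using 1 by (subst exp_le_cancel_iff) linarith
    qed
    also note low
    finally have low': "exp (real n * (- (\<Sum>i<r. K c (x i)) - L c ?s - e)) \<le>
      gam (p n) n / gam (p n) (n - (\<Sum>i<r. k i)) * (\<Prod>k\<leftarrow>map k [0..<r]. wgt (p n) k / real n)" .
    have sl: "sum_list (map k [0..<r]) = (\<Sum>i<r. k i)"
      by (simp add: sum.list_conv_set_nth atLeast0LessThan)
    show ?case
    proof (intro exI[of _ k] conjI allI impI)
      fix Q
      have "exp (real n * (- (\<Sum>i<r. K c (x i)) - L c ?s - e)) *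
        profile_prob (p n) (n - (\<Sum>i<r. k i)) (\<lambda>\<mu>. Q (mset (map k [0..<r]) + \<mu>)) \<le>
        gam (p n) n / gam (p n) (n - (\<Sum>i<r. k i)) * (\<Prod>k\<leftarrow>map k [0..<r]. wgt (p n) k / real n) *
        profile_prob (p n) (n - (\<Sum>i<r. k i)) (\<lambda>\<mu>. Q (mset (map k [0..<r]) + \<mu>))"
        by (rule mult_right_mono[OF low']) (use p in \<open>simp add: profile_prob_nonneg\<close>)
      also have "\<dots> \<le> profile_prob (p n) n Q"
        using profile_prob_lower_list[OF p _ less_imp_le[OF S[folded sl]] order_refl, of Q, unfolded sl] k(1)
        by fastforce
      finally show "exp (real n * (- (\<Sum>i<r. K c (x i)) - L c ?s - e)) *
        profile_prob (p n) (n - (\<Sum>i<r. k i)) (\<lambda>\<mu>. Q (mset (map k [0..<r]) + \<mu>)) \<le> profile_prob (p n) n Q" .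
    next
      fix i assume "i < r"
      then show "\<bar>real (k i) / real n - x i\<bar> < \<delta>" using k(2)[of i] \<delta>'(2) by linarith
    qed (rule S)
  qed
qed

end

section \<open>Large deviations from local estimates\<close>

lemma log_prob_mono:
  assumes "0 \<le> q" "q \<le> exp y" shows "log_prob q \<le> ereal y"
proof (cases "q = 0")
  case False
  then have "ln q \<le> ln (exp y)" using assms by (subst ln_le_cancel_iff) auto
  then show ?thesis using False by (simp add: log_prob_def)
qed (simp add: log_prob_def)

lemma log_prob_ge:
  assumes "exp y \<le> q" shows "ereal y \<le> log_prob q"
proof -
  have q: "0 < q" using assms exp_gt_zero[of y] by linarith
  then have "ln (exp y) \<le> ln q" using assms by (subst ln_le_cancel_iff) auto
  then show ?thesis using q by (simp add: log_prob_def)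
qed

text \<open>A closed set is compact here and has a finite cover by neighbourhoods from the upper
  estimate. The nonnegativity of I and the compactness of its level sets are drawn from the two
  estimates themselves.\<close>

lemma LDP_pmf_from_local:
  fixes S :: "'b::metric_space set" and P :: "nat \<Rightarrow> 'a pmf" and X :: "nat \<Rightarrow> 'a \<Rightarrow> 'b"
  assumes cS: "compact S" and X: "\<And>n \<omega>. X n \<omega> \<in> S"
    and upper: "\<And>x r. x \<in> S \<Longrightarrow> ereal r < I x \<Longrightarrow> \<exists>G. open G \<and> x \<in> G \<and>
      (\<forall>\<^sub>F n in sequentially. measure_pmf.prob (P n) {\<omega>. X n \<omega> \<in> G} \<le> exp (- (real n * r)))"
    and lower: "\<And>x r G. x \<in> S \<Longrightarrow> I x < ereal r \<Longrightarrow> open G \<Longrightarrow> x \<in> G \<Longrightarrow>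
      (\<forall>\<^sub>F n in sequentially. exp (- (real n * r)) \<le> measure_pmf.prob (P n) {\<omega>. X n \<omega> \<in> G})"
  shows "LDP S (\<lambda>n. measure_pmf (P n)) X real I"
proof -
  \<comment> \<open>A negative value of I would force probabilities above one.\<close>
  have nonneg: "0 \<le> I x" if x: "x \<in> S" for x
  proof (rule ccontr)
    assume "\<not> 0 \<le> I x"
    then have "I x < ereal 0" by (simp add: not_le zero_ereal_def)
    then obtain r where r: "I x < ereal r" "ereal r < ereal 0" using ereal_dense2 by blast
    have "\<forall>\<^sub>F n in sequentially. exp (- (real n * r)) \<le> measure_pmf.prob (P n) {\<omega>. X n \<omega> \<in> UNIV}"
      by (rule lower[OF x r(1)]) auto
    then have "\<forall>\<^sub>F n in sequentially. False" using eventually_gt_at_top[of 0]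
    proof eventually_elim
      case (elim n)
      then have "exp (- (real n * r)) \<le> exp 0" by simp
      then have "0 \<le> real n * r" by (simp only: exp_le_cancel_iff)
      then show ?case using elim r by (simp add: zero_le_mult_iff)
    qed
    then show False by simp
  qed
  \<comment> \<open>If I were at most a at points arbitrarily close to some x with I x > a, the
    lower estimate at such a point would exceed the upper estimate around x. So the complement of
    the level set is open.\<close>
  have comp: "compact {x \<in> S. I x \<le> ereal a}" for a
  proof -
    have "\<exists>G. open G \<and> x \<in> G \<and> (\<forall>z\<in>G \<inter> S. \<not> I z \<le> ereal a)" if x: "x \<in> S" "\<not> I x \<le> ereal a" for x
    proof -
      have "ereal a < I x" using x by simp
      then obtain r where r: "ereal a < ereal r" "ereal r < I x" using ereal_dense2 by blast
      then obtain r' where r': "ereal a < ereal r'" "r' < r" by (meson dense less_ereal.simps(1))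
      obtain G where G: "open G" "x \<in> G" "\<forall>\<^sub>F n in sequentially. measure_pmf.prob (P n) {\<omega>. X n \<omega> \<in> G} \<le> exp (- (real n * r))"
        using upper[OF x(1) r(2)] by blast
      have "\<not> I z \<le> ereal a" if z: "z \<in> G \<inter> S" for z
      proof
        assume "I z \<le> ereal a"
        then have "I z < ereal r'" using r'(1) by (rule le_less_trans)
        then have "\<forall>\<^sub>F n in sequentially. exp (- (real n * r')) \<le> measure_pmf.prob (P n) {\<omega>. X n \<omega> \<in> G}"
          using lower[of z r' G] z G by auto
        then have "\<forall>\<^sub>F n in sequentially. False" using G(3) eventually_gt_at_top[of 0]
        proof eventually_elim
          case (elim n)
          then have "exp (- (real n * r')) \<le> exp (- (real n * r))" by linarith
          then have "real n * r \<le> real n * r'" by (simp only: exp_le_cancel_iff neg_le_iff_le)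
          then show ?case using elim r' by simp
        qed
        then show False by simp
      qed
      then show ?thesis using G by blast
    qed
    then obtain G where G: "\<And>x. x \<in> S \<Longrightarrow> \<not> I x \<le> ereal a \<Longrightarrow> open (G x)" "\<And>x. x \<in> S \<Longrightarrow> \<not> I x \<le> ereal a \<Longrightarrow> x \<in> G x"
      "\<And>x z. x \<in> S \<Longrightarrow> \<not> I x \<le> ereal a \<Longrightarrow> z \<in> G x \<inter> S \<Longrightarrow> \<not> I z \<le> ereal a" by metis
    have "{x \<in> S. I x \<le> ereal a} = S - (\<Union>x\<in>{x\<in>S. \<not> I x \<le> ereal a}. G x)"
      using G(2,3) by blast
    moreover have "open (\<Union>x\<in>{x\<in>S. \<not> I x \<le> ereal a}. G x)" using G(1) by auto
    ultimately show ?thesis using compact_diff[OF cS] by metis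
  qed
  have up: "limsup (\<lambda>n. ereal (1 / real n) * log_prob (measure_pmf.prob (P n) {\<omega>. X n \<omega> \<in> F})) \<le> - (INF x\<in>F. I x)"
    if F: "closedin (top_of_set S) F" for F
  proof -
    have cF: "compact F" using closedin_compact[OF cS F] .
    have FS: "F \<subseteq> S" using closedin_subset[OF F] by simp
    have *: "limsup (\<lambda>n. ereal (1 / real n) * log_prob (measure_pmf.prob (P n) {\<omega>. X n \<omega> \<in> F})) \<le> ereal (- r)"
      if r: "ereal r < (INF x\<in>F. I x)" for r
    proof -
      have "\<forall>x\<in>F. \<exists>G. open G \<and> x \<in> G \<and>
          (\<forall>\<^sub>F n in sequentially. measure_pmf.prob (P n) {\<omega>. X n \<omega> \<in> G} \<le> exp (- (real n * r)))"
      proof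
        fix x assume "x \<in> F"
        then have "ereal r < I x" using r INF_lower[of x F I] by (metis less_le_trans)
        with \<open>x \<in> F\<close> FS show "\<exists>G. open G \<and> x \<in> G \<and>
          (\<forall>\<^sub>F n in sequentially. measure_pmf.prob (P n) {\<omega>. X n \<omega> \<in> G} \<le> exp (- (real n * r)))"
          by (intro upper) auto
      qed
      from bchoice[OF this] obtain G where G: "\<And>x. x \<in> F \<Longrightarrow> open (G x)" "\<And>x. x \<in> F \<Longrightarrow> x \<in> G x"
        "\<And>x. x \<in> F \<Longrightarrow> \<forall>\<^sub>F n in sequentially. measure_pmf.prob (P n) {\<omega>. X n \<omega> \<in> G x} \<le> exp (- (real n * r))"
        by auto
      obtain C where C: "C \<subseteq> F" "finite C" "F \<subseteq> (\<Union>x\<in>C. G x)"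
        by (rule compactE_image[OF cF, of F G]) (use G(1,2) in auto)
      have "\<forall>\<^sub>F n in sequentially. \<forall>x\<in>C. measure_pmf.prob (P n) {\<omega>. X n \<omega> \<in> G x} \<le> exp (- (real n * r))"
        using C G(3) by (intro eventually_ball_finite) auto
      \<comment> \<open>The 1 added to \<open>card C\<close> keeps the argument of the logarithm
        positive when the cover is empty.\<close>
      then have "\<forall>\<^sub>F n in sequentially. ereal (1 / real n) * log_prob (measure_pmf.prob (P n) {\<omega>. X n \<omega> \<in> F})
          \<le> ereal (ln (real (card C + 1)) * (1 / real n) - r)"
        using eventually_gt_at_top[of 0]
      proof eventually_elim
        case (elim n)
        have "measure_pmf.prob (P n) {\<omega>. X n \<omega> \<in> F} \<le> measure_pmf.prob (P n) (\<Union>x\<in>C. {\<omega>. X n \<omega> \<in> G x})"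
          by (rule measure_pmf.finite_measure_mono) (use C in auto)
        also have "\<dots> \<le> (\<Sum>x\<in>C. measure_pmf.prob (P n) {\<omega>. X n \<omega> \<in> G x})"
          by (rule measure_pmf.finite_measure_subadditive_finite) (use C in auto)
        also have "\<dots> \<le> real (card C) * exp (- (real n * r))" by (rule sum_bounded_above) (use elim in auto)
        also have "\<dots> \<le> real (card C + 1) * exp (- (real n * r))" by (intro mult_right_mono) auto
        also have "\<dots> = exp (ln (real (card C + 1)) - real n * r)" by (simp add: exp_diff exp_minus field_simps)
        finally have "log_prob (measure_pmf.prob (P n) {\<omega>. X n \<omega> \<in> F}) \<le> ereal (ln (real (card C + 1)) - real n * r)"
          by (intro log_prob_mono) auto
        then have "ereal (1 / real n) * log_prob (measure_pmf.prob (P n) {\<omega>. X n \<omega> \<in> F}) \<le>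
          ereal (1 / real n) * ereal (ln (real (card C + 1)) - real n * r)"
          by (intro ereal_mult_left_mono) auto
        also have "\<dots> = ereal (ln (real (card C + 1)) * (1 / real n) - r)" using elim by (simp add: field_simps)
        finally show ?case .
      qed
      then have "limsup (\<lambda>n. ereal (1 / real n) * log_prob (measure_pmf.prob (P n) {\<omega>. X n \<omega> \<in> F})) \<le>
          limsup (\<lambda>n. ereal (ln (real (card C + 1)) * (1 / real n) - r))"
        by (rule Limsup_mono)
      also have "\<dots> = ereal (ln (real (card C + 1)) * 0 - r)"
        by (intro lim_imp_Limsup tendsto_ereal tendsto_intros lim_1_over_n) simp
      finally show ?thesis by simp
    qed
    show ?thesis
    proof (rule ccontr)
      assume "\<not> ?thesis"
      then obtain r' where r': "- (INF x\<in>F. I x) < ereal r'"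
        "ereal r' < limsup (\<lambda>n. ereal (1 / real n) * log_prob (measure_pmf.prob (P n) {\<omega>. X n \<omega> \<in> F}))"
        using ereal_dense2[of "- (INF x\<in>F. I x)"
            "limsup (\<lambda>n. ereal (1 / real n) * log_prob (measure_pmf.prob (P n) {\<omega>. X n \<omega> \<in> F}))"]
        by (auto simp: not_le)
      then have "ereal (- r') < (INF x\<in>F. I x)" 
        using ereal_uminus_less_reorder[of "INF x\<in>F. I x" "ereal r'"] by simp
      from *[OF this] r'(2) show False by simp
    qed
  qed
  have low: "- (INF x\<in>G. I x) \<le> liminf (\<lambda>n. ereal (1 / real n) * log_prob (measure_pmf.prob (P n) {\<omega>. X n \<omega> \<in> G}))"
    if G: "openin (top_of_set S) G" for G
  proof (rule ccontr)
    let ?l = "liminf (\<lambda>n. ereal (1 / real n) * log_prob (measure_pmf.prob (P n) {\<omega>. X n \<omega> \<in> G}))"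
    obtain T where T: "open T" "G = S \<inter> T" using G by (auto simp: openin_open)
    assume "\<not> - (INF x\<in>G. I x) \<le> ?l"
    then have "(INF x\<in>G. I x) < - ?l" 
      using ereal_less_uminus_reorder[of ?l "INF x\<in>G. I x"] by (simp add: not_le)
    then obtain x where x: "x \<in> G" "I x < - ?l" by (auto simp: INF_less_iff)
    then obtain r where r: "I x < ereal r" "ereal r < - ?l" using ereal_dense2 by blast
    have "\<forall>\<^sub>F n in sequentially. exp (- (real n * r)) \<le> measure_pmf.prob (P n) {\<omega>. X n \<omega> \<in> T}"
      using lower[of x r T] x r T by auto
    then have "\<forall>\<^sub>F n in sequentially. ereal (- r) \<le> ereal (1 / real n) * log_prob (measure_pmf.prob (P n) {\<omega>. X n \<omega> \<in> G})"
      using eventually_gt_at_top[of 0]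
    proof eventually_elim
      case (elim n)
      have "{\<omega>. X n \<omega> \<in> G} = {\<omega>. X n \<omega> \<in> T}" using T X by auto
      then have "ereal (- (real n * r)) \<le> log_prob (measure_pmf.prob (P n) {\<omega>. X n \<omega> \<in> G})"
        using elim by (intro log_prob_ge) simp
      then have "ereal (1 / real n) * ereal (- (real n * r)) \<le> ereal (1 / real n) * log_prob (measure_pmf.prob (P n) {\<omega>. X n \<omega> \<in> G})"
        by (intro ereal_mult_left_mono) auto
      then show ?case using elim by simp
    qed
    then have "ereal (- r) \<le> ?l" by (rule Liminf_bounded)
    then have "- ?l \<le> ereal r" 
      using ereal_uminus_le_reorder[of ?l "ereal r"] by simp
    then show False using r(2) by simp
  qed
  show ?thesis
    unfolding LDP_def
  proof (intro conjI allI impI ballI)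
    fix n show "prob_space (measure_pmf (P n))" by (rule measure_pmf.prob_space_axioms)
    show "X n \<in> measure_pmf (P n) \<rightarrow>\<^sub>M restrict_space borel S"
      using X by (auto simp: measurable_def space_restrict_space)
  next
    show "filterlim real at_top sequentially" by (rule filterlim_real_sequentially)
  qed (use nonneg comp up low in auto)
qed

section \<open>Ordered sizes and the space of sequences\<close>

definition nth_largest :: "nat multiset \<Rightarrow> nat \<Rightarrow> nat" where
  "nth_largest \<mu> i = (if i < size \<mu> then rev (sorted_list_of_multiset \<mu>) ! i else 0)"

lemma component_size_eq: "component_size n E i = nth_largest (profile {..<n} E) i"
proof -
  have "length (sorted_list_of_multiset \<mu>) = size \<mu>" for \<mu> :: "nat multiset"
    by (metis mset_sorted_list_of_multiset size_mset)
  then show ?thesis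
    by (simp add: component_size_def component_sizes_def nth_largest_def components_eq profile_def)
qed

lemma num_components_eq: "num_components n E = size (profile {..<n} E)"
  by (simp add: num_components_def components_eq profile_def)

lemma sorted_desc_list:
  obtains xs where "mset xs = \<mu>" "sorted (rev xs)" "\<And>i. nth_largest \<mu> i = (if i < length xs then xs ! i else 0)"
proof -
  let ?xs = "rev (sorted_list_of_multiset \<mu>)"
  have "mset ?xs = \<mu>" by simp
  then have "length ?xs = size \<mu>" by (metis size_mset)
  then show ?thesis using that[of ?xs] by (simp add: nth_largest_def)
qed

lemma filter_desc_take:
  assumes "sorted (rev xs)"
  shows "filter (\<lambda>k. \<theta> < real k) xs = take (length (filter (\<lambda>k. \<theta> < real k) xs)) xs"
    "filter (\<lambda>k. \<theta> < real k) xs = takeWhile (\<lambda>k. \<theta> < real k) xs"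
proof -
  have "sorted (rev (map real xs))"
    using assms by (simp add: rev_map sorted_map sorted_wrt_mono_rel[OF _ assms])
  then show tw: "filter (\<lambda>k. \<theta> < real k) xs = takeWhile (\<lambda>k. \<theta> < real k) xs"
    using filter_equals_takeWhile_sorted_rev by fastforce
  show "filter (\<lambda>k. \<theta> < real k) xs = take (length (filter (\<lambda>k. \<theta> < real k) xs)) xs"
    unfolding tw by (rule takeWhile_eq_take)
qed

text \<open>The entries above \<theta> form an initial segment of the descending list, and for
  \<theta> \<ge> 0 the padding zeros stay outside it. This turns statements about single ordered
  sizes into counts.\<close>

lemma less_nth_largest_iff:
  assumes "0 \<le> \<theta>"
  shows "\<theta> < real (nth_largest \<mu> i) \<longleftrightarrow> i < size (filter_mset (\<lambda>k. \<theta> < real k) \<mu>)"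
proof -
  obtain xs where xs: "mset xs = \<mu>" "sorted (rev xs)" "\<And>i. nth_largest \<mu> i = (if i < length xs then xs ! i else 0)"
    using sorted_desc_list by blast
  let ?P = "\<lambda>k. \<theta> < real k"
  let ?m = "length (takeWhile ?P xs)"
  have m: "size (filter_mset ?P \<mu>) = ?m"
    unfolding xs(1)[symmetric] mset_filter[symmetric] size_mset filter_desc_take(2)[OF xs(2)] ..
  have desc: "xs ! j \<le> xs ! i" if "i \<le> j" "j < length xs" for i j
    using sorted_rev_nth_mono[OF xs(2) that] .
  show ?thesis
  proof (cases "i < ?m")
    case True
    then have "?P (xs ! i)" by (metis nth_mem set_takeWhileD takeWhile_nth)
    moreover have "i < length xs" using True length_takeWhile_le[of ?P xs] by linarith
    ultimately show ?thesis using True m xs(3) by simp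
  next
    case False
    have "\<not> ?P (xs ! i)" if i: "i < length xs"
    proof -
      have ml: "?m < length xs" using False i by linarith
      then have "\<not> ?P (xs ! ?m)" by (rule nth_length_takeWhile)
      moreover have "xs ! i \<le> xs ! ?m" using desc False i by simp
      ultimately show ?thesis by (meson le_less_trans not_less of_nat_le_iff order_trans)
    qed
    then show ?thesis using False m xs(3) assms by auto
  qed
qed

lemma sum_filter_nth_largest:
  fixes g :: "nat \<Rightarrow> 'c::comm_monoid_add"
  shows "(\<Sum>k\<in>#filter_mset (\<lambda>k. \<theta> < real k) \<mu>. g k) =
    (\<Sum>i<size (filter_mset (\<lambda>k. \<theta> < real k) \<mu>). g (nth_largest \<mu> i))"
proof -
  obtain xs where xs: "mset xs = \<mu>" "sorted (rev xs)" "\<And>i. nth_largest \<mu> i = (if i < length xs then xs ! i else 0)"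
    using sorted_desc_list by blast
  let ?P = "\<lambda>k. \<theta> < real k"
  define m where "m = length (filter ?P xs)"
  have f: "filter ?P xs = take m xs" unfolding m_def by (rule filter_desc_take(1)[OF xs(2)])
  have ml: "m \<le> length xs" by (simp add: m_def)
  have fm: "filter_mset ?P \<mu> = mset (take m xs)" unfolding xs(1)[symmetric] mset_filter[symmetric] f ..
  have "(\<Sum>k\<in>#mset (take m xs). g k) = sum_list (map g (take m xs))"
    by (simp flip: mset_map add: sum_mset_sum_list)
  also have "\<dots> = (\<Sum>i<m. g (xs ! i))"
    using ml by (simp add: sum.list_conv_set_nth atLeast0LessThan min_absorb2)
  also have "\<dots> = (\<Sum>i<m. g (nth_largest \<mu> i))" using ml by (intro sum.cong) (auto simp: xs(3))
  finally show ?thesis unfolding fm using ml by (simp add: min_absorb2)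
qed

lemma nth_largest_antimono: "i \<le> j \<Longrightarrow> nth_largest \<mu> j \<le> nth_largest \<mu> i"
proof -
  assume "i \<le> j"
  obtain xs where xs: "mset xs = \<mu>" "sorted (rev xs)" "\<And>i. nth_largest \<mu> i = (if i < length xs then xs ! i else 0)"
    using sorted_desc_list by blast
  show ?thesis using sorted_rev_nth_mono[OF xs(2) \<open>i \<le> j\<close>] \<open>i \<le> j\<close> by (auto simp: xs(3))
qed

lemma sums_nth_largest: "(\<lambda>i. real (nth_largest \<mu> i)) sums real (sum_mset \<mu>)"
proof -
  have "(\<lambda>i. real (nth_largest \<mu> i)) sums (\<Sum>i<size \<mu>. real (nth_largest \<mu> i))"
    by (rule sums_finite) (auto simp: nth_largest_def)
  moreover have "(\<Sum>i<size \<mu>. real (nth_largest \<mu> i)) = real (sum_mset \<mu>)"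
  proof -
    have "filter_mset (\<lambda>k. - 1 < real k) \<mu> = \<mu>" by (simp add: filter_mset_eq_conv order_less_le_trans[of "-1" 0])
    then show ?thesis using sum_filter_nth_largest[of real "- 1" \<mu>] by simp
  qed
  ultimately show ?thesis by simp
qed

lemma component_sizes_in_S1: "(\<lambda>i. real (component_size n E i) / real n) \<in> S1"
proof -
  have s: "(\<lambda>i. real (component_size n E i) / real n) sums (real n / real n)"
    unfolding component_size_eq
    using sums_divide[OF sums_nth_largest[of "profile {..<n} E"], of "real n"] by (simp add: sum_mset_profile)
  have "decseq (\<lambda>i. real (component_size n E i) / real n)"
    unfolding component_size_eq decseq_def
    by (intro allI impI divide_right_mono) (auto intro: nth_largest_antimono)
  moreover have "(\<Sum>i. real (component_size n E i) / real n) \<le> 1"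
    using sums_unique[OF s] by (cases "n = 0") auto
  ultimately show ?thesis unfolding S1_def using sums_summable[OF s] by auto
qed

lemma summable_sum_le_iff:
  fixes u :: "nat \<Rightarrow> real"
  assumes "\<And>i. 0 \<le> u i"
  shows "summable u \<and> (\<Sum>i. u i) \<le> a \<longleftrightarrow> (\<forall>n. (\<Sum>i<n. u i) \<le> a)"
proof
  assume "summable u \<and> (\<Sum>i. u i) \<le> a"
  then show "\<forall>n. (\<Sum>i<n. u i) \<le> a"
    using sum_le_suminf[of u "{..<n}" for n] assms by (meson finite_lessThan order_trans)
next
  assume a: "\<forall>n. (\<Sum>i<n. u i) \<le> a"
  then have "summable u" using assms by (intro summableI_nonneg_bounded[of u a]) auto
  then show "summable u \<and> (\<Sum>i. u i) \<le> a" using a by (auto intro: suminf_le_const)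
qed

text \<open>Partial sums replace the series: each condition then involves finitely many coordinates
  and is closed in the product topology, although the sum of the series is not continuous
  there.\<close>

lemma S1_altdef: "S1 = (\<Inter>i. {u. u (Suc i) \<le> u i}) \<inter> (\<Inter>i. {u. 0 \<le> u i}) \<inter> (\<Inter>n. {u. (\<Sum>i<n. u i) \<le> 1})"
proof -
  have "u \<in> S1 \<longleftrightarrow> (\<forall>i. u (Suc i) \<le> u i) \<and> (\<forall>i. 0 \<le> u i) \<and> (\<forall>n. (\<Sum>i<n. u i) \<le> 1)" for u
    using summable_sum_le_iff[of u 1] unfolding S1_def decseq_Suc_iff by blast
  then show ?thesis by auto
qed

text \<open>A closed subset of a product of intervals, which is compact by Tychonoff's
  theorem.\<close>

lemma compact_S1: "compact S1"
proof -
  have "compactin (product_topology (\<lambda>_. euclidean) UNIV) (PiE UNIV (\<lambda>_::nat. {0..1::real}))"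
    by (subst compactin_PiE) auto
  then have c: "compact (PiE UNIV (\<lambda>_::nat. {0..1::real}))"
    by (simp add: euclidean_product_topology compactin_euclidean_iff)
  have coord: "continuous_on UNIV (\<lambda>u::nat \<Rightarrow> real. u i)" for i
    by (rule continuous_on_product_coordinates)
  have "closed S1" unfolding S1_altdef
    by (intro closed_Int closed_INT ballI closed_Collect_le continuous_intros coord)
  then have "compact (PiE UNIV (\<lambda>_::nat. {0..1::real}) \<inter> S1)" by (rule compact_Int_closed[OF c])
  moreover have "PiE UNIV (\<lambda>_::nat. {0..1::real}) \<inter> S1 = S1"
  proof -
    have "u i \<le> 1" if "u \<in> S1" for u i
    proof -
      have "u i \<le> (\<Sum>j<Suc i. u j)" using that by (intro member_le_sum) (auto simp: S1_def)
      also have "\<dots> \<le> 1" using that unfolding S1_altdef by blast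
      finally show ?thesis .
    qed
    then show ?thesis by (auto simp: S1_def PiE_def)
  qed
  ultimately show ?thesis by simp
qed

lemma S1_bounds:
  assumes "u \<in> S1"
  shows "0 \<le> u i" "u i \<le> 1" "0 \<le> suminf u" "suminf u \<le> 1" "summable u"
proof -
  show u0: "0 \<le> u i" for i using assms by (simp add: S1_def)
  show s: "summable u" "suminf u \<le> 1" using assms by (auto simp: S1_def)
  show "0 \<le> suminf u" using s u0 by (intro suminf_nonneg) auto
  have "sum u {i} \<le> suminf u" using s u0 by (intro sum_le_suminf) auto
  then show "u i \<le> 1" using s by simp
qed

lemma summable_K:
  assumes "u \<in> S1" "0 \<le> c"
  shows "summable (\<lambda>i. K c (u i))"
proof (rule summable_comparison_test')
  show "summable (\<lambda>i. c * u i)" using S1_bounds(5)[OF assms(1)] by (rule summable_mult)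
  fix i :: nat
  have u: "0 \<le> u i" "u i \<le> 1" using S1_bounds[OF assms(1)] by auto
  have "c * (u i)\<^sup>2 / 2 \<le> c * u i"
  proof -
    have "c * (u i)\<^sup>2 \<le> c * u i" using u assms(2) by (intro mult_left_mono) (auto simp: power2_eq_square mult_left_le_one_le)
    moreover have "0 \<le> c * (u i)\<^sup>2" using assms(2) by simp
    ultimately show ?thesis by linarith
  qed
  then show "norm (K c (u i)) \<le> c * u i"
    using K_ge[OF assms(2) u(1)] K_nonpos[OF assms(2) u(1)] by simp
qed

section \<open>The number of components\<close>

text \<open>The generating function of the number of edges, which is binomial.\<close>

lemma sum_graph_wt_tilted:
  assumes "finite V"
  shows "(\<Sum>E\<in>Pow (edges_on V). graph_wt p V E * y ^ card E) = (1 + p * (y - 1)) ^ (card V choose 2)"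
proof -
  have "(\<Prod>e\<in>edges_on V. p * y + (1 - p)) =
      (\<Sum>X\<in>Pow (edges_on V). (\<Prod>e\<in>X. p * y) * (\<Prod>e\<in>edges_on V - X. 1 - p))"
    by (rule prod_add) (use assms in simp)
  also have "\<dots> = (\<Sum>E\<in>Pow (edges_on V). graph_wt p V E * y ^ card E)"
    unfolding graph_wt_def using assms
    by (intro sum.cong) (auto simp: card_Diff_subset finite_subset[OF _ finite_edges_on] power_mult_distrib)
  also have "(\<Prod>e\<in>edges_on V. p * y + (1 - p)) = (1 + p * (y - 1)) ^ (card V choose 2)"
    using assms by (simp add: card_edges_on algebra_simps)
  finally show ?thesis by simp
qed

lemma real_choose_two: "real (n choose 2) = real n * (real n - 1) / 2"
proof (induction n)
  case (Suc n)
  have "Suc n choose 2 = (n choose 2) + n" by (simp add: numeral_2_eq_2)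
  then show ?case using Suc by (simp add: field_simps)
qed simp

lemma edge_count_chernoff:
  assumes t: "0 < t" "t \<le> 1" and M: "1 \<le> M" and \<delta>: "0 < \<delta>" "\<delta> \<le> 1"
  shows "(\<Sum>E\<in>{E\<in>Pow (edges_on {..<M}). (t / 2 + \<delta>) * real M < real (card E)}. graph_wt (t / real M) {..<M} E)
    \<le> exp (- (real M * (\<delta>\<^sup>2 / 8)))"
proof -
  define p where "p = t / real M"
  have p: "0 \<le> p" "p \<le> 1" using t M by (auto simp: p_def)
  \<comment> \<open>Tilting by 1 + h gains \<delta> h and loses at most 2 h^2 per vertex; \<delta>/4
    minimises 2 h^2 - \<delta> h, with value -\<delta>^2/8.\<close>
  define h where "h = \<delta> / 4"
  have h: "0 < h" "h \<le> 1" using \<delta> by (auto simp: h_def)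
  have lnh: "h - h\<^sup>2 \<le> ln (1 + h)" using ln_one_plus_pos_lower_bound[of h] h by simp
  let ?m = "(t / 2 + \<delta>) * real M"
  have m0: "0 \<le> ?m" using t \<delta> by simp
  have "(\<Sum>E\<in>{E\<in>Pow (edges_on {..<M}). ?m < real (card E)}. graph_wt p {..<M} E) \<le>
    (\<Sum>E\<in>{E\<in>Pow (edges_on {..<M}). ?m < real (card E)}. graph_wt p {..<M} E * (1 + h) ^ card E * exp (- (?m * ln (1 + h))))"
  proof (rule sum_mono)
    fix E assume "E \<in> {E\<in>Pow (edges_on {..<M}). ?m < real (card E)}"
    then have "?m * ln (1 + h) \<le> real (card E) * ln (1 + h)" using h by (intro mult_right_mono) auto
    then have "1 \<le> exp (real (card E) * ln (1 + h)) * exp (- (?m * ln (1 + h)))" by (simp add: exp_add[symmetric])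
    moreover have "exp (real (card E) * ln (1 + h)) = (1 + h) ^ card E" using h by (simp add: exp_of_nat_mult)
    ultimately have "1 \<le> (1 + h) ^ card E * exp (- (?m * ln (1 + h)))" by simp
    then have "graph_wt p {..<M} E * 1 \<le> graph_wt p {..<M} E * ((1 + h) ^ card E * exp (- (?m * ln (1 + h))))"
      using graph_wt_nonneg[OF p] by (intro mult_left_mono) auto
    then show "graph_wt p {..<M} E \<le> graph_wt p {..<M} E * (1 + h) ^ card E * exp (- (?m * ln (1 + h)))" by simp
  qed
  also have "\<dots> \<le> (\<Sum>E\<in>Pow (edges_on {..<M}). graph_wt p {..<M} E * (1 + h) ^ card E * exp (- (?m * ln (1 + h))))"
    by (rule sum_mono2) (use graph_wt_nonneg[OF p] h in \<open>auto intro!: mult_nonneg_nonneg\<close>)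
  also have "\<dots> = (1 + p * h) ^ (M choose 2) * exp (- (?m * ln (1 + h)))"
    using sum_graph_wt_tilted[of "{..<M}" p "1 + h"] by (simp add: sum_distrib_right[symmetric])
  also have "\<dots> \<le> exp (p * h) ^ (M choose 2) * exp (- (?m * ln (1 + h)))"
    using p h by (intro mult_right_mono power_mono) auto
  also have "\<dots> = exp (real (M choose 2) * (p * h) - ?m * ln (1 + h))"
    unfolding exp_of_nat_mult[symmetric] exp_add[symmetric] by simp
  also have "\<dots> \<le> exp (- (real M * (\<delta>\<^sup>2 / 8)))"
  proof (subst exp_le_cancel_iff)
    have "real (M choose 2) * p = t * (real M - 1) / 2" using M by (simp add: real_choose_two p_def)
    also have "\<dots> \<le> t / 2 * real M" using t by (simp add: field_simps)
    finally have "real (M choose 2) * p * h \<le> t / 2 * real M * h" using h by (intro mult_right_mono) auto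
    moreover have "?m * (h - h\<^sup>2) \<le> ?m * ln (1 + h)" using lnh m0 by (intro mult_left_mono) auto
    moreover have "t / 2 * real M * h - ?m * (h - h\<^sup>2) = real M * ((t / 2 + \<delta>) * h\<^sup>2 - \<delta> * h)"
      by (simp add: field_simps power2_eq_square)
    moreover have "real M * ((t / 2 + \<delta>) * h\<^sup>2 - \<delta> * h) \<le> real M * (- (\<delta>\<^sup>2 / 8))"
    proof (rule mult_left_mono)
      have "(t / 2 + \<delta>) * h\<^sup>2 \<le> 2 * h\<^sup>2" using t \<delta> by (intro mult_right_mono) auto
      moreover have "h\<^sup>2 = \<delta>\<^sup>2 / 16" "\<delta> * h = \<delta>\<^sup>2 / 4" by (auto simp: h_def power2_eq_square)
      ultimately show "(t / 2 + \<delta>) * h\<^sup>2 - \<delta> * h \<le> - (\<delta>\<^sup>2 / 8)" by linarith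
    qed simp
    ultimately show "real (M choose 2) * (p * h) - ?m * ln (1 + h) \<le> - (real M * (\<delta>\<^sup>2 / 8))"
      by (simp add: mult.assoc)
  qed
  finally show ?thesis by (simp add: p_def)
qed

text \<open>Upper tails suffice, since the number of components is at least the number of vertices minus
  the number of edges.\<close>

lemma subcritical_typical:
  assumes t: "0 < t" "t < 1" and \<delta>: "0 < \<delta>" "\<delta> \<le> 1"
  shows "\<forall>\<^sub>F M in sequentially. 1 / 2 \<le> (\<Sum>E\<in>{E\<in>Pow (edges_on {..<M}).
     real (card E) \<le> (t / 2 + \<delta>) * real M \<and> real (size (profile {..<M} E)) \<le> (1 - t / 2 + \<delta>) * real M}.
     graph_wt (t / real M) {..<M} E)"
proof -
  define p where "p M = t / real M" for M
  \<comment> \<open>The preceding asymptotics apply with c = t, and t itself is then an admissible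
    tilting parameter.\<close>
  interpret sparse_regime p t
    unfolding p_def[abs_def] by (rule sparse_regimeI) (use t in auto)
  define h where "h = \<delta> / 4"
  have h: "0 < h" "h \<le> 1" using \<delta> by (auto simp: h_def)
  have lnh: "h - h\<^sup>2 \<le> ln (1 + h)" using ln_one_plus_pos_lower_bound[of h] h by simp
  have \<eta>: "0 < \<delta>\<^sup>2 / 64" using \<delta> by simp
  obtain \<epsilon> where \<epsilon>: "0 < \<epsilon>" and bd:
    "\<forall>\<^sub>F n in sequentially. \<forall>s\<in>{t..1}. \<forall>y>0. profile_ex (p n) n (tilt t \<epsilon> n s y) \<le>
      exp (real n * (ln t - 1 - t / 2 - ln s + s + y * (s - s\<^sup>2 / 2) / t + (1 + y) * (\<delta>\<^sup>2 / 64)))"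
    using tilt_bound[OF t(1) \<eta>] by auto
  have nm: "\<forall>\<^sub>F n in sequentially. \<forall>M\<le>n. t * real M \<le> (1 - (1 - t)) * real n \<longrightarrow>
    1 - 1 / 8 \<le> profile_prob (p n) M (\<lambda>\<mu>. \<forall>k\<in>#\<mu>. real k \<le> \<epsilon> * real n)"
    by (rule no_macro) (use t \<epsilon> in auto)
  have "((\<lambda>x::real. exp (- (x * (\<delta>\<^sup>2 / 16)))) \<longlongrightarrow> 0) at_top" using \<delta> by real_asymp
  from filterlim_compose[OF this filterlim_real_sequentially]
  have small: "\<forall>\<^sub>F n in sequentially. exp (- (real n * (\<delta>\<^sup>2 / 16))) < 1 / 8" by (rule order_tendstoD) simp
  show ?thesis
    using bd nm small p01 eventually_ge_at_top[of 1]
  proof eventually_elim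
    case (elim n)
    then have p: "0 \<le> p n" "p n \<le> 1" and n: "1 \<le> n" by auto
    let ?V = "{..<n}"
    let ?Q1 = "\<lambda>\<mu>. \<not> (\<forall>k\<in>#\<mu>. real k \<le> \<epsilon> * real n)"
    let ?Q2 = "\<lambda>\<mu>. (\<forall>k\<in>#\<mu>. real k \<le> \<epsilon> * real n) \<and> (1 - t / 2 + \<delta>) * real n \<le> real (size \<mu>)"
    have P1: "profile_prob (p n) n ?Q1 \<le> 1 / 8"
      using elim(2)[rule_format, of n] profile_prob_compl[of "p n" n ?Q1] by simp
    \<comment> \<open>Without macroscopic components the tilt is 1 + h to the power of the number of
      components, so \<open>tilt_bound\<close> gives a Chernoff bound for this number.\<close>
    have P2: "profile_prob (p n) n ?Q2 \<le> 1 / 8"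
    proof -
      define B where "B = exp ((1 - t / 2 + \<delta>) * real n * ln (1 + h))"
      have "profile_prob (p n) n ?Q2 \<le> profile_ex (p n) n (tilt t \<epsilon> n t (1 + h)) / B"
      proof (rule profile_prob_markov[OF p])
        fix \<mu> assume Q: "?Q2 \<mu>"
        have "set_mset (macro \<epsilon> n \<mu>) = {}" using Q by (auto simp: macro_def not_less)
        then have e: "macro \<epsilon> n \<mu> = {#}" by simp
        then have "small \<epsilon> n \<mu> = \<mu>" using macro_small_union[of \<mu> \<epsilon> n] by simp
        then have "tilt t \<epsilon> n t (1 + h) \<mu> = (1 + h) ^ size \<mu>" using e by (simp add: tilt_def)
        also have "\<dots> = exp (real (size \<mu>) * ln (1 + h))" using h by (simp add: exp_of_nat_mult)
        finally show "B \<le> tilt t \<epsilon> n t (1 + h) \<mu>"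
          unfolding B_def using Q h by (auto intro!: mult_right_mono)
      qed (use h in \<open>auto simp: B_def tilt_def\<close>)
      also have "\<dots> \<le> exp (real n * (ln t - 1 - t / 2 - ln t + t + (1 + h) * (t - t\<^sup>2 / 2) / t + (1 + (1 + h)) * (\<delta>\<^sup>2 / 64))) / B"
        using elim(1)[rule_format, of t "1 + h"] t h by (intro divide_right_mono) (auto simp: B_def)
      also have "(1 + h) * (t - t\<^sup>2 / 2) / t = (1 + h) * (1 - t / 2)" using t by (simp add: power2_eq_square field_simps)
      also have "exp (real n * (ln t - 1 - t / 2 - ln t + t + (1 + h) * (1 - t / 2) + (1 + (1 + h)) * (\<delta>\<^sup>2 / 64))) / B =
        exp (real n * (h * (1 - t / 2) + (2 + h) * (\<delta>\<^sup>2 / 64) - (1 - t / 2 + \<delta>) * ln (1 + h)))"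
        unfolding B_def exp_diff[symmetric] by (rule arg_cong[where f=exp]) (simp add: algebra_simps)
      also have "\<dots> \<le> exp (real n * (- (\<delta>\<^sup>2 / 16)))"
      proof (subst exp_le_cancel_iff, rule mult_left_mono)
        have "(1 - t / 2 + \<delta>) * (h - h\<^sup>2) \<le> (1 - t / 2 + \<delta>) * ln (1 + h)"
          using lnh t \<delta> by (intro mult_left_mono) auto
        moreover have "(1 - t / 2 + \<delta>) * h\<^sup>2 \<le> 2 * h\<^sup>2" using t \<delta> by (intro mult_right_mono) auto
        moreover have "h * (1 - t / 2) - (1 - t / 2 + \<delta>) * (h - h\<^sup>2) = (1 - t / 2 + \<delta>) * h\<^sup>2 - \<delta> * h"
          by (simp add: algebra_simps)
        moreover have "(2 + h) * (\<delta>\<^sup>2 / 64) \<le> 3 * (\<delta>\<^sup>2 / 64)" using h by (intro mult_right_mono) auto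
        moreover have "2 * h\<^sup>2 - \<delta> * h = - (\<delta>\<^sup>2 / 8)" by (simp add: h_def power2_eq_square)
        moreover have "0 \<le> \<delta>\<^sup>2" by simp
        ultimately show "h * (1 - t / 2) + (2 + h) * (\<delta>\<^sup>2 / 64) - (1 - t / 2 + \<delta>) * ln (1 + h) \<le> - (\<delta>\<^sup>2 / 16)"
          by linarith
      qed simp
      finally show ?thesis using elim(3) by simp
    qed
    have P3: "(\<Sum>E\<in>{E\<in>Pow (edges_on ?V). (t / 2 + \<delta>) * real n < real (card E)}. graph_wt (p n) ?V E) \<le> 1 / 8"
    proof -
      have "0 \<le> real n * \<delta>\<^sup>2" by simp
      then have "exp (- (real n * (\<delta>\<^sup>2 / 8))) \<le> exp (- (real n * (\<delta>\<^sup>2 / 16)))" by simp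
      then show ?thesis
        using edge_count_chernoff[OF t(1) less_imp_le[OF t(2)] n \<delta>] elim(3) unfolding p_def by linarith
    qed
    have PQ: "profile_prob (p n) n Q = (\<Sum>E\<in>{E\<in>Pow (edges_on ?V). Q (profile ?V E)}. graph_wt (p n) ?V E)" for Q
      unfolding profile_prob_def profile_ex_def graph_sum_def by (intro sum.mono_neutral_cong_right) auto
    let ?G = "{E\<in>Pow (edges_on ?V). real (card E) \<le> (t / 2 + \<delta>) * real n \<and> real (size (profile ?V E)) \<le> (1 - t / 2 + \<delta>) * real n}"
    let ?A = "{E\<in>Pow (edges_on ?V). ?Q1 (profile ?V E)}"
    let ?B = "{E\<in>Pow (edges_on ?V). ?Q2 (profile ?V E)}"
    let ?C = "{E\<in>Pow (edges_on ?V). (t / 2 + \<delta>) * real n < real (card E)}"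
    let ?w = "graph_wt (p n) ?V"
    have nn: "\<And>E. 0 \<le> ?w E" using graph_wt_nonneg[OF p] .
    have fin: "finite ?G" "finite ?A" "finite ?B" "finite ?C" by auto
    have un: "sum ?w (X \<union> Y) \<le> sum ?w X + sum ?w Y" if "finite X" "finite Y" for X Y
      using sum.union_inter[OF that, of ?w] sum_nonneg[of "X \<inter> Y" ?w] nn by simp
    \<comment> \<open>The total mass one is covered by the good graphs and three exceptional sets of
      mass at most 1/8 each.\<close>
    have "1 = sum ?w (Pow (edges_on ?V))"
      using graph_sum_one[of ?V "p n"] by (simp add: graph_sum_def)
    also have "\<dots> \<le> sum ?w (?G \<union> (?A \<union> (?B \<union> ?C)))"
      by (rule sum_mono2) (use nn in auto)
    also have "\<dots> \<le> sum ?w ?G + (sum ?w ?A + (sum ?w ?B + sum ?w ?C))"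
      using un[of ?G "?A \<union> (?B \<union> ?C)"] un[of ?A "?B \<union> ?C"] un[of ?B ?C] fin by simp
    finally have "1 / 2 \<le> sum ?w ?G" using P1 P2 P3 unfolding PQ by linarith
    then show ?case by (simp add: p_def)
  qed
qed

text \<open>The density of one law with respect to the other depends on the number of edges only, so
  it is under control on graphs with about t M / 2 edges.\<close>

lemma graph_wt_change_of_measure:
  assumes p: "0 < p" "p < 1" and t: "0 < t" "t < 1" and M: "2 \<le> M" and E: "E \<subseteq> edges_on {..<M}"
    and e: "\<bar>real (card E) - t / 2 * real M\<bar> \<le> \<delta> * real M" "real (card E) \<le> 2 * real M"
  shows "exp (real M * (t / 2 * ln (p * real M / t) - \<delta> * \<bar>ln (p * real M / t)\<bar> + t / 2 - real M * lam p / 2) - 5 / 2 * t)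
      * graph_wt (t / real M) {..<M} E \<le> graph_wt p {..<M} E"
proof -
  define p' where "p' = t / real M"
  have p': "0 < p'" "p' < 1" using t M by (auto simp: p'_def field_simps)
  define B where "B = card (edges_on {..<M})"
  have B: "real B = real M * (real M - 1) / 2" by (simp add: B_def card_edges_on real_choose_two)
  have eB: "card E \<le> B" unfolding B_def using E by (intro card_mono) auto
  have l: "0 < lam p" by (rule lam_pos[OF p])
  have ex: "x ^ k = exp (real k * ln x)" if "0 < x" for x :: real and k
    using that by (simp add: exp_of_nat_mult)
  have w: "graph_wt p {..<M} E = exp (real (card E) * ln p - real (B - card E) * lam p)"
    using p unfolding graph_wt_def B_def[symmetric] lam_def by (simp add: ex exp_add[symmetric])
  have w': "graph_wt p' {..<M} E = exp (real (card E) * ln p' - real (B - card E) * lam p')"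
    using p' unfolding graph_wt_def B_def[symmetric] lam_def by (simp add: ex exp_add[symmetric])
  define x where "x = ln (p * real M / t)"
  have x: "x = ln p - ln p'" using p t M by (simp add: x_def p'_def ln_div ln_mult)
  have 1: "real M * (t / 2 * x - \<delta> * \<bar>x\<bar>) \<le> real (card E) * x"
  proof -
    have "(t / 2 * real M - real (card E)) * x \<le> \<bar>t / 2 * real M - real (card E)\<bar> * \<bar>x\<bar>"
      by (metis abs_ge_self abs_mult)
    also have "\<dots> \<le> \<delta> * real M * \<bar>x\<bar>" using e by (intro mult_right_mono) (auto simp: abs_minus_commute)
    finally show ?thesis by (simp add: algebra_simps)
  qed
  \<comment> \<open>There are M (M - 1) / 2 pairs and at most 2 M edges, so at least M (M/2 - 5/2)
    pairs are absent, and t/M is a lower bound for \<open>lam p'\<close>. This is the origin of the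
    constant 5/2.\<close>
  have 2: "real M * (t / 2) - 5 / 2 * t \<le> real (B - card E) * lam p'"
  proof -
    have "p' \<le> lam p'" using ln_le_minus_one[of "1 - p'"] p' by (simp add: lam_def)
    then have "real (B - card E) * p' \<le> real (B - card E) * lam p'" by (intro mult_left_mono) auto
    moreover have "real M * (real M / 2 - 5 / 2) \<le> real (B - card E)"
      using e eB B by (simp add: of_nat_diff algebra_simps)
    then have "real M * (real M / 2 - 5 / 2) * p' \<le> real (B - card E) * p'" using p' by (intro mult_right_mono) auto
    moreover have "real M * (real M / 2 - 5 / 2) * p' = real M * (t / 2) - 5 / 2 * t"
      using M by (simp add: p'_def field_simps)
    ultimately show ?thesis by linarith
  qed
  have 3: "real (B - card E) * lam p \<le> real M * (real M * lam p / 2)"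
  proof -
    have "real (B - card E) \<le> real M * real M / 2" using B by (simp add: algebra_simps of_nat_diff[OF eB])
    then have "real (B - card E) * lam p \<le> (real M * real M / 2) * lam p" using l by (intro mult_right_mono) auto
    then show ?thesis by (simp add: mult_ac)
  qed
  have "exp (real M * (t / 2 * x - \<delta> * \<bar>x\<bar> + t / 2 - real M * lam p / 2) - 5 / 2 * t) * graph_wt p' {..<M} E =
      exp (real M * (t / 2 * x - \<delta> * \<bar>x\<bar> + t / 2 - real M * lam p / 2) - 5 / 2 * t +
        (real (card E) * ln p' - real (B - card E) * lam p'))"
    unfolding w' exp_add ..
  also have "\<dots> \<le> exp (real (card E) * ln p - real (B - card E) * lam p)"
  proof (subst exp_le_cancel_iff)
    have "real (card E) * ln p = real (card E) * x + real (card E) * ln p'" unfolding x by (simp add: algebra_simps)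
    moreover have "real M * (t / 2 * x - \<delta> * \<bar>x\<bar> + t / 2 - real M * lam p / 2) =
      real M * (t / 2 * x - \<delta> * \<bar>x\<bar>) + real M * (t / 2) - real M * (real M * lam p / 2)"
      by (simp add: algebra_simps)
    ultimately show "real M * (t / 2 * x - \<delta> * \<bar>x\<bar> + t / 2 - real M * lam p / 2) - 5 / 2 * t +
        (real (card E) * ln p' - real (B - card E) * lam p') \<le> real (card E) * ln p - real (B - card E) * lam p"
      using 1 2 3 by linarith
  qed
  finally show ?thesis unfolding w x_def p'_def .
qed

section \<open>Changing the edge probability\<close>

context sparse_regime
begin

text \<open>By the sandwich \<lambda> exp(-\<lambda>) \<le> p \<le> \<lambda>.\<close>

lemma n_p_lim: "(\<lambda>n. real n * p n) \<longlonglongrightarrow> c"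
proof (rule real_tendsto_sandwich[OF _ _ _ lam_lim])
  have l0: "(\<lambda>n. lam (p n)) \<longlonglongrightarrow> 0"
  proof -
    have "(\<lambda>n. real n * lam (p n) * (1 / real n)) \<longlonglongrightarrow> c * 0" by (intro tendsto_intros lam_lim lim_1_over_n)
    moreover have "\<forall>\<^sub>F n in sequentially. real n * lam (p n) * (1 / real n) = lam (p n)"
      using eventually_gt_at_top[of 0] by eventually_elim simp
    ultimately show ?thesis by (simp add: filterlim_cong)
  qed
  have "(\<lambda>n. real n * lam (p n) * exp (- lam (p n))) \<longlonglongrightarrow> c * exp (- 0)" by (intro tendsto_intros lam_lim l0)
  then show "(\<lambda>n. real n * lam (p n) * exp (- lam (p n))) \<longlonglongrightarrow> c" by simp
  show "\<forall>\<^sub>F n in sequentially. real n * lam (p n) * exp (- lam (p n)) \<le> real n * p n"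
    using p01
  proof eventually_elim
    case (elim n)
    then have e: "exp (- lam (p n)) = 1 - p n" by (simp add: lam_def)
    have "(1 + lam (p n)) * exp (- lam (p n)) \<le> exp (lam (p n)) * exp (- lam (p n))" by (intro mult_right_mono) auto
    also have "\<dots> = 1" by (simp add: exp_add[symmetric])
    finally have "lam (p n) * exp (- lam (p n)) \<le> p n" unfolding distrib_right e by simp
    then show ?case by (simp add: mult_left_mono mult.assoc)
  qed
  show "\<forall>\<^sub>F n in sequentially. real n * p n \<le> real n * lam (p n)"
    using p01
  proof eventually_elim
    case (elim n)
    then have "p n \<le> lam (p n)" using ln_le_minus_one[of "1 - p n"] by (simp add: lam_def)
    then show ?case by (intro mult_left_mono) auto
  qed
qed

text \<open>Pass to the edge probability t/M, under which there are typically 1 - t/2 components per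
  vertex. The exponent is c b^2/2 times \<pi>(t / (c b)), the Poisson cost of having b t n / 2 edges
  where c b^2 n / 2 are expected.\<close>

lemma subcritical_lower:
  assumes b: "0 < b" "b \<le> 1" and t: "0 < t" "t < 1" and e: "0 < e" and \<delta>2: "0 < \<delta>2"
  shows "\<exists>\<delta>1>0. \<forall>\<^sub>F n in sequentially. \<forall>M. \<bar>real M / real n - b\<bar> < \<delta>1 \<longrightarrow>
    exp (- (real n * (b * t / 2 * ln (t / (c * b)) - b * t / 2 + c * b\<^sup>2 / 2 + e)))
      \<le> profile_prob (p n) M (\<lambda>\<mu>. \<bar>real (size \<mu>) - (1 - t / 2) * real M\<bar> \<le> \<delta>2 * real M)"
proof -
  \<comment> \<open>So small that a fluctuation of \<delta> M edges changes the exponent of the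
    density by at most e/4 per vertex.\<close>
  define \<delta> where "\<delta> = min 1 (min \<delta>2 (e / (4 * (1 + \<bar>ln (c * b / t)\<bar>))))"
  have \<delta>: "0 < \<delta>" "\<delta> \<le> 1" "\<delta> \<le> \<delta>2" using \<delta>2 e by (auto simp: \<delta>_def)
  have \<delta>e: "\<delta> * \<bar>ln (c * b / t)\<bar> \<le> e / 4"
  proof -
    have "\<delta> * \<bar>ln (c * b / t)\<bar> \<le> e / (4 * (1 + \<bar>ln (c * b / t)\<bar>)) * (1 + \<bar>ln (c * b / t)\<bar>)"
      using \<delta> e by (intro mult_mono) (auto simp: \<delta>_def)
    also have "\<dots> = e / 4"
    proof -
      define Z where "Z = 1 + \<bar>ln (c * b / t)\<bar>"
      have "0 < Z" unfolding Z_def using abs_ge_zero[of "ln (c * b / t)"] by linarith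
      then show ?thesis unfolding Z_def[symmetric] by simp
    qed
    finally show ?thesis .
  qed
  \<comment> \<open>The exponent per vertex as a function of the pair (M/n, n), with ln 2 for the
    probability 1/2 of a typical graph. Its limit along the product filter makes the estimate
    uniform in M.\<close>
  define \<Psi> where "\<Psi> z = (let x = ln (real (snd z) * p (snd z) * fst z / t) in
    fst z * (t / 2 * x - \<delta> * \<bar>x\<bar> + t / 2 - fst z * (real (snd z) * lam (p (snd z))) / 2)
      - 5 / 2 * t * (1 / real (snd z)) - ln 2 * (1 / real (snd z)))" for z
  let ?F = "nhds b \<times>\<^sub>F sequentially"
  have f1: "(fst \<longlongrightarrow> b) ?F" by (rule filterlim_fst)
  have f2: "((\<lambda>z. real (snd z) * p (snd z)) \<longlongrightarrow> c) ?F" by (rule filterlim_compose[OF n_p_lim filterlim_snd])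
  have f3: "((\<lambda>z. real (snd z) * lam (p (snd z))) \<longlongrightarrow> c) ?F" by (rule filterlim_compose[OF lam_lim filterlim_snd])
  have f4: "((\<lambda>z. 1 / real (snd z)) \<longlongrightarrow> 0) ?F" by (rule filterlim_compose[OF lim_1_over_n filterlim_snd])
  have f5: "((\<lambda>z. ln (real (snd z) * p (snd z) * fst z / t)) \<longlongrightarrow> ln (c * b / t)) ?F"
    using c_pos b t by (intro tendsto_intros f1 f2) auto
  have "(\<Psi> \<longlongrightarrow> b * (t / 2 * ln (c * b / t) - \<delta> * \<bar>ln (c * b / t)\<bar> + t / 2 - b * c / 2) - 5 / 2 * t * 0 - ln 2 * 0) ?F"
    unfolding \<Psi>_def[abs_def] Let_def by (intro tendsto_intros f1 f3 f4 f5) auto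
  moreover define T where "T = b * t / 2 * ln (t / (c * b)) - b * t / 2 + c * b\<^sup>2 / 2"
  have "- T - e / 2 < b * (t / 2 * ln (c * b / t) - \<delta> * \<bar>ln (c * b / t)\<bar> + t / 2 - b * c / 2) - 5 / 2 * t * 0 - ln 2 * 0"
  proof -
    have "ln (t / (c * b)) = - ln (c * b / t)" using c_pos b t by (simp add: ln_div)
    then have "- T = b * (t / 2 * ln (c * b / t) + t / 2 - b * c / 2)"
      by (simp add: T_def power2_eq_square algebra_simps)
    moreover have "b * (\<delta> * \<bar>ln (c * b / t)\<bar>) \<le> 1 * (e / 4)" using b \<delta>e \<delta> by (intro mult_mono) auto
    moreover have "b * (t / 2 * ln (c * b / t) - \<delta> * \<bar>ln (c * b / t)\<bar> + t / 2 - b * c / 2) =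
      b * (t / 2 * ln (c * b / t) + t / 2 - b * c / 2) - b * (\<delta> * \<bar>ln (c * b / t)\<bar>)"
      by (simp add: right_diff_distrib distrib_left)
    ultimately show ?thesis using e by linarith
  qed
  ultimately have "\<forall>\<^sub>F z in ?F. - T - e / 2 < \<Psi> z" by (rule order_tendstoD)
  then obtain P1 P2 where P: "eventually P1 (nhds b)" "eventually P2 sequentially"
    "\<And>x n. P1 x \<Longrightarrow> P2 n \<Longrightarrow> - T - e / 2 < \<Psi> (x, n)"
    unfolding eventually_prod_filter by blast
  obtain d where d: "0 < d" "\<And>x. dist x b < d \<Longrightarrow> P1 x" using P(1) unfolding eventually_nhds_metric by blast
  define \<delta>1 where "\<delta>1 = min d (b / 2)"
  obtain M0 where M0: "\<And>M. M0 \<le> M \<Longrightarrow> 1 / 2 \<le> (\<Sum>E\<in>{E\<in>Pow (edges_on {..<M}).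
     real (card E) \<le> (t / 2 + \<delta>) * real M \<and> real (size (profile {..<M} E)) \<le> (1 - t / 2 + \<delta>) * real M}.
     graph_wt (t / real M) {..<M} E)"
    using subcritical_typical[OF t \<delta>(1,2)] unfolding eventually_sequentially by blast
  have "\<forall>\<^sub>F n in sequentially. real M0 + 2 < b / 2 * real n" using b by real_asymp
  then have "\<forall>\<^sub>F n in sequentially. \<forall>M. \<bar>real M / real n - b\<bar> < \<delta>1 \<longrightarrow>
    exp (- (real n * (T + e))) \<le> profile_prob (p n) M (\<lambda>\<mu>. \<bar>real (size \<mu>) - (1 - t / 2) * real M\<bar> \<le> \<delta>2 * real M)"
    using P(2) p01 eventually_gt_at_top[of 0]
  proof (eventually_elim, intro allI impI)
    fix n M :: nat assume big: "real M0 + 2 < b / 2 * real n" and P2: "P2 n" and p: "0 < p n \<and> p n < 1" and n: "0 < n"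
      and M: "\<bar>real M / real n - b\<bar> < \<delta>1"
    have n0: "0 < real n" using n by simp
    have "\<bar>real M / real n - b\<bar> < b / 2" using M by (simp add: \<delta>1_def)
    then have "b / 2 < real M / real n" by linarith
    then have "b / 2 * real n < real M" using n0 by (simp add: field_simps)
    then have M2: "2 \<le> M" "M0 \<le> M" using big by linarith+
    have M1: "0 < real M" using M2 by simp
    have "- T - e / 2 < \<Psi> (real M / real n, n)" using P(3) d(2) P2 M by (auto simp: \<delta>1_def dist_real_def)
    then have "real n * (- T - e / 2) \<le> real n * \<Psi> (real M / real n, n)" by (intro mult_left_mono) auto
    also have "real n * \<Psi> (real M / real n, n) =
        real M * (t / 2 * ln (p n * real M / t) - \<delta> * \<bar>ln (p n * real M / t)\<bar> + t / 2 - real M * lam (p n) / 2) - 5 / 2 * t - ln 2"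
    proof -
      have "real n * p n * (real M / real n) = p n * real M" using n0 by simp
      then show ?thesis using n0 unfolding \<Psi>_def Let_def by (simp add: field_simps)
    qed
    finally have ge: "real n * (- T - e / 2) + ln 2 \<le>
      real M * (t / 2 * ln (p n * real M / t) - \<delta> * \<bar>ln (p n * real M / t)\<bar> + t / 2 - real M * lam (p n) / 2) - 5 / 2 * t"
      by simp
    let ?V = "{..<M}"
    let ?G = "{E\<in>Pow (edges_on ?V). real (card E) \<le> (t / 2 + \<delta>) * real M \<and> real (size (profile ?V E)) \<le> (1 - t / 2 + \<delta>) * real M}"
    let ?Q = "\<lambda>\<mu>. \<bar>real (size \<mu>) - (1 - t / 2) * real M\<bar> \<le> \<delta>2 * real M"
    let ?X = "exp (real n * (- T - e / 2) + ln 2)"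
    have good: "\<bar>real (card E) - t / 2 * real M\<bar> \<le> \<delta> * real M" "real (card E) \<le> 2 * real M" "?Q (profile ?V E)" if E: "E \<in> ?G" for E
    proof -
      have "card ?V \<le> card (comps ?V E) + card E" by (rule card_le_comps_plus_edges) (use E in auto)
      then have cm: "real M \<le> real (size (profile ?V E)) + real (card E)" by (simp add: profile_def)
      have s1: "real (card E) \<le> t / 2 * real M + \<delta> * real M" "real (size (profile ?V E)) \<le> (1 - t / 2) * real M + \<delta> * real M"
        using E by (auto simp: algebra_simps)
      have \<delta>M: "\<delta> * real M \<le> \<delta>2 * real M" using \<delta> by (intro mult_right_mono) auto
      have eq: "(1 - t / 2) * real M = real M - t / 2 * real M" by (simp add: algebra_simps)
      show "\<bar>real (card E) - t / 2 * real M\<bar> \<le> \<delta> * real M" using cm s1 unfolding eq by (intro abs_leI) linarith+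
      show "?Q (profile ?V E)" using cm s1 \<delta>M unfolding eq by (intro abs_leI) linarith+
      have "(t / 2 + \<delta>) * real M \<le> 2 * real M" using t \<delta> by (intro mult_right_mono) auto
      then show "real (card E) \<le> 2 * real M" using E by simp
    qed
    have "exp (- (real n * (T + e))) \<le> ?X * (1 / 2)"
    proof -
      have "?X * (1 / 2) = exp (real n * (- T - e / 2))" by (simp add: exp_add)
      moreover have "real n * (- (T + e)) \<le> real n * (- T - e / 2)" using e by (intro mult_left_mono) auto
      ultimately show ?thesis by (simp only: exp_le_cancel_iff mult_minus_right)
    qed
    also have "\<dots> \<le> ?X * (\<Sum>E\<in>?G. graph_wt (t / real M) ?V E)"
      by (rule mult_left_mono[OF M0[OF M2(2)]]) simp
    also have "\<dots> = (\<Sum>E\<in>?G. ?X * graph_wt (t / real M) ?V E)" by (rule sum_distrib_left)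
    also have "\<dots> \<le> (\<Sum>E\<in>?G. graph_wt (p n) ?V E)"
    proof (rule sum_mono)
      fix E assume E: "E \<in> ?G"
      have "?X * graph_wt (t / real M) ?V E \<le>
        exp (real M * (t / 2 * ln (p n * real M / t) - \<delta> * \<bar>ln (p n * real M / t)\<bar> + t / 2 - real M * lam (p n) / 2) - 5 / 2 * t)
        * graph_wt (t / real M) ?V E"
        using ge t M2 by (intro mult_right_mono graph_wt_nonneg) (auto simp: field_simps)
      also have "\<dots> \<le> graph_wt (p n) ?V E"
        using graph_wt_change_of_measure[OF _ _ t M2(1) _ good(1,2)[OF E]] p E by auto
      finally show "?X * graph_wt (t / real M) ?V E \<le> graph_wt (p n) ?V E" .
    qed
    also have "\<dots> \<le> (\<Sum>E\<in>{E\<in>Pow (edges_on ?V). ?Q (profile ?V E)}. graph_wt (p n) ?V E)"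
      by (rule sum_mono2) (use good(3) p in \<open>auto intro!: graph_wt_nonneg\<close>)
    also have "\<dots> = profile_prob (p n) M ?Q"
      unfolding profile_prob_def profile_ex_def graph_sum_def by (intro sum.mono_neutral_cong_left) auto
    finally show "exp (- (real n * (T + e))) \<le> profile_prob (p n) M ?Q" .
  qed
  then show ?thesis unfolding T_def using d b by (intro exI[of _ \<delta>1]) (auto simp: \<delta>1_def)
qed

end

lemma size_le_sum_mset:
  "(\<And>k. k \<in># \<mu> \<Longrightarrow> 1 \<le> k) \<Longrightarrow> size \<mu> \<le> sum_mset (\<mu> :: nat multiset)"
proof (induction \<mu>)
  case (add x \<mu>)
  then have "size \<mu> \<le> sum_mset \<mu>" "1 \<le> x" by auto
  then show ?case by simp
qed simp

lemma continuous_on_at_0: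
  fixes f :: "real \<Rightarrow> real"
  assumes "continuous_on {0..1} f" "0 < e"
  obtains d where "0 < d" "\<And>s. s \<in> {0..1} \<Longrightarrow> \<bar>s\<bar> < d \<Longrightarrow> \<bar>f s - f 0\<bar> < e"
  using assms(1)[unfolded continuous_on_iff, THEN bspec[of _ _ 0], rule_format, OF _ assms(2)]
  by (auto simp: dist_real_def)

section \<open>Local estimates for the number of components\<close>

context sparse_regime
begin

text \<open>Sort the profiles by macroscopic mass S and number m of small components, which gives at
  most (n+1)^2 types. The at most 1/\<epsilon> macroscopic components are negligible at scale n, so
  m/n is close to a, and each type is bounded through a pair (\<tau>, t) in the fibre over
  m/n.\<close>

lemma alpha_upper_local:
  assumes a: "0 \<le> a" "a \<le> 1" and r: "ereal r < I_alpha c a"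
  shows "\<exists>\<delta>>0. \<forall>\<^sub>F n in sequentially.
    profile_prob (p n) n (\<lambda>\<mu>. \<bar>real (size \<mu>) / real n - a\<bar> < \<delta>) \<le> exp (- (real n * r))"
proof -
  obtain r1 where r1: "ereal r < ereal r1" "ereal r1 < I_alpha c a" using ereal_dense2[OF r] by blast
  then have rr1: "r < r1" by simp
  define D where "D = {0..1::real} \<times> {0..1::real}"
  define f where "f = (\<lambda>(\<tau>, t). RA c \<tau> t)"
  define g where "g = (\<lambda>x::real \<times> real. (1 - fst x) * (1 - snd x / 2))"
  have cD: "compact D" unfolding D_def by (intro compact_Times) auto
  \<comment> \<open>The values reached by pairs with RA at most r1 form a compact set that does not
    contain a, so a whole ball around a is missed.\<close>
  have "closed (D \<inter> f -` {..r1})"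
    using continuous_on_RA[of c] c_pos unfolding D_def f_def
    by (intro continuous_closed_preimage closed_Times) auto
  then have cS: "compact (D \<inter> f -` {..r1})" using cD by (metis compact_Int_closed inf.left_idem)
  have "continuous_on (D \<inter> f -` {..r1}) g" unfolding g_def by (intro continuous_intros) auto
  then have "compact (g ` (D \<inter> f -` {..r1}))" using cS by (rule compact_continuous_image)
  then have cT: "open (- (g ` (D \<inter> f -` {..r1})))" by (intro open_Compl compact_imp_closed)
  have "a \<notin> g ` (D \<inter> f -` {..r1})"
  proof
    assume "a \<in> g ` (D \<inter> f -` {..r1})"
    then obtain \<tau> t where x: "\<tau> \<in> {0..1}" "t \<in> {0..1}" "RA c \<tau> t \<le> r1" "a = (1 - \<tau>) * (1 - t / 2)"
      by (auto simp: D_def f_def g_def)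
    have "I_alpha c a \<le> ereal (RA c (fst (\<tau>, t)) (snd (\<tau>, t)))"
      unfolding I_alpha_fibre[OF c_pos a] by (rule INF_lower) (use x in auto)
    also have "\<dots> \<le> ereal r1" using x by simp
    finally show False using r1 by simp
  qed
  then obtain \<rho> where \<rho>: "0 < \<rho>" "ball a \<rho> \<subseteq> - (g ` (D \<inter> f -` {..r1}))"
    using cT by (meson ComplI open_contains_ball)
  have RA_gt: "r1 < RA c \<tau> t" if "\<tau> \<in> {0..1}" "t \<in> {0..1}" "\<bar>(1 - \<tau>) * (1 - t / 2) - a\<bar> < \<rho>" for \<tau> t
  proof (rule ccontr)
    assume "\<not> r1 < RA c \<tau> t"
    then have "g (\<tau>, t) \<in> g ` (D \<inter> f -` {..r1})" using that by (auto simp: D_def f_def)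
    moreover have "g (\<tau>, t) \<in> ball a \<rho>" using that by (simp add: g_def dist_real_def abs_minus_commute)
    ultimately show False using \<rho> by auto
  qed
  define e where "e = (r1 - r) / 2"
  have e: "0 < e" using rr1 by (simp add: e_def)
  obtain \<epsilon> where \<epsilon>: "0 < \<epsilon>" and bd: "\<forall>\<^sub>F n in sequentially. \<forall>S m. S + m \<le> n \<longrightarrow>
    (\<exists>\<tau>\<in>{0..1}. \<exists>t\<in>{0..1}. (1 - \<tau>) * (1 - t / 2) = real m / real n \<and>
      profile_prob (p n) n (\<lambda>\<mu>. sum_mset (macro \<epsilon> n \<mu>) = S \<and> size (small \<epsilon> n \<mu>) = m)
        \<le> exp (real n * (- RA c \<tau> t + e)))"
    using alpha_type_upper[OF e] by blast
  have big1: "\<forall>\<^sub>F n in sequentially. 1 / \<epsilon> < \<rho> / 2 * real n" using \<epsilon> \<rho> by real_asymp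
  have big2: "\<forall>\<^sub>F n in sequentially. (real n + 1)\<^sup>2 \<le> exp (real n * e)" using e by real_asymp
  show ?thesis
  proof (intro exI[of _ "\<rho> / 2"] conjI)
    show "\<forall>\<^sub>F n in sequentially.
      profile_prob (p n) n (\<lambda>\<mu>. \<bar>real (size \<mu>) / real n - a\<bar> < \<rho> / 2) \<le> exp (- (real n * r))"
      using bd big1 big2 p01 eventually_gt_at_top[of 0]
    proof eventually_elim
      case (elim n)
      then have p: "0 \<le> p n" "p n \<le> 1" and n0: "0 < real n" by auto
      define J where "J = {(S, m). S + m \<le> n \<and> \<bar>real m / real n - a\<bar> < \<rho>}"
      have JS: "J \<subseteq> {..n} \<times> {..n}" by (auto simp: J_def)
      then have fJ: "finite J" by (rule finite_subset) auto
      have "card J \<le> (n + 1) * (n + 1)" using card_mono[OF _ JS] by (simp add: card_cartesian_product)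
      then have "real (card J) \<le> real ((n + 1) * (n + 1))" by (simp only: of_nat_le_iff)
      then have cJ: "real (card J) \<le> (real n + 1)\<^sup>2" by (simp add: power2_eq_square algebra_simps)
      have "profile_prob (p n) n (\<lambda>\<mu>. \<bar>real (size \<mu>) / real n - a\<bar> < \<rho> / 2) \<le>
        (\<Sum>i\<in>J. profile_prob (p n) n ((\<lambda>(S, m) \<mu>. sum_mset (macro \<epsilon> n \<mu>) = S \<and> size (small \<epsilon> n \<mu>) = m) i))"
      proof (rule profile_prob_union[OF p fJ])
        fix \<mu> :: "nat multiset" assume \<mu>: "sum_mset \<mu> = n" "\<And>k. k \<in># \<mu> \<Longrightarrow> 1 \<le> k"
          and Q: "\<bar>real (size \<mu>) / real n - a\<bar> < \<rho> / 2"
        let ?S = "sum_mset (macro \<epsilon> n \<mu>)" and ?m = "size (small \<epsilon> n \<mu>)"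
        have "?m \<le> sum_mset (small \<epsilon> n \<mu>)" by (rule size_le_sum_mset) (use \<mu> in \<open>auto simp: small_def\<close>)
        moreover have "?S + sum_mset (small \<epsilon> n \<mu>) = n" using \<mu>(1) macro_small_union[of \<mu> \<epsilon> n] by (metis sum_mset.union)
        ultimately have Sm: "?S + ?m \<le> n" by linarith
        have "size \<mu> = size (macro \<epsilon> n \<mu>) + ?m" using macro_small_union[of \<mu> \<epsilon> n] by (metis size_union)
        then have "real (size \<mu>) / real n - real ?m / real n = real (size (macro \<epsilon> n \<mu>)) / real n"
          by (simp add: add_divide_distrib)
        also have "\<dots> < \<rho> / 2"
        proof -
          have "real (size (macro \<epsilon> n \<mu>)) \<le> 1 / \<epsilon>" using size_macro_le[OF \<epsilon> _ \<mu>(1)] elim by simp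
          then have "real (size (macro \<epsilon> n \<mu>)) < \<rho> / 2 * real n" using elim(2) by linarith
          then show ?thesis using n0 by (simp add: field_simps)
        qed
        finally have "real (size \<mu>) / real n - real ?m / real n < \<rho> / 2" .
        moreover have "real ?m / real n \<le> real (size \<mu>) / real n"
          using \<open>size \<mu> = size (macro \<epsilon> n \<mu>) + ?m\<close> by (simp add: divide_right_mono)
        ultimately have "\<bar>real ?m / real n - a\<bar> < \<rho>" using Q by linarith
        then have "(?S, ?m) \<in> J" using Sm by (simp add: J_def)
        then show "\<exists>i\<in>J. (\<lambda>(S, m) \<mu>. sum_mset (macro \<epsilon> n \<mu>) = S \<and> size (small \<epsilon> n \<mu>) = m) i \<mu>"
          by (intro bexI[of _ "(?S, ?m)"]) auto
      qed
      also have "\<dots> \<le> real (card J) * exp (real n * (- r1 + e))"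
      proof (rule sum_bounded_above)
        fix i assume "i \<in> J"
        then obtain S m where i: "i = (S, m)" "S + m \<le> n" "\<bar>real m / real n - a\<bar> < \<rho>" by (auto simp: J_def)
        obtain \<tau> t where \<tau>: "\<tau> \<in> {0..1}" "t \<in> {0..1}" "(1 - \<tau>) * (1 - t / 2) = real m / real n"
          "profile_prob (p n) n (\<lambda>\<mu>. sum_mset (macro \<epsilon> n \<mu>) = S \<and> size (small \<epsilon> n \<mu>) = m)
            \<le> exp (real n * (- RA c \<tau> t + e))"
          using elim(1) i(2) by blast
        have "r1 < RA c \<tau> t" using RA_gt[OF \<tau>(1,2)] \<tau>(3) i(3) by simp
        then have "exp (real n * (- RA c \<tau> t + e)) \<le> exp (real n * (- r1 + e))" by (simp add: mult_left_mono)
        then show "profile_prob (p n) n ((\<lambda>(S, m) \<mu>. sum_mset (macro \<epsilon> n \<mu>) = S \<and> size (small \<epsilon> n \<mu>) = m) i) \<le>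
          exp (real n * (- r1 + e))" using order_trans[OF \<tau>(4)] i(1) by simp
      qed
      also have "\<dots> \<le> exp (real n * e) * exp (real n * (- r1 + e))"
        using cJ elim(3) by (intro mult_right_mono) auto
      also have "\<dots> = exp (- (real n * r))"
        unfolding exp_add[symmetric] by (rule arg_cong[where f=exp]) (simp add: e_def field_simps)
      finally show ?case .
    qed
  qed (use \<rho> in simp)
qed

text \<open>A pair (\<tau>, t) is realised by one component with about \<tau> n vertices and a
  remainder of mean degree t.\<close>

lemma alpha_lower_local:
  assumes a: "0 \<le> a" "a \<le> 1" and r: "I_alpha c a < ereal r" and \<delta>: "0 < \<delta>"
  shows "\<forall>\<^sub>F n in sequentially. exp (- (real n * r)) \<le>
    profile_prob (p n) n (\<lambda>\<mu>. \<bar>real (size \<mu>) / real n - a\<bar> < \<delta>)"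
proof -
  obtain \<tau>0 t0 where 0: "\<tau>0 \<in> {0..1}" "t0 \<in> {0..1}" "(1 - \<tau>0) * (1 - t0 / 2) = a" "RA c \<tau>0 t0 < r"
    using r unfolding I_alpha_fibre[OF c_pos a] by (auto simp: INF_less_iff)
  define e where "e = (r - RA c \<tau>0 t0) / 4"
  have e: "0 < e" using 0 by (simp add: e_def)
  \<comment> \<open>The constructions require 0 < \<tau> < 1 and 0 < t < 1. A nearly optimal pair
    may lie on the boundary of the square, so it is moved slightly along the segment to (1/2, 1/2);
    by continuity RA and the number of components per vertex change little.\<close>
  define z where "z s = ((1 - s) * \<tau>0 + s * (1 / 2), (1 - s) * t0 + s * (1 / 2))" for s :: real
  have z0: "z 0 = (\<tau>0, t0)" by (simp add: z_def)
  have zD: "z s \<in> {0..1} \<times> {0..1}" if "s \<in> {0..1}" for s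
  proof -
    have "0 \<le> (1 - s) * x + s * (1 / 2) \<and> (1 - s) * x + s * (1 / 2) \<le> 1" if "x \<in> {0..1}" for x
    proof -
      have "(1 - s) * x \<le> (1 - s) * 1" using that \<open>s \<in> {0..1}\<close> by (intro mult_left_mono) auto
      then show ?thesis using that \<open>s \<in> {0..1}\<close> by (auto intro!: add_nonneg_nonneg)
    qed
    then show ?thesis using 0 by (auto simp: z_def)
  qed
  have zc: "continuous_on {0..1} z" unfolding z_def by (intro continuous_intros)
  have "continuous_on {0..1} (\<lambda>s. (\<lambda>(\<tau>, t). RA c \<tau> t) (z s))"
  proof (rule continuous_on_compose2[OF continuous_on_RA zc])
    show "z ` {0..1} \<subseteq> {0..1} \<times> {0..1}" using zD by blast
  qed (use c_pos in simp)
  from continuous_on_at_0[OF this e] obtain d1 where d1: "0 < d1"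
    "\<And>s. s \<in> {0..1} \<Longrightarrow> \<bar>s\<bar> < d1 \<Longrightarrow> \<bar>(\<lambda>(\<tau>, t). RA c \<tau> t) (z s) - RA c \<tau>0 t0\<bar> < e"
    by (auto simp: z0)
  have "continuous_on {0..1} (\<lambda>s. (1 - fst (z s)) * (1 - snd (z s) / 2))"
    using zc by (intro continuous_intros) auto
  from continuous_on_at_0[OF this, of "\<delta> / 4"] \<delta> obtain d2 where d2: "0 < d2"
    "\<And>s. s \<in> {0..1} \<Longrightarrow> \<bar>s\<bar> < d2 \<Longrightarrow> \<bar>(1 - fst (z s)) * (1 - snd (z s) / 2) - a\<bar> < \<delta> / 4"
    using 0(3) by (auto simp: z0)
  define s where "s = min (1 / 2) (min d1 d2 / 2)"
  have s: "0 < s" "s < 1" "s \<in> {0..1}" "\<bar>s\<bar> < d1" "\<bar>s\<bar> < d2" using d1 d2 by (auto simp: s_def)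
  define \<tau> where "\<tau> = fst (z s)"
  define t where "t = snd (z s)"
  have int: "0 < (1 - s) * x + s * (1 / 2) \<and> (1 - s) * x + s * (1 / 2) < 1" if "x \<in> {0..1}" for x
  proof -
    define y where "y = (1 - s) * x"
    have "(1 - s) * x \<le> (1 - s) * 1" using that s by (intro mult_left_mono) auto
    then have "y \<le> 1 - s" by (simp only: y_def mult_1_right)
    moreover have "0 \<le> y" using that s by (simp add: y_def)
    ultimately show ?thesis using s(1,2) unfolding y_def[symmetric] by simp
  qed
  have \<tau>: "0 < \<tau>" "\<tau> < 1" and t: "0 < t" "t < 1" using int 0 by (auto simp: \<tau>_def t_def z_def)
  have RAe: "RA c \<tau> t < RA c \<tau>0 t0 + e" using d1(2)[OF s(3,4)] by (auto simp: \<tau>_def t_def case_prod_unfold abs_less_iff)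
  have ga: "\<bar>(1 - \<tau>) * (1 - t / 2) - a\<bar> < \<delta> / 4" using d2(2)[OF s(3,5)] by (simp add: \<tau>_def t_def)
  define b where "b = 1 - \<tau>"
  have b: "0 < b" "b \<le> 1" using \<tau> by (auto simp: b_def)
  define T where "T = b * t / 2 * ln (t / (c * b)) - b * t / 2 + c * b\<^sup>2 / 2"
  have RAT: "RA c \<tau> t = K c \<tau> + L c \<tau> + T"
  proof -
    have "c * b\<^sup>2 / 2 * pi_fun (t / (c * b)) = T"
      unfolding pi_fun_def T_def using c_pos b by (simp add: power2_eq_square field_simps)
    then show ?thesis using RA_eq[OF c_pos \<tau>(2), of t] t by (simp add: b_def)
  qed
  have \<delta>4: "0 < \<delta> / 4" using \<delta> by simp
  obtain \<delta>1 where \<delta>1: "0 < \<delta>1" and sub: "\<forall>\<^sub>F n in sequentially. \<forall>M. \<bar>real M / real n - b\<bar> < \<delta>1 \<longrightarrow>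
    exp (- (real n * (T + e))) \<le> profile_prob (p n) M (\<lambda>\<mu>. \<bar>real (size \<mu>) - (1 - t / 2) * real M\<bar> \<le> \<delta> / 4 * real M)"
    using subcritical_lower[OF b t e \<delta>4] unfolding T_def by blast
  have \<delta>': "0 < min \<delta>1 (\<delta> / 4)" using \<delta>1 \<delta> by simp
  have mac: "\<forall>\<^sub>F n in sequentially. \<exists>k::nat \<Rightarrow> nat. (\<forall>i<1. \<bar>real (k i) / real n - \<tau>\<bar> < min \<delta>1 (\<delta> / 4)) \<and> (\<Sum>i<1. k i) < n \<and>
    (\<forall>Q. exp (real n * (- (\<Sum>i<1::nat. K c \<tau>) - L c (\<Sum>i<1::nat. \<tau>) - e)) *
        profile_prob (p n) (n - (\<Sum>i<1. k i)) (\<lambda>\<mu>. Q (mset (map k [0..<1]) + \<mu>)) \<le> profile_prob (p n) n Q)"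
    by (rule macro_lower[where x="\<lambda>_. \<tau>"]) (use \<tau> e \<delta>' in auto)
  have big: "\<forall>\<^sub>F n in sequentially. 1 < \<delta> / 4 * real n" using \<delta> by real_asymp
  show ?thesis
    using mac sub big p01 eventually_gt_at_top[of 0]
  proof eventually_elim
    case (elim n)
    then have p: "0 \<le> p n" "p n \<le> 1" and n0: "0 < real n" by auto
    obtain k' :: "nat \<Rightarrow> nat" where k': "\<bar>real (k' 0) / real n - \<tau>\<bar> < min \<delta>1 (\<delta> / 4)" "k' 0 < n"
      "\<And>Q. exp (real n * (- K c \<tau> - L c \<tau> - e)) *
        profile_prob (p n) (n - k' 0) (\<lambda>\<mu>. Q (add_mset (k' 0) \<mu>)) \<le> profile_prob (p n) n Q"
      using elim(1) by auto
    define k where "k = k' 0"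
    define M where "M = n - k"
    have kn: "k < n" using k' by (simp add: k_def)
    have Mn: "real M / real n = 1 - real k / real n" using kn n0 by (simp add: M_def of_nat_diff diff_divide_distrib)
    have Mb: "\<bar>real M / real n - b\<bar> < min \<delta>1 (\<delta> / 4)" using k'(1) unfolding Mn b_def k_def by linarith
    let ?Q = "\<lambda>\<mu>. \<bar>real (size \<mu>) / real n - a\<bar> < \<delta>"
    have "exp (real n * (- K c \<tau> - L c \<tau> - e)) * exp (- (real n * (T + e))) \<le>
      exp (real n * (- K c \<tau> - L c \<tau> - e)) *
        profile_prob (p n) M (\<lambda>\<mu>. \<bar>real (size \<mu>) - (1 - t / 2) * real M\<bar> \<le> \<delta> / 4 * real M)"
      using elim(2) Mb by (intro mult_left_mono) auto
    also have "\<dots> \<le> exp (real n * (- K c \<tau> - L c \<tau> - e)) * profile_prob (p n) M (\<lambda>\<mu>. ?Q (add_mset k \<mu>))"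
    proof (intro mult_left_mono profile_prob_mono p)
      fix \<mu> :: "nat multiset" assume "\<bar>real (size \<mu>) - (1 - t / 2) * real M\<bar> \<le> \<delta> / 4 * real M"
      then have "\<bar>real (size \<mu>) - (1 - t / 2) * real M\<bar> / real n \<le> \<delta> / 4 * real M / real n"
        by (rule divide_right_mono) simp
      also have "\<dots> \<le> \<delta> / 4"
      proof -
        have "real M / real n \<le> 1" using Mn by simp
        then have "\<delta> / 4 * (real M / real n) \<le> \<delta> / 4 * 1" using \<delta> by (intro mult_left_mono) auto
        then show ?thesis by simp
      qed
      finally have "\<bar>real (size \<mu>) - (1 - t / 2) * real M\<bar> / real n \<le> \<delta> / 4" .
      moreover have "\<bar>real (size \<mu>) - (1 - t / 2) * real M\<bar> / real n =
          \<bar>real (size \<mu>) / real n - (1 - t / 2) * (real M / real n)\<bar>"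
      proof -
        have "(real (size \<mu>) - (1 - t / 2) * real M) / real n = real (size \<mu>) / real n - (1 - t / 2) * (real M / real n)"
          by (simp add: diff_divide_distrib)
        then show ?thesis using n0 by (metis abs_divide abs_of_pos)
      qed
      ultimately have 1: "\<bar>real (size \<mu>) / real n - (1 - t / 2) * (real M / real n)\<bar> \<le> \<delta> / 4" by simp
      have "\<bar>(1 - t / 2) * (real M / real n) - (1 - t / 2) * b\<bar> = (1 - t / 2) * \<bar>real M / real n - b\<bar>"
        using t unfolding right_diff_distrib[symmetric] abs_mult by simp
      also have "\<dots> \<le> 1 * (\<delta> / 4)" using t Mb by (intro mult_mono) auto
      finally have 2: "\<bar>(1 - t / 2) * (real M / real n) - (1 - t / 2) * b\<bar> \<le> \<delta> / 4" by simp
      have 3: "\<bar>(1 - t / 2) * b - a\<bar> < \<delta> / 4" using ga by (simp add: b_def mult.commute)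
      have 4: "real (size (add_mset k \<mu>)) / real n = real (size \<mu>) / real n + 1 / real n" by (simp add: add_divide_distrib)
      have 5: "0 < 1 / real n" "1 / real n < \<delta> / 4" using elim(3) n0 by (auto simp: field_simps)
      show "?Q (add_mset k \<mu>)" unfolding 4 using 1 2 3 5 by linarith
    qed simp
    also have "\<dots> \<le> profile_prob (p n) n ?Q" using k'(3)[of ?Q] by (simp add: k_def M_def)
    finally have "exp (real n * (- K c \<tau> - L c \<tau> - e)) * exp (- (real n * (T + e))) \<le> profile_prob (p n) n ?Q" .
    moreover have "exp (- (real n * r)) \<le> exp (real n * (- K c \<tau> - L c \<tau> - e)) * exp (- (real n * (T + e)))"
    proof -
      have "r = RA c \<tau>0 t0 + 4 * e" by (simp add: e_def field_simps)
      then have "K c \<tau> + L c \<tau> + T + 2 * e \<le> r" using RAe RAT e by linarith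
      then have "real n * (K c \<tau> + L c \<tau> + T + 2 * e) \<le> real n * r" by (intro mult_left_mono) auto
      then show ?thesis unfolding exp_add[symmetric] by (simp add: algebra_simps)
    qed
    ultimately show ?case by linarith
  qed
qed

end

section \<open>The sizes of the components\<close>

text \<open>A basic open set of the product topology restricts finitely many coordinates; take the
  smallest of their radii.\<close>

lemma open_fun_basis:
  fixes G :: "(nat \<Rightarrow> real) set"
  assumes "open G" "u \<in> G"
  obtains N \<delta> where "0 < \<delta>" "\<And>v. (\<And>i. i < N \<Longrightarrow> \<bar>v i - u i\<bar> < \<delta>) \<Longrightarrow> v \<in> G"
proof -
  have "openin (product_topology (\<lambda>i. euclidean) UNIV) G"
    using assms(1) unfolding open_fun_def .
  with product_topology_open_contains_basis[OF this assms(2)]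
  have "\<exists>X. u \<in> PiE UNIV X \<and> (\<forall>i. open (X i)) \<and> finite {i. X i \<noteq> UNIV} \<and> PiE UNIV X \<subseteq> G"
    by simp
  then obtain X where X': "u \<in> PiE UNIV X" "\<And>i. open (X i)" "finite {i. X i \<noteq> UNIV}" "PiE UNIV X \<subseteq> G"
    by metis
  have X: "u i \<in> X i" "open (X i)" for i
    using X' by (auto simp: PiE_def)
  have "\<forall>i. \<exists>d>0. \<forall>y. \<bar>y - u i\<bar> < d \<longrightarrow> y \<in> X i"
    using X(1,2) unfolding open_dist dist_real_def by blast
  then obtain d where d: "\<And>i. 0 < d i" "\<And>i y. \<bar>y - u i\<bar> < d i \<Longrightarrow> y \<in> X i" by metis
  obtain N where N: "{i. X i \<noteq> UNIV} \<subseteq> {..<N}" using X'(3) finite_nat_iff_bounded by blast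
  define \<delta> where "\<delta> = Min (insert 1 (d ` {..<N}))"
  have \<delta>0: "0 < \<delta>" and \<delta>d: "\<And>i. i < N \<Longrightarrow> \<delta> \<le> d i"
    unfolding \<delta>_def using d by (auto simp: Min_gr_iff)
  show ?thesis
  proof (rule that[OF \<delta>0, of N])
    fix v assume v: "\<And>i. i < N \<Longrightarrow> \<bar>v i - u i\<bar> < \<delta>"
    have "v i \<in> X i" for i
    proof (cases "X i = UNIV")
      case False
      then have "i < N" using N by auto
      then show ?thesis using v[of i] \<delta>d[of i] by (intro d(2)) auto
    qed simp
    then have "v \<in> PiE UNIV X" by (simp add: PiE_def)
    then show "v \<in> G" using X'(4) by (rule subsetD[rotated])
  qed
qed

lemma open_coordinate_box: "open {v :: nat \<Rightarrow> real. \<forall>i<N. \<bar>v i - u i\<bar> < \<delta>}"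
proof -
  have "{v :: nat \<Rightarrow> real. \<forall>i<N. \<bar>v i - u i\<bar> < \<delta>} = (\<Inter>i<N. {v. \<bar>v i - u i\<bar> < \<delta>})" by auto
  moreover have "open (\<Inter>i<N. {v :: nat \<Rightarrow> real. \<bar>v i - u i\<bar> < \<delta>})"
    by (intro open_INT ballI open_Collect_less continuous_intros continuous_on_product_coordinates) auto
  ultimately show ?thesis by simp
qed

lemma finite_uniform_continuity:
  fixes f :: "real \<Rightarrow> real" and x :: "nat \<Rightarrow> real"
  assumes f: "continuous_on {0..} f" and x: "\<And>i. 0 \<le> x i" and e: "0 < e"
  obtains \<delta> where "0 < \<delta>" "\<And>i y. i < N \<Longrightarrow> 0 \<le> y \<Longrightarrow> \<bar>y - x i\<bar> < \<delta> \<Longrightarrow> \<bar>f y - f (x i)\<bar> < e"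
proof -
  have "\<forall>i. \<exists>d>0. \<forall>y\<ge>0. \<bar>y - x i\<bar> < d \<longrightarrow> \<bar>f y - f (x i)\<bar> < e"
  proof
    fix i
    show "\<exists>d>0. \<forall>y\<ge>0. \<bar>y - x i\<bar> < d \<longrightarrow> \<bar>f y - f (x i)\<bar> < e"
      using f[unfolded continuous_on_iff, rule_format, of "x i" e] x[of i] e by (auto simp: dist_real_def)
  qed
  then obtain d where d: "\<And>i. 0 < d i" "\<And>i y. 0 \<le> y \<Longrightarrow> \<bar>y - x i\<bar> < d i \<Longrightarrow> \<bar>f y - f (x i)\<bar> < e"
    by metis
  define \<delta> where "\<delta> = Min (insert 1 (d ` {..<N}))"
  have \<delta>0: "0 < \<delta>" and \<delta>d: "\<And>i. i < N \<Longrightarrow> \<delta> \<le> d i"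
    unfolding \<delta>_def using d by (auto simp: Min_gr_iff)
  show ?thesis
  proof (rule that[OF \<delta>0])
    fix i y assume *: "i < N" "0 \<le> y" "\<bar>y - x i\<bar> < \<delta>"
    then show "\<bar>f y - f (x i)\<bar> < e" using \<delta>d[of i] by (intro d(2)) auto
  qed
qed

text \<open>All terms are nonpositive.\<close>

lemma K_sum_ge_suminf:
  assumes u: "u \<in> S1" and c: "0 \<le> c"
  shows "(\<Sum>i. K c (u i)) \<le> (\<Sum>i<N. K c (u i))"
proof -
  have "(\<Sum>i<N. - K c (u i)) \<le> (\<Sum>i. - K c (u i))"
    by (rule sum_le_suminf) (use summable_minus[OF summable_K[OF u c]] K_nonpos[OF c] S1_bounds(1)[OF u] in auto)
  then show ?thesis using suminf_minus[OF summable_K[OF u c]] by (simp add: sum_negf)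
qed

context sparse_regime
begin

text \<open>Closeness to u in finitely many coordinates bounds from below, up to small errors, the K
  sum of the macroscopic components by that of u and their mass by the sum of u. These are the two
  quantities that \<open>macro_upper\<close> needs.\<close>

lemma sizes_upper_local:
  assumes u: "u \<in> S1" and r: "r < (\<Sum>i. K c (u i)) + L c (max (1 - 1 / c) (\<Sum>i. u i))"
  shows "\<exists>N. \<exists>\<delta>>0. \<forall>\<^sub>F n in sequentially.
    profile_prob (p n) n (\<lambda>\<mu>. \<forall>i<N. \<bar>real (nth_largest \<mu> i) / real n - u i\<bar> < \<delta>) \<le> exp (- (real n * r))"
proof -
  note ub = S1_bounds[OF u]
  have c0: "0 \<le> c" using c_pos by simp
  define s where "s = (\<Sum>i. u i)"
  define Ks where "Ks = (\<Sum>i. K c (u i))"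
  define e where "e = (Ks + L c (max (1 - 1 / c) s) - r) / 4"
  have e: "0 < e" using r by (simp add: e_def s_def Ks_def)
  have c1: "1 - 1 / c \<le> 1" using c_pos by simp
  have m01: "max (1 - 1 / c) s \<in> {0..1}" using ub c1 by (auto simp: s_def)
  obtain \<zeta> where \<zeta>: "0 < \<zeta>" "\<And>y. y \<in> {0..1} \<Longrightarrow> \<bar>y - max (1 - 1 / c) s\<bar> < \<zeta> \<Longrightarrow> \<bar>L c y - L c (max (1 - 1 / c) s)\<bar> < e"
    using continuous_on_L[of c, unfolded continuous_on_iff, rule_format, OF m01 e] by (auto simp: dist_real_def)
  define s' where "s' = max 0 (s - \<zeta> / 2)"
  have s': "0 \<le> s'" "s' \<le> 1" using ub \<zeta> by (auto simp: s'_def s_def)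
  have Ls': "L c (max (1 - 1 / c) s) - e \<le> L c (max (1 - 1 / c) s')"
  proof -
    have "max (1 - 1 / c) s' \<in> {0..1}" using s' c1 by auto
    moreover have "\<bar>max (1 - 1 / c) s' - max (1 - 1 / c) s\<bar> < \<zeta>" using \<zeta> ub by (auto simp: s'_def s_def max_def)
    ultimately show ?thesis using \<zeta>(2)[of "max (1 - 1 / c) s'"] by linarith
  qed
  obtain \<epsilon>0 where \<epsilon>0: "0 < \<epsilon>0" and bd: "\<And>\<epsilon> s \<kappa>. 0 < \<epsilon> \<and> \<epsilon> \<le> \<epsilon>0 \<and> 0 \<le> s \<and> s \<le> 1 \<Longrightarrow>
    (\<forall>\<^sub>F n in sequentially. profile_prob (p n) n (\<lambda>\<mu>.
        \<kappa> \<le> (\<Sum>k\<in>#macro \<epsilon> n \<mu>. K c (real k / real n)) \<and> s * real n \<le> real (sum_mset (macro \<epsilon> n \<mu>)))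
      \<le> exp (real n * (- \<kappa> - L c (max (1 - 1 / c) s) + e)))"
    using macro_upper[OF e] by blast
  have "(\<lambda>n. \<Sum>i<n. u i) \<longlonglongrightarrow> s" unfolding s_def using ub(5) by (rule summable_LIMSEQ)
  then have "\<forall>\<^sub>F n in sequentially. s - \<zeta> / 4 < (\<Sum>i<n. u i)" by (rule order_tendstoD) (use \<zeta> in simp)
  then obtain N0 where N0: "s - \<zeta> / 4 < (\<Sum>i<N0. u i)" by (auto simp: eventually_sequentially)
  \<comment> \<open>A coordinate of u loses at most 2 \<epsilon> if the corresponding component is
    not macroscopic; over the first N0 coordinates this is at most \<zeta>/8.\<close>
  define \<epsilon> where "\<epsilon> = min \<epsilon>0 (\<zeta> / (16 * (real N0 + 1)))"
  have \<epsilon>: "0 < \<epsilon>" "\<epsilon> \<le> \<epsilon>0" using \<epsilon>0 \<zeta> by (auto simp: \<epsilon>_def)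
  have \<epsilon>N: "real N0 * (2 * \<epsilon>) \<le> \<zeta> / 8"
  proof -
    have "real N0 * (2 * \<epsilon>) \<le> (real N0 + 1) * (2 * (\<zeta> / (16 * (real N0 + 1))))"
      using \<epsilon> \<zeta> by (intro mult_mono) (auto simp: \<epsilon>_def)
    also have "\<dots> = \<zeta> / 8" by (simp add: field_simps)
    finally show ?thesis .
  qed
  have "u \<longlonglongrightarrow> 0" using ub(5) by (rule summable_LIMSEQ_zero)
  then have "\<forall>\<^sub>F n in sequentially. u n < \<epsilon> / 2" by (rule order_tendstoD) (use \<epsilon> in simp)
  then obtain N1' where N1': "\<And>n. N1' \<le> n \<Longrightarrow> u n < \<epsilon> / 2" by (auto simp: eventually_sequentially)
  \<comment> \<open>Since u is below \<epsilon>/2 at N1, controlling this coordinate as well, hence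
    N1 + 1 of them, forces all macroscopic components among the first N1.\<close>
  define N1 where "N1 = max N0 N1'"
  have N1: "N0 \<le> N1" "u N1 < \<epsilon> / 2" using N1'[of N1] by (auto simp: N1_def)
  have e1: "0 < e / (real N1 + 1)" using e by simp
  obtain \<delta>K where \<delta>K: "0 < \<delta>K" "\<And>i y. i < N1 \<Longrightarrow> 0 \<le> y \<Longrightarrow> \<bar>y - u i\<bar> < \<delta>K \<Longrightarrow> \<bar>K c y - K c (u i)\<bar> < e / (real N1 + 1)"
    by (rule finite_uniform_continuity[where x=u and N=N1, OF continuous_on_K[OF c0] ub(1) e1]) blast
  define \<delta> where "\<delta> = min \<delta>K (\<epsilon> / 2)"
  have \<delta>: "0 < \<delta>" "\<delta> \<le> \<delta>K" "\<delta> \<le> \<epsilon> / 2" using \<delta>K \<epsilon> by (auto simp: \<delta>_def)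
  have main: "Ks - e \<le> (\<Sum>k\<in>#macro \<epsilon> n \<mu>. K c (real k / real n)) \<and> s' * real n \<le> real (sum_mset (macro \<epsilon> n \<mu>))"
    if n: "0 < n" and close: "\<forall>i<N1 + 1. \<bar>real (nth_largest \<mu> i) / real n - u i\<bar> < \<delta>" for n \<mu>
  proof -
    have n0: "0 < real n" using n by simp
    define v where "v i = real (nth_largest \<mu> i) / real n" for i
    define m where "m = size (macro \<epsilon> n \<mu>)"
    have v0: "0 \<le> v i" for i by (simp add: v_def)
    have mi: "\<epsilon> < v i \<longleftrightarrow> i < m" for i
      using less_nth_largest_iff[of "\<epsilon> * real n" \<mu> i] \<epsilon> n0 by (simp add: v_def m_def macro_def field_simps)
    have sm: "(\<Sum>k\<in>#macro \<epsilon> n \<mu>. g k) = (\<Sum>i<m. g (nth_largest \<mu> i))" for g :: "nat \<Rightarrow> real"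
      unfolding macro_def m_def by (rule sum_filter_nth_largest)
    have "v N1 < u N1 + \<delta>" using close[rule_format, of N1] unfolding v_def by (simp add: abs_less_iff)
    then have "\<not> \<epsilon> < v N1" using N1 \<delta> by linarith
    then have mN: "m \<le> N1" using mi by (simp add: not_less)
    have "Ks - e \<le> (\<Sum>i<N1. K c (u i)) - e" using K_sum_ge_suminf[OF u c0] by (simp add: Ks_def)
    also have "\<dots> \<le> (\<Sum>i<N1. K c (u i)) - real N1 * (e / (real N1 + 1))"
    proof -
      have "real N1 * (e / (real N1 + 1)) \<le> (real N1 + 1) * (e / (real N1 + 1))" using e by (intro mult_right_mono) auto
      then show ?thesis by simp
    qed
    also have "\<dots> = (\<Sum>i<N1. K c (u i) - e / (real N1 + 1))" by (simp add: sum_subtractf)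
    also have "\<dots> \<le> (\<Sum>i<N1. K c (v i))"
    proof (rule sum_mono)
      fix i assume i: "i \<in> {..<N1}"
      then have "\<bar>v i - u i\<bar> < \<delta>" using close[rule_format, of i] by (simp add: v_def)
      then have "\<bar>K c (v i) - K c (u i)\<bar> < e / (real N1 + 1)"
        using i v0 \<delta> by (intro \<delta>K(2)) auto
      then show "K c (u i) - e / (real N1 + 1) \<le> K c (v i)" by linarith
    qed
    also have "\<dots> \<le> (\<Sum>i<m. K c (v i))"
    proof -
      have "(\<Sum>i<m. - K c (v i)) \<le> (\<Sum>i<N1. - K c (v i))"
        using mN v0 K_nonpos[OF c0] by (intro sum_mono2) auto
      then show ?thesis by (simp add: sum_negf)
    qed
    also have "\<dots> = (\<Sum>k\<in>#macro \<epsilon> n \<mu>. K c (real k / real n))" unfolding sm v_def ..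
    finally have 1: "Ks - e \<le> (\<Sum>k\<in>#macro \<epsilon> n \<mu>. K c (real k / real n))" .
    have "s' * real n \<le> (\<Sum>i<m. v i) * real n"
    proof (rule mult_right_mono)
      have vs: "0 \<le> (\<Sum>i<m. v i)" using v0 by (intro sum_nonneg) auto
      have "(\<Sum>i<N0. u i) \<le> (\<Sum>i<N0. (if i < m then v i else 0) + 2 * \<epsilon>)"
      proof (rule sum_mono)
        fix i assume "i \<in> {..<N0}"
        then have "u i < v i + \<delta>" using close[rule_format, of i] N1 unfolding v_def by (simp add: abs_less_iff)
        then show "u i \<le> (if i < m then v i else 0) + 2 * \<epsilon>" using mi[of i] \<delta> \<epsilon> by auto
      qed
      also have "\<dots> = (\<Sum>i<N0. if i < m then v i else 0) + real N0 * (2 * \<epsilon>)" by (simp add: sum.distrib)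
      also have "(\<Sum>i<N0. if i < m then v i else 0) = (\<Sum>i\<in>{..<N0} \<inter> {..<m}. v i)"
        by (subst sum.inter_restrict) auto
      also have "\<dots> \<le> (\<Sum>i<m. v i)" using v0 by (intro sum_mono2) auto
      finally have "s - \<zeta> / 2 \<le> (\<Sum>i<m. v i)" using N0 \<epsilon>N \<zeta> by linarith
      then show "s' \<le> (\<Sum>i<m. v i)" using vs by (simp add: s'_def)
    qed simp
    also have "(\<Sum>i<m. v i) * real n = (\<Sum>k\<in>#macro \<epsilon> n \<mu>. real k)"
      unfolding sm v_def using n0 by (simp add: sum_divide_distrib[symmetric])
    also have "\<dots> = real (sum_mset (macro \<epsilon> n \<mu>))" by simp
    finally show ?thesis using 1 by simp
  qed
  have "\<forall>\<^sub>F n in sequentially. profile_prob (p n) n (\<lambda>\<mu>.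
        Ks - e \<le> (\<Sum>k\<in>#macro \<epsilon> n \<mu>. K c (real k / real n)) \<and> s' * real n \<le> real (sum_mset (macro \<epsilon> n \<mu>)))
      \<le> exp (real n * (- (Ks - e) - L c (max (1 - 1 / c) s') + e))"
    by (rule bd) (use \<epsilon> s' in auto)
  then have "\<forall>\<^sub>F n in sequentially.
    profile_prob (p n) n (\<lambda>\<mu>. \<forall>i<N1 + 1. \<bar>real (nth_largest \<mu> i) / real n - u i\<bar> < \<delta>) \<le> exp (- (real n * r))"
    using p01 eventually_gt_at_top[of 0]
  proof eventually_elim
    case (elim n)
    have "profile_prob (p n) n (\<lambda>\<mu>. \<forall>i<N1 + 1. \<bar>real (nth_largest \<mu> i) / real n - u i\<bar> < \<delta>) \<le>
      profile_prob (p n) n (\<lambda>\<mu>.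
        Ks - e \<le> (\<Sum>k\<in>#macro \<epsilon> n \<mu>. K c (real k / real n)) \<and> s' * real n \<le> real (sum_mset (macro \<epsilon> n \<mu>)))"
      using elim main by (intro profile_prob_mono) auto
    also have "\<dots> \<le> exp (real n * (- (Ks - e) - L c (max (1 - 1 / c) s') + e))" by (rule elim(1))
    also have "\<dots> \<le> exp (- (real n * r))"
    proof -
      have "Ks + L c (max (1 - 1 / c) s) = r + 4 * e" by (simp add: e_def field_simps)
      then have "- (Ks - e) - L c (max (1 - 1 / c) s') + e \<le> - r" using Ls' e by linarith
      then have "real n * (- (Ks - e) - L c (max (1 - 1 / c) s') + e) \<le> real n * (- r)" by (intro mult_left_mono) auto
      then show ?thesis by simp
    qed
    finally show ?case .
  qed
  then show ?thesis using \<delta>(1) by blast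
qed

text \<open>Mass beyond the macroscopic components that must not stay in the subcritical remainder is cut
  into many pieces of the same small size \<open>w\<close>; their cost vanishes since \<open>K c w \<le> 0\<close>.\<close>

lemma sizes_lower_local:
  assumes u: "u \<in> S1" and r: "(\<Sum>i. K c (u i)) + L c (max (1 - 1 / c) (\<Sum>i. u i)) < r" and \<delta>: "0 < \<delta>"
  shows "\<forall>\<^sub>F n in sequentially. exp (- (real n * r)) \<le>
    profile_prob (p n) n (\<lambda>\<mu>. \<forall>i<N. \<bar>real (nth_largest \<mu> i) / real n - u i\<bar> < \<delta>)"
proof -
  note ub = S1_bounds[OF u]
  have c0: "0 \<le> c" using c_pos by simp
  define s where "s = (\<Sum>i. u i)"
  define Ks where "Ks = (\<Sum>i. K c (u i))"
  define m where "m = max (1 - 1 / c) s"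
  define e where "e = (r - (Ks + L c m)) / 5"
  have e: "0 < e" using r by (simp add: e_def s_def Ks_def m_def)
  have c1: "1 - 1 / c < 1" using c_pos by simp
  have s01: "0 \<le> s" "s \<le> 1" using ub by (auto simp: s_def)
  have m01: "m \<in> {0..1}" using s01 c1 by (auto simp: m_def)
  obtain \<zeta> where \<zeta>: "0 < \<zeta>" "\<And>y. y \<in> {0..1} \<Longrightarrow> \<bar>y - m\<bar> < \<zeta> \<Longrightarrow> \<bar>L c y - L c m\<bar> < e"
    using continuous_on_L[of c, unfolded continuous_on_iff, rule_format, OF m01 e] by (auto simp: dist_real_def)
  have "(\<lambda>n. \<Sum>i<n. K c (u i)) \<longlonglongrightarrow> Ks" unfolding Ks_def by (rule summable_LIMSEQ[OF summable_K[OF u c0]])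
  then have "\<forall>\<^sub>F n in sequentially. (\<Sum>i<n. K c (u i)) < Ks + e" by (rule order_tendstoD) (use e in simp)
  then obtain N2 where N2: "\<And>n. N2 \<le> n \<Longrightarrow> (\<Sum>i<n. K c (u i)) < Ks + e" by (auto simp: eventually_sequentially)
  define N' where "N' = max N N2"
  have KN: "(\<Sum>i<N'. K c (u i)) < Ks + e" by (rule N2) (simp add: N'_def)
  have e1: "0 < e / (real N' + 1)" using e by simp
  obtain \<delta>K where \<delta>K: "0 < \<delta>K" "\<And>i y. i < N' \<Longrightarrow> 0 \<le> y \<Longrightarrow> \<bar>y - u i\<bar> < \<delta>K \<Longrightarrow> \<bar>K c y - K c (u i)\<bar> < e / (real N' + 1)"
    by (rule finite_uniform_continuity[where x=u and N=N', OF continuous_on_K[OF c0] ub(1) e1]) blast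
  define \<beta> where "\<beta> = min (1 / 2) (min (\<delta>K / 4) (\<delta> / 16))"
  have \<beta>: "0 < \<beta>" "\<beta> < 1" "\<beta> \<le> \<delta>K / 4" "\<beta> \<le> \<delta> / 16" using \<delta>K \<delta> by (auto simp: \<beta>_def)
  define \<iota> where "\<iota> = min \<beta> \<zeta> / (2 * (real N' + 1))"
  have \<iota>0: "0 < \<iota>" using \<beta> \<zeta> by (simp add: \<iota>_def)
  have \<iota>N: "real N' * \<iota> < \<beta>" "real N' * \<iota> < \<zeta>" "\<iota> \<le> \<beta>"
  proof -
    have "(real N' + 1) * \<iota> = min \<beta> \<zeta> / 2" by (simp add: \<iota>_def field_simps)
    moreover have "real N' * \<iota> < (real N' + 1) * \<iota>" using \<iota>0 by simp
    moreover have "1 * \<iota> \<le> (real N' + 1) * \<iota>" using \<iota>0 by (intro mult_right_mono) auto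
    ultimately show "real N' * \<iota> < \<beta>" "real N' * \<iota> < \<zeta>" "\<iota> \<le> \<beta>" using \<beta>(1) \<zeta>(1) by auto
  qed
  \<comment> \<open>Shrinking by 1 - \<beta> makes room for a total below 1, and adding \<iota>
    makes every size positive, as \<open>macro_lower\<close> requires.\<close>
  define x where "x i = (1 - \<beta>) * u i + \<iota>" for i
  have x0: "0 < x i" for i using ub(1)[of i] \<beta> \<iota>0 by (simp add: x_def add_nonneg_pos)
  have xu: "\<bar>x i - u i\<bar> \<le> 2 * \<beta>" for i
  proof -
    have "\<beta> * u i \<le> \<beta> * 1" "0 \<le> \<beta> * u i" using ub(1)[of i] ub(2)[of i] \<beta> by (intro mult_left_mono mult_nonneg_nonneg; simp)+
    moreover have "x i - u i = \<iota> - \<beta> * u i" by (simp add: x_def algebra_simps)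
    ultimately show ?thesis using \<iota>N(3) \<iota>0 by (intro abs_leI) linarith+
  qed
  have Kx: "(\<Sum>i<N'. K c (x i)) \<le> Ks + 2 * e"
  proof -
    have "(\<Sum>i<N'. K c (x i)) \<le> (\<Sum>i<N'. K c (u i) + e / (real N' + 1))"
    proof (rule sum_mono)
      fix i assume "i \<in> {..<N'}"
      then have "\<bar>K c (x i) - K c (u i)\<bar> < e / (real N' + 1)"
        using xu[of i] x0[of i] \<beta> \<delta>K(1) by (intro \<delta>K(2)) auto
      then show "K c (x i) \<le> K c (u i) + e / (real N' + 1)" by linarith
    qed
    also have "\<dots> = (\<Sum>i<N'. K c (u i)) + real N' * (e / (real N' + 1))" by (simp add: sum.distrib)
    also have "real N' * (e / (real N' + 1)) \<le> (real N' + 1) * (e / (real N' + 1))"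
      using e by (intro mult_right_mono) auto
    also have "(real N' + 1) * (e / (real N' + 1)) = e" by simp
    finally show ?thesis using KN by linarith
  qed
  define s1 where "s1 = (\<Sum>i<N'. x i)"
  have s1: "s1 < 1" "s1 < m + \<zeta>"
  proof -
    have "(\<Sum>i<N'. u i) \<le> s" unfolding s_def using ub(1,5) by (intro sum_le_suminf) auto
    then have "(1 - \<beta>) * (\<Sum>i<N'. u i) \<le> (1 - \<beta>) * s" using \<beta> by (intro mult_left_mono) auto
    moreover have "s1 = (1 - \<beta>) * (\<Sum>i<N'. u i) + real N' * \<iota>"
      by (simp add: s1_def x_def sum.distrib sum_distrib_left)
    moreover have "(1 - \<beta>) * s \<le> (1 - \<beta>) * 1" "(1 - \<beta>) * s \<le> 1 * s" using \<beta> s01 by (intro mult_left_mono mult_right_mono; simp)+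
    moreover have "s \<le> m" by (simp add: m_def)
    ultimately have "s1 \<le> 1 - \<beta> + real N' * \<iota>" "s1 \<le> m + real N' * \<iota>" by (simp_all only: mult_1 mult_1_right)
    then show "s1 < 1" "s1 < m + \<zeta>" using \<iota>N(1,2) by simp_all
  qed
  \<comment> \<open>The total s' of all prescribed sizes must exceed 1 - 1/c, to make the remainder
    subcritical, and s1, to leave mass for the pieces. It stays below m + \<zeta>, so that L rises
    by at most e.\<close>
  have "max (max (1 - 1 / c) s1) 0 < min 1 (m + \<zeta>)" using s1 c1 \<zeta>(1) m01 by (auto simp: m_def)
  then obtain s' where s': "max (max (1 - 1 / c) s1) 0 < s'" "s' < min 1 (m + \<zeta>)" using dense by blast
  then have s'b: "1 - 1 / c < s'" "s1 < s'" "0 < s'" "s' < 1" "s' < m + \<zeta>" by auto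
  have Ls': "L c s' \<le> L c m + e"
  proof (cases "s' \<le> m")
    case True
    then have "L c s' \<le> L c m" using s'b m01 by (intro L_mono[OF c_pos]) auto
    then show ?thesis using e by simp
  next
    case False
    then have "\<bar>L c s' - L c m\<bar> < e" using s'b by (intro \<zeta>(2)) auto
    then show ?thesis by linarith
  qed
  \<comment> \<open>Enough pieces to make each of them smaller than \<delta>/8.\<close>
  obtain Q :: nat where Q: "(s' - s1) / (\<delta> / 8) < real Q" using reals_Archimedean2 by blast
  have "0 < (s' - s1) / (\<delta> / 8)" using s'b \<delta> by simp
  then have Q0: "0 < real Q" using Q by linarith
  define w where "w = (s' - s1) / real Q"
  have w: "0 < w" "w < \<delta> / 8" using Q0 s'b Q \<delta> by (auto simp: w_def field_simps)
  define R where "R = N' + Q"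
  define y where "y i = (if i < N' then x i else w)" for i
  have split: "(\<Sum>i<R. g (y i)) = (\<Sum>i<N'. g (x i)) + real Q * g w" for g :: "real \<Rightarrow> real"
  proof -
    have "(\<Sum>i<N' + q. g (y i)) = (\<Sum>i<N'. g (x i)) + real q * g w" for q
      by (induction q) (auto simp: y_def algebra_simps)
    then show ?thesis by (simp add: R_def)
  qed
  have sy: "(\<Sum>i<R. y i) = s'" using split[of "\<lambda>z. z"] Q0 by (simp add: s1_def[symmetric] w_def)
  have Ky: "(\<Sum>i<R. K c (y i)) \<le> Ks + 2 * e"
  proof -
    have "real Q * K c w \<le> 0" using K_nonpos[OF c0, of w] w by (simp add: mult_nonneg_nonpos)
    then show ?thesis using split[of "K c"] Kx by linarith
  qed
  \<comment> \<open>At most half the distance of the mean degree c (1 - s') of the remainder from 1;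
    an equal margin is reserved for the errors of the R prescribed sizes.\<close>
  define \<beta>1 where "\<beta>1 = min (1 / 2) ((1 - c * (1 - s')) / 2)"
  have cs: "c * (1 - s') < 1"
  proof -
    have "1 - s' < 1 / c" using s'b by linarith
    then show ?thesis using c_pos by (simp add: field_simps)
  qed
  have \<beta>1: "0 < \<beta>1" "\<beta>1 < 1" "c * (1 - s') \<le> 1 - 2 * \<beta>1"
  proof -
    show "0 < \<beta>1" "\<beta>1 < 1" using cs by (auto simp: \<beta>1_def)
    have "\<beta>1 \<le> (1 - c * (1 - s')) / 2" unfolding \<beta>1_def by (rule min.cobounded2)
    then show "c * (1 - s') \<le> 1 - 2 * \<beta>1" by (simp add: field_simps)
  qed
  define \<delta>' where "\<delta>' = min (\<delta> / 8) (\<beta>1 / (c * (real R + 1)))"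
  have cR: "0 < c * (real R + 1)" using c_pos by simp
  have \<delta>': "0 < \<delta>'" "\<delta>' \<le> \<delta> / 8" "\<delta>' \<le> \<beta>1 / (c * (real R + 1))"
  proof -
    show "0 < \<delta>'" unfolding \<delta>'_def using \<delta> \<beta>1(1) cR by (intro min_less_iff_conj[THEN iffD2] conjI divide_pos_pos) auto
    show "\<delta>' \<le> \<delta> / 8" unfolding \<delta>'_def by (rule min.cobounded1)
    show "\<delta>' \<le> \<beta>1 / (c * (real R + 1))" unfolding \<delta>'_def by (rule min.cobounded2)
  qed
  have c\<delta>': "c * (real R * \<delta>') \<le> \<beta>1"
  proof -
    have "c * (real R * \<delta>') \<le> c * ((real R + 1) * \<delta>')" using c_pos \<delta>' by (intro mult_left_mono mult_right_mono) auto
    also have "\<dots> = (c * (real R + 1)) * \<delta>'" by simp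
    also have "\<dots> \<le> (c * (real R + 1)) * (\<beta>1 / (c * (real R + 1)))" using \<delta>' cR by (intro mult_left_mono) auto
    also have "\<dots> = \<beta>1" using cR c_pos by simp
    finally show ?thesis .
  qed
  have mac: "\<forall>\<^sub>F n in sequentially. \<exists>k::nat \<Rightarrow> nat. (\<forall>i<R. \<bar>real (k i) / real n - y i\<bar> < \<delta>') \<and> (\<Sum>i<R. k i) < n \<and>
    (\<forall>Q. exp (real n * (- (\<Sum>i<R. K c (y i)) - L c (\<Sum>i<R. y i) - e)) *
        profile_prob (p n) (n - (\<Sum>i<R. k i)) (\<lambda>\<mu>. Q (mset (map k [0..<R]) + \<mu>)) \<le> profile_prob (p n) n Q)"
    by (rule macro_lower) (use x0 w sy s'b e \<delta>' in \<open>auto simp: y_def\<close>)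
  have nm: "\<forall>\<^sub>F n in sequentially. \<forall>M\<le>n. c * real M \<le> (1 - \<beta>1) * real n \<longrightarrow>
    1 - 1 / 2 \<le> profile_prob (p n) M (\<lambda>\<mu>. \<forall>k\<in>#\<mu>. real k \<le> \<delta> / 2 * real n)"
    by (rule no_macro) (use \<beta>1 \<delta> in auto)
  have big: "\<forall>\<^sub>F n in sequentially. ln 2 \<le> real n * e" using e by real_asymp
  show ?thesis
    using mac nm big p01 eventually_gt_at_top[of 0]
  proof eventually_elim
    case (elim n)
    then have p: "0 \<le> p n" "p n \<le> 1" and n0: "0 < real n" by auto
    obtain k :: "nat \<Rightarrow> nat" where k: "\<And>i. i < R \<Longrightarrow> \<bar>real (k i) / real n - y i\<bar> < \<delta>'" "(\<Sum>i<R. k i) < n"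
      "\<And>Q. exp (real n * (- (\<Sum>i<R. K c (y i)) - L c s' - e)) *
        profile_prob (p n) (n - (\<Sum>i<R. k i)) (\<lambda>\<mu>. Q (mset (map k [0..<R]) + \<mu>)) \<le> profile_prob (p n) n Q"
      using elim(1) unfolding sy by blast
    define M where "M = n - (\<Sum>i<R. k i)"
    have Mn: "real M / real n = 1 - (\<Sum>i<R. real (k i) / real n)"
    proof -
      have "real M = real n - (\<Sum>i<R. real (k i))" using k(2) by (simp add: M_def of_nat_diff)
      then show ?thesis using n0 by (simp add: diff_divide_distrib sum_divide_distrib)
    qed
    have "c * (real M / real n) \<le> 1 - \<beta>1"
    proof -
      have "(\<Sum>i<R. y i) - (\<Sum>i<R. real (k i) / real n) = (\<Sum>i<R. y i - real (k i) / real n)" by (simp add: sum_subtractf)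
      also have "\<dots> \<le> real (card {..<R}) * \<delta>'"
      proof (rule sum_bounded_above)
        fix i assume "i \<in> {..<R}"
        then have "\<bar>real (k i) / real n - y i\<bar> < \<delta>'" using k(1) by simp
        then show "y i - real (k i) / real n \<le> \<delta>'" by linarith
      qed
      finally have "real M / real n \<le> (1 - s') + real R * \<delta>'" unfolding Mn sy by simp
      then have "c * (real M / real n) \<le> c * ((1 - s') + real R * \<delta>')" using c_pos by (intro mult_left_mono) auto
      also have "\<dots> = c * (1 - s') + c * (real R * \<delta>')" by (rule distrib_left)
      also have "\<dots> \<le> 1 - \<beta>1" using \<beta>1 c\<delta>' by linarith
      finally show ?thesis .
    qed
    then have "c * real M \<le> (1 - \<beta>1) * real n" using n0 by (simp add: field_simps)
    then have half: "1 / 2 \<le> profile_prob (p n) M (\<lambda>\<mu>. \<forall>k\<in>#\<mu>. real k \<le> \<delta> / 2 * real n)"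
      using elim(2)[rule_format, of M] by (simp add: M_def)
    let ?Q = "\<lambda>\<mu>. \<forall>i<N. \<bar>real (nth_largest \<mu> i) / real n - u i\<bar> < \<delta>"
    have good: "?Q (mset (map k [0..<R]) + \<mu>)" if \<mu>: "\<forall>k\<in>#\<mu>. real k \<le> \<delta> / 2 * real n" for \<mu>
    proof (intro allI impI)
      fix i assume i: "i < N"
      let ?\<nu> = "mset (map k [0..<R]) + \<mu>"
      have iN: "i < N'" using i by (simp add: N'_def)
      have size_fil: "size (filter_mset (\<lambda>z. \<theta> < real z) (mset (map k [0..<R]))) = card {j\<in>{..<R}. \<theta> < real (k j)}" for \<theta>
      proof -
        have "filter_mset (\<lambda>z. \<theta> < real z) (mset (map k [0..<R])) = image_mset k (filter_mset (\<lambda>j. \<theta> < real (k j)) (mset_set {..<R}))"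
          by (simp add: filter_mset_image_mset mset_upt atLeast0LessThan)
        then show ?thesis by (simp add: filter_mset_mset_set)
      qed
      have kx: "\<bar>real (k j) / real n - u j\<bar> < \<delta> / 4" if "j < N'" for j
      proof -
        have "\<bar>real (k j) / real n - x j\<bar> < \<delta>'" using k(1)[of j] that by (simp add: R_def y_def)
        then show ?thesis using xu[of j] \<beta>(4) \<delta>'(2) by linarith
      qed
      \<comment> \<open>An entry above u i + \<delta>/2 can only be a prescribed size with index
        below i: later ones are close to u j \<le> u i, and the pieces and the remaining components
        are too small. So there are at most i such entries.\<close>
      have up: "real (nth_largest ?\<nu> i) / real n \<le> u i + \<delta> / 2"
      proof (rule ccontr)
        assume "\<not> ?thesis"
        then have "(u i + \<delta> / 2) * real n < real (nth_largest ?\<nu> i)" using n0 by (simp add: field_simps)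
        moreover have "0 \<le> (u i + \<delta> / 2) * real n" using ub(1) \<delta> by simp
        ultimately have lt: "i < size (filter_mset (\<lambda>z. (u i + \<delta> / 2) * real n < real z) ?\<nu>)"
          using less_nth_largest_iff by blast
        have "\<delta> / 2 * real n \<le> (u i + \<delta> / 2) * real n" using ub(1)[of i] by (intro mult_right_mono) auto
        then have "set_mset (filter_mset (\<lambda>z. (u i + \<delta> / 2) * real n < real z) \<mu>) = {}" using \<mu> by fastforce
        then have "size (filter_mset (\<lambda>z. (u i + \<delta> / 2) * real n < real z) ?\<nu>) =
          card {j\<in>{..<R}. (u i + \<delta> / 2) * real n < real (k j)}" using size_fil by simp
        also have "\<dots> \<le> card {..<i}"
        proof (rule card_mono)
          show "{j\<in>{..<R}. (u i + \<delta> / 2) * real n < real (k j)} \<subseteq> {..<i}"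
          proof
            fix j assume "j \<in> {j\<in>{..<R}. (u i + \<delta> / 2) * real n < real (k j)}"
            then have j: "j < R" "u i + \<delta> / 2 < real (k j) / real n" using n0 by (auto simp: field_simps)
            show "j \<in> {..<i}"
            proof (rule ccontr)
              assume "j \<notin> {..<i}"
              then have ij: "i \<le> j" by simp
              show False
              proof (cases "j < N'")
                case True
                have "u j \<le> u i" using u ij by (simp add: S1_def decseq_def)
                then show False using kx[OF True] j \<delta> by linarith
              next
                case False
                then have "\<bar>real (k j) / real n - w\<bar> < \<delta>'" using k(1)[OF j(1)] by (simp add: y_def)
                then show False using j w \<delta>'(2) ub(1)[of i] \<delta> by linarith
              qed
            qed
          qed
        qed simp
        finally show False using lt by simp
      qed
      \<comment> \<open>The prescribed sizes with indices 0 to i all exceed the bound, hence at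
        least i + 1 entries do.\<close>
      have low: "u i - \<delta> / 2 < real (nth_largest ?\<nu> i) / real n"
      proof (cases "u i - \<delta> / 2 < 0")
        case True
        then show ?thesis by (meson divide_nonneg_nonneg less_le_trans of_nat_0_le_iff)
      next
        case False
        let ?\<theta> = "(u i - \<delta> / 2) * real n"
        have "{..i} \<subseteq> {j\<in>{..<R}. ?\<theta> < real (k j)}"
        proof
          fix j assume j: "j \<in> {..i}"
          then have jN: "j < N'" using iN by simp
          have "u i \<le> u j" using u j by (simp add: S1_def decseq_def)
          then have "u i - \<delta> / 2 < real (k j) / real n" using kx[OF jN] \<delta> by linarith
          then show "j \<in> {j\<in>{..<R}. ?\<theta> < real (k j)}" using jN n0 by (simp add: R_def field_simps)
        qed
        then have "card {..i} \<le> card {j\<in>{..<R}. ?\<theta> < real (k j)}" by (intro card_mono) auto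
        then have "i < size (filter_mset (\<lambda>z. ?\<theta> < real z) ?\<nu>)" using size_fil[of ?\<theta>] by simp
        moreover have "0 \<le> ?\<theta>" using False by simp
        ultimately have "?\<theta> < real (nth_largest ?\<nu> i)" using less_nth_largest_iff by blast
        then show ?thesis using n0 by (simp add: field_simps)
      qed
      show "\<bar>real (nth_largest ?\<nu> i) / real n - u i\<bar> < \<delta>" using up low \<delta> by (simp add: abs_less_iff)
    qed
    have "exp (real n * (- (\<Sum>i<R. K c (y i)) - L c s' - e)) * (1 / 2) \<le>
      exp (real n * (- (\<Sum>i<R. K c (y i)) - L c s' - e)) * profile_prob (p n) M (\<lambda>\<mu>. ?Q (mset (map k [0..<R]) + \<mu>))"
    proof (rule mult_left_mono)
      have "profile_prob (p n) M (\<lambda>\<mu>. \<forall>k\<in>#\<mu>. real k \<le> \<delta> / 2 * real n) \<le>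
        profile_prob (p n) M (\<lambda>\<mu>. ?Q (mset (map k [0..<R]) + \<mu>))"
        using good by (intro profile_prob_mono p) blast
      then show "1 / 2 \<le> profile_prob (p n) M (\<lambda>\<mu>. ?Q (mset (map k [0..<R]) + \<mu>))" using half by linarith
    qed simp
    also have "\<dots> \<le> profile_prob (p n) n ?Q" unfolding M_def by (rule k(3))
    finally have "exp (real n * (- (\<Sum>i<R. K c (y i)) - L c s' - e)) * (1 / 2) \<le> profile_prob (p n) n ?Q" .
    moreover have "exp (- (real n * r)) \<le> exp (real n * (- (\<Sum>i<R. K c (y i)) - L c s' - e)) * (1 / 2)"
    proof -
      have "r = Ks + L c m + 5 * e" by (simp add: e_def field_simps)
      then have "- r \<le> - (\<Sum>i<R. K c (y i)) - L c s' - e - e" using Ky Ls' by linarith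
      then have "real n * (- r) \<le> real n * (- (\<Sum>i<R. K c (y i)) - L c s' - e - e)" by (intro mult_left_mono) auto
      then have "- (real n * r) \<le> real n * (- (\<Sum>i<R. K c (y i)) - L c s' - e) - real n * e"
        by (simp only: right_diff_distrib mult_minus_right)
      then have "- (real n * r) \<le> real n * (- (\<Sum>i<R. K c (y i)) - L c s' - e) - ln 2" using elim(3) by linarith
      then have "exp (- (real n * r)) \<le> exp (real n * (- (\<Sum>i<R. K c (y i)) - L c s' - e) - ln 2)"
        by (simp only: exp_le_cancel_iff)
      then show ?thesis by (simp add: exp_diff)
    qed
    ultimately show ?case by linarith
  qed
qed

end

theorem corollary2p2:
  fixes cn :: "nat \<Rightarrow> real" and c :: real
  assumes "\<forall>\<^sub>F n in sequentially. cn n / real n \<in> {0..1}"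
    and "cn \<longlonglongrightarrow> c"
    and "c > 0"
  shows "LDP {0..1} (\<lambda>n. measure_pmf (random_graph n (cn n / real n)))
           (\<lambda>n E. real (num_components n E) / real n) real (I_alpha c)
       \<and> LDP S1 (\<lambda>n. measure_pmf (random_graph n (cn n / real n)))
           (\<lambda>n E i. real (component_size n E i) / real n) real (I_U c)"
proof -
  define p where "p n = cn n / real n" for n
  interpret sparse_regime p c
    unfolding p_def[abs_def] by (rule sparse_regimeI[OF assms(2,3)])
  have "LDP {0..1} (\<lambda>n. measure_pmf (random_graph n (p n)))
           (\<lambda>n E. real (num_components n E) / real n) real (I_alpha c)"
  proof (rule LDP_pmf_from_local)
    \<comment> \<open>Membership is required for every n and every E; for n = 0 the quotient is 0 by
      the convention x / 0 = 0.\<close>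
    fix n :: nat and E
    have "num_components n E \<le> n"
      using size_le_sum_mset[of "profile {..<n} E"] profile_pos[of "{..<n}" _ E]
      by (simp add: num_components_eq sum_mset_profile)
    then show "real (num_components n E) / real n \<in> {0..1}" by (auto simp: divide_le_eq_1)
  next
    fix a r assume "a \<in> {0..1::real}" "ereal r < I_alpha c a"
    then obtain \<delta> where \<delta>: "0 < \<delta>" "\<forall>\<^sub>F n in sequentially.
      profile_prob (p n) n (\<lambda>\<mu>. \<bar>real (size \<mu>) / real n - a\<bar> < \<delta>) \<le> exp (- (real n * r))"
      using alpha_upper_local[of a r] by auto
    show "\<exists>G. open G \<and> a \<in> G \<and> (\<forall>\<^sub>F n in sequentially.
      measure_pmf.prob (random_graph n (p n)) {E. real (num_components n E) / real n \<in> G} \<le> exp (- (real n * r)))"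
    proof (intro exI[of _ "ball a \<delta>"] conjI)
      show "\<forall>\<^sub>F n in sequentially.
        measure_pmf.prob (random_graph n (p n)) {E. real (num_components n E) / real n \<in> ball a \<delta>} \<le> exp (- (real n * r))"
        using \<delta>(2) p01
      proof eventually_elim
        case (elim n)
        then show ?case
          using prob_random_graph_profile[of "p n" n "\<lambda>\<mu>. \<bar>real (size \<mu>) / real n - a\<bar> < \<delta>"]
          by (simp add: num_components_eq dist_real_def abs_minus_commute)
      qed
    qed (use \<delta> in auto)
  next
    fix a r G assume *: "a \<in> {0..1::real}" "I_alpha c a < ereal r" "open G" "a \<in> G"
    then obtain \<delta> where \<delta>: "0 < \<delta>" "ball a \<delta> \<subseteq> G" by (meson open_contains_ball)
    have "\<forall>\<^sub>F n in sequentially. exp (- (real n * r)) \<le>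
      profile_prob (p n) n (\<lambda>\<mu>. \<bar>real (size \<mu>) / real n - a\<bar> < \<delta>)"
      by (rule alpha_lower_local) (use * \<delta> in auto)
    then show "\<forall>\<^sub>F n in sequentially. exp (- (real n * r)) \<le>
      measure_pmf.prob (random_graph n (p n)) {E. real (num_components n E) / real n \<in> G}"
      using p01
    proof eventually_elim
      case (elim n)
      have "exp (- (real n * r)) \<le> measure_pmf.prob (random_graph n (p n))
          {E. \<bar>real (size (profile {..<n} E)) / real n - a\<bar> < \<delta>}"
        using elim prob_random_graph_profile[of "p n" n "\<lambda>\<mu>. \<bar>real (size \<mu>) / real n - a\<bar> < \<delta>"] by simp
      also have "\<dots> \<le> measure_pmf.prob (random_graph n (p n)) {E. real (num_components n E) / real n \<in> G}"
        using \<delta>(2) by (intro measure_pmf.finite_measure_mono)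
          (auto simp: num_components_eq dist_real_def abs_minus_commute subset_eq)
      finally show ?case .
    qed
  qed simp
  moreover have "LDP S1 (\<lambda>n. measure_pmf (random_graph n (p n)))
           (\<lambda>n E i. real (component_size n E i) / real n) real (I_U c)"
  proof (rule LDP_pmf_from_local[OF compact_S1 component_sizes_in_S1])
    fix u r assume u: "u \<in> S1" and r: "ereal r < I_U c u"
    obtain N \<delta> where \<delta>: "0 < \<delta>" "\<forall>\<^sub>F n in sequentially.
      profile_prob (p n) n (\<lambda>\<mu>. \<forall>i<N. \<bar>real (nth_largest \<mu> i) / real n - u i\<bar> < \<delta>) \<le> exp (- (real n * r))"
      using sizes_upper_local[OF u, of r] r by (auto simp: I_U_def)
    let ?G = "{v :: nat \<Rightarrow> real. \<forall>i<N. \<bar>v i - u i\<bar> < \<delta>}"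
    show "\<exists>G. open G \<and> u \<in> G \<and> (\<forall>\<^sub>F n in sequentially.
      measure_pmf.prob (random_graph n (p n)) {E. (\<lambda>i. real (component_size n E i) / real n) \<in> G} \<le> exp (- (real n * r)))"
    proof (intro exI[of _ ?G] conjI open_coordinate_box)
      show "\<forall>\<^sub>F n in sequentially.
        measure_pmf.prob (random_graph n (p n)) {E. (\<lambda>i. real (component_size n E i) / real n) \<in> ?G} \<le> exp (- (real n * r))"
        using \<delta>(2) p01
      proof eventually_elim
        case (elim n)
        then show ?case
          using prob_random_graph_profile[of "p n" n "\<lambda>\<mu>. \<forall>i<N. \<bar>real (nth_largest \<mu> i) / real n - u i\<bar> < \<delta>"]
          by (simp add: component_size_eq)
      qed
    qed (use \<delta> in auto)
  next
    fix u r G assume u: "u \<in> S1" and r: "I_U c u < ereal r" and G: "open G" "u \<in> G"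
    obtain N \<delta> where \<delta>: "0 < \<delta>" "\<And>v. (\<And>i. i < N \<Longrightarrow> \<bar>v i - u i\<bar> < \<delta>) \<Longrightarrow> v \<in> G"
      by (rule open_fun_basis[OF G]) blast
    have "\<forall>\<^sub>F n in sequentially. exp (- (real n * r)) \<le>
      profile_prob (p n) n (\<lambda>\<mu>. \<forall>i<N. \<bar>real (nth_largest \<mu> i) / real n - u i\<bar> < \<delta>)"
      by (rule sizes_lower_local[OF u _ \<delta>(1)]) (use r in \<open>simp add: I_U_def\<close>)
    then show "\<forall>\<^sub>F n in sequentially. exp (- (real n * r)) \<le>
      measure_pmf.prob (random_graph n (p n)) {E. (\<lambda>i. real (component_size n E i) / real n) \<in> G}"
      using p01
    proof eventually_elim
      case (elim n)
      have "exp (- (real n * r)) \<le> measure_pmf.prob (random_graph n (p n))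
          {E. \<forall>i<N. \<bar>real (nth_largest (profile {..<n} E) i) / real n - u i\<bar> < \<delta>}"
        using elim prob_random_graph_profile[of "p n" n "\<lambda>\<mu>. \<forall>i<N. \<bar>real (nth_largest \<mu> i) / real n - u i\<bar> < \<delta>"] by simp
      also have "\<dots> \<le> measure_pmf.prob (random_graph n (p n)) {E. (\<lambda>i. real (component_size n E i) / real n) \<in> G}"
      proof (rule measure_pmf.finite_measure_mono)
        show "{E. \<forall>i<N. \<bar>real (nth_largest (profile {..<n} E) i) / real n - u i\<bar> < \<delta>} \<subseteq>
            {E. (\<lambda>i. real (component_size n E i) / real n) \<in> G}"
        proof (intro subsetI CollectI)
          fix E assume "E \<in> {E. \<forall>i<N. \<bar>real (nth_largest (profile {..<n} E) i) / real n - u i\<bar> < \<delta>}"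
          then show "(\<lambda>i. real (component_size n E i) / real n) \<in> G"
            by (intro \<delta>(2)) (simp add: component_size_eq)
        qed
      qed simp
      finally show ?case .
    qed
  qed
  ultimately show ?thesis by (simp add: p_def)
qed

end
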